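(* Let $H$ be a Hopf algebra over a field $k$ and let $B=P^{co H}\subseteq P$ be a Hopf-Galois extension with Hopf algebra $H$, with $P$ faithfully flat as a left $B$-module. Then the Ehresmann-Schauenburg bialgebroid $\mathcal{B}=\mathcal{L}(P,H)$ is a left Hopf algebroid over $B$.
   Context: Sumless Sweedler notation is used: $\Delta(h)=h_{(1)}\otimes h_{(2)}$ for coproducts and $\Delta_R(p)=p_{(0)}\otimes p_{(1)}$ for right coactions. Hopf-Galois extension: a right $H$-comodule algebra $P$ (i.e. the right coaction $\Delta_R:P\to P\otimes H$ is an algebra map) with $B=\{b\in P\mid \Delta_R(b)=b\otimes 1_H\}$ such that $\mathrm{can}:P\otimes_B P\to P\otimes H$, $p\otimes_B q\mapsto p q_{(0)}\otimes q_{(1)}$, is bijective. The translation map is $\tau:H\to P\otimes_B P$, $\tau(h)=\mathrm{can}^{-1}(1\otimes h)$. Ehresmann-Schauenburg bialgebroid (a known left $B$-bialgebroid): the space $$\mathcal{B}=\{p\otimes q\in P\otimes P\mid p_{(0)}\otimes\tau(p_{(1)})q=p\otimes q\otimes_B 1\}=\{p\otimes q\in P\otimes P\mid p_{(0)}\otimes q_{(0)}\otimes p_{(1)}q_{(1)}=p\otimes q\otimes 1_H\}$$ (sums of terms understood), with product $(p\otimes q)(r\otimes u)=pr\otimes uq$, unit $1\otimes 1$, source $s(b)=b\otimes 1$, target $t(b)=1\otimes b$, coproduct $\Delta(p\otimes q)=p_{(0)}\otimes\tau(p_{(1)})\otimes q\in\mathcal{B}\otimes_B\mathcal{B}$ and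 counit $\epsilon(p\otimes q)=pq\in B$. Left $B$-bialgebroid: an algebra $\mathcal{L}$ with algebra maps $s:B\to\mathcal{L}$, $t:B^{op}\to\mathcal{L}$ with commuting images, and a $B$-coring structure $(\Delta,\epsilon)$ (coalgebra in $B$-bimodules) for the bimodule structure $b.X.c=s(b)t(c)X$, such that (i) $\Delta$ corestricts to an algebra map $\mathcal{L}\to\mathcal{L}\times_B\mathcal{L}=\{\sum_i X_i\otimes_B Y_i\mid \sum_i X_it(b)\otimes_B Y_i=\sum_i X_i\otimes_B Y_is(b)\ \forall b\in B\}\subseteq\mathcal{L}\otimes_B\mathcal{L}$ with factorwise product; (ii) $\epsilon(1)=1$, $\epsilon(s(b)X)=b\epsilon(X)$, $\epsilon(Xs(\epsilon(Y)))=\epsilon(XY)=\epsilon(Xt(\epsilon(Y)))$. Left Hopf algebroid: a left $B$-bialgebroid $\mathcal{L}$ such that $\lambda:\mathcal{L}\otimes_{B^{op}}\mathcal{L}\to\mathcal{L}\otimes_B\mathcal{L}$, $\lambda(X\otimes_{B^{op}}Y)=X_{(1)}\otimes_B X_{(2)}Y$, is invertible, where $Xt(b)\otimes_{B^{op}}Y=X\otimes_{B^{op}}t(b)Y$ and $t(b)X\otimes_B Y=X\otimes_B s(b)Y$. *)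

theory Defs
  imports "HOL-Algebra.AbelCoset" "HOL-Algebra.Module" "HOL-Algebra.Free_Abelian_Groups"
begin

section \<open>Modules over noncommutative rings\<close>

text \<open>
  \<^term>\<open>module\<close> of the library is restricted to commutative rings.  Below, the action is a
  separate argument, because the same additive group carries several actions
  (through source and target, on either side).
\<close>

locale left_module = R: ring R + M: abelian_group M
  for R (structure) and M (structure) and act :: "'r \<Rightarrow> 'm \<Rightarrow> 'm" +
  assumes closed: "\<lbrakk>a \<in> carrier R; x \<in> carrier M\<rbrakk> \<Longrightarrow> act a x \<in> carrier M"
    and distrib_scalar: "\<lbrakk>a \<in> carrier R; b \<in> carrier R; x \<in> carrier M\<rbrakk>
          \<Longrightarrow> act (a \<oplus>\<^bsub>R\<^esub> b) x = act a x \<oplus>\<^bsub>M\<^esub> act b x"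
    and distrib: "\<lbrakk>a \<in> carrier R; x \<in> carrier M; y \<in> carrier M\<rbrakk>
          \<Longrightarrow> act a (x \<oplus>\<^bsub>M\<^esub> y) = act a x \<oplus>\<^bsub>M\<^esub> act a y"
    and assoc: "\<lbrakk>a \<in> carrier R; b \<in> carrier R; x \<in> carrier M\<rbrakk>
          \<Longrightarrow> act (a \<otimes>\<^bsub>R\<^esub> b) x = act a (act b x)"
    and unit: "x \<in> carrier M \<Longrightarrow> act \<one>\<^bsub>R\<^esub> x = x"

locale right_module = R: ring R + M: abelian_group M
  for R (structure) and M (structure) and act :: "'m \<Rightarrow> 'r \<Rightarrow> 'm" +
  assumes closed: "\<lbrakk>a \<in> carrier R; x \<in> carrier M\<rbrakk> \<Longrightarrow> act x a \<in> carrier M"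
    and distrib_scalar: "\<lbrakk>a \<in> carrier R; b \<in> carrier R; x \<in> carrier M\<rbrakk>
          \<Longrightarrow> act x (a \<oplus>\<^bsub>R\<^esub> b) = act x a \<oplus>\<^bsub>M\<^esub> act x b"
    and distrib: "\<lbrakk>a \<in> carrier R; x \<in> carrier M; y \<in> carrier M\<rbrakk>
          \<Longrightarrow> act (x \<oplus>\<^bsub>M\<^esub> y) a = act x a \<oplus>\<^bsub>M\<^esub> act y a"
    and assoc: "\<lbrakk>a \<in> carrier R; b \<in> carrier R; x \<in> carrier M\<rbrakk>
          \<Longrightarrow> act x (a \<otimes>\<^bsub>R\<^esub> b) = act (act x a) b"
    and unit: "x \<in> carrier M \<Longrightarrow> act x \<one>\<^bsub>R\<^esub> = x"

definition right_module_hom ::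
  "('r, 'c) ring_scheme \<Rightarrow> ('m, 'd) ring_scheme \<Rightarrow> ('m \<Rightarrow> 'r \<Rightarrow> 'm) \<Rightarrow>
   ('n, 'e) ring_scheme \<Rightarrow> ('n \<Rightarrow> 'r \<Rightarrow> 'n) \<Rightarrow> ('m \<Rightarrow> 'n) set" where
  "right_module_hom R M ra N ra' =
     {f \<in> hom (add_monoid M) (add_monoid N).
        \<forall>x\<in>carrier M. \<forall>a\<in>carrier R. f (ra x a) = ra' (f x) a}"


section \<open>Tensor products\<close>

text \<open>
  For a right \<open>R\<close>-module \<open>M\<close> and a left \<open>R\<close>-module \<open>N\<close>, the group \<open>M \<otimes>\<^sub>R N\<close> is the free
  abelian group on \<open>M \<times> N\<close> modulo the biadditive, \<open>R\<close>-balanced relations.  The result is an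
  additive group, so the multiplicative part of the record carries no information.
\<close>

definition tensor_relations ::
  "('r, 'c) ring_scheme \<Rightarrow> ('m, 'd) ring_scheme \<Rightarrow> ('m \<Rightarrow> 'r \<Rightarrow> 'm) \<Rightarrow>
   ('n, 'e) ring_scheme \<Rightarrow> ('r \<Rightarrow> 'n \<Rightarrow> 'n) \<Rightarrow> (('m \<times> 'n) \<Rightarrow>\<^sub>0 int) set" where
  "tensor_relations R M ra N la =
     {frag_of (x \<oplus>\<^bsub>M\<^esub> x', y) - frag_of (x, y) - frag_of (x', y) | x x' y.
        x \<in> carrier M \<and> x' \<in> carrier M \<and> y \<in> carrier N} \<union>
     {frag_of (x, y \<oplus>\<^bsub>N\<^esub> y') - frag_of (x, y) - frag_of (x, y') | x y y'.
        x \<in> carrier M \<and> y \<in> carrier N \<and> y' \<in> carrier N} \<union>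
     {frag_of (ra x a, y) - frag_of (x, la a y) | x a y.
        x \<in> carrier M \<and> a \<in> carrier R \<and> y \<in> carrier N}"

definition tensor ::
  "('r, 'c) ring_scheme \<Rightarrow> ('m, 'd) ring_scheme \<Rightarrow> ('m \<Rightarrow> 'r \<Rightarrow> 'm) \<Rightarrow>
   ('n, 'e) ring_scheme \<Rightarrow> ('r \<Rightarrow> 'n \<Rightarrow> 'n) \<Rightarrow> (('m \<times> 'n) \<Rightarrow>\<^sub>0 int) set ring" where
  "tensor R M ra N la =
     (let F = free_Abelian_group (carrier M \<times> carrier N);
          Q = F Mod generate F (tensor_relations R M ra N la)
      in \<lparr>carrier = carrier Q, monoid.mult = undefined, one = undefined,
          ring.zero = one Q, ring.add = monoid.mult Q\<rparr>)"

definition pure_tensor ::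
  "((('m \<times> 'n) \<Rightarrow>\<^sub>0 int) set, 'c) ring_scheme \<Rightarrow> 'm \<Rightarrow> 'n \<Rightarrow> (('m \<times> 'n) \<Rightarrow>\<^sub>0 int) set" where
  "pure_tensor T x y = (THE X. X \<in> carrier T \<and> frag_of (x, y) \<in> X)"

abbreviation pure_tensor_syntax (\<open>_ \<boxtimes>\<index> _\<close> [71, 71] 70) where
  "x \<boxtimes>\<^bsub>T\<^esub> y \<equiv> pure_tensor T x y"

text \<open>
  \<open>tensor_lift G f X\<close> is the value of \<open>\<Sum>\<^sub>i f x\<^sub>i y\<^sub>i\<close> in the abelian group \<open>G\<close> for
  \<open>X = \<Sum>\<^sub>i x\<^sub>i \<otimes> y\<^sub>i\<close>, computed on some representative of \<open>X\<close>.  It is independent of the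
  representative whenever \<open>f\<close> is biadditive and balanced.  A formula in sumless Sweedler
  notation is rendered as \<open>tensor_lift G (\<lambda>h\<^sub>1 h\<^sub>2. \<dots>) (\<Delta> h)\<close>.
\<close>

definition frag_eval ::
  "('g, 'c) ring_scheme \<Rightarrow> ('m \<Rightarrow> 'n \<Rightarrow> 'g) \<Rightarrow> (('m \<times> 'n) \<Rightarrow>\<^sub>0 int) \<Rightarrow> 'g" where
  "frag_eval G f c =
     (\<Oplus>\<^bsub>G\<^esub>z\<in>Poly_Mapping.keys c. [Poly_Mapping.lookup c z] \<cdot>\<^bsub>G\<^esub> f (fst z) (snd z))"

definition tensor_lift ::
  "('g, 'c) ring_scheme \<Rightarrow> ('m \<Rightarrow> 'n \<Rightarrow> 'g) \<Rightarrow> (('m \<times> 'n) \<Rightarrow>\<^sub>0 int) set \<Rightarrow> 'g" where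
  "tensor_lift G f X = frag_eval G f (SOME c. c \<in> X)"

text \<open>
  The factorwise product.  On \<open>\<L> \<otimes>\<^sub>B \<L>\<close> it is well defined only when the first argument lies in
  the Takeuchi product; since both arguments are expanded in representatives, the same formula
  covers that case.
\<close>

definition factorwise_mult ::
  "((('a \<times> 'b) \<Rightarrow>\<^sub>0 int) set, 'c) ring_scheme \<Rightarrow> ('a, 'd) ring_scheme \<Rightarrow> ('b, 'e) ring_scheme \<Rightarrow>
   (('a \<times> 'b) \<Rightarrow>\<^sub>0 int) set \<Rightarrow> (('a \<times> 'b) \<Rightarrow>\<^sub>0 int) set \<Rightarrow> (('a \<times> 'b) \<Rightarrow>\<^sub>0 int) set" where
  "factorwise_mult T A B X Y =
     tensor_lift T
       (\<lambda>a b. tensor_lift T (\<lambda>a' b'. (a \<otimes>\<^bsub>A\<^esub> a') \<boxtimes>\<^bsub>T\<^esub> (b \<otimes>\<^bsub>B\<^esub> b')) Y) X"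


section \<open>Faithful flatness\<close>

definition tensor_right_map ::
  "('r, 'c) ring_scheme \<Rightarrow> ('l, 'd) ring_scheme \<Rightarrow> ('l \<Rightarrow> 'r \<Rightarrow> 'l) \<Rightarrow>
   ('n, 'e) ring_scheme \<Rightarrow> ('r \<Rightarrow> 'n \<Rightarrow> 'n) \<Rightarrow> ('m \<Rightarrow> 'l) \<Rightarrow>
   (('m \<times> 'n) \<Rightarrow>\<^sub>0 int) set \<Rightarrow> (('l \<times> 'n) \<Rightarrow>\<^sub>0 int) set" where
  "tensor_right_map R M' ra' N la f =
     (let T = tensor R M' ra' N la in tensor_lift T (\<lambda>x y. f x \<boxtimes>\<^bsub>T\<^esub> y))"

definition exact ::
  "('l, 'c) ring_scheme \<Rightarrow> ('l \<Rightarrow> 'm) \<Rightarrow> ('m, 'd) ring_scheme \<Rightarrow> ('m \<Rightarrow> 'n) \<Rightarrow>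
   ('n, 'e) ring_scheme \<Rightarrow> bool" where
  "exact L f M g N \<longleftrightarrow> f ` carrier L = a_kernel M N g"

text \<open>
  A left \<open>R\<close>-module \<open>N\<close> is faithfully flat if a sequence \<open>M\<^sub>1 \<rightarrow> M\<^sub>2 \<rightarrow> M\<^sub>3\<close> of right \<open>R\<close>-modules is
  exact exactly when \<open>M\<^sub>1 \<otimes>\<^sub>R N \<rightarrow> M\<^sub>2 \<otimes>\<^sub>R N \<rightarrow> M\<^sub>3 \<otimes>\<^sub>R N\<close> is.  HOL has no quantification over
  types, so the test modules have carriers in a universe type \<open>'u\<close>.  If \<open>'u\<close> is infinite and has
  at least the cardinality of \<open>R\<close>, this is faithful flatness with respect to all modules:
  flatness can be tested on the inclusions of right ideals into \<open>R\<close>, and faithfulness of a flat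
  module on cyclic right modules.
\<close>

definition faithfully_flat_left ::
  "'u itself \<Rightarrow> ('r, 'c) ring_scheme \<Rightarrow> ('n, 'd) ring_scheme \<Rightarrow> ('r \<Rightarrow> 'n \<Rightarrow> 'n) \<Rightarrow> bool" where
  "faithfully_flat_left _ R N la \<longleftrightarrow>
     left_module R N la \<and>
     (\<forall>(M1 :: 'u ring) r1 (M2 :: 'u ring) r2 (M3 :: 'u ring) r3 f g.
        right_module R M1 r1 \<longrightarrow> right_module R M2 r2 \<longrightarrow> right_module R M3 r3 \<longrightarrow>
        f \<in> right_module_hom R M1 r1 M2 r2 \<longrightarrow> g \<in> right_module_hom R M2 r2 M3 r3 \<longrightarrow>
        (exact M1 f M2 g M3 \<longleftrightarrow>
         exact (tensor R M1 r1 N la) (tensor_right_map R M2 r2 N la f)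
               (tensor R M2 r2 N la) (tensor_right_map R M3 r3 N la g)
               (tensor R M3 r3 N la)))"


section \<open>Algebras over a field and their tensor products\<close>

locale algebra_over_field = field K + module K A + A: ring A
  for K (structure) and A (structure) +
  assumes smult_mult_left: "\<lbrakk>a \<in> carrier K; x \<in> carrier A; y \<in> carrier A\<rbrakk>
          \<Longrightarrow> (a \<odot>\<^bsub>A\<^esub> x) \<otimes>\<^bsub>A\<^esub> y = a \<odot>\<^bsub>A\<^esub> (x \<otimes>\<^bsub>A\<^esub> y)"
    and smult_mult_right: "\<lbrakk>a \<in> carrier K; x \<in> carrier A; y \<in> carrier A\<rbrakk>
          \<Longrightarrow> x \<otimes>\<^bsub>A\<^esub> (a \<odot>\<^bsub>A\<^esub> y) = a \<odot>\<^bsub>A\<^esub> (x \<otimes>\<^bsub>A\<^esub> y)"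

definition algebra_hom ::
  "('k, 'c) ring_scheme \<Rightarrow> ('k, 'a, 'd) module_scheme \<Rightarrow> ('k, 'b, 'e) module_scheme \<Rightarrow>
   ('a \<Rightarrow> 'b) set" where
  "algebra_hom K A B =
     {f \<in> ring_hom A B. \<forall>a\<in>carrier K. \<forall>x\<in>carrier A. f (a \<odot>\<^bsub>A\<^esub> x) = a \<odot>\<^bsub>B\<^esub> f x}"

definition opposite :: "('a, 'c) ring_scheme \<Rightarrow> ('a, 'c) ring_scheme" where
  "opposite A = A\<lparr>monoid.mult := \<lambda>x y. y \<otimes>\<^bsub>A\<^esub> x\<rparr>"

definition tensor_algebra ::
  "('k, 'c) ring_scheme \<Rightarrow> ('k, 'a, 'd) module_scheme \<Rightarrow> ('k, 'b, 'e) module_scheme \<Rightarrow>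
   ('k, (('a \<times> 'b) \<Rightarrow>\<^sub>0 int) set) module" where
  "tensor_algebra K A B =
     (let T = tensor K A (\<lambda>x a. a \<odot>\<^bsub>A\<^esub> x) B (\<lambda>a y. a \<odot>\<^bsub>B\<^esub> y)
      in \<lparr>carrier = carrier T, monoid.mult = factorwise_mult T A B,
          one = \<one>\<^bsub>A\<^esub> \<boxtimes>\<^bsub>T\<^esub> \<one>\<^bsub>B\<^esub>, ring.zero = \<zero>\<^bsub>T\<^esub>, ring.add = ring.add T,
          smult = (\<lambda>a. tensor_lift T (\<lambda>x y. (a \<odot>\<^bsub>A\<^esub> x) \<boxtimes>\<^bsub>T\<^esub> y))\<rparr>)"


section \<open>Hopf algebras and Hopf-Galois extensions\<close>

text \<open>Both sides of coassociativity are evaluated in the bracketing \<open>H \<otimes> (H \<otimes> H)\<close>.\<close>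

locale hopf_algebra = algebra_over_field K H
  for K (structure) and H (structure)
    and \<Delta> :: "'h \<Rightarrow> (('h \<times> 'h) \<Rightarrow>\<^sub>0 int) set" and \<epsilon> :: "'h \<Rightarrow> 'k" and S :: "'h \<Rightarrow> 'h" +
  assumes comult_hom: "\<Delta> \<in> algebra_hom K H (tensor_algebra K H H)"
    and coassoc: "\<And>h. h \<in> carrier H \<Longrightarrow>
          (let HH = tensor_algebra K H H; HHH = tensor_algebra K H HH in
           tensor_lift HHH (\<lambda>h1 h2. tensor_lift HHH
              (\<lambda>h11 h12. h11 \<boxtimes>\<^bsub>HHH\<^esub> (h12 \<boxtimes>\<^bsub>HH\<^esub> h2)) (\<Delta> h1)) (\<Delta> h)
           = tensor_lift HHH (\<lambda>h1 h2. h1 \<boxtimes>\<^bsub>HHH\<^esub> \<Delta> h2) (\<Delta> h))"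
    and counit_hom: "\<epsilon> \<in> ring_hom H K"
    and counit_smult: "\<lbrakk>a \<in> carrier K; h \<in> carrier H\<rbrakk> \<Longrightarrow> \<epsilon> (a \<odot>\<^bsub>H\<^esub> h) = a \<otimes>\<^bsub>K\<^esub> \<epsilon> h"
    and counit_left: "h \<in> carrier H \<Longrightarrow> tensor_lift H (\<lambda>h1 h2. \<epsilon> h1 \<odot>\<^bsub>H\<^esub> h2) (\<Delta> h) = h"
    and counit_right: "h \<in> carrier H \<Longrightarrow> tensor_lift H (\<lambda>h1 h2. \<epsilon> h2 \<odot>\<^bsub>H\<^esub> h1) (\<Delta> h) = h"
    and antipode_hom: "S \<in> hom (add_monoid H) (add_monoid H)"
    and antipode_smult: "\<lbrakk>a \<in> carrier K; h \<in> carrier H\<rbrakk> \<Longrightarrow> S (a \<odot>\<^bsub>H\<^esub> h) = a \<odot>\<^bsub>H\<^esub> S h"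
    and antipode_left: "h \<in> carrier H \<Longrightarrow>
          tensor_lift H (\<lambda>h1 h2. S h1 \<otimes>\<^bsub>H\<^esub> h2) (\<Delta> h) = \<epsilon> h \<odot>\<^bsub>H\<^esub> \<one>\<^bsub>H\<^esub>"
    and antipode_right: "h \<in> carrier H \<Longrightarrow>
          tensor_lift H (\<lambda>h1 h2. h1 \<otimes>\<^bsub>H\<^esub> S h2) (\<Delta> h) = \<epsilon> h \<odot>\<^bsub>H\<^esub> \<one>\<^bsub>H\<^esub>"

locale comodule_algebra = hopf_algebra K H \<Delta> \<epsilon> S + P: algebra_over_field K P
  for K (structure) and H (structure) and \<Delta> and \<epsilon> and S and P (structure)
    and \<delta> :: "'p \<Rightarrow> (('p \<times> 'h) \<Rightarrow>\<^sub>0 int) set" +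
  assumes coaction_hom: "\<delta> \<in> algebra_hom K P (tensor_algebra K P H)"
    and coaction_coassoc: "\<And>p. p \<in> carrier P \<Longrightarrow>
          (let HH = tensor_algebra K H H; PHH = tensor_algebra K P HH in
           tensor_lift PHH (\<lambda>p0 p1. tensor_lift PHH
              (\<lambda>p00 p01. p00 \<boxtimes>\<^bsub>PHH\<^esub> (p01 \<boxtimes>\<^bsub>HH\<^esub> p1)) (\<delta> p0)) (\<delta> p)
           = tensor_lift PHH (\<lambda>p0 p1. p0 \<boxtimes>\<^bsub>PHH\<^esub> \<Delta> p1) (\<delta> p))"
    and coaction_counit: "p \<in> carrier P \<Longrightarrow>
          tensor_lift P (\<lambda>p0 p1. \<epsilon> p1 \<odot>\<^bsub>P\<^esub> p0) (\<delta> p) = p"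

definition coinvariants ::
  "('k, 'c) ring_scheme \<Rightarrow> ('k, 'h, 'd) module_scheme \<Rightarrow> ('k, 'p, 'e) module_scheme \<Rightarrow>
   ('p \<Rightarrow> (('p \<times> 'h) \<Rightarrow>\<^sub>0 int) set) \<Rightarrow> ('k, 'p, 'e) module_scheme" where
  "coinvariants K H P \<delta> =
     P\<lparr>carrier := {b \<in> carrier P. \<delta> b = b \<boxtimes>\<^bsub>tensor_algebra K P H\<^esub> \<one>\<^bsub>H\<^esub>}\<rparr>"

text \<open>\<open>P \<otimes>\<^sub>B P\<close> for the coinvariant subalgebra \<open>B\<close>.\<close>

definition balanced_square ::
  "('k, 'c) ring_scheme \<Rightarrow> ('k, 'h, 'd) module_scheme \<Rightarrow> ('k, 'p, 'e) module_scheme \<Rightarrow>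
   ('p \<Rightarrow> (('p \<times> 'h) \<Rightarrow>\<^sub>0 int) set) \<Rightarrow> (('p \<times> 'p) \<Rightarrow>\<^sub>0 int) set ring" where
  "balanced_square K H P \<delta> =
     tensor (coinvariants K H P \<delta>) P (\<lambda>p b. p \<otimes>\<^bsub>P\<^esub> b) P (\<lambda>b p. b \<otimes>\<^bsub>P\<^esub> p)"

definition canonical_map ::
  "('k, 'c) ring_scheme \<Rightarrow> ('k, 'h, 'd) module_scheme \<Rightarrow> ('k, 'p, 'e) module_scheme \<Rightarrow>
   ('p \<Rightarrow> (('p \<times> 'h) \<Rightarrow>\<^sub>0 int) set) \<Rightarrow>
   (('p \<times> 'p) \<Rightarrow>\<^sub>0 int) set \<Rightarrow> (('p \<times> 'h) \<Rightarrow>\<^sub>0 int) set" where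
  "canonical_map K H P \<delta> =
     (let PH = tensor_algebra K P H in
      tensor_lift PH (\<lambda>p q. tensor_lift PH (\<lambda>q0 q1. (p \<otimes>\<^bsub>P\<^esub> q0) \<boxtimes>\<^bsub>PH\<^esub> q1) (\<delta> q)))"

locale hopf_galois_extension = comodule_algebra +
  assumes canonical_bij:
    "bij_betw (canonical_map K H P \<delta>)
       (carrier (balanced_square K H P \<delta>)) (carrier (tensor_algebra K P H))"

definition translation_map ::
  "('k, 'c) ring_scheme \<Rightarrow> ('k, 'h, 'd) module_scheme \<Rightarrow> ('k, 'p, 'e) module_scheme \<Rightarrow>
   ('p \<Rightarrow> (('p \<times> 'h) \<Rightarrow>\<^sub>0 int) set) \<Rightarrow> 'h \<Rightarrow> (('p \<times> 'p) \<Rightarrow>\<^sub>0 int) set" where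
  "translation_map K H P \<delta> h =
     inv_into (carrier (balanced_square K H P \<delta>)) (canonical_map K H P \<delta>)
       (\<one>\<^bsub>P\<^esub> \<boxtimes>\<^bsub>tensor_algebra K P H\<^esub> h)"


section \<open>Left bialgebroids and left Hopf algebroids\<close>

text \<open>
  \<open>\<L> \<otimes>\<^sub>B \<L>\<close> for the bimodule structure \<open>b.X.c = s(b) t(c) X\<close>, and the tensor product
  \<open>\<L> \<otimes>\<^sub>B (\<L> \<otimes>\<^sub>B \<L>)\<close>, where \<open>B\<close> acts from the left on \<open>\<L> \<otimes>\<^sub>B \<L>\<close> through the first factor.
\<close>

definition bimodule_square ::
  "('b, 'c) ring_scheme \<Rightarrow> ('l, 'd) ring_scheme \<Rightarrow> ('b \<Rightarrow> 'l) \<Rightarrow> ('b \<Rightarrow> 'l) \<Rightarrow>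
   (('l \<times> 'l) \<Rightarrow>\<^sub>0 int) set ring" where
  "bimodule_square B L s t =
     tensor B L (\<lambda>X b. t b \<otimes>\<^bsub>L\<^esub> X) L (\<lambda>b Y. s b \<otimes>\<^bsub>L\<^esub> Y)"

definition bimodule_cube ::
  "('b, 'c) ring_scheme \<Rightarrow> ('l, 'd) ring_scheme \<Rightarrow> ('b \<Rightarrow> 'l) \<Rightarrow> ('b \<Rightarrow> 'l) \<Rightarrow>
   (('l \<times> (('l \<times> 'l) \<Rightarrow>\<^sub>0 int) set) \<Rightarrow>\<^sub>0 int) set ring" where
  "bimodule_cube B L s t =
     (let LL = bimodule_square B L s t in
      tensor B L (\<lambda>X b. t b \<otimes>\<^bsub>L\<^esub> X)
             LL (\<lambda>b. tensor_lift LL (\<lambda>X Y. (s b \<otimes>\<^bsub>L\<^esub> X) \<boxtimes>\<^bsub>LL\<^esub> Y)))"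

definition takeuchi_product ::
  "('b, 'c) ring_scheme \<Rightarrow> ('l, 'd) ring_scheme \<Rightarrow> ('b \<Rightarrow> 'l) \<Rightarrow> ('b \<Rightarrow> 'l) \<Rightarrow>
   (('l \<times> 'l) \<Rightarrow>\<^sub>0 int) set set" where
  "takeuchi_product B L s t =
     (let LL = bimodule_square B L s t in
      {Z \<in> carrier LL. \<forall>b\<in>carrier B.
         tensor_lift LL (\<lambda>X Y. (X \<otimes>\<^bsub>L\<^esub> t b) \<boxtimes>\<^bsub>LL\<^esub> Y) Z =
         tensor_lift LL (\<lambda>X Y. X \<boxtimes>\<^bsub>LL\<^esub> (Y \<otimes>\<^bsub>L\<^esub> s b)) Z})"

locale left_bialgebroid = B: algebra_over_field K B + L: algebra_over_field K L
  for K (structure) and B (structure) and L (structure)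
    and s :: "'b \<Rightarrow> 'l" and t :: "'b \<Rightarrow> 'l"
    and \<Delta> :: "'l \<Rightarrow> (('l \<times> 'l) \<Rightarrow>\<^sub>0 int) set" and \<epsilon> :: "'l \<Rightarrow> 'b" +
  assumes source_hom: "s \<in> algebra_hom K B L"
    and target_hom: "t \<in> algebra_hom K (opposite B) L"
    and source_target_commute: "\<lbrakk>b \<in> carrier B; c \<in> carrier B\<rbrakk>
          \<Longrightarrow> s b \<otimes>\<^bsub>L\<^esub> t c = t c \<otimes>\<^bsub>L\<^esub> s b"
    and comult_additive: "\<Delta> \<in> hom (add_monoid L) (add_monoid (bimodule_square B L s t))"
    and comult_bimodule: "\<lbrakk>b \<in> carrier B; c \<in> carrier B; X \<in> carrier L\<rbrakk> \<Longrightarrow>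
          \<Delta> (s b \<otimes>\<^bsub>L\<^esub> (t c \<otimes>\<^bsub>L\<^esub> X)) =
          tensor_lift (bimodule_square B L s t)
            (\<lambda>X1 X2. (s b \<otimes>\<^bsub>L\<^esub> X1) \<boxtimes>\<^bsub>bimodule_square B L s t\<^esub> (t c \<otimes>\<^bsub>L\<^esub> X2)) (\<Delta> X)"
    and counit_additive: "\<epsilon> \<in> hom (add_monoid L) (add_monoid B)"
    and counit_bimodule: "\<lbrakk>b \<in> carrier B; c \<in> carrier B; X \<in> carrier L\<rbrakk> \<Longrightarrow>
          \<epsilon> (s b \<otimes>\<^bsub>L\<^esub> (t c \<otimes>\<^bsub>L\<^esub> X)) = b \<otimes>\<^bsub>B\<^esub> \<epsilon> X \<otimes>\<^bsub>B\<^esub> c"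
    and coassoc: "\<And>X. X \<in> carrier L \<Longrightarrow>
          (let LL = bimodule_square B L s t; LLL = bimodule_cube B L s t in
           tensor_lift LLL (\<lambda>X1 X2. tensor_lift LLL
              (\<lambda>X11 X12. X11 \<boxtimes>\<^bsub>LLL\<^esub> (X12 \<boxtimes>\<^bsub>LL\<^esub> X2)) (\<Delta> X1)) (\<Delta> X)
           = tensor_lift LLL (\<lambda>X1 X2. X1 \<boxtimes>\<^bsub>LLL\<^esub> \<Delta> X2) (\<Delta> X))"
    and counit_left: "X \<in> carrier L \<Longrightarrow>
          tensor_lift L (\<lambda>X1 X2. s (\<epsilon> X1) \<otimes>\<^bsub>L\<^esub> X2) (\<Delta> X) = X"
    and counit_right: "X \<in> carrier L \<Longrightarrow>
          tensor_lift L (\<lambda>X1 X2. t (\<epsilon> X2) \<otimes>\<^bsub>L\<^esub> X1) (\<Delta> X) = X"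
    and comult_takeuchi: "X \<in> carrier L \<Longrightarrow> \<Delta> X \<in> takeuchi_product B L s t"
    and comult_one: "\<Delta> \<one>\<^bsub>L\<^esub> = \<one>\<^bsub>L\<^esub> \<boxtimes>\<^bsub>bimodule_square B L s t\<^esub> \<one>\<^bsub>L\<^esub>"
    and comult_mult: "\<lbrakk>X \<in> carrier L; Y \<in> carrier L\<rbrakk> \<Longrightarrow>
          \<Delta> (X \<otimes>\<^bsub>L\<^esub> Y) = factorwise_mult (bimodule_square B L s t) L L (\<Delta> X) (\<Delta> Y)"
    and counit_one: "\<epsilon> \<one>\<^bsub>L\<^esub> = \<one>\<^bsub>B\<^esub>"
    and counit_source: "\<lbrakk>b \<in> carrier B; X \<in> carrier L\<rbrakk> \<Longrightarrow> \<epsilon> (s b \<otimes>\<^bsub>L\<^esub> X) = b \<otimes>\<^bsub>B\<^esub> \<epsilon> X"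
    and counit_mult_source: "\<lbrakk>X \<in> carrier L; Y \<in> carrier L\<rbrakk> \<Longrightarrow>
          \<epsilon> (X \<otimes>\<^bsub>L\<^esub> s (\<epsilon> Y)) = \<epsilon> (X \<otimes>\<^bsub>L\<^esub> Y)"
    and counit_mult_target: "\<lbrakk>X \<in> carrier L; Y \<in> carrier L\<rbrakk> \<Longrightarrow>
          \<epsilon> (X \<otimes>\<^bsub>L\<^esub> t (\<epsilon> Y)) = \<epsilon> (X \<otimes>\<^bsub>L\<^esub> Y)"

text \<open>\<open>\<L> \<otimes>\<^bsub>B\<^sup>o\<^sup>p\<^esub> \<L>\<close>, with \<open>X t(b) \<otimes> Y = X \<otimes> t(b) Y\<close>.\<close>

definition opposite_square ::
  "('b, 'c) ring_scheme \<Rightarrow> ('l, 'd) ring_scheme \<Rightarrow> ('b \<Rightarrow> 'l) \<Rightarrow>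
   (('l \<times> 'l) \<Rightarrow>\<^sub>0 int) set ring" where
  "opposite_square B L t =
     tensor (opposite B) L (\<lambda>X b. X \<otimes>\<^bsub>L\<^esub> t b) L (\<lambda>b Y. t b \<otimes>\<^bsub>L\<^esub> Y)"

definition hopf_map ::
  "('b, 'c) ring_scheme \<Rightarrow> ('l, 'd) ring_scheme \<Rightarrow> ('b \<Rightarrow> 'l) \<Rightarrow> ('b \<Rightarrow> 'l) \<Rightarrow>
   ('l \<Rightarrow> (('l \<times> 'l) \<Rightarrow>\<^sub>0 int) set) \<Rightarrow>
   (('l \<times> 'l) \<Rightarrow>\<^sub>0 int) set \<Rightarrow> (('l \<times> 'l) \<Rightarrow>\<^sub>0 int) set" where
  "hopf_map B L s t \<Delta> =
     (let LL = bimodule_square B L s t in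
      tensor_lift LL (\<lambda>X Y. tensor_lift LL (\<lambda>X1 X2. X1 \<boxtimes>\<^bsub>LL\<^esub> (X2 \<otimes>\<^bsub>L\<^esub> Y)) (\<Delta> X)))"

locale left_hopf_algebroid = left_bialgebroid +
  assumes hopf_map_bij:
    "bij_betw (hopf_map B L s t \<Delta>)
       (carrier (opposite_square B L t)) (carrier (bimodule_square B L s t))"


section \<open>The Ehresmann-Schauenburg bialgebroid\<close>

text \<open>
  The product \<open>(p \<otimes> q)(r \<otimes> u) = pr \<otimes> uq\<close> is that of \<open>P \<otimes> P\<^sup>o\<^sup>p\<close>; the bialgebroid is the
  subalgebra of elements with \<open>p\<^sub>0 \<otimes> q\<^sub>0 \<otimes> p\<^sub>1q\<^sub>1 = p \<otimes> q \<otimes> 1\<close>.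
\<close>

definition ES_ambient ::
  "('k, 'c) ring_scheme \<Rightarrow> ('k, 'p, 'e) module_scheme \<Rightarrow>
   ('k, (('p \<times> 'p) \<Rightarrow>\<^sub>0 int) set) module" where
  "ES_ambient K P = tensor_algebra K P (opposite P)"

definition diagonal_coaction ::
  "('k, 'c) ring_scheme \<Rightarrow> ('k, 'h, 'd) module_scheme \<Rightarrow> ('k, 'p, 'e) module_scheme \<Rightarrow>
   ('p \<Rightarrow> (('p \<times> 'h) \<Rightarrow>\<^sub>0 int) set) \<Rightarrow>
   (('p \<times> 'p) \<Rightarrow>\<^sub>0 int) set \<Rightarrow> (((('p \<times> 'p) \<Rightarrow>\<^sub>0 int) set \<times> 'h) \<Rightarrow>\<^sub>0 int) set" where
  "diagonal_coaction K H P \<delta> =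
     (let PP = ES_ambient K P; PPH = tensor_algebra K PP H in
      tensor_lift PPH (\<lambda>p q.
        tensor_lift PPH (\<lambda>p0 p1.
          tensor_lift PPH (\<lambda>q0 q1. (p0 \<boxtimes>\<^bsub>PP\<^esub> q0) \<boxtimes>\<^bsub>PPH\<^esub> (p1 \<otimes>\<^bsub>H\<^esub> q1)) (\<delta> q)) (\<delta> p)))"

definition ES_algebra ::
  "('k, 'c) ring_scheme \<Rightarrow> ('k, 'h, 'd) module_scheme \<Rightarrow> ('k, 'p, 'e) module_scheme \<Rightarrow>
   ('p \<Rightarrow> (('p \<times> 'h) \<Rightarrow>\<^sub>0 int) set) \<Rightarrow> ('k, (('p \<times> 'p) \<Rightarrow>\<^sub>0 int) set) module" where
  "ES_algebra K H P \<delta> =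
     (let PP = ES_ambient K P in
      PP\<lparr>carrier := {X \<in> carrier PP.
           diagonal_coaction K H P \<delta> X = X \<boxtimes>\<^bsub>tensor_algebra K PP H\<^esub> \<one>\<^bsub>H\<^esub>}\<rparr>)"

definition ES_source ::
  "('k, 'c) ring_scheme \<Rightarrow> ('k, 'p, 'e) module_scheme \<Rightarrow> 'p \<Rightarrow> (('p \<times> 'p) \<Rightarrow>\<^sub>0 int) set" where
  "ES_source K P b = b \<boxtimes>\<^bsub>ES_ambient K P\<^esub> \<one>\<^bsub>P\<^esub>"

definition ES_target ::
  "('k, 'c) ring_scheme \<Rightarrow> ('k, 'p, 'e) module_scheme \<Rightarrow> 'p \<Rightarrow> (('p \<times> 'p) \<Rightarrow>\<^sub>0 int) set" where
  "ES_target K P b = \<one>\<^bsub>P\<^esub> \<boxtimes>\<^bsub>ES_ambient K P\<^esub> b"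

text \<open>
  \<open>\<B> \<otimes>\<^sub>B \<B>\<close>, and \<open>(P \<otimes> P) \<otimes>\<^sub>B (P \<otimes> P) = P \<otimes> (P \<otimes>\<^sub>B P) \<otimes> P\<close>, balanced by
  \<open>p \<otimes> qb \<otimes>\<^sub>B r \<otimes> u = p \<otimes> q \<otimes>\<^sub>B br \<otimes> u\<close>.
\<close>

definition ES_square ::
  "('k, 'c) ring_scheme \<Rightarrow> ('k, 'h, 'd) module_scheme \<Rightarrow> ('k, 'p, 'e) module_scheme \<Rightarrow>
   ('p \<Rightarrow> (('p \<times> 'h) \<Rightarrow>\<^sub>0 int) set) \<Rightarrow>
   (((('p \<times> 'p) \<Rightarrow>\<^sub>0 int) set \<times> (('p \<times> 'p) \<Rightarrow>\<^sub>0 int) set) \<Rightarrow>\<^sub>0 int) set ring" where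
  "ES_square K H P \<delta> =
     bimodule_square (coinvariants K H P \<delta>) (ES_algebra K H P \<delta>) (ES_source K P) (ES_target K P)"

definition ES_ambient_square ::
  "('k, 'c) ring_scheme \<Rightarrow> ('k, 'h, 'd) module_scheme \<Rightarrow> ('k, 'p, 'e) module_scheme \<Rightarrow>
   ('p \<Rightarrow> (('p \<times> 'h) \<Rightarrow>\<^sub>0 int) set) \<Rightarrow>
   (((('p \<times> 'p) \<Rightarrow>\<^sub>0 int) set \<times> (('p \<times> 'p) \<Rightarrow>\<^sub>0 int) set) \<Rightarrow>\<^sub>0 int) set ring" where
  "ES_ambient_square K H P \<delta> =
     bimodule_square (coinvariants K H P \<delta>) (ES_ambient K P) (ES_source K P) (ES_target K P)"

definition ES_inclusion ::
  "('k, 'c) ring_scheme \<Rightarrow> ('k, 'h, 'd) module_scheme \<Rightarrow> ('k, 'p, 'e) module_scheme \<Rightarrow>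
   ('p \<Rightarrow> (('p \<times> 'h) \<Rightarrow>\<^sub>0 int) set) \<Rightarrow>
   (((('p \<times> 'p) \<Rightarrow>\<^sub>0 int) set \<times> (('p \<times> 'p) \<Rightarrow>\<^sub>0 int) set) \<Rightarrow>\<^sub>0 int) set \<Rightarrow>
   (((('p \<times> 'p) \<Rightarrow>\<^sub>0 int) set \<times> (('p \<times> 'p) \<Rightarrow>\<^sub>0 int) set) \<Rightarrow>\<^sub>0 int) set" where
  "ES_inclusion K H P \<delta> =
     (let T = ES_ambient_square K H P \<delta> in tensor_lift T (\<lambda>X Y. X \<boxtimes>\<^bsub>T\<^esub> Y))"

text \<open>
  The formula \<open>p\<^sub>0 \<otimes> \<tau>(p\<^sub>1) \<otimes> q\<close> a priori defines an element of \<open>(P \<otimes> P) \<otimes>\<^sub>B (P \<otimes> P)\<close>.  The coproduct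
  is the element of \<open>\<B> \<otimes>\<^sub>B \<B>\<close> whose image under the map induced by \<open>\<B> \<subseteq> P \<otimes> P\<close> is given by
  this formula.
\<close>

definition ES_coproduct_formula ::
  "('k, 'c) ring_scheme \<Rightarrow> ('k, 'h, 'd) module_scheme \<Rightarrow> ('k, 'p, 'e) module_scheme \<Rightarrow>
   ('p \<Rightarrow> (('p \<times> 'h) \<Rightarrow>\<^sub>0 int) set) \<Rightarrow> (('p \<times> 'p) \<Rightarrow>\<^sub>0 int) set \<Rightarrow>
   (((('p \<times> 'p) \<Rightarrow>\<^sub>0 int) set \<times> (('p \<times> 'p) \<Rightarrow>\<^sub>0 int) set) \<Rightarrow>\<^sub>0 int) set" where
  "ES_coproduct_formula K H P \<delta> =
     (let PP = ES_ambient K P; T = ES_ambient_square K H P \<delta> in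
      tensor_lift T (\<lambda>p q.
        tensor_lift T (\<lambda>p0 p1.
          tensor_lift T (\<lambda>u v. (p0 \<boxtimes>\<^bsub>PP\<^esub> u) \<boxtimes>\<^bsub>T\<^esub> (v \<boxtimes>\<^bsub>PP\<^esub> q))
            (translation_map K H P \<delta> p1)) (\<delta> p)))"

definition ES_coproduct ::
  "('k, 'c) ring_scheme \<Rightarrow> ('k, 'h, 'd) module_scheme \<Rightarrow> ('k, 'p, 'e) module_scheme \<Rightarrow>
   ('p \<Rightarrow> (('p \<times> 'h) \<Rightarrow>\<^sub>0 int) set) \<Rightarrow> (('p \<times> 'p) \<Rightarrow>\<^sub>0 int) set \<Rightarrow>
   (((('p \<times> 'p) \<Rightarrow>\<^sub>0 int) set \<times> (('p \<times> 'p) \<Rightarrow>\<^sub>0 int) set) \<Rightarrow>\<^sub>0 int) set" where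
  "ES_coproduct K H P \<delta> X =
     (THE Y. Y \<in> carrier (ES_square K H P \<delta>) \<and>
             ES_inclusion K H P \<delta> Y = ES_coproduct_formula K H P \<delta> X)"

definition ES_counit :: "('k, 'p, 'e) module_scheme \<Rightarrow> (('p \<times> 'p) \<Rightarrow>\<^sub>0 int) set \<Rightarrow> 'p" where
  "ES_counit P = tensor_lift P (\<lambda>p q. p \<otimes>\<^bsub>P\<^esub> q)"

end

theory Submission
  imports Defs
begin

text \<open>
  The map \<open>(p \<otimes> q) \<otimes> (r \<otimes> u) \<mapsto> p \<otimes> qr \<otimes> u\<close> identifies \<open>\<B> \<otimes>\<^sub>B \<B>\<close> with a subgroup of \<open>P \<otimes> P \<otimes> P\<close>.
  The coproduct becomes \<open>p \<otimes> q \<mapsto> p \<otimes> 1 \<otimes> q\<close>, so the bialgebroid axioms turn into evident identities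
  between tensors over the field (coassociativity by means of the analogous embedding of the triple
  tensor product).  Likewise \<open>(p \<otimes> q) \<otimes> (r \<otimes> u) \<mapsto> p \<otimes> r \<otimes> uq\<close> embeds the domain of \<open>\<lambda>\<close> with the same
  image, and \<open>\<lambda>\<close> becomes the identity of this image.  Injectivity of the embeddings and the description
  of their images may be tested after applying \<open>- \<otimes>\<^sub>B P\<close>, because \<open>P\<close> is faithfully flat; there they
  follow from \<open>\<B> \<otimes>\<^sub>B P \<cong> P \<otimes> P\<close>, \<open>p \<otimes> q \<otimes> x \<mapsto> p \<otimes> qx\<close>, which holds by Galois descent for the diagonal
  coaction.
\<close>

text \<open>Elements of a tensor product over \<open>B\<close> are hard to compare, and nothing
  formal makes the map from \<open>L \<otimes>\<^sub>B L\<close> to the space of the coproduct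
  formula injective. Multiplying the two legs that meet at \<open>B\<close> moves each comparison to
  a tensor power over the field, where additive maps are checked on pure tensors.

  The two images agree because \<open>M \<otimes>\<^sub>B P \<cong> M \<otimes> H\<close>, the
  extension of \<open>can\<close> to right \<open>P\<close>-modules \<open>M\<close>, turns the
  descent criterion of both embeddings into coinvariance under one map, \<open>p \<otimes> q
  \<otimes> u \<mapsto> p_0 \<otimes> q_0 \<otimes> u_0 \<otimes> p_1 q_1 u_1\<close>. The same
  isomorphism turns the equation defining \<open>L\<close> into one that coassociativity of the
  diagonal coaction solves.

  \<open>tensor_lift\<close> evaluates one chosen representative, so additive maps pass through
  Sweedler sums even where the summand is not balanced. Faithful flatness is assumed for test
  modules in one universe type, so each module to which it is applied is shown to embed
  there.\<close>

abbreviation ahom where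
  "ahom A B \<equiv> hom (add_monoid A) (add_monoid B)"

lemma ahomI:
  assumes "\<And>x. x \<in> carrier A \<Longrightarrow> f x \<in> carrier B"
    and "\<And>x y. x \<in> carrier A \<Longrightarrow> y \<in> carrier A \<Longrightarrow> f (x \<oplus>\<^bsub>A\<^esub> y) = f x \<oplus>\<^bsub>B\<^esub> f y"
  shows "f \<in> ahom A B"
  using assms by (auto simp: hom_def)

lemma ahom_closed: "f \<in> ahom A B \<Longrightarrow> x \<in> carrier A \<Longrightarrow> f x \<in> carrier B"
  by (auto simp: hom_def)

lemma ahom_add:
  "f \<in> ahom A B \<Longrightarrow> x \<in> carrier A \<Longrightarrow> y \<in> carrier A \<Longrightarrow> f (x \<oplus>\<^bsub>A\<^esub> y) = f x \<oplus>\<^bsub>B\<^esub> f y"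
  by (auto simp: hom_def)

lemma ahom_zero:
  assumes "f \<in> ahom A B" "abelian_group A" "abelian_group B"
  shows "f \<zero>\<^bsub>A\<^esub> = \<zero>\<^bsub>B\<^esub>"
proof -
  interpret A: abelian_group A by fact
  interpret B: abelian_group B by fact
  show ?thesis
    using hom_one[OF assms(1)] A.a_group B.a_group by simp
qed

lemma ahom_uminus:
  assumes "f \<in> ahom A B" "abelian_group A" "abelian_group B" "x \<in> carrier A"
  shows "f (\<ominus>\<^bsub>A\<^esub> x) = \<ominus>\<^bsub>B\<^esub> f x"
proof -
  interpret A: abelian_group A by fact
  interpret B: abelian_group B by fact
  interpret group_hom "add_monoid A" "add_monoid B" f
    using assms(1) A.a_group B.a_group by (simp add: group_hom_def group_hom_axioms_def)
  show ?thesis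
    using hom_inv[of x] assms(4) by (simp add: a_inv_def)
qed

lemma ahom_minus:
  assumes "f \<in> ahom A B" "abelian_group A" "abelian_group B" "x \<in> carrier A" "y \<in> carrier A"
  shows "f (x \<ominus>\<^bsub>A\<^esub> y) = f x \<ominus>\<^bsub>B\<^esub> f y"
proof -
  interpret A: abelian_group A by fact
  interpret B: abelian_group B by fact
  show ?thesis
    using assms by (simp add: a_minus_def ahom_add ahom_uminus)
qed

lemma ahom_comp: "g \<in> ahom B C \<Longrightarrow> (\<lambda>x. f x) \<in> ahom A B \<Longrightarrow> (\<lambda>x. g (f x)) \<in> ahom A C"
  by (auto simp: hom_def)

lemma ahom_ident: "(\<lambda>x. x) \<in> ahom A A"
  by (auto simp: hom_def)

lemma ahom_cong:
  "f \<in> ahom A C \<Longrightarrow> (\<And>x. x \<in> carrier A \<Longrightarrow> g x = f x) \<Longrightarrow> abelian_group A \<Longrightarrow> g \<in> ahom A C"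
  by (rule ahomI) (simp_all add: ahom_closed ahom_add abelian_groupE(1))

lemma ahom_inv_into:
  assumes f: "f \<in> ahom A B" and bij: "bij_betw f (carrier A) (carrier B)" and A: "abelian_group A"
  shows "inv_into (carrier A) f \<in> ahom B A"
proof (rule ahomI)
  interpret A: abelian_group A by fact
  let ?g = "inv_into (carrier A) f"
  have cl: "?g y \<in> carrier A" if "y \<in> carrier B" for y
    using bij that by (metis bij_betw_def inv_into_into)
  then show "?g y \<in> carrier A" if "y \<in> carrier B" for y
    using that .
  fix x y assume xy: "x \<in> carrier B" "y \<in> carrier B"
  have "f (?g x \<oplus>\<^bsub>A\<^esub> ?g y) = x \<oplus>\<^bsub>B\<^esub> y"
    using xy cl f bij by (simp add: ahom_add bij_betw_inv_into_right)
  then show "?g (x \<oplus>\<^bsub>B\<^esub> y) = ?g x \<oplus>\<^bsub>A\<^esub> ?g y"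
    using xy cl bij by (metis A.a_closed bij_betw_inv_into_left)
qed

lemma ahom_inj:
  assumes "f \<in> ahom A B" "abelian_group A" "abelian_group B"
    and "\<And>x. x \<in> carrier A \<Longrightarrow> f x = \<zero>\<^bsub>B\<^esub> \<Longrightarrow> x = \<zero>\<^bsub>A\<^esub>"
  shows "inj_on f (carrier A)"
proof (rule inj_onI)
  interpret A: abelian_group A by fact
  interpret B: abelian_group B by fact
  fix x y assume xy: "x \<in> carrier A" "y \<in> carrier A" "f x = f y"
  then have "f (x \<ominus>\<^bsub>A\<^esub> y) = \<zero>\<^bsub>B\<^esub>"
    using assms(1-3) by (simp add: ahom_minus ahom_closed B.minus_eq B.r_neg)
  then have "x \<ominus>\<^bsub>A\<^esub> y = \<zero>\<^bsub>A\<^esub>"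
    using assms(4) xy by simp
  then show "x = y"
    using xy by (simp add: A.minus_eq) (metis A.add.inv_closed A.minus_equality A.minus_minus)
qed

section \<open>Evaluation of formal integer combinations in an abelian group\<close>

context abelian_group
begin

lemma add_int_pow_closed: "x \<in> carrier G \<Longrightarrow> [(k::int)] \<cdot>\<^bsub>G\<^esub> x \<in> carrier G"
  using add.int_pow_closed[of x k] by (simp add: add_pow_def)

text \<open>Coefficients vanish outside the support, so enlarging the index set adds only zero
  terms. Two combinations can then be summed over a common index set.\<close>

lemma frag_eval_superset:
  assumes "finite S" "Poly_Mapping.keys c \<subseteq> S" "\<And>z. z \<in> S \<Longrightarrow> f (fst z) (snd z) \<in> carrier G"
  shows "frag_eval G f c = (\<Oplus>z\<in>S. [Poly_Mapping.lookup c z] \<cdot>\<^bsub>G\<^esub> f (fst z) (snd z))"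
  unfolding frag_eval_def
  by (rule add.finprod_mono_neutral_cong_left)
    (use assms add_int_pow_closed in \<open>auto simp: Pi_def in_keys_iff add_pow_def\<close>)

lemma frag_eval_closed:
  assumes "Poly_Mapping.keys c \<subseteq> A \<times> B" "\<And>x y. x \<in> A \<Longrightarrow> y \<in> B \<Longrightarrow> f x y \<in> carrier G"
  shows "frag_eval G f c \<in> carrier G"
  unfolding frag_eval_def
  by (rule finsum_closed) (use assms add_int_pow_closed in \<open>force simp: Pi_def\<close>)

lemma frag_eval_of:
  assumes "f x y \<in> carrier G"
  shows "frag_eval G f (frag_of (x, y)) = f x y"
proof -
  have "frag_eval G f (frag_of (x, y)) =
        (\<Oplus>z\<in>{(x, y)}. [Poly_Mapping.lookup (frag_of (x,y)) z] \<cdot>\<^bsub>G\<^esub> f (fst z) (snd z))"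
    by (rule frag_eval_superset) (use assms in auto)
  then show ?thesis
    using assms add_int_pow_closed by (simp add: Pi_def add.int_pow_1[folded add_pow_def])
qed

lemma frag_eval_zero: "frag_eval G f 0 = \<zero>"
  by (simp add: frag_eval_def)

lemma frag_eval_plus:
  assumes "Poly_Mapping.keys c \<subseteq> A \<times> B" "Poly_Mapping.keys d \<subseteq> A \<times> B"
    and "\<And>x y. x \<in> A \<Longrightarrow> y \<in> B \<Longrightarrow> f x y \<in> carrier G"
  shows "frag_eval G f (c + d) = frag_eval G f c \<oplus> frag_eval G f d"
proof -
  let ?S = "Poly_Mapping.keys c \<union> Poly_Mapping.keys d"
  have cl: "\<And>z. z \<in> ?S \<Longrightarrow> f (fst z) (snd z) \<in> carrier G"
    using assms by fastforce
  have "frag_eval G f (c + d) = (\<Oplus>z\<in>?S. [Poly_Mapping.lookup (c + d) z] \<cdot>\<^bsub>G\<^esub> f (fst z) (snd z))"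
    by (rule frag_eval_superset) (use cl Poly_Mapping.keys_add[of c d] in auto)
  also have "\<dots> = (\<Oplus>z\<in>?S. [Poly_Mapping.lookup c z] \<cdot>\<^bsub>G\<^esub> f (fst z) (snd z)
                      \<oplus> [Poly_Mapping.lookup d z] \<cdot>\<^bsub>G\<^esub> f (fst z) (snd z))"
    by (rule finsum_cong')
      (use cl add_int_pow_closed in \<open>auto simp: lookup_add add.int_pow_mult[folded add_pow_def] Pi_def\<close>)
  also have "\<dots> = (\<Oplus>z\<in>?S. [Poly_Mapping.lookup c z] \<cdot>\<^bsub>G\<^esub> f (fst z) (snd z))
                      \<oplus> (\<Oplus>z\<in>?S. [Poly_Mapping.lookup d z] \<cdot>\<^bsub>G\<^esub> f (fst z) (snd z))"
    by (rule finsum_addf) (use cl add_int_pow_closed in \<open>auto simp: Pi_def\<close>)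
  also have "\<dots> = frag_eval G f c \<oplus> frag_eval G f d"
    using frag_eval_superset[of ?S c f] frag_eval_superset[of ?S d f] cl by simp
  finally show ?thesis .
qed

lemma frag_eval_minus:
  assumes "Poly_Mapping.keys c \<subseteq> A \<times> B" "Poly_Mapping.keys d \<subseteq> A \<times> B"
    and "\<And>x y. x \<in> A \<Longrightarrow> y \<in> B \<Longrightarrow> f x y \<in> carrier G"
  shows "frag_eval G f (c - d) = frag_eval G f c \<ominus> frag_eval G f d"
proof -
  have k: "Poly_Mapping.keys (c - d) \<subseteq> A \<times> B"
    using assms(1,2) keys_diff[of c d] by blast
  have "frag_eval G f c = frag_eval G f ((c - d) + d)" by simp
  also have "\<dots> = frag_eval G f (c - d) \<oplus> frag_eval G f d"
    by (rule frag_eval_plus[OF k assms(2)]) (use assms(3) in auto)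
  finally have "frag_eval G f (c - d) \<oplus> frag_eval G f d = frag_eval G f c" by simp
  moreover have "frag_eval G f (c - d) \<in> carrier G" "frag_eval G f c \<in> carrier G" "frag_eval G f d \<in> carrier G"
    using frag_eval_closed[OF k] frag_eval_closed[OF assms(1)] frag_eval_closed[OF assms(2)] assms(3)
    by auto
  ultimately show ?thesis
    by (metis a_minus_def add.inv_solve_right')
qed

end

text \<open>Differences alone generate the free abelian group from zero and the generators, so one
  closure case covers sums and negatives together.\<close>

lemma frag_induct [consumes 1, case_names zero of diff]:
  assumes "Poly_Mapping.keys c \<subseteq> S" "P 0" "\<And>x. x \<in> S \<Longrightarrow> P (frag_of x)"
    and "\<And>a b. Poly_Mapping.keys a \<subseteq> S \<Longrightarrow> Poly_Mapping.keys b \<subseteq> S \<Longrightarrow> P a \<Longrightarrow> P b \<Longrightarrow> P (a - b)"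
  shows "P c"
proof -
  have "Poly_Mapping.keys c \<subseteq> S \<and> P c"
    using assms(1)
  proof (rule frag_induction)
    show "Poly_Mapping.keys (a - b) \<subseteq> S \<and> P (a - b)"
      if "Poly_Mapping.keys a \<subseteq> S \<and> P a" "Poly_Mapping.keys b \<subseteq> S \<and> P b" for a b
      using that assms(4) keys_diff[of a b] by blast
  qed (use assms in auto)
  then show ?thesis ..
qed

lemma (in abelian_group) frag_eval_cong:
  assumes "Poly_Mapping.keys c \<subseteq> A \<times> B" "\<And>x y. x \<in> A \<Longrightarrow> y \<in> B \<Longrightarrow> f x y = g x y"
    and "\<And>x y. x \<in> A \<Longrightarrow> y \<in> B \<Longrightarrow> g x y \<in> carrier G"
  shows "frag_eval G f c = frag_eval G g c"
  unfolding frag_eval_def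
proof (rule finsum_cong')
  show "[Poly_Mapping.lookup c z] \<cdot>\<^bsub>G\<^esub> f (fst z) (snd z) = [Poly_Mapping.lookup c z] \<cdot>\<^bsub>G\<^esub> g (fst z) (snd z)"
    if "z \<in> Poly_Mapping.keys c" for z
    using that assms by fastforce
qed (use assms add_int_pow_closed in \<open>force simp: Pi_def\<close>)+

section \<open>The universal property of tensor products\<close>

definition balanced ::
  "('r, 'c) ring_scheme \<Rightarrow> ('m, 'd) ring_scheme \<Rightarrow> ('m \<Rightarrow> 'r \<Rightarrow> 'm) \<Rightarrow>
   ('n, 'e) ring_scheme \<Rightarrow> ('r \<Rightarrow> 'n \<Rightarrow> 'n) \<Rightarrow> ('g, 'f) ring_scheme \<Rightarrow> ('m \<Rightarrow> 'n \<Rightarrow> 'g) \<Rightarrow> bool" where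
  "balanced R M ra N la G f \<longleftrightarrow>
     (\<forall>x\<in>carrier M. f x \<in> ahom N G) \<and>
     (\<forall>y\<in>carrier N. (\<lambda>x. f x y) \<in> ahom M G) \<and>
     (\<forall>x\<in>carrier M. \<forall>a\<in>carrier R. \<forall>y\<in>carrier N. f (ra x a) y = f x (la a y))"

lemma balancedI:
  assumes "\<And>x. x \<in> carrier M \<Longrightarrow> (\<lambda>y. f x y) \<in> ahom N G"
    and "\<And>y. y \<in> carrier N \<Longrightarrow> (\<lambda>x. f x y) \<in> ahom M G"
    and "\<And>x a y. x \<in> carrier M \<Longrightarrow> a \<in> carrier R \<Longrightarrow> y \<in> carrier N \<Longrightarrow> f (ra x a) y = f x (la a y)"
  shows "balanced R M ra N la G f"
  using assms by (simp add: balanced_def)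

lemma balanced_closed:
  "balanced R M ra N la G f \<Longrightarrow> x \<in> carrier M \<Longrightarrow> y \<in> carrier N \<Longrightarrow> f x y \<in> carrier G"
  by (auto simp: balanced_def intro: ahom_closed)

lemma balanced_comp:
  "balanced R M ra N la G f \<Longrightarrow> h \<in> ahom G G' \<Longrightarrow> balanced R M ra N la G' (\<lambda>x y. h (f x y))"
  by (auto simp: balanced_def intro: ahom_comp)

text \<open>
  \<open>T\<close> is any record that agrees with \<^const>\<open>tensor\<close> on its additive structure, so that
  \<^const>\<open>tensor_algebra\<close> and its subalgebras are covered as well.
\<close>

locale tensor_product = M: right_module R M ra + N: left_module R N la
  for R (structure) and M :: "('m, 'd) ring_scheme" (structure) and ra
    and N :: "('n, 'e) ring_scheme" (structure) and la +
  fixes T :: "((('m \<times> 'n) \<Rightarrow>\<^sub>0 int) set, 'x) ring_scheme" (structure)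
  assumes carrier_tensor: "carrier T = carrier (tensor R M ra N la)"
    and zero_tensor: "\<zero>\<^bsub>T\<^esub> = \<zero>\<^bsub>tensor R M ra N la\<^esub>"
    and add_tensor: "ring.add T = ring.add (tensor R M ra N la)"
begin

abbreviation (input) "FA \<equiv> free_Abelian_group (carrier M \<times> carrier N)"
abbreviation (input) "Rel \<equiv> generate FA (tensor_relations R M ra N la)"

lemma relations_subset: "tensor_relations R M ra N la \<subseteq> carrier FA"
proof -
  have k1: "Poly_Mapping.keys (frag_of a - frag_of b) \<subseteq> S" if "a \<in> S" "b \<in> S"
    for a b :: "'m \<times> 'n" and S
    using that keys_diff[of "frag_of a" "frag_of b"] by auto
  have k2: "Poly_Mapping.keys (frag_of a - frag_of b - frag_of c) \<subseteq> S"
    if "a \<in> S" "b \<in> S" "c \<in> S" for a b c :: "'m \<times> 'n" and S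
    using that k1[of a S b] keys_diff[of "frag_of a - frag_of b" "frag_of c"] by auto
  show ?thesis
    unfolding tensor_relations_def
    by (intro Un_least subsetI; elim CollectE exE conjE;
        simp only: carrier_free_Abelian_group_iff; (rule k2 | rule k1)) (simp_all add: M.closed N.closed)
qed

lemma group_FA: "group FA"
  by simp

lemma subgroup_Rel: "subgroup Rel FA"
  by (rule group.generate_is_subgroup[OF group_FA relations_subset])

lemma normal_Rel: "Rel \<lhd> FA"
  by (rule comm_group.subgroup_imp_normal[OF abelian_free_Abelian_group subgroup_Rel])

lemma add_monoid_FactGroup:
  "carrier (add_monoid T) = carrier (FA Mod Rel)" "monoid.mult (add_monoid T) = monoid.mult (FA Mod Rel)"
  "one (add_monoid T) = one (FA Mod Rel)"
  by (simp_all add: carrier_tensor zero_tensor add_tensor tensor_def Let_def)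

lemma comm_group_T: "comm_group (add_monoid T)"
proof -
  interpret Q: comm_group "FA Mod Rel"
    by (rule comm_group.abelian_FactGroup[OF abelian_free_Abelian_group subgroup_Rel])
  note eq = add_monoid_FactGroup
  show ?thesis
    by (rule comm_groupI; unfold eq)
      (use Q.m_closed Q.one_closed Q.m_assoc Q.m_comm Q.l_one Q.l_inv_ex in auto)
qed

sublocale T: abelian_group T
  by (rule comm_group_abelian_groupI[OF comm_group_T])

definition coset where "coset c = r_coset FA Rel c"

lemma carrier_T: "carrier T = coset ` {c. Poly_Mapping.keys c \<subseteq> carrier M \<times> carrier N}"
  using add_monoid_FactGroup(1) by (auto simp: FactGroup_def RCOSETS_def coset_def)

lemma coset_plus:
  assumes "Poly_Mapping.keys c \<subseteq> carrier M \<times> carrier N" "Poly_Mapping.keys d \<subseteq> carrier M \<times> carrier N"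
  shows "coset (c + d) = coset c \<oplus>\<^bsub>T\<^esub> coset d"
  using normal.rcos_sum[OF normal_Rel, of c d] assms add_monoid_FactGroup(2)
  by (simp add: FactGroup_def coset_def)

lemma coset_hom: "coset \<in> hom FA (add_monoid T)"
  by (rule homI) (auto simp: carrier_T coset_plus)

lemma coset_in: "Poly_Mapping.keys c \<subseteq> carrier M \<times> carrier N \<Longrightarrow> c \<in> coset c"
  unfolding coset_def by (rule group.rcos_self[OF group_FA _ subgroup_Rel]) simp

lemma coset_eqI:
  assumes "Poly_Mapping.keys c \<subseteq> carrier M \<times> carrier N" "d \<in> coset c"
  shows "coset d = coset c"
  using group.repr_independence[OF group_FA _ _ subgroup_Rel, of d c] assms by (simp add: coset_def)

lemma coset_relation:
  assumes "c - d \<in> tensor_relations R M ra N la"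
    "Poly_Mapping.keys c \<subseteq> carrier M \<times> carrier N" "Poly_Mapping.keys d \<subseteq> carrier M \<times> carrier N"
  shows "coset c = coset d"
proof -
  have "c - d \<in> Rel" by (rule generate.incl) (rule assms(1))
  then have "c \<in> coset d"
    unfolding coset_def r_coset_def by (auto intro!: bexI[of _ "c - d"])
  then show ?thesis using coset_eqI assms by blast
qed

lemma pure_eq_coset:
  assumes "x \<in> carrier M" "y \<in> carrier N"
  shows "x \<boxtimes>\<^bsub>T\<^esub> y = coset (frag_of (x, y))"
  unfolding pure_tensor_def
proof (rule the_equality)
  show "coset (frag_of (x, y)) \<in> carrier T \<and> frag_of (x, y) \<in> coset (frag_of (x, y))"
    using assms by (auto simp: carrier_T intro!: coset_in)
next
  fix X assume "X \<in> carrier T \<and> frag_of (x, y) \<in> X"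
  then show "X = coset (frag_of (x, y))"
    using coset_eqI by (auto simp: carrier_T)
qed

lemma pure_closed [simp, intro]: "x \<in> carrier M \<Longrightarrow> y \<in> carrier N \<Longrightarrow> x \<boxtimes>\<^bsub>T\<^esub> y \<in> carrier T"
  by (auto simp: pure_eq_coset carrier_T)

lemma pure_hom_right: assumes "x \<in> carrier M" shows "(\<lambda>y. x \<boxtimes>\<^bsub>T\<^esub> y) \<in> ahom N T"
proof (rule ahomI)
  fix y y' assume y: "y \<in> carrier N" "y' \<in> carrier N"
  have "coset (frag_of (x, y \<oplus>\<^bsub>N\<^esub> y')) = coset (frag_of (x, y) + frag_of (x, y'))"
  proof (rule coset_relation)
    show "frag_of (x, y \<oplus>\<^bsub>N\<^esub> y') - (frag_of (x, y) + frag_of (x, y')) \<in> tensor_relations R M ra N la"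
      unfolding tensor_relations_def diff_add_eq_diff_diff_swap
      using assms y by (auto simp: algebra_simps)
  qed (use assms y keys_add[of "frag_of (x, y)" "frag_of (x, y')"] in auto)
  then show "x \<boxtimes>\<^bsub>T\<^esub> (y \<oplus>\<^bsub>N\<^esub> y') = x \<boxtimes>\<^bsub>T\<^esub> y \<oplus>\<^bsub>T\<^esub> x \<boxtimes>\<^bsub>T\<^esub> y'"
    using assms y by (simp add: pure_eq_coset coset_plus)
qed (use assms in auto)

lemma pure_hom_left: assumes "y \<in> carrier N" shows "(\<lambda>x. x \<boxtimes>\<^bsub>T\<^esub> y) \<in> ahom M T"
proof (rule ahomI)
  fix x x' assume x: "x \<in> carrier M" "x' \<in> carrier M"
  have "coset (frag_of (x \<oplus>\<^bsub>M\<^esub> x', y)) = coset (frag_of (x, y) + frag_of (x', y))"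
  proof (rule coset_relation)
    show "frag_of (x \<oplus>\<^bsub>M\<^esub> x', y) - (frag_of (x, y) + frag_of (x', y)) \<in> tensor_relations R M ra N la"
      unfolding tensor_relations_def diff_add_eq_diff_diff_swap
      using assms x by (auto simp: algebra_simps)
  qed (use assms x keys_add[of "frag_of (x, y)" "frag_of (x', y)"] in auto)
  then show "(x \<oplus>\<^bsub>M\<^esub> x') \<boxtimes>\<^bsub>T\<^esub> y = x \<boxtimes>\<^bsub>T\<^esub> y \<oplus>\<^bsub>T\<^esub> x' \<boxtimes>\<^bsub>T\<^esub> y"
    using assms x by (simp add: pure_eq_coset coset_plus)
qed (use assms in auto)

lemma pure_balance:
  assumes "x \<in> carrier M" "a \<in> carrier R" "y \<in> carrier N"
  shows "ra x a \<boxtimes>\<^bsub>T\<^esub> y = x \<boxtimes>\<^bsub>T\<^esub> la a y"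
proof -
  have "coset (frag_of (ra x a, y)) = coset (frag_of (x, la a y))"
    by (rule coset_relation)
      (use assms in \<open>auto simp: tensor_relations_def M.closed N.closed\<close>)
  then show ?thesis
    using assms by (simp add: pure_eq_coset M.closed N.closed)
qed

lemma balanced_pure: "balanced R M ra N la T (\<lambda>x y. x \<boxtimes>\<^bsub>T\<^esub> y)"
  by (rule balancedI) (simp_all add: pure_hom_left pure_hom_right pure_balance)

text \<open>\<open>tensor_lift\<close> evaluates the representative selected by \<open>SOME\<close>.
  That choice is a formal combination over the right carriers and lies over \<open>X\<close>, which
  is all that later arguments need to know about it.\<close>

lemma rep:
  assumes "X \<in> carrier T"
  shows "Poly_Mapping.keys (SOME c. c \<in> X) \<subseteq> carrier M \<times> carrier N" "coset (SOME c. c \<in> X) = X"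
proof -
  obtain c where c: "Poly_Mapping.keys c \<subseteq> carrier M \<times> carrier N" "X = coset c"
    using assms by (auto simp: carrier_T)
  have "X \<subseteq> carrier FA"
    unfolding c(2) coset_def
    by (rule monoid.r_coset_subset_G[OF group.is_monoid[OF group_FA] subgroup.subset[OF subgroup_Rel]])
      (simp add: c(1))
  moreover have *: "(SOME c. c \<in> X) \<in> X"
    using coset_in[OF c(1)] unfolding c(2) by (rule someI)
  ultimately have "(SOME c. c \<in> X) \<in> carrier FA" ..
  then show "Poly_Mapping.keys (SOME c. c \<in> X) \<subseteq> carrier M \<times> carrier N" by simp
  show "coset (SOME c. c \<in> X) = X"
    using coset_eqI[OF c(1)] * c(2) by simp
qed

lemma lift_closed:
  assumes "abelian_group G" "X \<in> carrier T"
    "\<And>x y. x \<in> carrier M \<Longrightarrow> y \<in> carrier N \<Longrightarrow> f x y \<in> carrier G"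
  shows "tensor_lift G f X \<in> carrier G"
  unfolding tensor_lift_def
  by (rule abelian_group.frag_eval_closed[OF assms(1) rep(1)[OF assms(2)]]) (use assms in auto)

lemma lift_cong:
  assumes "abelian_group G" "X \<in> carrier T"
    and "\<And>x y. x \<in> carrier M \<Longrightarrow> y \<in> carrier N \<Longrightarrow> f x y = g x y"
    and "\<And>x y. x \<in> carrier M \<Longrightarrow> y \<in> carrier N \<Longrightarrow> g x y \<in> carrier G"
  shows "tensor_lift G f X = tensor_lift G g X"
  unfolding tensor_lift_def
  by (rule abelian_group.frag_eval_cong[OF assms(1) rep(1)[OF assms(2)]]) (use assms in auto)

text \<open>The representative chosen by \<open>tensor_lift\<close> depends on \<open>X\<close> and
  not on the parameter \<open>a\<close>, so additivity in \<open>a\<close> passes through a fixed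
  finite sum. This holds for balanced and unbalanced \<open>f a\<close> alike, hence also for the
  inner parts of nested Sweedler sums.\<close>

lemma lift_param_hom:
  assumes "abelian_group G" "X \<in> carrier T"
    and "\<And>x y. x \<in> carrier M \<Longrightarrow> y \<in> carrier N \<Longrightarrow> (\<lambda>a. f a x y) \<in> ahom A G"
  shows "(\<lambda>a. tensor_lift G (f a) X) \<in> ahom A G"
proof -
  interpret G: abelian_group G by fact
  have *: "(\<lambda>a. frag_eval G (f a) c) \<in> ahom A G" if "Poly_Mapping.keys c \<subseteq> carrier M \<times> carrier N" for c
    using that
  proof (induction rule: frag_induct)
    case zero
    show ?case by (rule ahomI) (auto simp: G.frag_eval_zero)
  next
    case (of z)
    then obtain x y where z: "z = (x, y)" "x \<in> carrier M" "y \<in> carrier N" by auto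
    show ?case
      by (rule ahomI)
        (use z assms(3)[of x y] in \<open>auto simp: hom_def Pi_def G.frag_eval_of\<close>)
  next
    case (diff c d)
    have cl: "\<And>x y a. x \<in> carrier M \<Longrightarrow> y \<in> carrier N \<Longrightarrow> a \<in> carrier A \<Longrightarrow> f a x y \<in> carrier G"
      using assms(3) ahom_closed by fastforce
    have e: "frag_eval G (f a) (c - d) = frag_eval G (f a) c \<ominus>\<^bsub>G\<^esub> frag_eval G (f a) d" if "a \<in> carrier A" for a
      by (rule G.frag_eval_minus[OF diff(1,2)]) (use cl that in auto)
    have cc: "frag_eval G (f a) c \<in> carrier G" "frag_eval G (f a) d \<in> carrier G" if "a \<in> carrier A" for a
      using diff(3,4) that by (auto simp: hom_def)
    show ?case
    proof (rule ahomI)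
      show "frag_eval G (f a) (c - d) \<in> carrier G" if "a \<in> carrier A" for a
        using e cc that by simp
      fix x y assume xy: "x \<in> carrier A" "y \<in> carrier A"
      have h: "frag_eval G (f (x \<oplus>\<^bsub>A\<^esub> y)) k = frag_eval G (f x) k \<oplus>\<^bsub>G\<^esub> frag_eval G (f y) k" if "k = c \<or> k = d" for k
        using that ahom_add[OF diff(3) xy] ahom_add[OF diff(4) xy] by auto
      have "frag_eval G (f (x \<oplus>\<^bsub>A\<^esub> y)) (c - d) = frag_eval G (f (x \<oplus>\<^bsub>A\<^esub> y)) c \<ominus>\<^bsub>G\<^esub> frag_eval G (f (x \<oplus>\<^bsub>A\<^esub> y)) d"
        by (rule G.frag_eval_minus[OF diff(1,2)])
          (use assms(3) xy in \<open>auto simp: hom_def Pi_def\<close>)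
      then show "frag_eval G (f (x \<oplus>\<^bsub>A\<^esub> y)) (c - d) = frag_eval G (f x) (c - d) \<oplus>\<^bsub>G\<^esub> frag_eval G (f y) (c - d)"
        using xy cc e by (simp add: h a_minus_def G.minus_add G.a_ac)
    qed
  qed
  show ?thesis
    unfolding tensor_lift_def by (rule *[OF rep(1)[OF assms(2)]])
qed

text \<open>An additive map commutes with the integer combination that \<open>tensor_lift\<close>
  evaluates. Sweedler sums are moved term by term to another group in this way, before any
  well-definedness is discussed.\<close>

lemma hom_lift:
  assumes "abelian_group G" "abelian_group G'" "h \<in> ahom G G'" "X \<in> carrier T"
    and "\<And>x y. x \<in> carrier M \<Longrightarrow> y \<in> carrier N \<Longrightarrow> f x y \<in> carrier G"
  shows "h (tensor_lift G f X) = tensor_lift G' (\<lambda>x y. h (f x y)) X"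
proof -
  interpret G: abelian_group G by fact
  interpret G': abelian_group G' by fact
  have *: "h (frag_eval G f c) = frag_eval G' (\<lambda>x y. h (f x y)) c" if "Poly_Mapping.keys c \<subseteq> carrier M \<times> carrier N" for c
    using that
  proof (induction rule: frag_induct)
    case zero then show ?case using assms(1-3) by (simp add: G.frag_eval_zero G'.frag_eval_zero ahom_zero[OF assms(3,1,2)])
  next
    case (of z)
    then show ?case using assms ahom_closed[OF assms(3)] by (auto simp: G.frag_eval_of G'.frag_eval_of)
  next
    case (diff c d)
    then show ?case
      using G.frag_eval_minus[OF diff(1,2), of f] G'.frag_eval_minus[OF diff(1,2), of "\<lambda>x y. h (f x y)"]
        G.frag_eval_closed[OF diff(1), of f] G.frag_eval_closed[OF diff(2), of f] assms
      by (simp add: ahom_minus[OF assms(3,1,2)] ahom_closed[OF assms(3)])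
  qed
  show ?thesis
    unfolding tensor_lift_def by (rule *[OF rep(1)[OF assms(4)]])
qed

text \<open>Both sums are finite and run over fixed representatives, so they may be exchanged even
  when the summand is balanced in one pair of variables only. The factorwise product on
  \<open>L \<otimes>\<^sub>B L\<close> is of this kind.\<close>

lemma lift_swap:
  assumes "tensor_product R' M' ra' N' la' T'" "abelian_group G" "X \<in> carrier T" "Y \<in> carrier T'"
    and "\<And>x y x' y'. x \<in> carrier M \<Longrightarrow> y \<in> carrier N \<Longrightarrow> x' \<in> carrier M' \<Longrightarrow> y' \<in> carrier N' \<Longrightarrow> f x y x' y' \<in> carrier G"
  shows "tensor_lift G (\<lambda>x y. tensor_lift G (f x y) Y) X =
         tensor_lift G (\<lambda>x' y'. tensor_lift G (\<lambda>x y. f x y x' y') X) Y"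
proof -
  interpret G: abelian_group G by fact
  interpret T': tensor_product R' M' ra' N' la' T' by fact
  let ?d = "SOME d. d \<in> Y"
  have d: "Poly_Mapping.keys ?d \<subseteq> carrier M' \<times> carrier N'" by (rule T'.rep(1)[OF assms(4)])
  have cl: "frag_eval G (f x y) ?d \<in> carrier G" if "x \<in> carrier M" "y \<in> carrier N" for x y
    by (rule G.frag_eval_closed[OF d]) (use that assms(5) in auto)
  have *: "frag_eval G (\<lambda>x y. frag_eval G (f x y) ?d) c = frag_eval G (\<lambda>x' y'. frag_eval G (\<lambda>x y. f x y x' y') c) ?d"
    if "Poly_Mapping.keys c \<subseteq> carrier M \<times> carrier N" for c
    using that
  proof (induction rule: frag_induct)
    case zero
    have "frag_eval G (\<lambda>x y. \<zero>\<^bsub>G\<^esub>) ?d = \<zero>\<^bsub>G\<^esub>"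
      by (simp add: frag_eval_def add_pow_def group.int_pow_one[OF G.a_group, simplified])
    then show ?case by (simp add: G.frag_eval_zero)
  next
    case (of z)
    then obtain x y where z: "z = (x, y)" "x \<in> carrier M" "y \<in> carrier N" by auto
    have "frag_eval G (\<lambda>x' y'. frag_eval G (\<lambda>x y. f x y x' y') (frag_of z)) ?d = frag_eval G (f x y) ?d"
      by (rule G.frag_eval_cong[OF d]) (use z assms(5) in \<open>auto simp: G.frag_eval_of\<close>)
    then show ?case using z cl by (simp add: G.frag_eval_of)
  next
    case (diff c c')
    let ?g = "\<lambda>k x' y'. frag_eval G (\<lambda>x y. f x y x' y') k"
    have gcl: "?g k x' y' \<in> carrier G" if "k = c \<or> k = c'" "x' \<in> carrier M'" "y' \<in> carrier N'" for k x' y'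
      by (rule G.frag_eval_closed[of _ "carrier M" "carrier N"]) (use that diff assms(5) in auto)
    \<comment> \<open>Evaluation is additive in the summand as well; the difference case needs this
      for the sum over the other representative.\<close>
    have m: "frag_eval G (\<lambda>x' y'. g x' y' \<ominus>\<^bsub>G\<^esub> h x' y') e = frag_eval G g e \<ominus>\<^bsub>G\<^esub> frag_eval G h e"
      if "Poly_Mapping.keys e \<subseteq> carrier M' \<times> carrier N'"
        "\<And>x y. x \<in> carrier M' \<Longrightarrow> y \<in> carrier N' \<Longrightarrow> g x y \<in> carrier G"
        "\<And>x y. x \<in> carrier M' \<Longrightarrow> y \<in> carrier N' \<Longrightarrow> h x y \<in> carrier G" for e g h
      using that(1)
    proof (induction rule: frag_induct)
      case zero then show ?case by (simp add: G.frag_eval_zero G.minus_eq G.r_neg)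
    next
      case (of z) then show ?case using that by (auto simp: G.frag_eval_of)
    next
      case (diff a b)
      have cl: "frag_eval G g a \<in> carrier G" "frag_eval G g b \<in> carrier G"
        "frag_eval G h a \<in> carrier G" "frag_eval G h b \<in> carrier G"
        using G.frag_eval_closed[OF diff(1), of g] G.frag_eval_closed[OF diff(2), of g]
          G.frag_eval_closed[OF diff(1), of h] G.frag_eval_closed[OF diff(2), of h] that by auto
      show ?case
        using G.frag_eval_minus[OF diff(1,2), of "\<lambda>x' y'. g x' y' \<ominus>\<^bsub>G\<^esub> h x' y'"]
          G.frag_eval_minus[OF diff(1,2), of g] G.frag_eval_minus[OF diff(1,2), of h] diff(3,4) that cl
        by (simp add: G.minus_eq G.minus_add G.a_ac)
    qed
    have "frag_eval G (?g (c - c')) ?d = frag_eval G (\<lambda>x' y'. ?g c x' y' \<ominus>\<^bsub>G\<^esub> ?g c' x' y') ?d"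
    proof (rule G.frag_eval_cong[OF d])
      fix x' y' assume "x' \<in> carrier M'" "y' \<in> carrier N'"
      then show "?g (c - c') x' y' = ?g c x' y' \<ominus>\<^bsub>G\<^esub> ?g c' x' y'"
        "?g c x' y' \<ominus>\<^bsub>G\<^esub> ?g c' x' y' \<in> carrier G"
        using G.frag_eval_minus[OF diff(1,2), of "\<lambda>x y. f x y x' y'"] assms(5) gcl by auto
    qed
    also have "\<dots> = frag_eval G (?g c) ?d \<ominus>\<^bsub>G\<^esub> frag_eval G (?g c') ?d"
      by (rule m[OF d]) (use gcl in auto)
    finally show ?case
      using diff G.frag_eval_minus[OF diff(1,2), of "\<lambda>x y. frag_eval G (f x y) ?d"] cl by simp
  qed
  show ?thesis
    unfolding tensor_lift_def by (rule *[OF rep(1)[OF assms(3)]])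
qed

text \<open>A balanced map sends the three kinds of relations to zero, so its kernel contains the
  subgroup that they generate, and the value depends on the coset alone.\<close>

lemma frag_eval_coset:
  assumes "abelian_group G" "balanced R M ra N la G f"
    "Poly_Mapping.keys c \<subseteq> carrier M \<times> carrier N" "Poly_Mapping.keys d \<subseteq> carrier M \<times> carrier N" "coset c = coset d"
  shows "frag_eval G f c = frag_eval G f d"
proof -
  interpret G: abelian_group G by fact
  have cl: "\<And>x y. x \<in> carrier M \<Longrightarrow> y \<in> carrier N \<Longrightarrow> f x y \<in> carrier G"
    using balanced_closed[OF assms(2)] .
  have h: "frag_eval G f \<in> hom FA (add_monoid G)"
    by (rule homI; simp)
      (rule G.frag_eval_closed G.frag_eval_plus, assumption+, use cl in simp)+
  interpret gh: group_hom FA "add_monoid G" "frag_eval G f"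
    using h G.a_group by (simp add: group_hom_def group_hom_axioms_def)
  have fo: "frag_eval G f (frag_of (x, y)) = f x y" if "x \<in> carrier M" "y \<in> carrier N" for x y
    using that cl by (simp add: G.frag_eval_of)
  have ko: "Poly_Mapping.keys (frag_of (x, y)) \<subseteq> carrier M \<times> carrier N" if "x \<in> carrier M" "y \<in> carrier N" for x y
    using that by simp
  have md: "frag_eval G f (a - b) = frag_eval G f a \<ominus>\<^bsub>G\<^esub> frag_eval G f b"
    if "Poly_Mapping.keys a \<subseteq> carrier M \<times> carrier N" "Poly_Mapping.keys b \<subseteq> carrier M \<times> carrier N" for a b
    by (rule G.frag_eval_minus[OF that]) (use cl in auto)
  have kd: "Poly_Mapping.keys (a - b) \<subseteq> carrier M \<times> carrier N"
    if "Poly_Mapping.keys a \<subseteq> carrier M \<times> carrier N" "Poly_Mapping.keys b \<subseteq> carrier M \<times> carrier N" for a b :: "('m \<times> 'n) \<Rightarrow>\<^sub>0 int"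
    using keys_diff[of a b] that by auto
  have arith: "(u \<oplus>\<^bsub>G\<^esub> v) \<ominus>\<^bsub>G\<^esub> u \<ominus>\<^bsub>G\<^esub> v = \<zero>\<^bsub>G\<^esub>" if "u \<in> carrier G" "v \<in> carrier G" for u v
    proof -
    have "v \<oplus>\<^bsub>G\<^esub> (\<ominus>\<^bsub>G\<^esub> u \<oplus>\<^bsub>G\<^esub> \<ominus>\<^bsub>G\<^esub> v) = \<ominus>\<^bsub>G\<^esub> u"
      using that by (subst G.a_lcomm) (simp_all add: G.r_neg)
    then show ?thesis using that by (simp add: G.minus_eq G.a_assoc G.r_neg)
  qed
  have r1: "frag_eval G f (frag_of (x \<oplus>\<^bsub>M\<^esub> x', y) - frag_of (x, y) - frag_of (x', y)) = \<zero>\<^bsub>G\<^esub>"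
    if "x \<in> carrier M" "x' \<in> carrier M" "y \<in> carrier N" for x x' y
  proof -
    have "f (x \<oplus>\<^bsub>M\<^esub> x') y = f x y \<oplus>\<^bsub>G\<^esub> f x' y"
      using assms(2) that by (simp add: balanced_def hom_def)
    then show ?thesis using that by (simp add: md kd fo cl arith)
  qed
  have r2: "frag_eval G f (frag_of (x, y \<oplus>\<^bsub>N\<^esub> y') - frag_of (x, y) - frag_of (x, y')) = \<zero>\<^bsub>G\<^esub>"
    if "x \<in> carrier M" "y \<in> carrier N" "y' \<in> carrier N" for x y y'
  proof -
    have "f x (y \<oplus>\<^bsub>N\<^esub> y') = f x y \<oplus>\<^bsub>G\<^esub> f x y'"
      using assms(2) that by (simp add: balanced_def hom_def)
    then show ?thesis using that by (simp add: md kd fo cl arith)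
  qed
  have r3: "frag_eval G f (frag_of (ra x a, y) - frag_of (x, la a y)) = \<zero>\<^bsub>G\<^esub>"
    if "x \<in> carrier M" "a \<in> carrier R" "y \<in> carrier N" for x a y
  proof -
    have "f (ra x a) y = f x (la a y)"
      using assms(2) that by (simp add: balanced_def)
    then show ?thesis using that by (simp add: md fo cl M.closed N.closed G.minus_eq G.r_neg)
  qed
  have "frag_eval G f z = \<zero>\<^bsub>G\<^esub>" if "z \<in> tensor_relations R M ra N la" for z
    using that unfolding tensor_relations_def
    by (elim UnE CollectE exE conjE) (simp_all only: r1 r2 r3)
  then have "tensor_relations R M ra N la \<subseteq> kernel FA (add_monoid G) (frag_eval G f)"
    using relations_subset by (auto simp: kernel_def simp del: carrier_free_Abelian_group_iff)
  then have "Rel \<subseteq> kernel FA (add_monoid G) (frag_eval G f)"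
    by (rule group.generate_subgroup_incl[OF group_FA _ gh.subgroup_kernel])
  moreover have "c - d \<in> Rel"
  proof -
    have "c \<in> coset d" using coset_in[OF assms(3)] assms(5) by simp
    then obtain r where "r \<in> Rel" "c = r + d" by (auto simp: coset_def r_coset_def)
    then show ?thesis by simp
  qed
  ultimately have "frag_eval G f (c - d) = \<zero>\<^bsub>G\<^esub>"
    by (auto simp: kernel_def)
  moreover have "frag_eval G f ((c - d) + d) = frag_eval G f (c - d) \<oplus>\<^bsub>G\<^esub> frag_eval G f d"
    by (rule G.frag_eval_plus) (use kd[OF assms(3,4)] assms(4) cl in auto)
  ultimately show ?thesis
    using G.frag_eval_closed[OF assms(4)] cl by simp
qed

lemma lift_coset:
  assumes "abelian_group G" "balanced R M ra N la G f" "Poly_Mapping.keys c \<subseteq> carrier M \<times> carrier N"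
  shows "tensor_lift G f (coset c) = frag_eval G f c"
proof -
  have "coset c \<in> carrier T" using assms(3) by (auto simp: carrier_T)
  then show ?thesis
    unfolding tensor_lift_def
    by (intro frag_eval_coset assms rep) (simp_all add: assms)
qed

lemma lift_hom:
  assumes "abelian_group G" "balanced R M ra N la G f"
  shows "tensor_lift G f \<in> ahom T G"
proof (rule ahomI)
  interpret G: abelian_group G by fact
  have cl: "\<And>x y. x \<in> carrier M \<Longrightarrow> y \<in> carrier N \<Longrightarrow> f x y \<in> carrier G"
    using balanced_closed[OF assms(2)] .
  show "tensor_lift G f X \<in> carrier G" if "X \<in> carrier T" for X
    by (rule lift_closed) (use assms that cl in auto)
  fix X Y assume "X \<in> carrier T" "Y \<in> carrier T"
  then obtain c d where cd: "Poly_Mapping.keys c \<subseteq> carrier M \<times> carrier N" "X = coset c"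
    "Poly_Mapping.keys d \<subseteq> carrier M \<times> carrier N" "Y = coset d"
    by (auto simp: carrier_T)
  have "Poly_Mapping.keys (c + d) \<subseteq> carrier M \<times> carrier N"
    using keys_add[of c d] cd by auto
  then show "tensor_lift G f (X \<oplus>\<^bsub>T\<^esub> Y) = tensor_lift G f X \<oplus>\<^bsub>G\<^esub> tensor_lift G f Y"
    using assms cd G.frag_eval_plus[OF cd(1,3), of f] cl by (simp add: coset_plus[symmetric] lift_coset)
qed

lemma lift_pure:
  assumes "abelian_group G" "balanced R M ra N la G f" "x \<in> carrier M" "y \<in> carrier N"
  shows "tensor_lift G f (x \<boxtimes>\<^bsub>T\<^esub> y) = f x y"
  using assms balanced_closed[OF assms(2)]
  by (simp add: pure_eq_coset lift_coset abelian_group.frag_eval_of[of G f])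

text \<open>The uniqueness half of the universal property. Almost every identity below is reduced by
  it to pure tensors, after both sides have been recognised as additive maps.\<close>

lemma hom_ext:
  assumes "abelian_group G" "g \<in> ahom T G" "h \<in> ahom T G"
    and "\<And>x y. x \<in> carrier M \<Longrightarrow> y \<in> carrier N \<Longrightarrow> g (x \<boxtimes>\<^bsub>T\<^esub> y) = h (x \<boxtimes>\<^bsub>T\<^esub> y)"
    and "X \<in> carrier T"
  shows "g X = h X"
proof -
  interpret G: abelian_group G by fact
  have "g (coset c) = h (coset c)" if "Poly_Mapping.keys c \<subseteq> carrier M \<times> carrier N" for c
    using that
  proof (induction rule: frag_induct)
    case zero
    have "coset 0 = \<zero>\<^bsub>T\<^esub>"
      using hom_one[OF coset_hom group_FA T.a_group] by simp
    then show ?case using assms(1-3) ahom_zero[OF _ T.abelian_group_axioms assms(1)] by metis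
  next
    case (of z) then show ?case using assms(4) by (auto simp: pure_eq_coset)
  next
    case (diff c d)
    have k: "Poly_Mapping.keys (c - d) \<subseteq> carrier M \<times> carrier N"
      using keys_diff[of c d] diff by auto
    have cl: "coset c \<in> carrier T" "coset d \<in> carrier T" "coset (c - d) \<in> carrier T"
      using diff k by (auto simp: carrier_T)
    have "coset c = coset (c - d) \<oplus>\<^bsub>T\<^esub> coset d"
      using coset_plus[OF k diff(2)] by simp
    then have "g (coset (c - d)) \<oplus>\<^bsub>G\<^esub> g (coset d) = h (coset (c - d)) \<oplus>\<^bsub>G\<^esub> g (coset d)"
      using diff cl assms(2,3) by (metis ahom_add)
    then show ?case
      using cl ahom_closed[OF assms(2)] ahom_closed[OF assms(3)] by simp
  qed
  then show ?thesis using assms(5) by (auto simp: carrier_T)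
qed

text \<open>Reads an additive map back as a Sweedler sum, and so connects maps characterised on pure
  tensors with the explicit formulas of the definitions.\<close>

lemma hom_eq_lift:
  assumes "abelian_group G" "g \<in> ahom T G" "X \<in> carrier T"
  shows "g X = tensor_lift G (\<lambda>x y. g (x \<boxtimes>\<^bsub>T\<^esub> y)) X"
proof -
  have b: "balanced R M ra N la G (\<lambda>x y. g (x \<boxtimes>\<^bsub>T\<^esub> y))"
    by (rule balanced_comp[OF balanced_pure assms(2)])
  show ?thesis
    by (rule hom_ext[OF assms(1,2) lift_hom[OF assms(1) b] _ assms(3)])
      (simp add: lift_pure[OF assms(1) b])
qed

end

lemma tensor_productI:
  assumes "right_module R M ra" "left_module R N la"
  shows "tensor_product R M ra N la (tensor R M ra N la)"
  using assms by (simp add: tensor_product_def tensor_product_axioms_def)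

text \<open>Interchanging the factors also interchanges left and right actions, so the base ring is
  replaced by one with the same carrier. With \<open>opposite B\<close> and \<open>B\<close> this
  brings the domain of \<lambda> into the shape handled by the descent argument.\<close>

lemma (in tensor_product)
  assumes "tensor_product R' N ra' M la' T'" "carrier R' = carrier R"
    and "\<And>y a. y \<in> carrier N \<Longrightarrow> a \<in> carrier R \<Longrightarrow> ra' y a = la a y"
    and "\<And>a x. a \<in> carrier R \<Longrightarrow> x \<in> carrier M \<Longrightarrow> la' a x = ra x a"
  shows flip_hom: "tensor_lift T' (\<lambda>x y. y \<boxtimes>\<^bsub>T'\<^esub> x) \<in> ahom T T'"
    and flip_pure: "\<And>x y. x \<in> carrier M \<Longrightarrow> y \<in> carrier N \<Longrightarrow>
      tensor_lift T' (\<lambda>x y. y \<boxtimes>\<^bsub>T'\<^esub> x) (x \<boxtimes>\<^bsub>T\<^esub> y) = y \<boxtimes>\<^bsub>T'\<^esub> x"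
proof -
  interpret T': tensor_product R' N ra' M la' T' by fact
  have b: "balanced R M ra N la T' (\<lambda>x y. y \<boxtimes>\<^bsub>T'\<^esub> x)"
  proof (rule balancedI)
    show "y \<boxtimes>\<^bsub>T'\<^esub> ra x a = la a y \<boxtimes>\<^bsub>T'\<^esub> x" if "x \<in> carrier M" "a \<in> carrier R" "y \<in> carrier N" for x a y
      using T'.pure_balance[of y a x] that assms(2-4) by simp
  qed (erule T'.pure_hom_left T'.pure_hom_right)+
  show "tensor_lift T' (\<lambda>x y. y \<boxtimes>\<^bsub>T'\<^esub> x) \<in> ahom T T'"
    by (rule lift_hom[OF T'.T.abelian_group_axioms b])
  show "tensor_lift T' (\<lambda>x y. y \<boxtimes>\<^bsub>T'\<^esub> x) (x \<boxtimes>\<^bsub>T\<^esub> y) = y \<boxtimes>\<^bsub>T'\<^esub> x" if "x \<in> carrier M" "y \<in> carrier N" for x y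
    by (rule lift_pure[OF T'.T.abelian_group_axioms b that])
qed

text \<open>Every balancing condition is an equality in \<open>G\<close>, so it can be tested after
  the injective map \<open>g\<close>. A Sweedler formula with values in
  \<open>L \<otimes>\<^sub>B L\<close> is thus checked in a tensor power over the field.\<close>

lemma balanced_reflect:
  assumes f: "\<And>x y. x \<in> carrier M \<Longrightarrow> y \<in> carrier N \<Longrightarrow> f x y \<in> carrier G"
    and g: "g \<in> ahom G G'" "inj_on g (carrier G)"
    and b: "balanced R M ra N la G' (\<lambda>x y. g (f x y))"
    and G: "abelian_group G" and M: "right_module R M ra" and N: "left_module R N la"
  shows "balanced R M ra N la G f"
proof (rule balancedI)
  interpret G: abelian_group G by fact
  interpret M: right_module R M ra by fact
  interpret N: left_module R N la by fact
  have b1: "(\<lambda>y. g (f x y)) \<in> ahom N G'" if "x \<in> carrier M" for x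
    using b that by (simp add: balanced_def)
  have b2: "(\<lambda>x. g (f x y)) \<in> ahom M G'" if "y \<in> carrier N" for y
    using b that by (simp add: balanced_def)
  have eqI: "u = v" if "g u = g v" "u \<in> carrier G" "v \<in> carrier G" for u v
    using inj_onD[OF g(2) that] .
  show "(\<lambda>y. f x y) \<in> ahom N G" if x: "x \<in> carrier M" for x
  proof (rule ahomI)
    fix y y' assume y: "y \<in> carrier N" "y' \<in> carrier N"
    show "f x (y \<oplus>\<^bsub>N\<^esub> y') = f x y \<oplus>\<^bsub>G\<^esub> f x y'"
    proof (rule eqI)
      show "g (f x (y \<oplus>\<^bsub>N\<^esub> y')) = g (f x y \<oplus>\<^bsub>G\<^esub> f x y')"
        using ahom_add[OF b1[OF x] y] ahom_add[OF g(1) f[OF x y(1)] f[OF x y(2)]] by simp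
    qed (use f x y in simp_all)
  qed (rule f[OF x])
  show "(\<lambda>x. f x y) \<in> ahom M G" if y: "y \<in> carrier N" for y
  proof (rule ahomI)
    fix x x' assume x: "x \<in> carrier M" "x' \<in> carrier M"
    show "f (x \<oplus>\<^bsub>M\<^esub> x') y = f x y \<oplus>\<^bsub>G\<^esub> f x' y"
    proof (rule eqI)
      show "g (f (x \<oplus>\<^bsub>M\<^esub> x') y) = g (f x y \<oplus>\<^bsub>G\<^esub> f x' y)"
        using ahom_add[OF b2[OF y] x] ahom_add[OF g(1) f[OF x(1) y] f[OF x(2) y]] by simp
    qed (use f x y in simp_all)
  qed (rule f[OF _ y])
  show "f (ra x a) y = f x (la a y)" if "x \<in> carrier M" "a \<in> carrier R" "y \<in> carrier N" for x a y
  proof (rule eqI)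
    show "g (f (ra x a) y) = g (f x (la a y))"
      using b that by (simp add: balanced_def)
  qed (use f that M.closed N.closed in simp_all)
qed

section \<open>Additivity of actions, products and scalar multiples in each argument\<close>

lemma right_module_mult_hom:
  assumes "right_module R M ra" "a \<in> carrier R"
  shows "(\<lambda>x. ra x a) \<in> ahom M M"
proof -
  interpret right_module R M ra by fact
  show ?thesis by (rule ahomI) (use assms in \<open>auto simp: closed distrib\<close>)
qed

lemma right_module_scalar_hom:
  assumes "right_module R M ra" "x \<in> carrier M"
  shows "(\<lambda>a. ra x a) \<in> ahom R M"
proof -
  interpret right_module R M ra by fact
  show ?thesis by (rule ahomI) (use assms in \<open>auto simp: closed distrib_scalar\<close>)
qed

lemma left_module_mult_hom:
  assumes "left_module R M la" "a \<in> carrier R"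
  shows "(\<lambda>x. la a x) \<in> ahom M M"
proof -
  interpret left_module R M la by fact
  show ?thesis by (rule ahomI) (use assms in \<open>auto simp: closed distrib\<close>)
qed

lemma left_module_scalar_hom:
  assumes "left_module R M la" "x \<in> carrier M"
  shows "(\<lambda>a. la a x) \<in> ahom R M"
proof -
  interpret left_module R M la by fact
  show ?thesis by (rule ahomI) (use assms in \<open>auto simp: closed distrib_scalar\<close>)
qed

lemma ring_mult_left_hom:
  assumes "ring A" "c \<in> carrier A" "(\<lambda>x. f x) \<in> ahom B A"
  shows "(\<lambda>x. c \<otimes>\<^bsub>A\<^esub> f x) \<in> ahom B A"
proof -
  interpret ring A by fact
  show ?thesis by (rule ahomI) (use assms in \<open>auto simp: hom_def Pi_def r_distr\<close>)
qed

lemma ring_mult_right_hom: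
  assumes "ring A" "c \<in> carrier A" "(\<lambda>x. f x) \<in> ahom B A"
  shows "(\<lambda>x. f x \<otimes>\<^bsub>A\<^esub> c) \<in> ahom B A"
proof -
  interpret ring A by fact
  show ?thesis by (rule ahomI) (use assms in \<open>auto simp: hom_def Pi_def l_distr\<close>)
qed

lemma module_smult_hom:
  assumes "module K A" "c \<in> carrier K" "(\<lambda>x. f x) \<in> ahom B A"
  shows "(\<lambda>x. c \<odot>\<^bsub>A\<^esub> f x) \<in> ahom B A"
proof -
  interpret module K A by fact
  show ?thesis by (rule ahomI) (use assms in \<open>auto simp: hom_def Pi_def smult_r_distr\<close>)
qed

lemma module_scalar_hom:
  assumes "module K A" "y \<in> carrier A" "(\<lambda>x. f x) \<in> ahom B K"
  shows "(\<lambda>x. f x \<odot>\<^bsub>A\<^esub> y) \<in> ahom B A"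
proof -
  interpret module K A by fact
  show ?thesis by (rule ahomI) (use assms in \<open>auto simp: hom_def Pi_def smult_l_distr\<close>)
qed

lemma module_imp_left_module:
  assumes "module K A" shows "left_module K A (\<lambda>a x. a \<odot>\<^bsub>A\<^esub> x)"
proof -
  interpret module K A by fact
  show ?thesis by unfold_locales (auto simp: smult_l_distr smult_r_distr smult_assoc1)
qed

lemma module_imp_right_module:
  assumes "module K A" shows "right_module K A (\<lambda>x a. a \<odot>\<^bsub>A\<^esub> x)"
proof -
  interpret module K A by fact
  show ?thesis
    by unfold_locales (auto simp: smult_l_distr smult_r_distr smult_assoc1[symmetric] R.m_comm)
qed

section \<open>Endomorphisms and module structures induced on one tensor factor\<close>

context tensor_product
begin

lemma pure_left_comp:
  "y \<in> carrier N \<Longrightarrow> (\<lambda>a. f a) \<in> ahom A M \<Longrightarrow> (\<lambda>a. f a \<boxtimes>\<^bsub>T\<^esub> y) \<in> ahom A T"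
  by (rule ahom_comp[OF pure_hom_left])

lemma pure_right_comp:
  "x \<in> carrier M \<Longrightarrow> (\<lambda>a. f a) \<in> ahom A N \<Longrightarrow> (\<lambda>a. x \<boxtimes>\<^bsub>T\<^esub> f a) \<in> ahom A T"
  by (rule ahom_comp[OF pure_hom_right])

lemma balanced_right_action:
  assumes "(\<lambda>y. g y) \<in> ahom N N" "\<And>a y. a \<in> carrier R \<Longrightarrow> y \<in> carrier N \<Longrightarrow> g (la a y) = la a (g y)"
  shows "balanced R M ra N la T (\<lambda>x y. x \<boxtimes>\<^bsub>T\<^esub> g y)"
proof (rule balancedI)
  have gc: "g y \<in> carrier N" if "y \<in> carrier N" for y using assms(1) that by (rule ahom_closed)
  show "(\<lambda>y. x \<boxtimes>\<^bsub>T\<^esub> g y) \<in> ahom N T" if "x \<in> carrier M" for x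
    using that assms(1) by (rule pure_right_comp)
  show "(\<lambda>x. x \<boxtimes>\<^bsub>T\<^esub> g y) \<in> ahom M T" if "y \<in> carrier N" for y
    using gc[OF that] ahom_ident by (rule pure_left_comp)
  show "ra x a \<boxtimes>\<^bsub>T\<^esub> g y = x \<boxtimes>\<^bsub>T\<^esub> g (la a y)" if "x \<in> carrier M" "a \<in> carrier R" "y \<in> carrier N" for x a y
    using that by (simp add: gc assms(2) pure_balance)
qed

lemma balanced_left_action:
  assumes "(\<lambda>x. g x) \<in> ahom M M" "\<And>a x. a \<in> carrier R \<Longrightarrow> x \<in> carrier M \<Longrightarrow> g (ra x a) = ra (g x) a"
  shows "balanced R M ra N la T (\<lambda>x y. g x \<boxtimes>\<^bsub>T\<^esub> y)"
proof (rule balancedI)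
  have gc: "g x \<in> carrier M" if "x \<in> carrier M" for x using assms(1) that by (rule ahom_closed)
  show "(\<lambda>y. g x \<boxtimes>\<^bsub>T\<^esub> y) \<in> ahom N T" if "x \<in> carrier M" for x
    using gc[OF that] by (rule pure_hom_right)
  show "(\<lambda>x. g x \<boxtimes>\<^bsub>T\<^esub> y) \<in> ahom M T" if "y \<in> carrier N" for y
    using that assms(1) by (rule pure_left_comp)
  show "g (ra x a) \<boxtimes>\<^bsub>T\<^esub> y = g x \<boxtimes>\<^bsub>T\<^esub> la a y" if "x \<in> carrier M" "a \<in> carrier R" "y \<in> carrier N" for x a y
    using that by (simp add: gc assms(2) pure_balance)
qed

definition right_act :: "('n \<Rightarrow> 's \<Rightarrow> 'n) \<Rightarrow> _ \<Rightarrow> 's \<Rightarrow> _" where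
  "right_act rs X b = tensor_lift T (\<lambda>x y. x \<boxtimes>\<^bsub>T\<^esub> rs y b) X"

text \<open>Given as a \<open>tensor_lift\<close> of this form so that it unfolds to the left action
  written out in \<open>bimodule_cube\<close>.\<close>

definition left_act :: "('s \<Rightarrow> 'm \<Rightarrow> 'm) \<Rightarrow> 's \<Rightarrow> _ \<Rightarrow> _" where
  "left_act ls b = tensor_lift T (\<lambda>x y. ls b x \<boxtimes>\<^bsub>T\<^esub> y)"

lemma
  assumes S: "right_module S N rs"
    and comm: "\<And>a b y. a \<in> carrier R \<Longrightarrow> b \<in> carrier S \<Longrightarrow> y \<in> carrier N \<Longrightarrow> rs (la a y) b = la a (rs y b)"
  shows right_act_pure: "\<And>x y b. \<lbrakk>x \<in> carrier M; y \<in> carrier N; b \<in> carrier S\<rbrakk> \<Longrightarrow>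
      right_act rs (x \<boxtimes>\<^bsub>T\<^esub> y) b = x \<boxtimes>\<^bsub>T\<^esub> rs y b"
    and right_act_hom: "\<And>b. b \<in> carrier S \<Longrightarrow> (\<lambda>X. right_act rs X b) \<in> ahom T T"
    and right_act_module: "right_module S T (right_act rs)"
proof -
  interpret S: right_module S N rs by fact
  have bal: "balanced R M ra N la T (\<lambda>x y. x \<boxtimes>\<^bsub>T\<^esub> rs y b)" if "b \<in> carrier S" for b
    by (rule balanced_right_action[OF right_module_mult_hom[OF S that]]) (use comm that in simp)
  show pure: "right_act rs (x \<boxtimes>\<^bsub>T\<^esub> y) b = x \<boxtimes>\<^bsub>T\<^esub> rs y b"
    if "x \<in> carrier M" "y \<in> carrier N" "b \<in> carrier S" for x y b
    unfolding right_act_def using lift_pure[OF T.abelian_group_axioms bal] that by simp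
  show hom: "(\<lambda>X. right_act rs X b) \<in> ahom T T" if "b \<in> carrier S" for b
    unfolding right_act_def using lift_hom[OF T.abelian_group_axioms bal[OF that]] .
  show "right_module S T (right_act rs)"
  proof
    fix a X assume "a \<in> carrier S" "X \<in> carrier T"
    then show "right_act rs X a \<in> carrier T" using hom ahom_closed by fastforce
  next
    fix a b X assume ab: "a \<in> carrier S" "b \<in> carrier S" and X: "X \<in> carrier T"
    \<comment> \<open>Additivity in the scalar is not a statement about maps out of
      \<open>T\<close>; it comes from keeping the representative of \<open>X\<close> fixed while
      \<open>c\<close> varies.\<close>
    have "(\<lambda>c. right_act rs X c) \<in> ahom S T"
      unfolding right_act_def
      by (rule lift_param_hom[OF T.abelian_group_axioms X])
        (rule pure_right_comp[OF _ right_module_scalar_hom[OF S]])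
    then show "right_act rs X (a \<oplus>\<^bsub>S\<^esub> b) = right_act rs X a \<oplus>\<^bsub>T\<^esub> right_act rs X b"
      using ab by (rule ahom_add)
    show "right_act rs X (a \<otimes>\<^bsub>S\<^esub> b) = right_act rs (right_act rs X a) b"
      by (rule hom_ext[OF T.abelian_group_axioms hom ahom_comp[OF hom hom] _ X])
        (use ab in \<open>auto simp: pure S.closed S.assoc\<close>)
  next
    fix a X Y assume "a \<in> carrier S" "X \<in> carrier T" "Y \<in> carrier T"
    then show "right_act rs (X \<oplus>\<^bsub>T\<^esub> Y) a = right_act rs X a \<oplus>\<^bsub>T\<^esub> right_act rs Y a"
      by (metis ahom_add[OF hom])
  next
    fix X assume X: "X \<in> carrier T"
    show "right_act rs X \<one>\<^bsub>S\<^esub> = X"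
      by (rule hom_ext[OF T.abelian_group_axioms hom ahom_ident _ X]) (auto simp: pure S.unit)
  qed
qed

lemma
  assumes S: "left_module S M ls"
    and comm: "\<And>a b x. a \<in> carrier R \<Longrightarrow> b \<in> carrier S \<Longrightarrow> x \<in> carrier M \<Longrightarrow> ls b (ra x a) = ra (ls b x) a"
  shows left_act_pure: "\<And>x y b. \<lbrakk>x \<in> carrier M; y \<in> carrier N; b \<in> carrier S\<rbrakk> \<Longrightarrow>
      left_act ls b (x \<boxtimes>\<^bsub>T\<^esub> y) = ls b x \<boxtimes>\<^bsub>T\<^esub> y"
    and left_act_hom: "\<And>b. b \<in> carrier S \<Longrightarrow> left_act ls b \<in> ahom T T"
    and left_act_module: "left_module S T (left_act ls)"
proof -
  interpret S: left_module S M ls by fact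
  have bal: "balanced R M ra N la T (\<lambda>x y. ls b x \<boxtimes>\<^bsub>T\<^esub> y)" if "b \<in> carrier S" for b
    by (rule balanced_left_action[OF left_module_mult_hom[OF S that]]) (use comm that in simp)
  show pure: "left_act ls b (x \<boxtimes>\<^bsub>T\<^esub> y) = ls b x \<boxtimes>\<^bsub>T\<^esub> y"
    if "x \<in> carrier M" "y \<in> carrier N" "b \<in> carrier S" for x y b
    unfolding left_act_def using lift_pure[OF T.abelian_group_axioms bal] that by simp
  show hom: "left_act ls b \<in> ahom T T" if "b \<in> carrier S" for b
    unfolding left_act_def using lift_hom[OF T.abelian_group_axioms bal[OF that]] .
  show "left_module S T (left_act ls)"
  proof
    fix a X assume "a \<in> carrier S" "X \<in> carrier T"
    then show "left_act ls a X \<in> carrier T" using hom ahom_closed by fastforce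
  next
    fix a b X assume ab: "a \<in> carrier S" "b \<in> carrier S" and X: "X \<in> carrier T"
    have "(\<lambda>c. left_act ls c X) \<in> ahom S T"
      unfolding left_act_def
      by (rule lift_param_hom[OF T.abelian_group_axioms X])
        (rule pure_left_comp[OF _ left_module_scalar_hom[OF S]])
    then show "left_act ls (a \<oplus>\<^bsub>S\<^esub> b) X = left_act ls a X \<oplus>\<^bsub>T\<^esub> left_act ls b X"
      using ab by (rule ahom_add)
    show "left_act ls (a \<otimes>\<^bsub>S\<^esub> b) X = left_act ls a (left_act ls b X)"
      by (rule hom_ext[OF T.abelian_group_axioms hom ahom_comp[OF hom hom] _ X])
        (use ab in \<open>auto simp: pure S.closed S.assoc\<close>)
  next
    fix a X Y assume "a \<in> carrier S" "X \<in> carrier T" "Y \<in> carrier T"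
    then show "left_act ls a (X \<oplus>\<^bsub>T\<^esub> Y) = left_act ls a X \<oplus>\<^bsub>T\<^esub> left_act ls a Y"
      by (metis ahom_add[OF hom])
  next
    fix X assume X: "X \<in> carrier T"
    show "left_act ls \<one>\<^bsub>S\<^esub> X = X"
      by (rule hom_ext[OF T.abelian_group_axioms hom ahom_ident _ X]) (auto simp: pure S.unit)
  qed
qed

end

section \<open>Tensor products of algebras\<close>

lemma opposite_simps [simp]:
  "carrier (opposite A) = carrier A" "ring.zero (opposite A) = ring.zero A"
  "ring.add (opposite A) = ring.add A" "one (opposite A) = one A"
  "x \<otimes>\<^bsub>opposite A\<^esub> y = y \<otimes>\<^bsub>A\<^esub> x"
  by (simp_all add: opposite_def)

lemma opposite_smult [simp]: "smult (opposite A) = smult A"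
  by (simp add: opposite_def)

lemma opposite_ring: assumes "ring A" shows "ring (opposite A)"
proof -
  interpret ring A by fact
  show ?thesis
    by (rule ringI; (rule abelian_groupI monoidI)?)
      (auto simp: a_ac m_assoc r_distr l_distr intro: add.l_inv_ex)
qed

lemma opposite_algebra: assumes "algebra_over_field K A" shows "algebra_over_field K (opposite A)"
proof -
  interpret algebra_over_field K A by fact
  interpret O: ring "opposite A" by (rule opposite_ring) (rule A.ring_axioms)
  show ?thesis
    by unfold_locales
      (auto simp: smult_l_distr smult_r_distr smult_assoc1 smult_mult_left smult_mult_right)
qed

lemma left_module_opposite:
  assumes "right_module R M ra" shows "left_module (opposite R) M (\<lambda>a x. ra x a)"
proof -
  interpret right_module R M ra by fact
  show ?thesis
    by (rule left_module.intro[OF opposite_ring[OF R.ring_axioms] M.abelian_group_axioms], unfold left_module_axioms_def)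
      (simp add: closed distrib_scalar distrib assoc unit)
qed

lemma right_module_opposite:
  assumes "left_module R M la" shows "right_module (opposite R) M (\<lambda>x a. la a x)"
proof -
  interpret left_module R M la by fact
  show ?thesis
    by (rule right_module.intro[OF opposite_ring[OF R.ring_axioms] M.abelian_group_axioms], unfold right_module_axioms_def)
      (simp add: closed distrib_scalar distrib assoc unit)
qed

text \<open>Negatives are obtained through the scalar \<open>-1\<close>, and zero as
  \<open>-1 + 1\<close>, so closure under sums, products and scalars together with the unit
  suffices.\<close>

lemma subalgebra_algebra:
  assumes "algebra_over_field K A" "S \<subseteq> carrier A" "\<one>\<^bsub>A\<^esub> \<in> S"
    and "\<And>x y. x \<in> S \<Longrightarrow> y \<in> S \<Longrightarrow> x \<oplus>\<^bsub>A\<^esub> y \<in> S"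
    and "\<And>x y. x \<in> S \<Longrightarrow> y \<in> S \<Longrightarrow> x \<otimes>\<^bsub>A\<^esub> y \<in> S"
    and "\<And>k x. k \<in> carrier K \<Longrightarrow> x \<in> S \<Longrightarrow> k \<odot>\<^bsub>A\<^esub> x \<in> S"
  shows "algebra_over_field K (A\<lparr>carrier := S\<rparr>)"
proof -
  interpret algebra_over_field K A by fact
  have sub: "x \<in> carrier A" if "x \<in> S" for x using that assms(2) by auto
  have neg1: "(\<ominus>\<^bsub>K\<^esub> \<one>\<^bsub>K\<^esub>) \<odot>\<^bsub>A\<^esub> x \<oplus>\<^bsub>A\<^esub> x = \<zero>\<^bsub>A\<^esub>" if "x \<in> carrier A" for x
  proof -
    have "\<ominus>\<^bsub>K\<^esub> \<one>\<^bsub>K\<^esub> \<oplus>\<^bsub>K\<^esub> \<one>\<^bsub>K\<^esub> = \<zero>\<^bsub>K\<^esub>" by (rule abelian_group.l_neg) (unfold_locales, simp)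
    then show ?thesis
      using smult_l_distr[of "\<ominus>\<^bsub>K\<^esub> \<one>\<^bsub>K\<^esub>" "\<one>\<^bsub>K\<^esub>" x] that smult_l_null[of x] by simp
  qed
  have neg: "(\<ominus>\<^bsub>K\<^esub> \<one>\<^bsub>K\<^esub>) \<odot>\<^bsub>A\<^esub> x \<in> S" if "x \<in> S" for x using that assms(6) by simp
  have zero: "\<zero>\<^bsub>A\<^esub> \<in> S" using neg1[OF sub] neg assms(3,4) by metis
  have inv: "\<exists>y\<in>S. y \<oplus>\<^bsub>A\<^esub> x = \<zero>\<^bsub>A\<^esub>" if "x \<in> S" for x
    using neg1[OF sub[OF that]] neg[OF that] by blast
  interpret S: ring "A\<lparr>carrier := S\<rparr>"
    by (rule ringI; (rule abelian_groupI monoidI)?)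
      (use inv zero assms(3-5) in \<open>auto simp: sub a_ac A.m_assoc A.r_distr A.l_distr\<close>)
  show ?thesis
    by unfold_locales
      (use assms(6) in \<open>auto simp: sub smult_l_distr smult_r_distr smult_assoc1 smult_mult_left smult_mult_right\<close>)
qed

locale algebra_pair = A: algebra_over_field K A + B: algebra_over_field K B
  for K (structure) and A :: "('k, 'a, 'c) module_scheme" (structure)
    and B :: "('k, 'b, 'd) module_scheme" (structure)
begin

abbreviation "AB \<equiv> tensor_algebra K A B"

sublocale tensor_product K A "\<lambda>x a. a \<odot>\<^bsub>A\<^esub> x" B "\<lambda>a y. a \<odot>\<^bsub>B\<^esub> y" AB
  unfolding tensor_product_def tensor_product_axioms_def
  by (auto simp: tensor_algebra_def Let_def
      intro: module_imp_left_module module_imp_right_module A.module_axioms B.module_axioms)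

lemma pure_tensor_algebra: "pure_tensor AB = pure_tensor (tensor K A (\<lambda>x a. a \<odot>\<^bsub>A\<^esub> x) B (\<lambda>a y. a \<odot>\<^bsub>B\<^esub> y))"
  by (simp add: pure_tensor_def fun_eq_iff carrier_tensor)

text \<open>Finite sums and integer multiples read only the additive part of a record, on which the
  bare group \<open>tensor\<close> and the algebra agree. The operations of
  \<open>tensor_algebra\<close> can then be stated without the bare group.\<close>

lemma lift_tensor_algebra:
  "tensor_lift (tensor K A (\<lambda>x a. a \<odot>\<^bsub>A\<^esub> x) B (\<lambda>a y. a \<odot>\<^bsub>B\<^esub> y)) = tensor_lift AB"
proof -
  have e: "add_pow (tensor K A (\<lambda>x a. a \<odot>\<^bsub>A\<^esub> x) B (\<lambda>a y. a \<odot>\<^bsub>B\<^esub> y)) k x = add_pow AB k x" for k :: int and x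
    by (simp add: add_pow_def int_pow_def2 nat_pow_def zero_tensor add_tensor m_inv_def carrier_tensor)
  show ?thesis
    by (simp add: tensor_lift_def frag_eval_def fun_eq_iff e finsum_def finprod_def
        zero_tensor add_tensor carrier_tensor)
qed

lemma smult_eq: "a \<odot>\<^bsub>AB\<^esub> X = tensor_lift AB (\<lambda>x y. (a \<odot>\<^bsub>A\<^esub> x) \<boxtimes>\<^bsub>AB\<^esub> y) X"
  unfolding pure_tensor_algebra lift_tensor_algebra[symmetric]
  by (simp add: tensor_algebra_def Let_def)

lemma mult_eq: "X \<otimes>\<^bsub>AB\<^esub> Y = tensor_lift AB (\<lambda>a b. tensor_lift AB (\<lambda>a' b'. (a \<otimes>\<^bsub>A\<^esub> a') \<boxtimes>\<^bsub>AB\<^esub> (b \<otimes>\<^bsub>B\<^esub> b')) Y) X"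
  unfolding pure_tensor_algebra lift_tensor_algebra[symmetric]
  by (simp add: tensor_algebra_def Let_def factorwise_mult_def)

lemma one_eq: "\<one>\<^bsub>AB\<^esub> = \<one>\<^bsub>A\<^esub> \<boxtimes>\<^bsub>AB\<^esub> \<one>\<^bsub>B\<^esub>"
  unfolding pure_tensor_algebra by (simp add: tensor_algebra_def Let_def)

lemma smult_balance:
  "\<lbrakk>x \<in> carrier A; a \<in> carrier K; y \<in> carrier B\<rbrakk> \<Longrightarrow> x \<boxtimes>\<^bsub>AB\<^esub> (a \<odot>\<^bsub>B\<^esub> y) = (a \<odot>\<^bsub>A\<^esub> x) \<boxtimes>\<^bsub>AB\<^esub> y"
  by (simp add: pure_balance)

lemma smult_hom: "a \<in> carrier K \<Longrightarrow> (\<lambda>X. a \<odot>\<^bsub>AB\<^esub> X) \<in> ahom AB AB"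
  and smult_pure: "\<lbrakk>x \<in> carrier A; a \<in> carrier K; y \<in> carrier B\<rbrakk> \<Longrightarrow> a \<odot>\<^bsub>AB\<^esub> (x \<boxtimes>\<^bsub>AB\<^esub> y) = (a \<odot>\<^bsub>A\<^esub> x) \<boxtimes>\<^bsub>AB\<^esub> y"
proof -
  have comm: "b \<odot>\<^bsub>A\<^esub> (a \<odot>\<^bsub>A\<^esub> x) = a \<odot>\<^bsub>A\<^esub> (b \<odot>\<^bsub>A\<^esub> x)" if "a \<in> carrier K" "b \<in> carrier K" "x \<in> carrier A" for a b x
    using that by (simp add: A.smult_assoc1[symmetric] A.m_comm)
  note * = left_act_hom[OF module_imp_left_module[OF A.module_axioms] comm]
    left_act_pure[OF module_imp_left_module[OF A.module_axioms] comm]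
  show "a \<in> carrier K \<Longrightarrow> (\<lambda>X. a \<odot>\<^bsub>AB\<^esub> X) \<in> ahom AB AB"
    using *(1)[of a] by (simp add: smult_eq left_act_def[abs_def])
  show "\<lbrakk>x \<in> carrier A; a \<in> carrier K; y \<in> carrier B\<rbrakk> \<Longrightarrow> a \<odot>\<^bsub>AB\<^esub> (x \<boxtimes>\<^bsub>AB\<^esub> y) = (a \<odot>\<^bsub>A\<^esub> x) \<boxtimes>\<^bsub>AB\<^esub> y"
    using *(2)[of x y a] by (simp add: smult_eq left_act_def)
qed

lemma module_AB: "module K AB"
proof -
  have comm: "b \<odot>\<^bsub>A\<^esub> (a \<odot>\<^bsub>A\<^esub> x) = a \<odot>\<^bsub>A\<^esub> (b \<odot>\<^bsub>A\<^esub> x)" if "a \<in> carrier K" "b \<in> carrier K" "x \<in> carrier A" for a b x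
    using that by (simp add: A.smult_assoc1[symmetric] A.m_comm)
  interpret L: left_module K AB "\<lambda>a X. a \<odot>\<^bsub>AB\<^esub> X"
    using left_act_module[OF module_imp_left_module[OF A.module_axioms] comm]
    by (simp add: smult_eq[abs_def] left_act_def[abs_def])
  show ?thesis
    by unfold_locales (simp_all add: L.closed L.distrib L.distrib_scalar L.assoc L.unit)
qed

lemma mult_balanced:
  assumes "a \<in> carrier A" "b \<in> carrier B"
  shows "balanced K A (\<lambda>x a. a \<odot>\<^bsub>A\<^esub> x) B (\<lambda>a y. a \<odot>\<^bsub>B\<^esub> y) AB (\<lambda>a' b'. (a \<otimes>\<^bsub>A\<^esub> a') \<boxtimes>\<^bsub>AB\<^esub> (b \<otimes>\<^bsub>B\<^esub> b'))"
  using assms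
  by (intro balancedI pure_left_comp pure_right_comp ring_mult_left_hom ahom_ident A.A.ring_axioms B.A.ring_axioms)
    (simp_all add: A.smult_mult_right B.smult_mult_right smult_balance)

lemma mult_balanced':
  assumes "Y \<in> carrier AB"
  shows "balanced K A (\<lambda>x a. a \<odot>\<^bsub>A\<^esub> x) B (\<lambda>a y. a \<odot>\<^bsub>B\<^esub> y) AB
    (\<lambda>a b. tensor_lift AB (\<lambda>a' b'. (a \<otimes>\<^bsub>A\<^esub> a') \<boxtimes>\<^bsub>AB\<^esub> (b \<otimes>\<^bsub>B\<^esub> b')) Y)"
proof (rule balancedI)
  fix x a y assume "x \<in> carrier A" "a \<in> carrier K" "y \<in> carrier B"
  then show "tensor_lift AB (\<lambda>a' b'. ((a \<odot>\<^bsub>A\<^esub> x) \<otimes>\<^bsub>A\<^esub> a') \<boxtimes>\<^bsub>AB\<^esub> (y \<otimes>\<^bsub>B\<^esub> b')) Y =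
    tensor_lift AB (\<lambda>a' b'. (x \<otimes>\<^bsub>A\<^esub> a') \<boxtimes>\<^bsub>AB\<^esub> ((a \<odot>\<^bsub>B\<^esub> y) \<otimes>\<^bsub>B\<^esub> b')) Y"
    by (intro lift_cong[OF T.abelian_group_axioms assms])
      (simp_all add: A.smult_mult_left B.smult_mult_left smult_balance)
qed (intro lift_param_hom[OF T.abelian_group_axioms assms] pure_left_comp pure_right_comp
    ring_mult_right_hom ahom_ident A.A.ring_axioms B.A.ring_axioms; simp)+

lemma mult_left_hom: "X \<in> carrier AB \<Longrightarrow> (\<lambda>Y. X \<otimes>\<^bsub>AB\<^esub> Y) \<in> ahom AB AB"
  unfolding mult_eq
  by (rule lift_param_hom[OF T.abelian_group_axioms])
    (auto intro: lift_hom[OF T.abelian_group_axioms mult_balanced])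

lemma mult_right_hom: "Y \<in> carrier AB \<Longrightarrow> (\<lambda>X. X \<otimes>\<^bsub>AB\<^esub> Y) \<in> ahom AB AB"
  unfolding mult_eq by (rule lift_hom[OF T.abelian_group_axioms mult_balanced'])

lemma mult_pure [simp]:
  assumes "a \<in> carrier A" "b \<in> carrier B" "a' \<in> carrier A" "b' \<in> carrier B"
  shows "(a \<boxtimes>\<^bsub>AB\<^esub> b) \<otimes>\<^bsub>AB\<^esub> (a' \<boxtimes>\<^bsub>AB\<^esub> b') = (a \<otimes>\<^bsub>A\<^esub> a') \<boxtimes>\<^bsub>AB\<^esub> (b \<otimes>\<^bsub>B\<^esub> b')"
  unfolding mult_eq using assms
  by (simp add: lift_pure[OF T.abelian_group_axioms mult_balanced'] lift_pure[OF T.abelian_group_axioms mult_balanced])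

lemma hom_ext2:
  assumes "abelian_group G" "\<And>X. X \<in> carrier AB \<Longrightarrow> (\<lambda>Y. g X Y) \<in> ahom AB G" "\<And>X. X \<in> carrier AB \<Longrightarrow> (\<lambda>Y. h X Y) \<in> ahom AB G"
    "\<And>Y. Y \<in> carrier AB \<Longrightarrow> (\<lambda>X. g X Y) \<in> ahom AB G" "\<And>Y. Y \<in> carrier AB \<Longrightarrow> (\<lambda>X. h X Y) \<in> ahom AB G"
    and "\<And>a b a' b'. \<lbrakk>a \<in> carrier A; b \<in> carrier B; a' \<in> carrier A; b' \<in> carrier B\<rbrakk> \<Longrightarrow>
      g (a \<boxtimes>\<^bsub>AB\<^esub> b) (a' \<boxtimes>\<^bsub>AB\<^esub> b') = h (a \<boxtimes>\<^bsub>AB\<^esub> b) (a' \<boxtimes>\<^bsub>AB\<^esub> b')"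
    and X: "X \<in> carrier AB" and Y: "Y \<in> carrier AB"
  shows "g X Y = h X Y"
proof (rule hom_ext[OF assms(1) assms(4,5)[OF Y] _ X])
  fix x y assume xy: "x \<in> carrier A" "y \<in> carrier B"
  show "g (x \<boxtimes>\<^bsub>AB\<^esub> y) Y = h (x \<boxtimes>\<^bsub>AB\<^esub> y) Y"
    by (rule hom_ext[OF assms(1) assms(2,3) _ Y]) (use xy assms(6) in auto)
qed

sublocale AB: algebra_over_field K AB
proof -
  interpret module K AB by (rule module_AB)
  note ag = T.abelian_group_axioms
  have cl: "X \<otimes>\<^bsub>AB\<^esub> Y \<in> carrier AB" if "X \<in> carrier AB" "Y \<in> carrier AB" for X Y
    using mult_left_hom[OF that(1)] that(2) by (rule ahom_closed)
  have assoc: "(X \<otimes>\<^bsub>AB\<^esub> Y) \<otimes>\<^bsub>AB\<^esub> Z = X \<otimes>\<^bsub>AB\<^esub> (Y \<otimes>\<^bsub>AB\<^esub> Z)"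
    if XYZ: "X \<in> carrier AB" "Y \<in> carrier AB" "Z \<in> carrier AB" for X Y Z
  proof (rule hom_ext2[OF ag, where X=X and Y=Y])
    fix a b a' b' assume ab: "a \<in> carrier A" "b \<in> carrier B" "a' \<in> carrier A" "b' \<in> carrier B"
    show "((a \<boxtimes>\<^bsub>AB\<^esub> b) \<otimes>\<^bsub>AB\<^esub> (a' \<boxtimes>\<^bsub>AB\<^esub> b')) \<otimes>\<^bsub>AB\<^esub> Z = (a \<boxtimes>\<^bsub>AB\<^esub> b) \<otimes>\<^bsub>AB\<^esub> ((a' \<boxtimes>\<^bsub>AB\<^esub> b') \<otimes>\<^bsub>AB\<^esub> Z)"
      by (rule hom_ext[OF ag mult_left_hom ahom_comp[OF mult_left_hom mult_left_hom] _ XYZ(3)])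
        (use ab in \<open>auto simp: A.A.m_assoc B.A.m_assoc cl\<close>)
  qed (use XYZ cl in \<open>auto intro!: ahom_comp[OF mult_left_hom] ahom_comp[OF mult_right_hom] mult_left_hom mult_right_hom\<close>)
  have one: "\<one>\<^bsub>AB\<^esub> \<in> carrier AB" by (simp add: one_eq)
  have l_one: "\<one>\<^bsub>AB\<^esub> \<otimes>\<^bsub>AB\<^esub> X = X" if "X \<in> carrier AB" for X
    by (rule hom_ext[OF ag mult_left_hom[OF one] ahom_ident _ that]) (auto simp: one_eq)
  have r_one: "X \<otimes>\<^bsub>AB\<^esub> \<one>\<^bsub>AB\<^esub> = X" if "X \<in> carrier AB" for X
    by (rule hom_ext[OF ag mult_right_hom[OF one] ahom_ident _ that]) (auto simp: one_eq)
  interpret r: ring AB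
    by (rule ringI[OF ag]; (rule monoidI)?)
      (auto simp: cl assoc one l_one r_one ahom_add[OF mult_left_hom] ahom_add[OF mult_right_hom])
  show "algebra_over_field K AB"
  proof
    fix a X Y assume *: "a \<in> carrier K" "X \<in> carrier AB" "Y \<in> carrier AB"
    show "(a \<odot>\<^bsub>AB\<^esub> X) \<otimes>\<^bsub>AB\<^esub> Y = a \<odot>\<^bsub>AB\<^esub> (X \<otimes>\<^bsub>AB\<^esub> Y)"
      by (rule hom_ext2[OF ag, where X=X and Y=Y])
        (use * in \<open>auto intro!: ahom_comp[OF mult_left_hom] ahom_comp[OF mult_right_hom] ahom_comp[OF smult_hom]
          mult_left_hom mult_right_hom smult_hom simp: smult_pure A.smult_mult_left\<close>)
    show "X \<otimes>\<^bsub>AB\<^esub> (a \<odot>\<^bsub>AB\<^esub> Y) = a \<odot>\<^bsub>AB\<^esub> (X \<otimes>\<^bsub>AB\<^esub> Y)"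
      by (rule hom_ext2[OF ag, where X=X and Y=Y])
        (use * in \<open>auto intro!: ahom_comp[OF mult_left_hom] ahom_comp[OF mult_right_hom] ahom_comp[OF smult_hom]
          mult_left_hom mult_right_hom smult_hom simp: smult_pure A.smult_mult_right\<close>)
  qed
qed

end

text \<open>Complements \<open>hom_ext\<close> for properties that are not equations between
  homomorphisms, such as membership in an image. Zero is covered as a pure tensor minus
  itself.\<close>

lemma (in tensor_product) tensor_induct [consumes 1, case_names pure minus]:
  assumes "X \<in> carrier T"
    and pure: "\<And>x y. x \<in> carrier M \<Longrightarrow> y \<in> carrier N \<Longrightarrow> Q (x \<boxtimes>\<^bsub>T\<^esub> y)"
    and minus: "\<And>X Y. X \<in> carrier T \<Longrightarrow> Y \<in> carrier T \<Longrightarrow> Q X \<Longrightarrow> Q Y \<Longrightarrow> Q (X \<ominus>\<^bsub>T\<^esub> Y)"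
  shows "Q X"
proof -
  have d: "coset (c - d) = coset c \<ominus>\<^bsub>T\<^esub> coset d"
    if "Poly_Mapping.keys c \<subseteq> carrier M \<times> carrier N" "Poly_Mapping.keys d \<subseteq> carrier M \<times> carrier N" for c d
  proof -
    have k: "Poly_Mapping.keys (c - d) \<subseteq> carrier M \<times> carrier N"
      using keys_diff[of c d] that by auto
    have cl: "coset c \<in> carrier T" "coset d \<in> carrier T" "coset (c - d) \<in> carrier T"
      using that k by (auto simp: carrier_T)
    have "coset c = coset (c - d) \<oplus>\<^bsub>T\<^esub> coset d"
      using coset_plus[OF k that(2)] by simp
    then show ?thesis using cl by (simp add: T.minus_eq T.a_assoc T.r_neg)
  qed
  have "Q (coset c)" if "Poly_Mapping.keys c \<subseteq> carrier M \<times> carrier N" for c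
    using that
  proof (induction rule: frag_induct)
    case zero
    let ?p = "\<zero>\<^bsub>M\<^esub> \<boxtimes>\<^bsub>T\<^esub> \<zero>\<^bsub>N\<^esub>"
    have "?p \<ominus>\<^bsub>T\<^esub> ?p = \<zero>\<^bsub>T\<^esub>" by (simp add: T.minus_eq T.r_neg)
    moreover have "coset 0 = \<zero>\<^bsub>T\<^esub>" using hom_one[OF coset_hom group_FA T.a_group] by simp
    ultimately show ?case using minus[of ?p ?p] pure by simp
  next
    case (of z) then show ?case using pure by (auto simp flip: pure_eq_coset)
  next
    case (diff c e) then show ?case using d[OF diff(1,2)] minus by (auto simp: carrier_T)
  qed
  then show ?thesis using assms(1) by (auto simp: carrier_T)
qed

section \<open>Faithful flatness\<close>

text \<open>Bounds the size of a carrier by the universe type over which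
  \<open>faithfully_flat_left\<close> quantifies.\<close>

definition embeds :: "'u itself \<Rightarrow> 'a set \<Rightarrow> bool" where
  "embeds _ A \<longleftrightarrow> (\<exists>f :: 'a \<Rightarrow> 'u. inj_on f A)"

lemma embeds_subset: "embeds TYPE('u) A \<Longrightarrow> B \<subseteq> A \<Longrightarrow> embeds TYPE('u) B"
  unfolding embeds_def using inj_on_subset by blast

lemma list_encoding:
  assumes "infinite (UNIV :: 'u set)"
  shows "\<exists>e :: 'u list \<Rightarrow> 'u. inj e"
proof -
  have "|UNIV :: 'u list set| =o |UNIV :: 'u set|"
    using card_of_lists_infinite[OF assms] by simp
  then show ?thesis
    by (auto simp: card_of_ordIso[symmetric] bij_betw_def)
qed

text \<open>A tensor is represented by a finite word of signed pairs. Hence there are at most as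
  many tensors as words over \<open>'u\<close>, and an infinite type absorbs its own words.\<close>

lemma (in tensor_product) embeds_tensor:
  assumes inf: "infinite (UNIV :: 'u set)"
    and "embeds TYPE('u) (carrier M)" "embeds TYPE('u) (carrier N)"
  shows "embeds TYPE('u) (carrier T)"
proof -
  obtain e :: "'u list \<Rightarrow> 'u" where e: "inj e" using list_encoding[OF inf] by blast
  obtain f :: "'m \<Rightarrow> 'u" where f: "inj_on f (carrier M)" using assms by (auto simp: embeds_def)
  obtain g :: "'n \<Rightarrow> 'u" where g: "inj_on g (carrier N)" using assms by (auto simp: embeds_def)
  \<comment> \<open>Two distinct letters encode the sign of a term.\<close>
  obtain u0 u1 :: 'u where u: "u0 \<noteq> u1"
    using inf by (metis (full_types) finite.simps infinite_UNIV_char_0 UNIV_eq_I finite.emptyI insertI1)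
  define S where "S = (carrier M \<times> carrier N) \<times> (UNIV :: bool set)"
  define val :: "(('m \<times> 'n) \<times> bool) list \<Rightarrow> ('m \<times> 'n) \<Rightarrow>\<^sub>0 int"
    where "val l = sum_list (map (\<lambda>(z, b). if b then frag_of z else - frag_of z) l)" for l
  have neg: "val (map (apsnd Not) l) = - val l" for l
    by (induction l) (auto simp: val_def)
  have ex: "\<exists>l \<in> lists S. c = val l" if "Poly_Mapping.keys c \<subseteq> carrier M \<times> carrier N" for c
    using that
  proof (induction rule: frag_induct)
    case zero show ?case by (rule bexI[of _ "[]"]) (auto simp: val_def)
  next
    case (of z) then show ?case by (intro bexI[of _ "[(z, True)]"]) (auto simp: val_def S_def)
  next
    case (diff a b)
    then obtain la lb where l: "la \<in> lists S" "lb \<in> lists S" "a = val la" "b = val lb" by auto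
    have "val (la @ map (apsnd Not) lb) = a - b"
      using neg[of lb] l by (simp add: val_def)
    moreover have "la @ map (apsnd Not) lb \<in> lists S"
      using l by (fastforce simp: S_def in_lists_conv_set)
    ultimately show ?case by metis
  qed
  have "\<exists>l \<in> lists S. X = coset (val l)" if X: "X \<in> carrier T" for X
  proof -
    obtain c where "Poly_Mapping.keys c \<subseteq> carrier M \<times> carrier N" "X = coset c"
      using X unfolding carrier_T by blast
    then show ?thesis using ex[of c] by metis
  qed
  \<comment> \<open>One word is selected for each tensor; since \<open>coset (val (r X))\<close>
    recovers \<open>X\<close>, distinct tensors receive distinct words.\<close>
  then obtain r where r: "\<And>X. X \<in> carrier T \<Longrightarrow> r X \<in> lists S \<and> X = coset (val (r X))"
    by metis
  define h where "h = (\<lambda>((x, y), b). e [f x, g y, if b then u0 else u1])"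
  have h: "inj_on h S"
    using e f g u by (auto simp: inj_on_def h_def S_def split: if_splits dest!: injD[OF e])
  have "inj_on (\<lambda>X. e (map h (r X))) (carrier T)"
  proof (rule inj_onI)
    fix X Y assume XY: "X \<in> carrier T" "Y \<in> carrier T" "e (map h (r X)) = e (map h (r Y))"
    then have "map h (r X) = map h (r Y)" using e by (simp add: inj_eq)
    moreover have "inj_on h (set (r X) \<union> set (r Y))"
      by (rule inj_on_subset[OF h]) (use r[OF XY(1)] r[OF XY(2)] in auto)
    ultimately have "r X = r Y" by (simp add: inj_on_map_eq_map)
    then show "X = Y" using r[OF XY(1)] r[OF XY(2)] by metis
  qed
  then show ?thesis by (auto simp: embeds_def)
qed

text \<open>Test modules must be carried by the universe type, so addition and action are
  transported to the image of \<open>f\<close> through its inverse. The multiplicative fields of the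
  record carry no information.\<close>

lemma transport_right_module:
  assumes "right_module R M ra" "inj_on (f :: 'm \<Rightarrow> 'u) (carrier M)"
  obtains M' :: "'u ring" and ra' where "right_module R M' ra'" "f \<in> ahom M M'"
    "bij_betw f (carrier M) (carrier M')" "\<And>x a. x \<in> carrier M \<Longrightarrow> a \<in> carrier R \<Longrightarrow> f (ra x a) = ra' (f x) a"
proof -
  interpret right_module R M ra by fact
  define g where "g = inv_into (carrier M) f"
  have g: "g (f x) = x" if "x \<in> carrier M" for x
    using that assms(2) by (simp add: g_def)
  define M' :: "'u ring" where "M' = \<lparr>carrier = f ` carrier M, monoid.mult = undefined, one = undefined,
    ring.zero = f \<zero>\<^bsub>M\<^esub>, ring.add = (\<lambda>u v. f (g u \<oplus>\<^bsub>M\<^esub> g v))\<rparr>"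
  have ag: "abelian_group M'"
  proof (rule abelian_groupI)
    show "\<exists>y\<in>carrier M'. y \<oplus>\<^bsub>M'\<^esub> x = \<zero>\<^bsub>M'\<^esub>" if "x \<in> carrier M'" for x
      using that by (auto simp: M'_def g M.l_neg intro!: bexI[of _ "\<ominus>\<^bsub>M\<^esub> z" for z])
  qed (auto simp: M'_def g M.a_ac)
  interpret M': abelian_group M' by (rule ag)
  show thesis
  proof (rule that[of M' "\<lambda>u a. f (ra (g u) a)"])
    show "right_module R M' (\<lambda>u a. f (ra (g u) a))"
      by unfold_locales (auto simp: M'_def g closed distrib distrib_scalar assoc unit)
    show "f \<in> ahom M M'" by (rule ahomI) (auto simp: M'_def g)
    show "bij_betw f (carrier M) (carrier M')" using assms(2) by (simp add: M'_def bij_betw_def)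
  qed (simp add: g)
qed

lemma right_module_homI:
  assumes "f \<in> ahom M N" "\<And>x a. x \<in> carrier M \<Longrightarrow> a \<in> carrier R \<Longrightarrow> f (ra x a) = ra' (f x) a"
  shows "f \<in> right_module_hom R M ra N ra'"
  using assms by (simp add: right_module_hom_def)

lemma right_module_homD:
  assumes "f \<in> right_module_hom R M ra N ra'"
  shows "f \<in> ahom M N" "\<And>x a. x \<in> carrier M \<Longrightarrow> a \<in> carrier R \<Longrightarrow> f (ra x a) = ra' (f x) a"
    "\<And>x. x \<in> carrier M \<Longrightarrow> f x \<in> carrier N"
  using assms by (auto simp: right_module_hom_def intro: ahom_closed)

lemma submodule_right_module:
  assumes "right_module R M ra" "S \<subseteq> carrier M" "\<zero>\<^bsub>M\<^esub> \<in> S"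
    and "\<And>x y. x \<in> S \<Longrightarrow> y \<in> S \<Longrightarrow> x \<oplus>\<^bsub>M\<^esub> y \<in> S" "\<And>x. x \<in> S \<Longrightarrow> \<ominus>\<^bsub>M\<^esub> x \<in> S"
    and "\<And>x a. x \<in> S \<Longrightarrow> a \<in> carrier R \<Longrightarrow> ra x a \<in> S"
  shows "right_module R (M\<lparr>carrier := S\<rparr>) ra"
proof -
  interpret right_module R M ra by fact
  have sub: "x \<in> carrier M" if "x \<in> S" for x using that assms(2) by auto
  have inv: "\<exists>y\<in>S. y \<oplus>\<^bsub>M\<^esub> x = \<zero>\<^bsub>M\<^esub>" if "x \<in> S" for x
    using assms(5)[OF that] M.l_neg[OF sub[OF that]] by blast
  interpret S: abelian_group "M\<lparr>carrier := S\<rparr>"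
    by (rule abelian_groupI) (use assms(3,4) inv sub in \<open>auto simp: M.a_ac\<close>)
  show ?thesis
    by unfold_locales (use assms(6) in \<open>auto simp: sub closed distrib distrib_scalar assoc unit\<close>)
qed

lemma exactI:
  assumes "\<And>x. x \<in> carrier L \<Longrightarrow> f x \<in> carrier M \<and> g (f x) = \<zero>\<^bsub>N\<^esub>"
    and "\<And>y. y \<in> carrier M \<Longrightarrow> g y = \<zero>\<^bsub>N\<^esub> \<Longrightarrow> y \<in> f ` carrier L"
  shows "exact L f M g N"
  using assms by (auto simp: exact_def a_kernel_def kernel_def)

lemma exactD:
  assumes "exact L f M g N" "y \<in> carrier M" "g y = \<zero>\<^bsub>N\<^esub>" shows "y \<in> f ` carrier L"
  using assms by (auto simp: exact_def a_kernel_def kernel_def)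

lemma exact_iso:
  assumes 1: "bij_betw \<phi>1 (carrier L) (carrier L')" and 2: "bij_betw \<phi>2 (carrier M) (carrier M')"
    and 3: "bij_betw \<phi>3 (carrier N) (carrier N')" and z: "\<phi>3 \<zero>\<^bsub>N\<^esub> = \<zero>\<^bsub>N'\<^esub>" "\<zero>\<^bsub>N\<^esub> \<in> carrier N"
    and f: "\<And>x. x \<in> carrier L \<Longrightarrow> f x \<in> carrier M" "\<And>x. x \<in> carrier L \<Longrightarrow> f' (\<phi>1 x) = \<phi>2 (f x)"
    and g: "\<And>x. x \<in> carrier M \<Longrightarrow> g x \<in> carrier N" "\<And>x. x \<in> carrier M \<Longrightarrow> g' (\<phi>2 x) = \<phi>3 (g x)"
  shows "exact L f M g N \<longleftrightarrow> exact L' f' M' g' N'"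
proof -
  have i: "inj_on \<phi>2 (carrier M)" "\<phi>2 ` carrier M = carrier M'" using 2 by (auto simp: bij_betw_def)
  have im: "f' ` carrier L' = \<phi>2 ` (f ` carrier L)"
    using 1 f(2) unfolding bij_betw_def image_image by (metis (no_types, lifting) image_cong image_image)
  have "g' (\<phi>2 x) = \<zero>\<^bsub>N'\<^esub> \<longleftrightarrow> g x = \<zero>\<^bsub>N\<^esub>" if "x \<in> carrier M" for x
    using that g z 3 by (metis bij_betw_inv_into_left)
  then have ker: "a_kernel M' N' g' = \<phi>2 ` (a_kernel M N g)"
    unfolding a_kernel_def kernel_def using i(2)[symmetric] by auto
  have "f ` carrier L \<subseteq> carrier M" "a_kernel M N g \<subseteq> carrier M"
    using f by (auto simp: a_kernel_def kernel_def)
  then show ?thesis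
    unfolding exact_def im ker by (rule inj_on_image_eq_iff[OF i(1), symmetric])
qed

section \<open>The functor of tensoring right modules with a fixed left module\<close>

locale tensor_functor = N: left_module R N la
  for R (structure) and N :: "('n, 'e) ring_scheme" (structure) and la
begin

abbreviation "TN M ra \<equiv> tensor R M ra N la"

lemma TN: "right_module R M ra \<Longrightarrow> tensor_product R M ra N la (TN M ra)"
  by (rule tensor_productI[OF _ N.left_module_axioms])

lemma TN_abelian_group: "right_module R M ra \<Longrightarrow> abelian_group (TN M ra)"
  using tensor_product.comm_group_T[OF TN] by (rule comm_group_abelian_groupI)

context
  fixes M ra M' ra' f
  assumes M: "right_module R M ra" and M': "right_module R M' ra'"
    and f: "f \<in> right_module_hom R M ra M' ra'"
begin

interpretation TM: tensor_product R M ra N la "TN M ra" by (rule TN[OF M])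
interpretation TM': tensor_product R M' ra' N la "TN M' ra'" by (rule TN[OF M'])

lemma map_balanced: "balanced R M ra N la (TN M' ra') (\<lambda>x y. f x \<boxtimes>\<^bsub>TN M' ra'\<^esub> y)"
proof (rule balancedI)
  show "(\<lambda>y. f x \<boxtimes>\<^bsub>TN M' ra'\<^esub> y) \<in> ahom N (TN M' ra')" if "x \<in> carrier M" for x
    by (rule TM'.pure_hom_right[OF right_module_homD(3)[OF f that]])
  show "(\<lambda>x. f x \<boxtimes>\<^bsub>TN M' ra'\<^esub> y) \<in> ahom M (TN M' ra')" if "y \<in> carrier N" for y
    by (rule TM'.pure_left_comp[OF that right_module_homD(1)[OF f]])
qed (use right_module_homD[OF f] in \<open>simp add: TM'.pure_balance\<close>)

lemma map_hom: "tensor_right_map R M' ra' N la f \<in> ahom (TN M ra) (TN M' ra')"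
  unfolding tensor_right_map_def Let_def
  by (rule TM.lift_hom[OF TM'.T.abelian_group_axioms map_balanced])

lemma map_closed: "X \<in> carrier (TN M ra) \<Longrightarrow> tensor_right_map R M' ra' N la f X \<in> carrier (TN M' ra')"
  using map_hom by (rule ahom_closed)

lemma map_pure:
  "x \<in> carrier M \<Longrightarrow> y \<in> carrier N \<Longrightarrow>
   tensor_right_map R M' ra' N la f (x \<boxtimes>\<^bsub>TN M ra\<^esub> y) = f x \<boxtimes>\<^bsub>TN M' ra'\<^esub> y"
  unfolding tensor_right_map_def Let_def
  by (rule TM.lift_pure[OF TM'.T.abelian_group_axioms map_balanced])

end

text \<open>The composite is a separate function \<open>h\<close> that agrees with it on the
  carrier, so the rule also covers maps that are equal only there, such as a map composed with its
  inverse.\<close>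

lemma map_comp:
  assumes M: "right_module R M ra" and M': "right_module R M' ra'" and M'': "right_module R M'' ra''"
    and f: "f \<in> right_module_hom R M ra M' ra'" and g: "g \<in> right_module_hom R M' ra' M'' ra''"
    and h: "h \<in> right_module_hom R M ra M'' ra''" and eq: "\<And>x. x \<in> carrier M \<Longrightarrow> g (f x) = h x"
    and X: "X \<in> carrier (TN M ra)"
  shows "tensor_right_map R M'' ra'' N la g (tensor_right_map R M' ra' N la f X) = tensor_right_map R M'' ra'' N la h X"
  by (rule tensor_product.hom_ext[OF TN[OF M] TN_abelian_group[OF M'']
      ahom_comp[OF map_hom[OF M' M'' g] map_hom[OF M M' f]] map_hom[OF M M'' h] _ X])
    (use right_module_homD[OF f] in \<open>simp add: map_pure[OF M M' f] map_pure[OF M' M'' g] map_pure[OF M M'' h] eq\<close>)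

lemma map_ident:
  assumes M: "right_module R M ra" and h: "h \<in> right_module_hom R M ra M ra"
    and eq: "\<And>x. x \<in> carrier M \<Longrightarrow> h x = x" and X: "X \<in> carrier (TN M ra)"
  shows "tensor_right_map R M ra N la h X = X"
  by (rule tensor_product.hom_ext[OF TN[OF M] TN_abelian_group[OF M] map_hom[OF M M h] ahom_ident _ X])
    (simp add: map_pure[OF M M h] eq)

lemma map_bij:
  assumes M: "right_module R M ra" and M': "right_module R M' ra'"
    and f: "f \<in> right_module_hom R M ra M' ra'" and bij: "bij_betw f (carrier M) (carrier M')"
  shows "bij_betw (tensor_right_map R M' ra' N la f) (carrier (TN M ra)) (carrier (TN M' ra'))"
proof -
  interpret M: right_module R M ra by fact
  let ?g = "inv_into (carrier M) f"
  have gcl: "?g y \<in> carrier M" if "y \<in> carrier M'" for y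
    using bij that by (metis bij_betw_def inv_into_into)
  have fg: "f (?g y) = y" if "y \<in> carrier M'" for y using bij that by (simp add: bij_betw_inv_into_right)
  have gf: "?g (f y) = y" if "y \<in> carrier M" for y using bij that by (simp add: bij_betw_inv_into_left)
  have g: "?g \<in> right_module_hom R M' ra' M ra"
  proof (rule right_module_homI)
    show "?g \<in> ahom M' M"
      by (rule ahom_inv_into[OF right_module_homD(1)[OF f] bij M.M.abelian_group_axioms])
    fix y a assume ya: "y \<in> carrier M'" "a \<in> carrier R"
    have "f (ra (?g y) a) = ra' y a"
      using right_module_homD(2)[OF f gcl ya(2)] ya fg by simp
    then show "?g (ra' y a) = ra (?g y) a"
      using gf[of "ra (?g y) a"] ya gcl by (simp add: M.closed)
  qed
  have id: "(\<lambda>x. x) \<in> right_module_hom R M ra M ra" "(\<lambda>x. x) \<in> right_module_hom R M' ra' M' ra'"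
    by (auto intro!: right_module_homI ahom_ident)
  note i = map_ident[OF M id(1) refl] map_ident[OF M' id(2) refl]
  show ?thesis
    by (rule bij_betw_byWitness[where f' = "tensor_right_map R M ra N la ?g"])
      (use map_comp[OF M M' M f g id(1) gf] map_comp[OF M' M M' g f id(2) fg] i
        map_closed[OF M M' f] map_closed[OF M' M g] in auto)
qed

end

text \<open>The definition speaks about modules carried by the universe type. A sequence whose
  carriers embed there is isomorphic to such a sequence, its tensored version is isomorphic to the
  tensored copy by functoriality, and exactness is invariant under both isomorphisms.\<close>

lemma faithfully_flat_exact:
  fixes M1 :: "('a, 'x) ring_scheme" and M2 :: "('b, 'y) ring_scheme" and M3 :: "('c, 'z) ring_scheme"
  assumes FF: "faithfully_flat_left TYPE('u) R N la"
    and M1: "right_module R M1 r1" and M2: "right_module R M2 r2" and M3: "right_module R M3 r3"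
    and emb: "embeds TYPE('u) (carrier M1)" "embeds TYPE('u) (carrier M2)" "embeds TYPE('u) (carrier M3)"
    and f: "f \<in> right_module_hom R M1 r1 M2 r2" and g: "g \<in> right_module_hom R M2 r2 M3 r3"
  shows "exact M1 f M2 g M3 \<longleftrightarrow>
    exact (tensor R M1 r1 N la) (tensor_right_map R M2 r2 N la f)
          (tensor R M2 r2 N la) (tensor_right_map R M3 r3 N la g) (tensor R M3 r3 N la)"
proof -
  interpret tensor_functor R N la
    using FF by (simp add: tensor_functor_def faithfully_flat_left_def)
  interpret M1: right_module R M1 r1 by fact
  interpret M2: right_module R M2 r2 by fact
  interpret M3: right_module R M3 r3 by fact
  obtain e1 :: "'a \<Rightarrow> 'u" and e2 :: "'b \<Rightarrow> 'u" and e3 :: "'c \<Rightarrow> 'u"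
    where e: "inj_on e1 (carrier M1)" "inj_on e2 (carrier M2)" "inj_on e3 (carrier M3)"
    using emb by (auto simp: embeds_def)
  obtain N1 :: "'u ring" and s1 where N1: "right_module R N1 s1" "e1 \<in> ahom M1 N1"
    "bij_betw e1 (carrier M1) (carrier N1)" "\<And>x a. x \<in> carrier M1 \<Longrightarrow> a \<in> carrier R \<Longrightarrow> e1 (r1 x a) = s1 (e1 x) a"
    by (rule transport_right_module[OF M1 e(1)]) (rule that)
  obtain N2 :: "'u ring" and s2 where N2: "right_module R N2 s2" "e2 \<in> ahom M2 N2"
    "bij_betw e2 (carrier M2) (carrier N2)" "\<And>x a. x \<in> carrier M2 \<Longrightarrow> a \<in> carrier R \<Longrightarrow> e2 (r2 x a) = s2 (e2 x) a"
    by (rule transport_right_module[OF M2 e(2)]) (rule that)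
  obtain N3 :: "'u ring" and s3 where N3: "right_module R N3 s3" "e3 \<in> ahom M3 N3"
    "bij_betw e3 (carrier M3) (carrier N3)" "\<And>x a. x \<in> carrier M3 \<Longrightarrow> a \<in> carrier R \<Longrightarrow> e3 (r3 x a) = s3 (e3 x) a"
    by (rule transport_right_module[OF M3 e(3)]) (rule that)
  interpret N1: right_module R N1 s1 by (rule N1)
  interpret N2: right_module R N2 s2 by (rule N2)
  interpret N3: right_module R N3 s3 by (rule N3)
  have E: "e1 \<in> right_module_hom R M1 r1 N1 s1" "e2 \<in> right_module_hom R M2 r2 N2 s2"
    "e3 \<in> right_module_hom R M3 r3 N3 s3"
    using N1 N2 N3 by (auto intro!: right_module_homI)
  have inv: "inv_into (carrier M) e \<in> ahom N' M" if "e \<in> ahom M N'" "bij_betw e (carrier M) (carrier N')" "abelian_group M"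
    for e and M :: "('v, 'w) ring_scheme" and N' :: "'u ring"
    by (rule ahom_inv_into) (use that in auto)
  define f' where "f' = (\<lambda>u. e2 (f (inv_into (carrier M1) e1 u)))"
  define g' where "g' = (\<lambda>u. e3 (g (inv_into (carrier M2) e2 u)))"
  have f'e: "f' (e1 x) = e2 (f x)" if "x \<in> carrier M1" for x
    using that N1(3) by (simp add: f'_def bij_betw_inv_into_left)
  have g'e: "g' (e2 x) = e3 (g x)" if "x \<in> carrier M2" for x
    using that N2(3) by (simp add: g'_def bij_betw_inv_into_left)
  have f': "f' \<in> right_module_hom R N1 s1 N2 s2"
  proof (rule right_module_homI)
    show "f' \<in> ahom N1 N2" unfolding f'_def
      by (intro ahom_comp[OF N2(2)] ahom_comp[OF right_module_homD(1)[OF f]] ahom_inv_into N1 M1.M.abelian_group_axioms)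
    fix u a assume u: "u \<in> carrier N1" "a \<in> carrier R"
    then obtain x where x: "u = e1 x" "x \<in> carrier M1" using N1(3) by (auto simp: bij_betw_def)
    then show "f' (s1 u a) = s2 (f' u) a"
      using u right_module_homD(2,3)[OF f] by (simp add: f'e M1.closed flip: N1(4) N2(4))
  qed
  have g': "g' \<in> right_module_hom R N2 s2 N3 s3"
  proof (rule right_module_homI)
    show "g' \<in> ahom N2 N3" unfolding g'_def
      by (intro ahom_comp[OF N3(2)] ahom_comp[OF right_module_homD(1)[OF g]] ahom_inv_into N2 M2.M.abelian_group_axioms)
    fix u a assume u: "u \<in> carrier N2" "a \<in> carrier R"
    then obtain x where x: "u = e2 x" "x \<in> carrier M2" using N2(3) by (auto simp: bij_betw_def)
    then show "g' (s2 u a) = s3 (g' u) a"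
      using u right_module_homD(2,3)[OF g] by (simp add: g'e M2.closed flip: N2(4) N3(4))
  qed
  have "exact M1 f M2 g M3 \<longleftrightarrow> exact N1 f' N2 g' N3"
    by (rule exact_iso[OF N1(3) N2(3) N3(3)])
      (use right_module_homD(3)[OF f] right_module_homD(3)[OF g] f'e g'e
        ahom_zero[OF N3(2) M3.M.abelian_group_axioms N3.M.abelian_group_axioms] in auto)
  also have "\<dots> \<longleftrightarrow> exact (TN N1 s1) (tensor_right_map R N2 s2 N la f')
          (TN N2 s2) (tensor_right_map R N3 s3 N la g') (TN N3 s3)"
    using FF N1(1) N2(1) N3(1) f' g' unfolding faithfully_flat_left_def by blast
  also have "\<dots> \<longleftrightarrow> exact (TN M1 r1) (tensor_right_map R M2 r2 N la f)
          (TN M2 r2) (tensor_right_map R M3 r3 N la g) (TN M3 r3)"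
  proof (rule sym, rule exact_iso[OF map_bij[OF M1 N1(1) E(1) N1(3)] map_bij[OF M2 N2(1) E(2) N2(3)] map_bij[OF M3 N3(1) E(3) N3(3)]])
    interpret T3: tensor_product R M3 r3 N la "TN M3 r3" by (rule TN[OF M3])
    show "tensor_right_map R N3 s3 N la e3 \<zero>\<^bsub>TN M3 r3\<^esub> = \<zero>\<^bsub>TN N3 s3\<^esub>"
      by (rule ahom_zero[OF map_hom[OF M3 N3(1) E(3)] TN_abelian_group[OF M3] TN_abelian_group[OF N3(1)]])
    show "\<zero>\<^bsub>TN M3 r3\<^esub> \<in> carrier (TN M3 r3)" by simp
    fix X assume X: "X \<in> carrier (TN M1 r1)"
    show "tensor_right_map R M2 r2 N la f X \<in> carrier (TN M2 r2)" by (rule map_closed[OF M1 M2 f X])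
    have h: "(\<lambda>x. e2 (f x)) \<in> right_module_hom R M1 r1 N2 s2"
      using right_module_homD[OF f] N2 by (auto intro!: right_module_homI ahom_comp[OF N2(2)])
    show "tensor_right_map R N2 s2 N la f' (tensor_right_map R N1 s1 N la e1 X) =
         tensor_right_map R N2 s2 N la e2 (tensor_right_map R M2 r2 N la f X)"
      using map_comp[OF M1 N1(1) N2(1) E(1) f' h f'e X] map_comp[OF M1 M2 N2(1) f E(2) h refl X] by simp
  next
    fix X assume X: "X \<in> carrier (TN M2 r2)"
    show "tensor_right_map R M3 r3 N la g X \<in> carrier (TN M3 r3)" by (rule map_closed[OF M2 M3 g X])
    have h: "(\<lambda>x. e3 (g x)) \<in> right_module_hom R M2 r2 N3 s3"
      using right_module_homD[OF g] N3 by (auto intro!: right_module_homI ahom_comp[OF N3(2)])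
    show "tensor_right_map R N3 s3 N la g' (tensor_right_map R N2 s2 N la e2 X) =
         tensor_right_map R N3 s3 N la e3 (tensor_right_map R M3 r3 N la g X)"
      using map_comp[OF M2 N2(1) N3(1) E(2) g' h g'e X] map_comp[OF M2 M3 N3(1) g E(3) h refl X] by simp
  qed
  finally show ?thesis .
qed

lemma zero_right_module:
  assumes "right_module R M ra" shows "right_module R (M\<lparr>carrier := {\<zero>\<^bsub>M\<^esub>}\<rparr>) ra"
proof -
  interpret right_module R M ra by fact
  have "ra \<zero>\<^bsub>M\<^esub> a = \<zero>\<^bsub>M\<^esub>" if "a \<in> carrier R" for a
    using ahom_zero[OF right_module_mult_hom[OF assms that] M.abelian_group_axioms M.abelian_group_axioms] .
  then show ?thesis by (intro submodule_right_module[OF assms]) auto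
qed

lemma kernel_right_module:
  assumes M: "right_module R M ra" and M': "right_module R M' ra'" and g: "g \<in> right_module_hom R M ra M' ra'"
  shows "right_module R (M\<lparr>carrier := a_kernel M M' g\<rparr>) ra"
proof -
  interpret M: right_module R M ra by fact
  interpret M': right_module R M' ra' by fact
  note ag = M.M.abelian_group_axioms M'.M.abelian_group_axioms
  have z: "ra' \<zero>\<^bsub>M'\<^esub> a = \<zero>\<^bsub>M'\<^esub>" if "a \<in> carrier R" for a
    using ahom_zero[OF right_module_mult_hom[OF M' that] ag(2,2)] .
  show ?thesis
    by (rule submodule_right_module[OF M])
      (auto simp: a_kernel_def kernel_def M.closed z right_module_homD(2)[OF g]
        ahom_zero[OF right_module_homD(1)[OF g] ag] ahom_uminus[OF right_module_homD(1)[OF g] ag]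
        ahom_add[OF right_module_homD(1)[OF g]])
qed

lemma inclusion_right_module_hom:
  "S \<subseteq> carrier M \<Longrightarrow> (\<lambda>x. x) \<in> right_module_hom R (M\<lparr>carrier := S\<rparr>) ra M ra"
  by (auto simp: right_module_hom_def hom_def)

section \<open>Injectivity, kernels and images under a faithfully flat tensor functor\<close>

context
  fixes R :: "('r, 'c) ring_scheme" and N :: "('n, 'd) ring_scheme" and la and u :: "'u itself"
  assumes FF: "faithfully_flat_left TYPE('u) R N la"
begin

interpretation tensor_functor R N la
  using FF by (simp add: tensor_functor_def faithfully_flat_left_def)

interpretation N: left_module R N la
  using FF by (simp add: faithfully_flat_left_def)

lemma TN_zero_module:
  assumes M: "right_module R M ra" and X: "X \<in> carrier (TN (M\<lparr>carrier := {\<zero>\<^bsub>M\<^esub>}\<rparr>) ra)"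
  shows "X = \<zero>\<^bsub>TN (M\<lparr>carrier := {\<zero>\<^bsub>M\<^esub>}\<rparr>) ra\<^esub>"
proof -
  let ?Z = "M\<lparr>carrier := {\<zero>\<^bsub>M\<^esub>}\<rparr>"
  interpret M: right_module R M ra by fact
  have Z: "right_module R ?Z ra" by (rule zero_right_module[OF M])
  interpret Z: right_module R ?Z ra by (rule Z)
  interpret T: tensor_product R ?Z ra N la "TN ?Z ra" by (rule TN[OF Z])
  show ?thesis
    using X
  proof (induction rule: T.tensor_induct)
    case (pure x y)
    have "\<zero>\<^bsub>?Z\<^esub> \<boxtimes>\<^bsub>TN ?Z ra\<^esub> y = \<zero>\<^bsub>TN ?Z ra\<^esub>"
      using ahom_zero[OF T.pure_hom_left[OF pure(2)] Z.M.abelian_group_axioms T.T.abelian_group_axioms] .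
    then show ?case using pure by simp
  next
    case (minus X Y) then show ?case by (simp add: T.T.minus_eq T.T.r_neg)
  qed
qed

text \<open>\<open>Z\<close> is any source mapped to zero, because the criterion is applied both to
  the zero submodule and to its tensor product with \<open>N\<close>, which is zero but has another
  carrier type.\<close>

lemma inj_iff_exact:
  assumes "f \<in> ahom M M'" "abelian_group M" "abelian_group M'" "h \<in> carrier Z \<rightarrow> {\<zero>\<^bsub>M\<^esub>}" "carrier Z \<noteq> {}"
  shows "inj_on f (carrier M) \<longleftrightarrow> exact Z h M f M'"
proof -
  interpret M: abelian_group M by fact
  have z: "f \<zero>\<^bsub>M\<^esub> = \<zero>\<^bsub>M'\<^esub>" by (rule ahom_zero[OF assms(1-3)])
  have im: "h ` carrier Z = {\<zero>\<^bsub>M\<^esub>}"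
    using subset_singletonD[of "h ` carrier Z"] assms(4,5) by (simp add: image_subset_iff_funcset)
  show ?thesis
  proof
    assume "inj_on f (carrier M)"
    then show "exact Z h M f M'"
      unfolding exact_def im a_kernel_def kernel_def using z by (auto dest: inj_onD[of f _ _ "\<zero>\<^bsub>M\<^esub>"])
  next
    assume "exact Z h M f M'"
    then show "inj_on f (carrier M)"
      unfolding exact_def im a_kernel_def kernel_def by (intro ahom_inj[OF assms(1-3)]) auto
  qed
qed

text \<open>Injectivity is exactness of \<open>0 \<rightarrow> M \<rightarrow> M'\<close>. One
  direction later embeds \<open>L \<otimes>\<^sub>B P\<close> in
  \<open>PP \<otimes>\<^sub>B P\<close>, the other brings injectivity of the embeddings down from
  their tensored versions.\<close>

lemma faithfully_flat_inj:
  assumes M: "right_module R M ra" and M': "right_module R M' ra'"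
    and emb: "embeds TYPE('u) (carrier M)" "embeds TYPE('u) (carrier M')"
    and f: "f \<in> right_module_hom R M ra M' ra'"
  shows "inj_on f (carrier M) \<longleftrightarrow> inj_on (tensor_right_map R M' ra' N la f) (carrier (TN M ra))"
proof -
  let ?Z = "M\<lparr>carrier := {\<zero>\<^bsub>M\<^esub>}\<rparr>"
  interpret M: right_module R M ra by fact
  interpret M': right_module R M' ra' by fact
  have Z: "right_module R ?Z ra" by (rule zero_right_module[OF M])
  interpret TZ: tensor_product R ?Z ra N la "TN ?Z ra" by (rule TN[OF Z])
  interpret TM: tensor_product R M ra N la "TN M ra" by (rule TN[OF M])
  have i: "(\<lambda>x. x) \<in> right_module_hom R ?Z ra M ra" by (rule inclusion_right_module_hom) simp
  have "inj_on f (carrier M) \<longleftrightarrow> exact ?Z (\<lambda>x. x) M f M'"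
    by (rule inj_iff_exact[OF right_module_homD(1)[OF f] M.M.abelian_group_axioms M'.M.abelian_group_axioms]) auto
  also have "\<dots> \<longleftrightarrow> exact (TN ?Z ra) (tensor_right_map R M ra N la (\<lambda>x. x))
        (TN M ra) (tensor_right_map R M' ra' N la f) (TN M' ra')"
    by (rule faithfully_flat_exact[OF FF Z M M' _ emb i f]) (rule embeds_subset[OF emb(1)], simp)
  also have "\<dots> \<longleftrightarrow> inj_on (tensor_right_map R M' ra' N la f) (carrier (TN M ra))"
  proof (rule sym, rule inj_iff_exact[OF map_hom[OF M M' f] TN_abelian_group[OF M] TN_abelian_group[OF M']])
    have z: "tensor_right_map R M ra N la (\<lambda>x. x) \<zero>\<^bsub>TN ?Z ra\<^esub> = \<zero>\<^bsub>TN M ra\<^esub>"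
      by (rule ahom_zero[OF map_hom[OF Z M i] TN_abelian_group[OF Z] TN_abelian_group[OF M]])
    show "tensor_right_map R M ra N la (\<lambda>x. x) \<in> carrier (TN ?Z ra) \<rightarrow> {\<zero>\<^bsub>TN M ra\<^esub>}"
      using TN_zero_module[OF M] z by (metis Pi_I singletonI)
    show "carrier (TN ?Z ra) \<noteq> {}" using TZ.T.zero_closed by blast
  qed
  finally show ?thesis .
qed

text \<open>The inclusion of the kernel followed by \<open>g\<close> is exact by definition, and
  stays exact after tensoring.\<close>

lemma faithfully_flat_kernel:
  assumes M: "right_module R M ra" and M': "right_module R M' ra'"
    and emb: "embeds TYPE('u) (carrier M)" "embeds TYPE('u) (carrier M')"
    and g: "g \<in> right_module_hom R M ra M' ra'"
    and y: "y \<in> carrier (TN M ra)" "tensor_right_map R M' ra' N la g y = \<zero>\<^bsub>TN M' ra'\<^esub>"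
  shows "y \<in> tensor_right_map R M ra N la (\<lambda>x. x) ` carrier (TN (M\<lparr>carrier := a_kernel M M' g\<rparr>) ra)"
proof -
  let ?L = "M\<lparr>carrier := a_kernel M M' g\<rparr>"
  have sub: "a_kernel M M' g \<subseteq> carrier M" by (auto simp: a_kernel_def kernel_def)
  have i: "(\<lambda>x. x) \<in> right_module_hom R ?L ra M ra" by (rule inclusion_right_module_hom[OF sub])
  have "exact ?L (\<lambda>x. x) M g M'" by (simp add: exact_def)
  then have "exact (TN ?L ra) (tensor_right_map R M ra N la (\<lambda>x. x))
        (TN M ra) (tensor_right_map R M' ra' N la g) (TN M' ra')"
    by (subst (asm) faithfully_flat_exact[OF FF kernel_right_module[OF M M' g] M M' _ emb i g])
      (use embeds_subset[OF emb(1) sub] in simp)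
  then show ?thesis using y by (rule exactD)
qed

text \<open>
  Descent of membership in an image.  The elements \<open>w\<close> of \<open>M\<close> with \<open>w \<otimes> e \<in> Im(f \<otimes> N)\<close> form a
  submodule \<open>W \<supseteq> Im f\<close> for which \<open>L \<otimes> N \<rightarrow> W \<otimes> N\<close> is onto.
\<close>

lemma faithfully_flat_image:
  assumes L: "right_module R L rl" and M: "right_module R M ra"
    and emb: "embeds TYPE('u) (carrier L)" "embeds TYPE('u) (carrier M)"
    and f: "f \<in> right_module_hom R L rl M ra"
    and e: "e \<in> carrier N"
    and \<rho>: "\<And>z. z \<in> carrier N \<Longrightarrow> \<rho> z \<in> ahom N N" "\<And>z. z \<in> carrier N \<Longrightarrow> \<rho> z e = z"
      "\<And>z a y. \<lbrakk>z \<in> carrier N; a \<in> carrier R; y \<in> carrier N\<rbrakk> \<Longrightarrow> \<rho> z (la a y) = la a (\<rho> z y)"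
    and w: "w \<in> carrier M" "w \<boxtimes>\<^bsub>TN M ra\<^esub> e \<in> tensor_right_map R M ra N la f ` carrier (TN L rl)"
  shows "w \<in> f ` carrier L"
proof -
  interpret L: right_module R L rl by fact
  interpret M: right_module R M ra by fact
  interpret TL: tensor_product R L rl N la "TN L rl" by (rule TN[OF L])
  interpret TM: tensor_product R M ra N la "TN M ra" by (rule TN[OF M])
  let ?f = "tensor_right_map R M ra N la f"
  let ?I = "?f ` carrier (TN L rl)"
  note fh = map_hom[OF L M f] and fp = map_pure[OF L M f]
  have Iminus: "x \<ominus>\<^bsub>TN M ra\<^esub> y \<in> ?I" if "x \<in> ?I" "y \<in> ?I" for x y
  proof -
    obtain a b where "x = ?f a" "y = ?f b" "a \<in> carrier (TN L rl)" "b \<in> carrier (TN L rl)" using \<open>x \<in> ?I\<close> \<open>y \<in> ?I\<close> by blast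
    then show ?thesis
      using ahom_minus[OF fh TL.T.abelian_group_axioms TM.T.abelian_group_axioms, of a b] by (metis TL.T.minus_closed image_eqI)
  qed
  have I\<rho>: "tensor_lift (TN M ra) (\<lambda>x y. x \<boxtimes>\<^bsub>TN M ra\<^esub> \<rho> z y) X \<in> ?I" if "z \<in> carrier N" "X \<in> ?I" for z X
  proof -
    note bL = TL.balanced_right_action[of "\<rho> z", OF \<rho>(1)[OF that(1)] \<rho>(3)[OF that(1)]]
    note bM = TM.balanced_right_action[of "\<rho> z", OF \<rho>(1)[OF that(1)] \<rho>(3)[OF that(1)]]
    let ?rL = "tensor_lift (TN L rl) (\<lambda>x y. x \<boxtimes>\<^bsub>TN L rl\<^esub> \<rho> z y)"
    let ?rM = "tensor_lift (TN M ra) (\<lambda>x y. x \<boxtimes>\<^bsub>TN M ra\<^esub> \<rho> z y)"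
    obtain Y where Y: "X = ?f Y" "Y \<in> carrier (TN L rl)" using \<open>X \<in> ?I\<close> by blast
    have rL: "?rL \<in> ahom (TN L rl) (TN L rl)" by (rule TL.lift_hom[OF TL.T.abelian_group_axioms bL])
    have rM: "?rM \<in> ahom (TN M ra) (TN M ra)" by (rule TM.lift_hom[OF TM.T.abelian_group_axioms bM])
    have "?rM (?f Y) = ?f (?rL Y)"
    proof (rule TL.hom_ext[OF TM.T.abelian_group_axioms ahom_comp[OF rM fh] ahom_comp[OF fh rL] _ Y(2)])
      fix x y assume xy: "x \<in> carrier L" "y \<in> carrier N"
      then show "?rM (?f (x \<boxtimes>\<^bsub>TN L rl\<^esub> y)) = ?f (?rL (x \<boxtimes>\<^bsub>TN L rl\<^esub> y))"
        using right_module_homD(3)[OF f] ahom_closed[OF \<rho>(1)[OF that(1)]]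
        by (simp add: fp TM.lift_pure[OF TM.T.abelian_group_axioms bM] TL.lift_pure[OF TL.T.abelian_group_axioms bL])
    qed
    then show ?thesis unfolding Y(1) by (rule image_eqI) (rule ahom_closed[OF rL Y(2)])
  qed
  \<comment> \<open>The map \<open>id \<otimes> \<rho> z\<close> preserves the image and sends
    \<open>v \<otimes> e\<close> to \<open>v \<otimes> z\<close>, so the single test element
    \<open>e\<close> controls all tensors \<open>v \<otimes> z\<close>.\<close>
  have mult: "v \<boxtimes>\<^bsub>TN M ra\<^esub> z \<in> ?I" if "v \<in> carrier M" "z \<in> carrier N" "v \<boxtimes>\<^bsub>TN M ra\<^esub> e \<in> ?I" for v z
    using I\<rho>[OF that(2,3)] that e \<rho>(2)
    by (simp add: TM.lift_pure[OF TM.T.abelian_group_axioms TM.balanced_right_action[of "\<rho> z", OF \<rho>(1)[OF that(2)] \<rho>(3)[OF that(2)]]])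
  define S where "S = {v \<in> carrier M. v \<boxtimes>\<^bsub>TN M ra\<^esub> e \<in> ?I}"
  let ?W = "M\<lparr>carrier := S\<rparr>"
  have SM: "S \<subseteq> carrier M" by (auto simp: S_def)
  have Sminus: "x \<ominus>\<^bsub>M\<^esub> y \<in> S" if "x \<in> S" "y \<in> S" for x y
    using that Iminus ahom_minus[OF TM.pure_hom_left[OF e] M.M.abelian_group_axioms TM.T.abelian_group_axioms, of x y]
    by (auto simp: S_def)
  have fS: "f n \<in> S" if "n \<in> carrier L" for n
    using that right_module_homD(3)[OF f that] fp[OF that e] by (auto simp: S_def intro!: image_eqI[of _ _ "n \<boxtimes>\<^bsub>TN L rl\<^esub> e"] TL.pure_closed e)
  have Sz: "\<zero>\<^bsub>M\<^esub> \<in> S"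
    using fS[OF L.M.zero_closed] ahom_zero[OF right_module_homD(1)[OF f] L.M.abelian_group_axioms M.M.abelian_group_axioms] by simp
  have Sneg: "\<ominus>\<^bsub>M\<^esub> x \<in> S" if "x \<in> S" for x
    using Sminus[OF Sz that] that SM by (auto simp: M.M.minus_eq)
  have Sadd: "x \<oplus>\<^bsub>M\<^esub> y \<in> S" if "x \<in> S" "y \<in> S" for x y
    using Sminus[OF that(1) Sneg[OF that(2)]] that SM by (auto simp: M.M.minus_eq)
  have W: "right_module R ?W ra"
  proof (rule submodule_right_module[OF M SM Sz Sadd Sneg])
    fix x a assume "x \<in> S" "a \<in> carrier R"
    then show "ra x a \<in> S"
      \<comment> \<open>Balancing gives \<open>xa \<otimes> e = x \<otimes> ae\<close>, which is in
        the image by \<open>mult\<close>.\<close>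
      using mult[of x "la a e"] e by (auto simp: S_def M.closed N.closed TM.pure_balance)
  qed
  have Z: "right_module R (M\<lparr>carrier := {\<zero>\<^bsub>M\<^esub>}\<rparr>) ra" by (rule zero_right_module[OF M])
  let ?Z = "M\<lparr>carrier := {\<zero>\<^bsub>M\<^esub>}\<rparr>"
  interpret TW: tensor_product R ?W ra N la "TN ?W ra" by (rule TN[OF W])
  interpret TZ: tensor_product R ?Z ra N la "TN ?Z ra" by (rule TN[OF Z])
  have embW: "embeds TYPE('u) (carrier ?W)" "embeds TYPE('u) (carrier ?Z)"
    using embeds_subset[OF emb(2)] SM by simp_all
  have i: "(\<lambda>x. x) \<in> right_module_hom R ?W ra M ra" by (rule inclusion_right_module_hom[OF SM])
  have fW: "f \<in> right_module_hom R L rl ?W ra"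
    using f fS by (auto simp: right_module_hom_def hom_def)
  have zero: "(\<lambda>x. \<zero>\<^bsub>M\<^esub>) \<in> right_module_hom R ?W ra ?Z ra"
    using TZ.M.closed by (auto simp: right_module_hom_def hom_def)
  let ?i = "tensor_right_map R M ra N la (\<lambda>x. x)"
  let ?g = "tensor_right_map R ?W ra N la f"
  have inj: "inj_on ?i (carrier (TN ?W ra))"
    using faithfully_flat_inj[OF W M embW(1) emb(2) i] by simp
  \<comment> \<open>Seen in \<open>M \<otimes> N\<close>, the image of \<open>W \<otimes> N\<close>
    is no larger than that of \<open>L \<otimes> N\<close>.\<close>
  have iI: "?i X \<in> ?I" if "X \<in> carrier (TN ?W ra)" for X
    using that
  proof (induction rule: TW.tensor_induct)
    case (pure x y)
    have "x \<boxtimes>\<^bsub>TN M ra\<^esub> y \<in> ?I"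
      by (rule mult) (use pure in \<open>simp_all add: S_def\<close>)
    then show ?case by (subst map_pure[OF W M i pure])
  next
    case (minus X Y)
    then show ?case
      by (subst ahom_minus[OF map_hom[OF W M i] TW.T.abelian_group_axioms TM.T.abelian_group_axioms minus(1,2)])
        (rule Iminus)
  qed
  \<comment> \<open>Surjectivity of \<open>L \<otimes> N \<rightarrow> W \<otimes> N\<close>,
    written as exactness before a zero module. Faithfulness then makes
    \<open>L \<rightarrow> W\<close> onto, and \<open>w\<close> lies in \<open>W\<close> by
    hypothesis.\<close>
  have "exact (TN L rl) ?g (TN ?W ra) (tensor_right_map R ?Z ra N la (\<lambda>x. \<zero>\<^bsub>M\<^esub>)) (TN ?Z ra)"
  proof (rule exactI)
    fix X assume X: "X \<in> carrier (TN L rl)"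
    show "?g X \<in> carrier (TN ?W ra) \<and> tensor_right_map R ?Z ra N la (\<lambda>x. \<zero>\<^bsub>M\<^esub>) (?g X) = \<zero>\<^bsub>TN ?Z ra\<^esub>"
      using map_closed[OF L W fW X] TN_zero_module[OF M map_closed[OF W Z zero map_closed[OF L W fW X]]] by blast
  next
    fix Y assume Y: "Y \<in> carrier (TN ?W ra)"
    obtain X where X: "X \<in> carrier (TN L rl)" "?i Y = ?f X" using iI[OF Y] by blast
    then have "?i Y = ?i (?g X)"
      using map_comp[OF L W M fW i f refl X(1)] by simp
    then have "Y = ?g X" using inj Y map_closed[OF L W fW X(1)] by (auto dest: inj_onD)
    then show "Y \<in> ?g ` carrier (TN L rl)" using X(1) by blast
  qed
  then have "exact L f ?W (\<lambda>x. \<zero>\<^bsub>M\<^esub>) ?Z"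
    using faithfully_flat_exact[OF FF L W Z emb(1) embW fW zero] by simp
  moreover have "w \<in> carrier ?W" using w by (simp add: S_def)
  ultimately show ?thesis by (auto intro: exactD)
qed

end

section \<open>Comodule algebras and the Galois condition\<close>

lemma algebra_pairI: "algebra_over_field K A \<Longrightarrow> algebra_over_field K B \<Longrightarrow> algebra_pair K A B"
  by (simp add: algebra_pair_def)

lemma coinvariants_simps [simp]:
  "ring.add (coinvariants K H P \<delta>) = ring.add P" "\<zero>\<^bsub>coinvariants K H P \<delta>\<^esub> = \<zero>\<^bsub>P\<^esub>"
  "monoid.mult (coinvariants K H P \<delta>) = monoid.mult P" "\<one>\<^bsub>coinvariants K H P \<delta>\<^esub> = \<one>\<^bsub>P\<^esub>"
  "smult (coinvariants K H P \<delta>) = smult P"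
  by (simp_all add: coinvariants_def)

context comodule_algebra
begin

abbreviation B where "B \<equiv> coinvariants K H P \<delta>"

sublocale H': algebra_over_field K H by unfold_locales

sublocale PH: algebra_pair K P H by (intro algebra_pairI) unfold_locales

abbreviation PH where "PH \<equiv> tensor_algebra K P H"

lemma \<delta>_ring_hom: "\<delta> \<in> ring_hom P PH"
  using coaction_hom by (simp add: algebra_hom_def)

lemma \<delta>_closed [simp]: "p \<in> carrier P \<Longrightarrow> \<delta> p \<in> carrier PH"
  using ring_hom_closed[OF \<delta>_ring_hom] .

lemma \<delta>_hom: "\<delta> \<in> ahom P PH"
  using \<delta>_ring_hom by (intro ahomI) (auto simp: ring_hom_def)

lemma \<delta>_mult: "p \<in> carrier P \<Longrightarrow> q \<in> carrier P \<Longrightarrow> \<delta> (p \<otimes>\<^bsub>P\<^esub> q) = \<delta> p \<otimes>\<^bsub>PH\<^esub> \<delta> q"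
  by (rule ring_hom_mult[OF \<delta>_ring_hom])

lemma \<delta>_one: "\<delta> \<one>\<^bsub>P\<^esub> = \<one>\<^bsub>P\<^esub> \<boxtimes>\<^bsub>PH\<^esub> \<one>\<^bsub>H\<^esub>"
  using ring_hom_one[OF \<delta>_ring_hom] by (simp add: PH.one_eq)

lemma \<delta>_smult: "k \<in> carrier K \<Longrightarrow> p \<in> carrier P \<Longrightarrow> \<delta> (k \<odot>\<^bsub>P\<^esub> p) = k \<odot>\<^bsub>PH\<^esub> \<delta> p"
  using coaction_hom by (simp add: algebra_hom_def)

lemma B_iff: "b \<in> carrier B \<longleftrightarrow> b \<in> carrier P \<and> \<delta> b = b \<boxtimes>\<^bsub>PH\<^esub> \<one>\<^bsub>H\<^esub>"
  by (simp add: coinvariants_def)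

lemma B_closed: "b \<in> carrier B \<Longrightarrow> b \<in> carrier P"
  by (simp add: B_iff)

lemma B_algebra: "algebra_over_field K B"
proof -
  have "algebra_over_field K (P\<lparr>carrier := carrier B\<rparr>)"
    by (rule subalgebra_algebra[OF P.algebra_over_field_axioms])
      (auto simp: B_iff \<delta>_one \<delta>_mult \<delta>_smult ahom_add[OF \<delta>_hom] ahom_add[OF PH.pure_hom_left] PH.smult_pure)
  moreover have "P\<lparr>carrier := carrier B\<rparr> = B" by (simp add: coinvariants_def)
  ultimately show ?thesis by metis
qed

sublocale B: algebra_over_field K B by (rule B_algebra)

lemma right_module_restrict:
  assumes "right_module P M act" shows "right_module B M act"
proof -
  interpret right_module P M act by fact
  show ?thesis
    by (rule right_module.intro[OF B.A.ring_axioms M.abelian_group_axioms])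
      (auto simp: B_closed right_module_axioms_def closed distrib distrib_scalar assoc unit)
qed

lemma P_right_module: "right_module P P (\<lambda>p q. p \<otimes>\<^bsub>P\<^esub> q)"
  by (rule right_module.intro[OF P.A.ring_axioms P.abelian_group_axioms])
    (auto simp: right_module_axioms_def P.A.m_assoc P.A.l_distr P.A.r_distr)

lemma P_left_module: "left_module P P (\<lambda>p q. p \<otimes>\<^bsub>P\<^esub> q)"
  by (rule left_module.intro[OF P.A.ring_axioms P.abelian_group_axioms])
    (auto simp: B_closed left_module_axioms_def P.A.m_assoc P.A.l_distr P.A.r_distr)

lemma P_left_B_module: "left_module B P (\<lambda>b p. b \<otimes>\<^bsub>P\<^esub> p)"
  by (rule left_module.intro[OF B.A.ring_axioms P.abelian_group_axioms])
    (auto simp: B_closed left_module_axioms_def P.A.m_assoc P.A.l_distr P.A.r_distr)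

end

text \<open>
  For a right \<open>P\<close>-module \<open>M\<close>, the map \<open>M \<otimes>\<^sub>B P \<rightarrow> M \<otimes> H\<close>, \<open>m \<otimes> y \<mapsto> m y\<^sub>0 \<otimes> y\<^sub>1\<close>, generalises the
  canonical map.
\<close>

locale comodule_algebra_module = comodule_algebra K H \<Delta> \<epsilon> S P \<delta> + M: algebra_over_field K M + Mact: right_module P M act
  for K (structure) and H (structure) and \<Delta> \<epsilon> S and P :: "('k, 'p, 'e) module_scheme" (structure) and \<delta>
    and M :: "('k, 'm, 'f) module_scheme" (structure) and act :: "'m \<Rightarrow> 'p \<Rightarrow> 'm" +
  assumes act_scalar: "\<And>m k. m \<in> carrier M \<Longrightarrow> k \<in> carrier K \<Longrightarrow> act m (k \<odot>\<^bsub>P\<^esub> \<one>\<^bsub>P\<^esub>) = k \<odot>\<^bsub>M\<^esub> m"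
begin

sublocale MH: algebra_pair K M H by (intro algebra_pairI) unfold_locales

abbreviation MH where "MH \<equiv> tensor_algebra K M H"

abbreviation MP where "MP \<equiv> tensor B M act P (\<lambda>b p. b \<otimes>\<^bsub>P\<^esub> p)"

sublocale MP: tensor_product B M act P "\<lambda>b p. b \<otimes>\<^bsub>P\<^esub> p" MP
  by (rule tensor_productI[OF right_module_restrict[OF Mact.right_module_axioms] P_left_B_module])

lemma act_smult: "m \<in> carrier M \<Longrightarrow> k \<in> carrier K \<Longrightarrow> p \<in> carrier P \<Longrightarrow> act m (k \<odot>\<^bsub>P\<^esub> p) = k \<odot>\<^bsub>M\<^esub> act m p"
  using Mact.assoc[of "k \<odot>\<^bsub>P\<^esub> \<one>\<^bsub>P\<^esub>" p m] Mact.assoc[of p "k \<odot>\<^bsub>P\<^esub> \<one>\<^bsub>P\<^esub>" m] act_scalar[of "act m p" k]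
  by (simp add: P.smult_mult_left P.smult_mult_right Mact.closed)

lemma act_smult': "m \<in> carrier M \<Longrightarrow> k \<in> carrier K \<Longrightarrow> p \<in> carrier P \<Longrightarrow> act (k \<odot>\<^bsub>M\<^esub> m) p = k \<odot>\<^bsub>M\<^esub> act m p"
  using Mact.assoc[of "k \<odot>\<^bsub>P\<^esub> \<one>\<^bsub>P\<^esub>" p m] act_smult[of m k p]
  by (simp add: P.smult_mult_left act_scalar)

text \<open>Makes \<open>m y_0 \<otimes> y_1\<close> available as \<open>c m (\<delta> y)\<close>,
  with the coaction left unexpanded. Identities in the algebra \<open>P \<otimes> H\<close> then
  replace manipulations of Sweedler sums.\<close>

definition c where "c m = tensor_lift MH (\<lambda>p h. act m p \<boxtimes>\<^bsub>MH\<^esub> h)"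

lemma c_balanced:
  assumes "m \<in> carrier M"
  shows "balanced K P (\<lambda>x a. a \<odot>\<^bsub>P\<^esub> x) H (\<lambda>a y. a \<odot>\<^bsub>H\<^esub> y) MH (\<lambda>p h. act m p \<boxtimes>\<^bsub>MH\<^esub> h)"
proof (rule balancedI)
  show "(\<lambda>h. act m p \<boxtimes>\<^bsub>MH\<^esub> h) \<in> ahom H MH" if "p \<in> carrier P" for p
    by (rule MH.pure_hom_right) (simp add: Mact.closed that assms)
  show "(\<lambda>p. act m p \<boxtimes>\<^bsub>MH\<^esub> h) \<in> ahom P MH" if "h \<in> carrier H" for h
    by (rule MH.pure_left_comp[OF that right_module_scalar_hom[OF Mact.right_module_axioms assms]])
qed (simp add: act_smult assms MH.smult_balance Mact.closed)

lemma c_hom: "m \<in> carrier M \<Longrightarrow> c m \<in> ahom PH MH"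
  unfolding c_def by (rule PH.lift_hom[OF MH.T.abelian_group_axioms c_balanced])

lemma c_closed [simp]: "m \<in> carrier M \<Longrightarrow> X \<in> carrier PH \<Longrightarrow> c m X \<in> carrier MH"
  using c_hom by (rule ahom_closed)

lemma c_pure [simp]: "m \<in> carrier M \<Longrightarrow> p \<in> carrier P \<Longrightarrow> h \<in> carrier H \<Longrightarrow> c m (p \<boxtimes>\<^bsub>PH\<^esub> h) = act m p \<boxtimes>\<^bsub>MH\<^esub> h"
  unfolding c_def by (rule PH.lift_pure[OF MH.T.abelian_group_axioms c_balanced])

lemma c_param_hom: "X \<in> carrier PH \<Longrightarrow> (\<lambda>m. c m X) \<in> ahom M MH"
  unfolding c_def
  by (rule PH.lift_param_hom[OF MH.T.abelian_group_axioms])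
    (auto intro: MH.pure_left_comp right_module_mult_hom[OF Mact.right_module_axioms])

lemma c_act:
  assumes "m \<in> carrier M" "p \<in> carrier P" "X \<in> carrier PH"
  shows "c m ((p \<boxtimes>\<^bsub>PH\<^esub> \<one>\<^bsub>H\<^esub>) \<otimes>\<^bsub>PH\<^esub> X) = c (act m p) X"
  by (rule PH.hom_ext[OF MH.T.abelian_group_axioms ahom_comp[OF c_hom PH.mult_left_hom] c_hom _ assms(3)])
    (use assms in \<open>simp_all add: Mact.closed Mact.assoc\<close>)

definition C where "C = tensor_lift MH (\<lambda>m y. c m (\<delta> y))"

lemma C_balanced: "balanced B M act P (\<lambda>b p. b \<otimes>\<^bsub>P\<^esub> p) MH (\<lambda>m y. c m (\<delta> y))"
proof (rule balancedI)
  show "(\<lambda>y. c m (\<delta> y)) \<in> ahom P MH" if "m \<in> carrier M" for m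
    by (rule ahom_comp[OF c_hom[OF that] \<delta>_hom])
  show "(\<lambda>m. c m (\<delta> y)) \<in> ahom M MH" if "y \<in> carrier P" for y
    using that by (intro c_param_hom) simp
  show "c (act m b) (\<delta> y) = c m (\<delta> (b \<otimes>\<^bsub>P\<^esub> y))" if "m \<in> carrier M" "b \<in> carrier B" "y \<in> carrier P" for m b y
    using that B_closed[OF that(2)] c_act[OF that(1) B_closed[OF that(2)] \<delta>_closed[OF that(3)]]
    by (simp add: \<delta>_mult B_iff)
qed

lemma C_hom: "C \<in> ahom MP MH"
  unfolding C_def by (rule MP.lift_hom[OF MH.T.abelian_group_axioms C_balanced])

lemma C_closed [simp]: "X \<in> carrier MP \<Longrightarrow> C X \<in> carrier MH"
  using C_hom by (rule ahom_closed)

lemma C_pure: "m \<in> carrier M \<Longrightarrow> y \<in> carrier P \<Longrightarrow> C (m \<boxtimes>\<^bsub>MP\<^esub> y) = c m (\<delta> y)"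
  unfolding C_def by (rule MP.lift_pure[OF MH.T.abelian_group_axioms C_balanced])

end

text \<open>With coefficients in \<open>P\<close> itself the map \<open>C\<close> is the canonical
  map.\<close>

sublocale comodule_algebra \<subseteq> Pm: comodule_algebra_module K H \<Delta> \<epsilon> S P \<delta> P "\<lambda>p q. p \<otimes>\<^bsub>P\<^esub> q"
proof -
  interpret r: right_module P P "\<lambda>p q. p \<otimes>\<^bsub>P\<^esub> q" by (rule P_right_module)
  show "comodule_algebra_module K H \<Delta> \<epsilon> S P \<delta> P (\<lambda>p q. p \<otimes>\<^bsub>P\<^esub> q)"
    by unfold_locales (simp add: P.smult_mult_right)
qed

context comodule_algebra
begin

lemma \<epsilon>_closed [simp]: "h \<in> carrier H \<Longrightarrow> \<epsilon> h \<in> carrier K"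
  using ring_hom_closed[OF counit_hom] .

lemma \<epsilon>_hom: "\<epsilon> \<in> ahom H K"
  using counit_hom by (intro ahomI) (auto simp: ring_hom_def)

lemma \<epsilon>_mult: "g \<in> carrier H \<Longrightarrow> h \<in> carrier H \<Longrightarrow> \<epsilon> (g \<otimes>\<^bsub>H\<^esub> h) = \<epsilon> g \<otimes>\<^bsub>K\<^esub> \<epsilon> h"
  by (rule ring_hom_mult[OF counit_hom])

end

section \<open>The action of \<open>P\<close> on \<open>M \<otimes> H\<close>\<close>

context comodule_algebra_module
begin

lemma c_smult:
  assumes "m \<in> carrier M" "k \<in> carrier K" "X \<in> carrier PH"
  shows "c (k \<odot>\<^bsub>M\<^esub> m) X = c m (k \<odot>\<^bsub>PH\<^esub> X)"
  by (rule PH.hom_ext[OF MH.T.abelian_group_axioms c_hom ahom_comp[OF c_hom PH.smult_hom] _ assms(3)])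
    (use assms in \<open>simp_all add: PH.smult_pure act_smult act_smult'\<close>)

text \<open>This is the right action \<open>(m \<otimes> h) x = m x_0 \<otimes> h x_1\<close>. The
  value of \<open>C\<close> at \<open>m \<otimes> y\<close> is \<open>m \<otimes> 1\<close> acted on
  by \<open>y\<close>, so \<open>C\<close> becomes a \<open>P\<close>-linear map.\<close>

definition \<theta> where "\<theta> x = tensor_lift MH (\<lambda>m h. c m ((\<one>\<^bsub>P\<^esub> \<boxtimes>\<^bsub>PH\<^esub> h) \<otimes>\<^bsub>PH\<^esub> \<delta> x))"

lemma \<theta>_balanced:
  assumes "x \<in> carrier P"
  shows "balanced K M (\<lambda>m a. a \<odot>\<^bsub>M\<^esub> m) H (\<lambda>a h. a \<odot>\<^bsub>H\<^esub> h) MH (\<lambda>m h. c m ((\<one>\<^bsub>P\<^esub> \<boxtimes>\<^bsub>PH\<^esub> h) \<otimes>\<^bsub>PH\<^esub> \<delta> x))"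
proof (rule balancedI)
  show "(\<lambda>h. c m ((\<one>\<^bsub>P\<^esub> \<boxtimes>\<^bsub>PH\<^esub> h) \<otimes>\<^bsub>PH\<^esub> \<delta> x)) \<in> ahom H MH" if "m \<in> carrier M" for m
    by (rule ahom_comp[OF c_hom[OF that]], rule ring_mult_right_hom[OF PH.AB.A.ring_axioms])
      (use assms in \<open>auto intro: PH.pure_hom_right\<close>)
  show "(\<lambda>m. c m ((\<one>\<^bsub>P\<^esub> \<boxtimes>\<^bsub>PH\<^esub> h) \<otimes>\<^bsub>PH\<^esub> \<delta> x)) \<in> ahom M MH" if "h \<in> carrier H" for h
    by (rule c_param_hom) (use assms that in auto)
  show "c (a \<odot>\<^bsub>M\<^esub> m) ((\<one>\<^bsub>P\<^esub> \<boxtimes>\<^bsub>PH\<^esub> h) \<otimes>\<^bsub>PH\<^esub> \<delta> x) = c m ((\<one>\<^bsub>P\<^esub> \<boxtimes>\<^bsub>PH\<^esub> (a \<odot>\<^bsub>H\<^esub> h)) \<otimes>\<^bsub>PH\<^esub> \<delta> x)"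
    if "m \<in> carrier M" "a \<in> carrier K" "h \<in> carrier H" for m a h
    using that assms by (simp add: c_smult PH.AB.smult_mult_left[symmetric] PH.smult_pure PH.smult_balance)
qed

lemma \<theta>_hom: "x \<in> carrier P \<Longrightarrow> \<theta> x \<in> ahom MH MH"
  unfolding \<theta>_def by (rule MH.lift_hom[OF MH.T.abelian_group_axioms \<theta>_balanced])

lemma \<theta>_closed [simp]: "x \<in> carrier P \<Longrightarrow> Z \<in> carrier MH \<Longrightarrow> \<theta> x Z \<in> carrier MH"
  using \<theta>_hom by (rule ahom_closed)

lemma \<theta>_pure: "x \<in> carrier P \<Longrightarrow> m \<in> carrier M \<Longrightarrow> h \<in> carrier H \<Longrightarrow>
    \<theta> x (m \<boxtimes>\<^bsub>MH\<^esub> h) = c m ((\<one>\<^bsub>P\<^esub> \<boxtimes>\<^bsub>PH\<^esub> h) \<otimes>\<^bsub>PH\<^esub> \<delta> x)"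
  unfolding \<theta>_def by (rule MH.lift_pure[OF MH.T.abelian_group_axioms \<theta>_balanced])

lemma \<theta>_param_hom: "Z \<in> carrier MH \<Longrightarrow> (\<lambda>x. \<theta> x Z) \<in> ahom P MH"
  unfolding \<theta>_def
  by (rule MH.lift_param_hom[OF MH.T.abelian_group_axioms])
    (auto intro!: ahom_comp[OF c_hom] ring_mult_left_hom[OF PH.AB.A.ring_axioms] \<delta>_hom)

text \<open>Under \<open>c m\<close> the action is right multiplication by \<open>\<delta> x\<close>
  in \<open>P \<otimes> H\<close>. The action law thereby reduces to associativity and to
  multiplicativity of \<delta>.\<close>

lemma \<theta>_c:
  assumes "x \<in> carrier P" "m \<in> carrier M" "X \<in> carrier PH"
  shows "\<theta> x (c m X) = c m (X \<otimes>\<^bsub>PH\<^esub> \<delta> x)"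
proof (rule PH.hom_ext[OF MH.T.abelian_group_axioms ahom_comp[OF \<theta>_hom c_hom] ahom_comp[OF c_hom PH.mult_right_hom] _ assms(3)])
  fix p h assume ph: "p \<in> carrier P" "h \<in> carrier H"
  have "(p \<boxtimes>\<^bsub>PH\<^esub> \<one>\<^bsub>H\<^esub>) \<otimes>\<^bsub>PH\<^esub> ((\<one>\<^bsub>P\<^esub> \<boxtimes>\<^bsub>PH\<^esub> h) \<otimes>\<^bsub>PH\<^esub> \<delta> x) = (p \<boxtimes>\<^bsub>PH\<^esub> h) \<otimes>\<^bsub>PH\<^esub> \<delta> x"
    using ph assms by (simp add: PH.AB.A.m_assoc[symmetric])
  then show "\<theta> x (c m (p \<boxtimes>\<^bsub>PH\<^esub> h)) = c m ((p \<boxtimes>\<^bsub>PH\<^esub> h) \<otimes>\<^bsub>PH\<^esub> \<delta> x)"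
    using ph assms by (simp add: \<theta>_pure Mact.closed c_act[symmetric])
qed (use assms in auto)

lemma C_pure_\<theta>: "m \<in> carrier M \<Longrightarrow> y \<in> carrier P \<Longrightarrow> C (m \<boxtimes>\<^bsub>MP\<^esub> y) = \<theta> y (m \<boxtimes>\<^bsub>MH\<^esub> \<one>\<^bsub>H\<^esub>)"
  by (simp add: C_pure \<theta>_pure PH.AB.A.l_one flip: PH.one_eq)

lemma \<theta>_one: assumes "Z \<in> carrier MH" shows "\<theta> \<one>\<^bsub>P\<^esub> Z = Z"
  by (rule MH.hom_ext[OF MH.T.abelian_group_axioms \<theta>_hom ahom_ident _ assms])
    (simp_all add: \<theta>_pure \<delta>_one Mact.unit)

lemma \<theta>_mult:
  assumes "x \<in> carrier P" "y \<in> carrier P" "Z \<in> carrier MH"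
  shows "\<theta> (x \<otimes>\<^bsub>P\<^esub> y) Z = \<theta> y (\<theta> x Z)"
  by (rule MH.hom_ext[OF MH.T.abelian_group_axioms \<theta>_hom ahom_comp[OF \<theta>_hom \<theta>_hom] _ assms(3)])
    (use assms in \<open>simp_all add: \<theta>_pure \<theta>_c \<delta>_mult PH.AB.A.m_assoc\<close>)

text \<open>A coinvariant acts through \<open>M\<close> alone; this is the source of the
  \<open>B\<close>-linearity of \<open>gap\<close>.\<close>

lemma \<theta>_coinvariant:
  assumes "b \<in> carrier B" "m \<in> carrier M" "h \<in> carrier H"
  shows "\<theta> b (m \<boxtimes>\<^bsub>MH\<^esub> h) = act m b \<boxtimes>\<^bsub>MH\<^esub> h"
  using assms B_closed[OF assms(1)] by (simp add: \<theta>_pure B_iff)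

lemma \<theta>_scalar:
  assumes "k \<in> carrier K" "Z \<in> carrier MH"
  shows "\<theta> (k \<odot>\<^bsub>P\<^esub> \<one>\<^bsub>P\<^esub>) Z = k \<odot>\<^bsub>MH\<^esub> Z"
  by (rule MH.hom_ext[OF MH.T.abelian_group_axioms \<theta>_hom MH.smult_hom _ assms(2)])
    (use assms in \<open>simp_all add: \<theta>_pure \<delta>_smult \<delta>_one PH.smult_pure MH.smult_pure act_scalar\<close>)

text \<open>Hence \<open>M \<otimes> H\<close> can serve as coefficients again, and the construction
  iterates to \<open>(M \<otimes> H) \<otimes> H\<close>.\<close>

lemma \<theta>_right_module: "right_module P MH (\<lambda>Z x. \<theta> x Z)"
  by (rule right_module.intro[OF P.A.ring_axioms MH.T.abelian_group_axioms])
    (auto simp: right_module_axioms_def ahom_add[OF \<theta>_param_hom] ahom_add[OF \<theta>_hom] \<theta>_mult \<theta>_one)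

lemma MP_comm: "a \<in> carrier B \<Longrightarrow> b \<in> carrier P \<Longrightarrow> y \<in> carrier P \<Longrightarrow> a \<otimes>\<^bsub>P\<^esub> y \<otimes>\<^bsub>P\<^esub> b = a \<otimes>\<^bsub>P\<^esub> (y \<otimes>\<^bsub>P\<^esub> b)"
  by (simp add: P.A.m_assoc B_closed)

definition mulP where "mulP = MP.right_act (\<lambda>p q. p \<otimes>\<^bsub>P\<^esub> q)"

lemmas mulP_pure = MP.right_act_pure[OF P_right_module MP_comm, folded mulP_def]
  and mulP_hom = MP.right_act_hom[OF P_right_module MP_comm, folded mulP_def]
  and mulP_right_module = MP.right_act_module[OF P_right_module MP_comm, folded mulP_def]

lemma C_mulP:
  assumes "Y \<in> carrier MP" "x \<in> carrier P"
  shows "C (mulP Y x) = \<theta> x (C Y)"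
  by (rule MP.hom_ext[OF MH.T.abelian_group_axioms ahom_comp[OF C_hom mulP_hom] ahom_comp[OF \<theta>_hom C_hom] _ assms(1)])
    (use assms in \<open>simp_all add: mulP_pure C_pure \<theta>_c \<delta>_mult\<close>)

text \<open>The map \<open>id \<otimes> \<epsilon>\<close>, which strips a coaction by
  counitality.\<close>

definition \<eta> where "\<eta> = tensor_lift M (\<lambda>m h. \<epsilon> h \<odot>\<^bsub>M\<^esub> m)"

lemma \<eta>_balanced: "balanced K M (\<lambda>m a. a \<odot>\<^bsub>M\<^esub> m) H (\<lambda>a h. a \<odot>\<^bsub>H\<^esub> h) M (\<lambda>m h. \<epsilon> h \<odot>\<^bsub>M\<^esub> m)"
  by (rule balancedI)
    (auto intro!: module_scalar_hom[OF M.module_axioms] module_smult_hom[OF M.module_axioms] \<epsilon>_hom ahom_ident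
      simp: counit_smult M.smult_assoc1[symmetric] m_comm)

lemma \<eta>_hom: "\<eta> \<in> ahom MH M"
  unfolding \<eta>_def by (rule MH.lift_hom[OF M.abelian_group_axioms \<eta>_balanced])

lemma \<eta>_pure: "m \<in> carrier M \<Longrightarrow> h \<in> carrier H \<Longrightarrow> \<eta> (m \<boxtimes>\<^bsub>MH\<^esub> h) = \<epsilon> h \<odot>\<^bsub>M\<^esub> m"
  unfolding \<eta>_def by (rule MH.lift_pure[OF M.abelian_group_axioms \<eta>_balanced])

lemma \<eta>_c:
  assumes "m \<in> carrier M" "X \<in> carrier PH"
  shows "\<eta> (c m X) = act m (tensor_lift P (\<lambda>p0 p1. \<epsilon> p1 \<odot>\<^bsub>P\<^esub> p0) X)"
proof -
  have b: "balanced K P (\<lambda>m a. a \<odot>\<^bsub>P\<^esub> m) H (\<lambda>a h. a \<odot>\<^bsub>H\<^esub> h) P (\<lambda>m h. \<epsilon> h \<odot>\<^bsub>P\<^esub> m)"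
    by (rule balancedI)
      (auto intro!: module_scalar_hom[OF P.module_axioms] module_smult_hom[OF P.module_axioms] \<epsilon>_hom ahom_ident
        simp: counit_smult P.smult_assoc1[symmetric] m_comm)
  show ?thesis
    by (rule PH.hom_ext[OF M.abelian_group_axioms ahom_comp[OF \<eta>_hom c_hom]
          ahom_comp[OF right_module_scalar_hom[OF Mact.right_module_axioms] PH.lift_hom[OF P.abelian_group_axioms b]] _ assms(2)])
      (use assms in \<open>simp_all add: PH.lift_pure[OF P.abelian_group_axioms b] \<eta>_pure act_smult Mact.closed\<close>)
qed

text \<open>Multiplicativity of \<epsilon> separates \<open>\<epsilon>(h)\<close> from
  \<open>\<epsilon>(x_1)\<close>, and the counit axiom contracts \<open>x_0 \<epsilon>(x_1)\<close>
  to \<open>x\<close>.\<close>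

lemma \<eta>_\<theta>:
  assumes "x \<in> carrier P" "Z \<in> carrier MH"
  shows "\<eta> (\<theta> x Z) = act (\<eta> Z) x"
proof (rule MH.hom_ext[OF M.abelian_group_axioms ahom_comp[OF \<eta>_hom \<theta>_hom]
    ahom_comp[OF right_module_mult_hom[OF Mact.right_module_axioms] \<eta>_hom] _ assms(2)])
  fix m h assume mh: "m \<in> carrier M" "h \<in> carrier H"
  have b: "balanced K P (\<lambda>m a. a \<odot>\<^bsub>P\<^esub> m) H (\<lambda>a h. a \<odot>\<^bsub>H\<^esub> h) P (\<lambda>m h. \<epsilon> h \<odot>\<^bsub>P\<^esub> m)"
    by (rule balancedI)
      (auto intro!: module_scalar_hom[OF P.module_axioms] module_smult_hom[OF P.module_axioms] \<epsilon>_hom ahom_ident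
        simp: counit_smult P.smult_assoc1[symmetric] m_comm)
  have "tensor_lift P (\<lambda>p0 p1. \<epsilon> p1 \<odot>\<^bsub>P\<^esub> p0) ((\<one>\<^bsub>P\<^esub> \<boxtimes>\<^bsub>PH\<^esub> h) \<otimes>\<^bsub>PH\<^esub> X) = \<epsilon> h \<odot>\<^bsub>P\<^esub> tensor_lift P (\<lambda>p0 p1. \<epsilon> p1 \<odot>\<^bsub>P\<^esub> p0) X"
    if X: "X \<in> carrier PH" for X
    by (rule PH.hom_ext[OF P.abelian_group_axioms ahom_comp[OF PH.lift_hom[OF P.abelian_group_axioms b] PH.mult_left_hom]
          module_smult_hom[OF P.module_axioms _ PH.lift_hom[OF P.abelian_group_axioms b]] _ X])
      (use mh in \<open>simp_all add: PH.lift_pure[OF P.abelian_group_axioms b] \<epsilon>_mult P.smult_assoc1\<close>)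
  then show "\<eta> (\<theta> x (m \<boxtimes>\<^bsub>MH\<^esub> h)) = act (\<eta> (m \<boxtimes>\<^bsub>MH\<^esub> h)) x"
    using mh assms by (simp add: \<theta>_pure \<eta>_c \<eta>_pure coaction_counit act_smult act_smult')
qed (use assms in auto)

end

section \<open>The inverse of the canonical map and the translation map\<close>

context hopf_galois_extension
begin

lemma canonical_map_eq: "canonical_map K H P \<delta> = Pm.C"
  by (simp add: canonical_map_def Pm.C_def Pm.c_def Let_def)

lemma balanced_square_eq: "balanced_square K H P \<delta> = Pm.MP"
  by (simp add: balanced_square_def)

lemma C_bij: "bij_betw Pm.C (carrier Pm.MP) (carrier PH)"
  using canonical_bij by (simp add: canonical_map_eq balanced_square_eq)

definition E where "E = inv_into (carrier Pm.MP) Pm.C"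

lemma E_hom: "E \<in> ahom PH Pm.MP"
  unfolding E_def by (rule ahom_inv_into[OF Pm.C_hom C_bij Pm.MP.T.abelian_group_axioms])

lemma E_closed [simp]: "X \<in> carrier PH \<Longrightarrow> E X \<in> carrier Pm.MP"
  using E_hom by (rule ahom_closed)

lemma C_E: "X \<in> carrier PH \<Longrightarrow> Pm.C (E X) = X"
  unfolding E_def using C_bij by (simp add: bij_betw_inv_into_right)

lemma E_C: "Z \<in> carrier Pm.MP \<Longrightarrow> E (Pm.C Z) = Z"
  unfolding E_def using C_bij by (simp add: bij_betw_inv_into_left)

lemma translation_map_eq: "translation_map K H P \<delta> h = E (\<one>\<^bsub>P\<^esub> \<boxtimes>\<^bsub>PH\<^esub> h)"
  by (simp add: translation_map_def E_def canonical_map_eq balanced_square_eq)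

text \<open>The identity \<open>y_0 \<tau>(y_1) = 1 \<otimes>\<^sub>B y\<close>, read off from
  \<open>can (1 \<otimes>\<^sub>B y) = \<delta> y\<close>.\<close>

lemma E_\<delta>: "y \<in> carrier P \<Longrightarrow> E (\<delta> y) = \<one>\<^bsub>P\<^esub> \<boxtimes>\<^bsub>Pm.MP\<^esub> y"
proof -
  have "Pm.c \<one>\<^bsub>P\<^esub> X = X" if "X \<in> carrier PH" for X
    by (rule PH.hom_ext[OF PH.T.abelian_group_axioms Pm.c_hom ahom_ident _ that]) simp_all
  then show "y \<in> carrier P \<Longrightarrow> E (\<delta> y) = \<one>\<^bsub>P\<^esub> \<boxtimes>\<^bsub>Pm.MP\<^esub> y"
    using E_C[of "\<one>\<^bsub>P\<^esub> \<boxtimes>\<^bsub>Pm.MP\<^esub> y"] by (simp add: Pm.C_pure)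
qed

definition mulL where "mulL = Pm.MP.left_act (\<lambda>p q. p \<otimes>\<^bsub>P\<^esub> q)"

lemma mulL_comm: "a \<in> carrier B \<Longrightarrow> b \<in> carrier P \<Longrightarrow> x \<in> carrier P \<Longrightarrow> b \<otimes>\<^bsub>P\<^esub> (x \<otimes>\<^bsub>P\<^esub> a) = b \<otimes>\<^bsub>P\<^esub> x \<otimes>\<^bsub>P\<^esub> a"
  by (simp add: P.A.m_assoc B_closed)

lemmas mulL_pure = Pm.MP.left_act_pure[OF P_left_module mulL_comm, folded mulL_def]
  and mulL_hom = Pm.MP.left_act_hom[OF P_left_module mulL_comm, folded mulL_def]

lemma mulL_closed [simp]: "p \<in> carrier P \<Longrightarrow> Z \<in> carrier Pm.MP \<Longrightarrow> mulL p Z \<in> carrier Pm.MP"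
  using mulL_hom by (rule ahom_closed)

lemma C_mulL:
  assumes "p \<in> carrier P" "Z \<in> carrier Pm.MP"
  shows "Pm.C (mulL p Z) = (p \<boxtimes>\<^bsub>PH\<^esub> \<one>\<^bsub>H\<^esub>) \<otimes>\<^bsub>PH\<^esub> Pm.C Z"
proof (rule Pm.MP.hom_ext[OF PH.T.abelian_group_axioms ahom_comp[OF Pm.C_hom mulL_hom] ahom_comp[OF PH.mult_left_hom Pm.C_hom] _ assms(2)])
  fix x y assume xy: "x \<in> carrier P" "y \<in> carrier P"
  have "Pm.c (p \<otimes>\<^bsub>P\<^esub> x) X = (p \<boxtimes>\<^bsub>PH\<^esub> \<one>\<^bsub>H\<^esub>) \<otimes>\<^bsub>PH\<^esub> Pm.c x X" if "X \<in> carrier PH" for X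
    by (rule PH.hom_ext[OF PH.T.abelian_group_axioms Pm.c_hom ahom_comp[OF PH.mult_left_hom Pm.c_hom] _ that])
      (use xy assms in \<open>simp_all add: P.A.m_assoc\<close>)
  then show "Pm.C (mulL p (x \<boxtimes>\<^bsub>Pm.MP\<^esub> y)) = (p \<boxtimes>\<^bsub>PH\<^esub> \<one>\<^bsub>H\<^esub>) \<otimes>\<^bsub>PH\<^esub> Pm.C (x \<boxtimes>\<^bsub>Pm.MP\<^esub> y)"
    using xy assms by (simp add: mulL_pure Pm.C_pure)
qed (use assms in auto)

text \<open>Left \<open>P\<close>-linearity of the canonical map passes to its inverse; in
  particular the inverse at \<open>p \<otimes> h\<close> is \<open>p \<tau>(h)\<close>.\<close>

lemma E_mulL:
  assumes "p \<in> carrier P" "X \<in> carrier PH"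
  shows "E ((p \<boxtimes>\<^bsub>PH\<^esub> \<one>\<^bsub>H\<^esub>) \<otimes>\<^bsub>PH\<^esub> X) = mulL p (E X)"
  using C_mulL[of p "E X"] E_C[of "mulL p (E X)"] assms by (simp add: C_E)

end

section \<open>The canonical isomorphism with coefficients in a right
  \<open>P\<close>-module\<close>

locale galois_module = hopf_galois_extension K H \<Delta> \<epsilon> S P \<delta> + comodule_algebra_module K H \<Delta> \<epsilon> S P \<delta> M act
  for K (structure) and H (structure) and \<Delta> \<epsilon> S and P :: "('k, 'p, 'e) module_scheme" (structure) and \<delta>
    and M :: "('k, 'm, 'f) module_scheme" (structure) and act :: "'m \<Rightarrow> 'p \<Rightarrow> 'm"
begin

text \<open>Gives a meaning to \<open>m \<tau>(h)\<close> inside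
  \<open>M \<otimes>\<^sub>B P\<close>.\<close>

definition ins where "ins m = tensor_lift MP (\<lambda>x y. act m x \<boxtimes>\<^bsub>MP\<^esub> y)"

lemma ins_balanced:
  assumes "m \<in> carrier M"
  shows "balanced B P (\<lambda>p b. p \<otimes>\<^bsub>P\<^esub> b) P (\<lambda>b p. b \<otimes>\<^bsub>P\<^esub> p) MP (\<lambda>x y. act m x \<boxtimes>\<^bsub>MP\<^esub> y)"
proof (rule balancedI)
  show "(\<lambda>y. act m x \<boxtimes>\<^bsub>MP\<^esub> y) \<in> ahom P MP" if "x \<in> carrier P" for x
    by (rule MP.pure_hom_right) (simp add: Mact.closed that assms)
  show "(\<lambda>x. act m x \<boxtimes>\<^bsub>MP\<^esub> y) \<in> ahom P MP" if "y \<in> carrier P" for y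
    by (rule MP.pure_left_comp[OF that right_module_scalar_hom[OF Mact.right_module_axioms assms]])
qed (simp add: assms Mact.closed Mact.assoc B_closed MP.pure_balance)

lemma ins_hom: "m \<in> carrier M \<Longrightarrow> ins m \<in> ahom Pm.MP MP"
  unfolding ins_def by (rule Pm.MP.lift_hom[OF MP.T.abelian_group_axioms ins_balanced])

lemma ins_closed [simp]: "m \<in> carrier M \<Longrightarrow> Z \<in> carrier Pm.MP \<Longrightarrow> ins m Z \<in> carrier MP"
  using ins_hom by (rule ahom_closed)

lemma ins_pure: "m \<in> carrier M \<Longrightarrow> x \<in> carrier P \<Longrightarrow> y \<in> carrier P \<Longrightarrow>
    ins m (x \<boxtimes>\<^bsub>Pm.MP\<^esub> y) = act m x \<boxtimes>\<^bsub>MP\<^esub> y"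
  unfolding ins_def by (rule Pm.MP.lift_pure[OF MP.T.abelian_group_axioms ins_balanced])

lemma ins_param_hom: "Z \<in> carrier Pm.MP \<Longrightarrow> (\<lambda>m. ins m Z) \<in> ahom M MP"
  unfolding ins_def
  by (rule Pm.MP.lift_param_hom[OF MP.T.abelian_group_axioms], assumption)
    (rule MP.pure_left_comp[OF _ right_module_mult_hom[OF Mact.right_module_axioms]])

lemma ins_act:
  assumes "m \<in> carrier M" "p \<in> carrier P" "Z \<in> carrier Pm.MP"
  shows "ins (act m p) Z = ins m (mulL p Z)"
  by (rule Pm.MP.hom_ext[OF MP.T.abelian_group_axioms ins_hom ahom_comp[OF ins_hom mulL_hom] _ assms(3)])
    (use assms in \<open>simp_all add: Mact.closed ins_pure mulL_pure Mact.assoc\<close>)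

text \<open>The inverse of \<open>C\<close>, namely
  \<open>m \<otimes> h \<mapsto> m \<tau>(h)\<close>. It is the base change from \<open>P\<close> to
  \<open>M\<close> of the inverse canonical map.\<close>

definition D where "D = tensor_lift MP (\<lambda>m h. ins m (E (\<one>\<^bsub>P\<^esub> \<boxtimes>\<^bsub>PH\<^esub> h)))"

lemma D_balanced: "balanced K M (\<lambda>m a. a \<odot>\<^bsub>M\<^esub> m) H (\<lambda>a h. a \<odot>\<^bsub>H\<^esub> h) MP (\<lambda>m h. ins m (E (\<one>\<^bsub>P\<^esub> \<boxtimes>\<^bsub>PH\<^esub> h)))"
proof (rule balancedI)
  show "(\<lambda>h. ins m (E (\<one>\<^bsub>P\<^esub> \<boxtimes>\<^bsub>PH\<^esub> h))) \<in> ahom H MP" if "m \<in> carrier M" for m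
    by (rule ahom_comp[OF ins_hom[OF that] ahom_comp[OF E_hom PH.pure_hom_right]]) simp
  show "(\<lambda>m. ins m (E (\<one>\<^bsub>P\<^esub> \<boxtimes>\<^bsub>PH\<^esub> h))) \<in> ahom M MP" if "h \<in> carrier H" for h
    by (rule ins_param_hom) (use that in auto)
  show "ins (a \<odot>\<^bsub>M\<^esub> m) (E (\<one>\<^bsub>P\<^esub> \<boxtimes>\<^bsub>PH\<^esub> h)) = ins m (E (\<one>\<^bsub>P\<^esub> \<boxtimes>\<^bsub>PH\<^esub> (a \<odot>\<^bsub>H\<^esub> h)))"
    if "m \<in> carrier M" "a \<in> carrier K" "h \<in> carrier H" for m a h
    using that by (simp add: ins_act E_mulL[symmetric] PH.smult_balance flip: act_scalar)
qed

lemma D_hom: "D \<in> ahom MH MP"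
  unfolding D_def by (rule MH.lift_hom[OF MP.T.abelian_group_axioms D_balanced])

lemma D_closed [simp]: "X \<in> carrier MH \<Longrightarrow> D X \<in> carrier MP"
  using D_hom by (rule ahom_closed)

lemma D_pure: "m \<in> carrier M \<Longrightarrow> h \<in> carrier H \<Longrightarrow> D (m \<boxtimes>\<^bsub>MH\<^esub> h) = ins m (E (\<one>\<^bsub>P\<^esub> \<boxtimes>\<^bsub>PH\<^esub> h))"
  unfolding D_def by (rule MH.lift_pure[OF MP.T.abelian_group_axioms D_balanced])

lemma D_c:
  assumes "m \<in> carrier M" "X \<in> carrier PH"
  shows "D (c m X) = ins m (E X)"
  by (rule PH.hom_ext[OF MP.T.abelian_group_axioms ahom_comp[OF D_hom c_hom] ahom_comp[OF ins_hom E_hom] _ assms(2)])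
    (use assms in \<open>simp_all add: D_pure Mact.closed ins_act E_mulL[symmetric]\<close>)

text \<open>For \<open>m \<otimes> y\<close> the composite is \<open>m\<close> inserted into
  \<open>y_0 \<tau>(y_1)\<close>, which \<open>E_\<delta>\<close> evaluates to
  \<open>1 \<otimes>\<^sub>B y\<close>.\<close>

lemma D_C: assumes "Z \<in> carrier MP" shows "D (C Z) = Z"
  by (rule MP.hom_ext[OF MP.T.abelian_group_axioms ahom_comp[OF D_hom C_hom] ahom_ident _ assms])
    (simp_all add: C_pure D_c E_\<delta> ins_pure Mact.unit)

lemma C_ins:
  assumes "m \<in> carrier M" "Z \<in> carrier Pm.MP"
  shows "C (ins m Z) = c m (Pm.C Z)"
proof (rule Pm.MP.hom_ext[OF MH.T.abelian_group_axioms ahom_comp[OF C_hom ins_hom] ahom_comp[OF c_hom Pm.C_hom] _ assms(2)])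
  fix x y assume xy: "x \<in> carrier P" "y \<in> carrier P"
  have "c (act m x) X = c m (Pm.c x X)" if "X \<in> carrier PH" for X
    by (rule PH.hom_ext[OF MH.T.abelian_group_axioms c_hom ahom_comp[OF c_hom Pm.c_hom] _ that])
      (use xy assms in \<open>simp_all add: Mact.closed Mact.assoc\<close>)
  then show "C (ins m (x \<boxtimes>\<^bsub>Pm.MP\<^esub> y)) = c m (Pm.C (x \<boxtimes>\<^bsub>Pm.MP\<^esub> y))"
    using xy assms by (simp add: ins_pure C_pure Pm.C_pure Mact.closed)
qed (use assms in auto)

text \<open>By \<open>C_ins\<close>, applying \<open>C\<close> to \<open>m \<tau>(h)\<close> is
  inserting \<open>m\<close> into \<open>can (\<tau> h)\<close>, which is
  \<open>1 \<otimes> h\<close>.\<close>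

lemma C_D: assumes "Z \<in> carrier MH" shows "C (D Z) = Z"
  by (rule MH.hom_ext[OF MH.T.abelian_group_axioms ahom_comp[OF C_hom D_hom] ahom_ident _ assms])
    (simp_all add: D_pure C_ins C_E Mact.unit)

lemma C_inj: "X \<in> carrier MP \<Longrightarrow> Y \<in> carrier MP \<Longrightarrow> C X = C Y \<Longrightarrow> X = Y"
  by (metis D_C)

end

context comodule_algebra_module
begin

lemma c_mult_lift:
  assumes "m \<in> carrier M" "h \<in> carrier H" "X \<in> carrier PH"
  shows "c m ((\<one>\<^bsub>P\<^esub> \<boxtimes>\<^bsub>PH\<^esub> h) \<otimes>\<^bsub>PH\<^esub> X) = tensor_lift MH (\<lambda>p0 p1. act m p0 \<boxtimes>\<^bsub>MH\<^esub> (h \<otimes>\<^bsub>H\<^esub> p1)) X"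
proof -
  have "c m ((\<one>\<^bsub>P\<^esub> \<boxtimes>\<^bsub>PH\<^esub> h) \<otimes>\<^bsub>PH\<^esub> X) = tensor_lift MH (\<lambda>p0 p1. c m ((\<one>\<^bsub>P\<^esub> \<boxtimes>\<^bsub>PH\<^esub> h) \<otimes>\<^bsub>PH\<^esub> (p0 \<boxtimes>\<^bsub>PH\<^esub> p1))) X"
    by (rule PH.hom_eq_lift[OF MH.T.abelian_group_axioms ahom_comp[OF c_hom PH.mult_left_hom] assms(3)])
      (use assms in auto)
  also have "\<dots> = tensor_lift MH (\<lambda>p0 p1. act m p0 \<boxtimes>\<^bsub>MH\<^esub> (h \<otimes>\<^bsub>H\<^esub> p1)) X"
    by (rule PH.lift_cong[OF MH.T.abelian_group_axioms assms(3)]) (use assms in \<open>simp_all add: Mact.closed\<close>)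
  finally show ?thesis .
qed

lemma \<theta>_pure_lift: "x \<in> carrier P \<Longrightarrow> m \<in> carrier M \<Longrightarrow> h \<in> carrier H \<Longrightarrow>
    \<theta> x (m \<boxtimes>\<^bsub>MH\<^esub> h) = tensor_lift MH (\<lambda>x0 x1. act m x0 \<boxtimes>\<^bsub>MH\<^esub> (h \<otimes>\<^bsub>H\<^esub> x1)) (\<delta> x)"
  by (simp add: \<theta>_pure c_mult_lift)

end

section \<open>Coassociativity in trilinear form, and the ambient algebra
  \<open>P \<otimes> P\<close>\<close>

context comodule_algebra
begin

sublocale HH: algebra_pair K H H by (intro algebra_pairI) unfold_locales

abbreviation HH where "HH \<equiv> tensor_algebra K H H"

sublocale PHH: algebra_pair K P HH by (intro algebra_pairI) unfold_locales

abbreviation PHH where "PHH \<equiv> tensor_algebra K P HH"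

lemma \<Delta>_ring_hom: "\<Delta> \<in> ring_hom H HH"
  using comult_hom by (simp add: algebra_hom_def)

lemma \<Delta>_closed [simp]: "h \<in> carrier H \<Longrightarrow> \<Delta> h \<in> carrier HH"
  using ring_hom_closed[OF \<Delta>_ring_hom] .

lemma \<Delta>_hom: "\<Delta> \<in> ahom H HH"
  using \<Delta>_ring_hom by (intro ahomI) (auto simp: ring_hom_def)

lemma \<Delta>_mult: "g \<in> carrier H \<Longrightarrow> h \<in> carrier H \<Longrightarrow> \<Delta> (g \<otimes>\<^bsub>H\<^esub> h) = \<Delta> g \<otimes>\<^bsub>HH\<^esub> \<Delta> h"
  by (rule ring_hom_mult[OF \<Delta>_ring_hom])

lemma \<Delta>_one: "\<Delta> \<one>\<^bsub>H\<^esub> = \<one>\<^bsub>H\<^esub> \<boxtimes>\<^bsub>HH\<^esub> \<one>\<^bsub>H\<^esub>"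
  using ring_hom_one[OF \<Delta>_ring_hom] by (simp add: HH.one_eq)

lemma \<Delta>_smult: "k \<in> carrier K \<Longrightarrow> h \<in> carrier H \<Longrightarrow> \<Delta> (k \<odot>\<^bsub>H\<^esub> h) = k \<odot>\<^bsub>HH\<^esub> \<Delta> h"
  using comult_hom by (simp add: algebra_hom_def)

text \<open>The axiom is an equality in \<open>P \<otimes> (H \<otimes> H)\<close>. A function that
  is additive in each variable and moves scalars between its variables factors through that space,
  so the equality may be read under it.\<close>

lemma coassoc_lift:
  assumes G: "abelian_group G"
    and f1: "\<And>h h'. h \<in> carrier H \<Longrightarrow> h' \<in> carrier H \<Longrightarrow> (\<lambda>p. f p h h') \<in> ahom P G"
    and f2: "\<And>p h'. p \<in> carrier P \<Longrightarrow> h' \<in> carrier H \<Longrightarrow> (\<lambda>h. f p h h') \<in> ahom H G"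
    and f3: "\<And>p h. p \<in> carrier P \<Longrightarrow> h \<in> carrier H \<Longrightarrow> (\<lambda>h'. f p h h') \<in> ahom H G"
    and k1: "\<And>k p h h'. \<lbrakk>k \<in> carrier K; p \<in> carrier P; h \<in> carrier H; h' \<in> carrier H\<rbrakk> \<Longrightarrow> f (k \<odot>\<^bsub>P\<^esub> p) h h' = f p (k \<odot>\<^bsub>H\<^esub> h) h'"
    and k2: "\<And>k p h h'. \<lbrakk>k \<in> carrier K; p \<in> carrier P; h \<in> carrier H; h' \<in> carrier H\<rbrakk> \<Longrightarrow> f p (k \<odot>\<^bsub>H\<^esub> h) h' = f p h (k \<odot>\<^bsub>H\<^esub> h')"
    and p: "p \<in> carrier P"
  shows "tensor_lift G (\<lambda>p0 p1. tensor_lift G (\<lambda>p00 p01. f p00 p01 p1) (\<delta> p0)) (\<delta> p) =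
    tensor_lift G (\<lambda>p0 p1. tensor_lift G (\<lambda>h1 h2. f p0 h1 h2) (\<Delta> p1)) (\<delta> p)"
proof -
  note ag = PHH.T.abelian_group_axioms
  have cl: "f p h h' \<in> carrier G" if "p \<in> carrier P" "h \<in> carrier H" "h' \<in> carrier H" for p h h'
    using ahom_closed[OF f1] that by simp
  have b1: "balanced K H (\<lambda>x a. a \<odot>\<^bsub>H\<^esub> x) H (\<lambda>a y. a \<odot>\<^bsub>H\<^esub> y) G (f p)" if "p \<in> carrier P" for p
    by (rule balancedI) (use that in \<open>auto intro: f2 f3 k2\<close>)
  have b2: "balanced K P (\<lambda>x a. a \<odot>\<^bsub>P\<^esub> x) HH (\<lambda>a y. a \<odot>\<^bsub>HH\<^esub> y) G (\<lambda>p hh. tensor_lift G (f p) hh)"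
  proof (rule balancedI)
    show "(\<lambda>hh. tensor_lift G (f p) hh) \<in> ahom HH G" if "p \<in> carrier P" for p
      by (rule HH.lift_hom[OF G b1[OF that]])
    show "(\<lambda>p. tensor_lift G (f p) hh) \<in> ahom P G" if "hh \<in> carrier HH" for hh
      by (rule HH.lift_param_hom[OF G that f1])
    show "tensor_lift G (f (k \<odot>\<^bsub>P\<^esub> p)) hh = tensor_lift G (f p) (k \<odot>\<^bsub>HH\<^esub> hh)"
      if "p \<in> carrier P" "k \<in> carrier K" "hh \<in> carrier HH" for p k hh
      by (rule HH.hom_ext[OF G HH.lift_hom[OF G b1] ahom_comp[OF HH.lift_hom[OF G b1] HH.smult_hom] _ that(3)])
        (use that in \<open>simp_all add: HH.lift_pure[OF G b1] HH.smult_pure k1\<close>)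
  qed
  \<comment> \<open>The map induced by \<open>f\<close> on the space of the axiom; evaluating it on
    the two sides of \<open>coaction_coassoc\<close> produces the two nested sums.\<close>
  define \<Phi> where "\<Phi> = tensor_lift G (\<lambda>p hh. tensor_lift G (f p) hh)"
  have \<Phi>: "\<Phi> \<in> ahom PHH G" unfolding \<Phi>_def by (rule PHH.lift_hom[OF G b2])
  have \<Phi>p: "\<Phi> (p \<boxtimes>\<^bsub>PHH\<^esub> hh) = tensor_lift G (f p) hh" if "p \<in> carrier P" "hh \<in> carrier HH" for p hh
    unfolding \<Phi>_def by (rule PHH.lift_pure[OF G b2 that])
  have lcl: "tensor_lift PHH (\<lambda>p00 p01. p00 \<boxtimes>\<^bsub>PHH\<^esub> (p01 \<boxtimes>\<^bsub>HH\<^esub> p1)) (\<delta> p0) \<in> carrier PHH"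
    if "p0 \<in> carrier P" "p1 \<in> carrier H" for p0 p1
    by (rule PH.lift_closed[OF ag]) (use that in auto)
  have "\<Phi> (tensor_lift PHH (\<lambda>p0 p1. tensor_lift PHH (\<lambda>p00 p01. p00 \<boxtimes>\<^bsub>PHH\<^esub> (p01 \<boxtimes>\<^bsub>HH\<^esub> p1)) (\<delta> p0)) (\<delta> p))
    = tensor_lift G (\<lambda>p0 p1. \<Phi> (tensor_lift PHH (\<lambda>p00 p01. p00 \<boxtimes>\<^bsub>PHH\<^esub> (p01 \<boxtimes>\<^bsub>HH\<^esub> p1)) (\<delta> p0))) (\<delta> p)"
    by (rule PH.hom_lift[OF ag G \<Phi> \<delta>_closed[OF p] lcl])
  also have "\<dots> = tensor_lift G (\<lambda>p0 p1. tensor_lift G (\<lambda>p00 p01. f p00 p01 p1) (\<delta> p0)) (\<delta> p)"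
  proof (rule PH.lift_cong[OF G \<delta>_closed[OF p]])
    fix p0 p1 assume a: "p0 \<in> carrier P" "p1 \<in> carrier H"
    have "\<Phi> (tensor_lift PHH (\<lambda>p00 p01. p00 \<boxtimes>\<^bsub>PHH\<^esub> (p01 \<boxtimes>\<^bsub>HH\<^esub> p1)) (\<delta> p0)) =
      tensor_lift G (\<lambda>p00 p01. \<Phi> (p00 \<boxtimes>\<^bsub>PHH\<^esub> (p01 \<boxtimes>\<^bsub>HH\<^esub> p1))) (\<delta> p0)"
      by (rule PH.hom_lift[OF ag G \<Phi>]) (use a in auto)
    also have "\<dots> = tensor_lift G (\<lambda>p00 p01. f p00 p01 p1) (\<delta> p0)"
      by (rule PH.lift_cong[OF G]) (use a cl in \<open>auto simp: \<Phi>p HH.lift_pure[OF G b1]\<close>)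
    finally show "\<Phi> (tensor_lift PHH (\<lambda>p00 p01. p00 \<boxtimes>\<^bsub>PHH\<^esub> (p01 \<boxtimes>\<^bsub>HH\<^esub> p1)) (\<delta> p0)) =
      tensor_lift G (\<lambda>p00 p01. f p00 p01 p1) (\<delta> p0)" .
    show "tensor_lift G (\<lambda>p00 p01. f p00 p01 p1) (\<delta> p0) \<in> carrier G"
      by (rule PH.lift_closed[OF G]) (use a cl in auto)
  qed
  finally have 1: "\<Phi> (tensor_lift PHH (\<lambda>p0 p1. tensor_lift PHH (\<lambda>p00 p01. p00 \<boxtimes>\<^bsub>PHH\<^esub> (p01 \<boxtimes>\<^bsub>HH\<^esub> p1)) (\<delta> p0)) (\<delta> p))
    = tensor_lift G (\<lambda>p0 p1. tensor_lift G (\<lambda>p00 p01. f p00 p01 p1) (\<delta> p0)) (\<delta> p)" .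
  have "\<Phi> (tensor_lift PHH (\<lambda>p0 p1. p0 \<boxtimes>\<^bsub>PHH\<^esub> \<Delta> p1) (\<delta> p)) = tensor_lift G (\<lambda>p0 p1. \<Phi> (p0 \<boxtimes>\<^bsub>PHH\<^esub> \<Delta> p1)) (\<delta> p)"
    by (rule PH.hom_lift[OF ag G \<Phi> \<delta>_closed[OF p]]) simp
  also have "\<dots> = tensor_lift G (\<lambda>p0 p1. tensor_lift G (f p0) (\<Delta> p1)) (\<delta> p)"
    by (rule PH.lift_cong[OF G \<delta>_closed[OF p]]) (simp_all add: \<Phi>p ahom_closed[OF HH.lift_hom[OF G b1]])
  finally show ?thesis
    using 1 coaction_coassoc[OF p] by (simp add: Let_def)
qed

sublocale PP: algebra_pair K P "opposite P"
  by (intro algebra_pairI opposite_algebra P.algebra_over_field_axioms)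

abbreviation PP where "PP \<equiv> tensor_algebra K P (opposite P)"

lemma ES_ambient_eq: "ES_ambient K P = PP"
  by (simp add: ES_ambient_def)

abbreviation src where "src x \<equiv> x \<boxtimes>\<^bsub>PP\<^esub> \<one>\<^bsub>P\<^esub>"
abbreviation tgt where "tgt x \<equiv> \<one>\<^bsub>P\<^esub> \<boxtimes>\<^bsub>PP\<^esub> x"

lemma opposite_hom: "ahom (opposite A) G = ahom A G" "ahom G (opposite A) = ahom G A"
  by (simp_all add: hom_def)

lemma PP_pure_hom [intro]: "x \<in> carrier P \<Longrightarrow> (\<lambda>y. x \<boxtimes>\<^bsub>PP\<^esub> y) \<in> ahom P PP"
  "y \<in> carrier P \<Longrightarrow> (\<lambda>x. x \<boxtimes>\<^bsub>PP\<^esub> y) \<in> ahom P PP"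
  using PP.pure_hom_left[of y] PP.pure_hom_right[of x] by (simp_all add: hom_def)

lemma PP_pure_closed [simp]: "x \<in> carrier P \<Longrightarrow> y \<in> carrier P \<Longrightarrow> x \<boxtimes>\<^bsub>PP\<^esub> y \<in> carrier PP"
  by (rule PP.pure_closed) simp_all

lemma PP_balancedI:
  assumes "\<And>x. x \<in> carrier P \<Longrightarrow> (\<lambda>y. f x y) \<in> ahom P G"
    and "\<And>y. y \<in> carrier P \<Longrightarrow> (\<lambda>x. f x y) \<in> ahom P G"
    and "\<And>x a y. x \<in> carrier P \<Longrightarrow> a \<in> carrier K \<Longrightarrow> y \<in> carrier P \<Longrightarrow> f (a \<odot>\<^bsub>P\<^esub> x) y = f x (a \<odot>\<^bsub>P\<^esub> y)"
  shows "balanced K P (\<lambda>x a. a \<odot>\<^bsub>P\<^esub> x) (opposite P) (\<lambda>a y. a \<odot>\<^bsub>opposite P\<^esub> y) G f"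
  using assms by (intro balancedI) (simp_all add: hom_def)

lemma PP_hom_ext:
  assumes "abelian_group G" "g \<in> ahom PP G" "h \<in> ahom PP G"
    and "\<And>x y. x \<in> carrier P \<Longrightarrow> y \<in> carrier P \<Longrightarrow> g (x \<boxtimes>\<^bsub>PP\<^esub> y) = h (x \<boxtimes>\<^bsub>PP\<^esub> y)"
    and "X \<in> carrier PP"
  shows "g X = h X"
  by (rule PP.hom_ext[OF assms(1-3) _ assms(5)]) (use assms(4) in simp)

text \<open>The second factor of \<open>PP\<close> is opposite, so left multiplication by
  \<open>tgt x\<close> sends \<open>p \<otimes> q\<close> to \<open>p \<otimes> qx\<close>. This is
  why a left multiplication defines a right action.\<close>

lemma tgt_right_module: "right_module P PP (\<lambda>v x. tgt x \<otimes>\<^bsub>PP\<^esub> v)"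
proof (rule right_module.intro[OF P.A.ring_axioms PP.T.abelian_group_axioms], unfold right_module_axioms_def, intro conjI allI impI)
  fix a b v assume ab: "a \<in> carrier P" "b \<in> carrier P" and v: "v \<in> carrier PP"
  show "tgt (a \<oplus>\<^bsub>P\<^esub> b) \<otimes>\<^bsub>PP\<^esub> v = (tgt a \<otimes>\<^bsub>PP\<^esub> v) \<oplus>\<^bsub>PP\<^esub> (tgt b \<otimes>\<^bsub>PP\<^esub> v)"
    using ab v by (simp add: ahom_add[OF PP_pure_hom(1)] PP.AB.A.l_distr)
  have "tgt (a \<otimes>\<^bsub>P\<^esub> b) = tgt b \<otimes>\<^bsub>PP\<^esub> tgt a" using ab by simp
  then show "tgt (a \<otimes>\<^bsub>P\<^esub> b) \<otimes>\<^bsub>PP\<^esub> v = tgt b \<otimes>\<^bsub>PP\<^esub> (tgt a \<otimes>\<^bsub>PP\<^esub> v)"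
    using ab v by (simp add: PP.AB.A.m_assoc del: PP.mult_pure)
next
  show "tgt \<one>\<^bsub>P\<^esub> \<otimes>\<^bsub>PP\<^esub> v = v" if "v \<in> carrier PP" for v
    using that PP.one_eq by (metis PP.AB.A.l_one opposite_simps(4))
qed (simp_all add: PP.AB.A.r_distr)

end

sublocale comodule_algebra \<subseteq> PPm: comodule_algebra_module K H \<Delta> \<epsilon> S P \<delta> PP "\<lambda>v x. tgt x \<otimes>\<^bsub>PP\<^esub> v"
proof -
  interpret r: right_module P PP "\<lambda>v x. tgt x \<otimes>\<^bsub>PP\<^esub> v" by (rule tgt_right_module)
  show "comodule_algebra_module K H \<Delta> \<epsilon> S P \<delta> PP (\<lambda>v x. tgt x \<otimes>\<^bsub>PP\<^esub> v)"
  proof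
    fix v k assume v: "v \<in> carrier PP" "k \<in> carrier K"
    have "tgt (k \<odot>\<^bsub>P\<^esub> \<one>\<^bsub>P\<^esub>) = k \<odot>\<^bsub>PP\<^esub> \<one>\<^bsub>PP\<^esub>"
      using PP.smult_balance[of "\<one>\<^bsub>P\<^esub>" k "\<one>\<^bsub>P\<^esub>"] PP.smult_pure[of "\<one>\<^bsub>P\<^esub>" k "\<one>\<^bsub>P\<^esub>"] v(2) by (simp add: PP.one_eq)
    then show "tgt (k \<odot>\<^bsub>P\<^esub> \<one>\<^bsub>P\<^esub>) \<otimes>\<^bsub>PP\<^esub> v = k \<odot>\<^bsub>PP\<^esub> v"
      using v by (simp add: PP.AB.smult_mult_left)
  qed
qed

text \<open>Coefficients in \<open>PP \<otimes> H\<close> with the action \<theta>. The resulting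
  space \<open>(PP \<otimes> H) \<otimes> H\<close> is where the two composites of coassociativity
  are compared.\<close>

sublocale comodule_algebra \<subseteq> PPHm: comodule_algebra_module K H \<Delta> \<epsilon> S P \<delta> PPm.MH "\<lambda>Z x. PPm.\<theta> x Z"
proof -
  interpret r: right_module P PPm.MH "\<lambda>Z x. PPm.\<theta> x Z" by (rule PPm.\<theta>_right_module)
  show "comodule_algebra_module K H \<Delta> \<epsilon> S P \<delta> PPm.MH (\<lambda>Z x. PPm.\<theta> x Z)"
    by unfold_locales (rule PPm.\<theta>_scalar)
qed

section \<open>The diagonal coaction and the algebra \<open>\<B>\<close>\<close>

context comodule_algebra
begin

abbreviation PPH where "PPH \<equiv> tensor_algebra K PP H"
abbreviation PPHH where "PPHH \<equiv> tensor_algebra K PPH H"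

text \<open>Places the \<open>P\<close>-factor in the first leg, so that
  \<open>src_ext (\<delta> p)\<close> is the diagonal coaction of
  \<open>p \<otimes> 1\<close>.\<close>

definition src_ext where "src_ext = tensor_lift PPH (\<lambda>p h. src p \<boxtimes>\<^bsub>PPH\<^esub> h)"

lemma src_ext_balanced: "balanced K P (\<lambda>x a. a \<odot>\<^bsub>P\<^esub> x) H (\<lambda>a y. a \<odot>\<^bsub>H\<^esub> y) PPH (\<lambda>p h. src p \<boxtimes>\<^bsub>PPH\<^esub> h)"
  by (intro balancedI PPm.MH.pure_hom_right PPm.MH.pure_left_comp PP_pure_hom)
    (simp_all add: PPm.MH.smult_balance PP.smult_pure)

lemma src_ext_hom: "src_ext \<in> ahom PH PPH"
  unfolding src_ext_def by (rule PH.lift_hom[OF PPm.MH.T.abelian_group_axioms src_ext_balanced])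

lemma src_ext_closed [simp]: "X \<in> carrier PH \<Longrightarrow> src_ext X \<in> carrier PPH"
  using src_ext_hom by (rule ahom_closed)

lemma src_ext_pure: "p \<in> carrier P \<Longrightarrow> h \<in> carrier H \<Longrightarrow> src_ext (p \<boxtimes>\<^bsub>PH\<^esub> h) = src p \<boxtimes>\<^bsub>PPH\<^esub> h"
  unfolding src_ext_def by (rule PH.lift_pure[OF PPm.MH.T.abelian_group_axioms src_ext_balanced])

lemma src_ext_smult: "k \<in> carrier K \<Longrightarrow> X \<in> carrier PH \<Longrightarrow> src_ext (k \<odot>\<^bsub>PH\<^esub> X) = k \<odot>\<^bsub>PPH\<^esub> src_ext X"
  by (rule PH.hom_ext[OF PPm.MH.T.abelian_group_axioms ahom_comp[OF src_ext_hom PH.smult_hom] ahom_comp[OF PPm.MH.smult_hom src_ext_hom]])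
    (simp_all add: PH.smult_pure src_ext_pure PPm.MH.smult_pure PP.smult_pure)

text \<open>
  \<open>diag\<close> is the diagonal coaction \<open>p \<otimes> q \<mapsto> p\<^sub>0 \<otimes> q\<^sub>0 \<otimes> p\<^sub>1 q\<^sub>1\<close>, written through the action
  \<open>\<theta>\<^sub>q (v \<otimes> h) = v q\<^sub>0 \<otimes> h q\<^sub>1\<close> of \<open>P\<close> on \<open>(P \<otimes> P) \<otimes> H\<close>.
\<close>

definition diag where "diag = tensor_lift PPH (\<lambda>p q. PPm.\<theta> q (src_ext (\<delta> p)))"

lemma \<theta>_smult:
  assumes "k \<in> carrier K" "x \<in> carrier P" "Z \<in> carrier PPH"
  shows "PPm.\<theta> (k \<odot>\<^bsub>P\<^esub> x) Z = PPm.\<theta> x (k \<odot>\<^bsub>PPH\<^esub> Z)"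
  using PPm.\<theta>_mult[of "k \<odot>\<^bsub>P\<^esub> \<one>\<^bsub>P\<^esub>" x Z] assms by (simp add: P.smult_mult_left PPm.\<theta>_scalar)

lemma diag_balanced:
  "balanced K P (\<lambda>x a. a \<odot>\<^bsub>P\<^esub> x) (opposite P) (\<lambda>a y. a \<odot>\<^bsub>opposite P\<^esub> y) PPH (\<lambda>p q. PPm.\<theta> q (src_ext (\<delta> p)))"
  by (rule PP_balancedI)
    (simp_all add: PPm.\<theta>_param_hom ahom_comp[OF PPm.\<theta>_hom ahom_comp[OF src_ext_hom \<delta>_hom]]
      \<delta>_smult \<theta>_smult src_ext_smult)

lemma diag_hom: "diag \<in> ahom PP PPH"
  unfolding diag_def by (rule PP.lift_hom[OF PPm.MH.T.abelian_group_axioms diag_balanced])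

lemma diag_closed [simp]: "X \<in> carrier PP \<Longrightarrow> diag X \<in> carrier PPH"
  using diag_hom by (rule ahom_closed)

lemma diag_pure: "p \<in> carrier P \<Longrightarrow> q \<in> carrier P \<Longrightarrow> diag (p \<boxtimes>\<^bsub>PP\<^esub> q) = PPm.\<theta> q (src_ext (\<delta> p))"
  unfolding diag_def by (rule PP.lift_pure[OF PPm.MH.T.abelian_group_axioms diag_balanced]) simp_all

lemma diag_pure_lift:
  assumes "p \<in> carrier P" "q \<in> carrier P"
  shows "diag (p \<boxtimes>\<^bsub>PP\<^esub> q) = tensor_lift PPH (\<lambda>p0 p1. tensor_lift PPH (\<lambda>q0 q1.
      (p0 \<boxtimes>\<^bsub>PP\<^esub> q0) \<boxtimes>\<^bsub>PPH\<^esub> (p1 \<otimes>\<^bsub>H\<^esub> q1)) (\<delta> q)) (\<delta> p)"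
proof -
  note ag = PPm.MH.T.abelian_group_axioms
  have "PPm.\<theta> q (src_ext (\<delta> p)) = tensor_lift PPH (\<lambda>p0 p1. PPm.\<theta> q (src p0 \<boxtimes>\<^bsub>PPH\<^esub> p1)) (\<delta> p)"
    unfolding src_ext_def by (rule PH.hom_lift[OF ag ag PPm.\<theta>_hom]) (use assms in auto)
  also have "\<dots> = tensor_lift PPH (\<lambda>p0 p1. tensor_lift PPH (\<lambda>q0 q1.
      (p0 \<boxtimes>\<^bsub>PP\<^esub> q0) \<boxtimes>\<^bsub>PPH\<^esub> (p1 \<otimes>\<^bsub>H\<^esub> q1)) (\<delta> q)) (\<delta> p)"
  proof (rule PH.lift_cong[OF ag])
    fix p0 p1 assume a: "p0 \<in> carrier P" "p1 \<in> carrier H"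
    show "PPm.\<theta> q (src p0 \<boxtimes>\<^bsub>PPH\<^esub> p1) = tensor_lift PPH (\<lambda>q0 q1. (p0 \<boxtimes>\<^bsub>PP\<^esub> q0) \<boxtimes>\<^bsub>PPH\<^esub> (p1 \<otimes>\<^bsub>H\<^esub> q1)) (\<delta> q)"
      unfolding PPm.\<theta>_pure_lift[OF assms(2) PP_pure_closed[OF a(1) P.A.one_closed] a(2)]
      by (rule PH.lift_cong[OF ag]) (use a assms in auto)
    show "tensor_lift PPH (\<lambda>q0 q1. (p0 \<boxtimes>\<^bsub>PP\<^esub> q0) \<boxtimes>\<^bsub>PPH\<^esub> (p1 \<otimes>\<^bsub>H\<^esub> q1)) (\<delta> q) \<in> carrier PPH"
      by (rule PH.lift_closed[OF ag]) (use a assms in auto)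
  qed (use assms in simp)
  finally show ?thesis using assms by (simp add: diag_pure)
qed

lemma diagonal_coaction_eq: "X \<in> carrier PP \<Longrightarrow> diagonal_coaction K H P \<delta> X = diag X"
  unfolding diagonal_coaction_def ES_ambient_eq Let_def
  by (subst PP.hom_eq_lift[OF PPm.MH.T.abelian_group_axioms diag_hom], assumption)
    (rule PP.lift_cong[OF PPm.MH.T.abelian_group_axioms], simp_all add: diag_pure_lift[symmetric])

text \<open>On \<open>p \<otimes> q\<close> this is the action law for \<open>qx\<close>. As
  \<open>p \<otimes> q\<close> is \<open>p \<otimes> 1\<close> acted on by \<open>q\<close>,
  statements about \<open>diag\<close> that are compatible with the action reduce to
  \<open>p \<otimes> 1\<close>.\<close>

lemma diag_act:
  assumes "x \<in> carrier P" "v \<in> carrier PP"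
  shows "diag (tgt x \<otimes>\<^bsub>PP\<^esub> v) = PPm.\<theta> x (diag v)"
  by (rule PP_hom_ext[OF PPm.MH.T.abelian_group_axioms ahom_comp[OF diag_hom PP.mult_left_hom] ahom_comp[OF PPm.\<theta>_hom diag_hom] _ assms(2)])
    (use assms in \<open>simp_all add: diag_pure PPm.\<theta>_mult\<close>)

lemma \<eta>_src_ext:
  assumes "X \<in> carrier PH"
  shows "PPm.\<eta> (src_ext X) = src (tensor_lift P (\<lambda>p0 p1. \<epsilon> p1 \<odot>\<^bsub>P\<^esub> p0) X)"
proof -
  have b: "balanced K P (\<lambda>m a. a \<odot>\<^bsub>P\<^esub> m) H (\<lambda>a h. a \<odot>\<^bsub>H\<^esub> h) P (\<lambda>m h. \<epsilon> h \<odot>\<^bsub>P\<^esub> m)"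
    by (rule balancedI)
      (auto intro!: module_scalar_hom[OF P.module_axioms] module_smult_hom[OF P.module_axioms] \<epsilon>_hom ahom_ident
        simp: counit_smult P.smult_assoc1[symmetric] m_comm)
  show ?thesis
    by (rule PH.hom_ext[OF PP.T.abelian_group_axioms ahom_comp[OF PPm.\<eta>_hom src_ext_hom]
          ahom_comp[OF PP_pure_hom(2) PH.lift_hom[OF P.abelian_group_axioms b]] _ assms])
      (simp_all add: PH.lift_pure[OF P.abelian_group_axioms b] src_ext_pure PPm.\<eta>_pure PP.smult_pure)
qed

text \<open>Counitality of the diagonal coaction. In particular \<open>diag\<close> is injective,
  which later yields surjectivity of \<mu>.\<close>

lemma \<eta>_diag: assumes "v \<in> carrier PP" shows "PPm.\<eta> (diag v) = v"
  by (rule PP_hom_ext[OF PP.T.abelian_group_axioms ahom_comp[OF PPm.\<eta>_hom diag_hom] ahom_ident _ assms])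
    (simp_all add: diag_pure PPm.\<eta>_\<theta> \<eta>_src_ext coaction_counit)

section \<open>Coassociativity of the diagonal coaction\<close>

definition com_in where "com_in v = tensor_lift PPHH (\<lambda>h h'. (v \<boxtimes>\<^bsub>PPH\<^esub> h) \<boxtimes>\<^bsub>PPHH\<^esub> h')"

lemma com_in_balanced:
  assumes "v \<in> carrier PP"
  shows "balanced K H (\<lambda>x a. a \<odot>\<^bsub>H\<^esub> x) H (\<lambda>a y. a \<odot>\<^bsub>H\<^esub> y) PPHH (\<lambda>h h'. (v \<boxtimes>\<^bsub>PPH\<^esub> h) \<boxtimes>\<^bsub>PPHH\<^esub> h')"
  using assms
  by (intro balancedI PPHm.MH.pure_hom_right PPHm.MH.pure_left_comp PPm.MH.pure_hom_right)
    (simp_all add: PPHm.MH.smult_balance PPm.MH.smult_pure PPm.MH.smult_balance)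

lemma com_in_hom: "v \<in> carrier PP \<Longrightarrow> com_in v \<in> ahom HH PPHH"
  unfolding com_in_def by (rule HH.lift_hom[OF PPHm.MH.T.abelian_group_axioms com_in_balanced])

lemma com_in_closed [simp]: "v \<in> carrier PP \<Longrightarrow> W \<in> carrier HH \<Longrightarrow> com_in v W \<in> carrier PPHH"
  using com_in_hom by (rule ahom_closed)

lemma com_in_pure: "v \<in> carrier PP \<Longrightarrow> h \<in> carrier H \<Longrightarrow> h' \<in> carrier H \<Longrightarrow>
    com_in v (h \<boxtimes>\<^bsub>HH\<^esub> h') = (v \<boxtimes>\<^bsub>PPH\<^esub> h) \<boxtimes>\<^bsub>PPHH\<^esub> h'"
  unfolding com_in_def by (rule HH.lift_pure[OF PPHm.MH.T.abelian_group_axioms com_in_balanced])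

lemma com_in_param_hom: "W \<in> carrier HH \<Longrightarrow> (\<lambda>v. com_in v W) \<in> ahom PP PPHH"
  unfolding com_in_def
  by (rule HH.lift_param_hom[OF PPHm.MH.T.abelian_group_axioms], assumption)
    (intro PPHm.MH.pure_left_comp PPm.MH.pure_hom_left)

lemma com_in_smult:
  assumes "v \<in> carrier PP" "k \<in> carrier K" "W \<in> carrier HH"
  shows "com_in (k \<odot>\<^bsub>PP\<^esub> v) W = com_in v (k \<odot>\<^bsub>HH\<^esub> W)"
  by (rule HH.hom_ext[OF PPHm.MH.T.abelian_group_axioms com_in_hom ahom_comp[OF com_in_hom HH.smult_hom] _ assms(3)])
    (use assms in \<open>simp_all add: com_in_pure HH.smult_pure PPm.MH.smult_balance\<close>)

text \<open>This is \<open>id \<otimes> \<Delta>\<close>, rebracketed by \<open>com_in\<close> so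
  that it shares its target with \<open>coa\<close>, which is
  \<open>diag \<otimes> id\<close>.\<close>

definition com where "com = tensor_lift PPHH (\<lambda>v h. com_in v (\<Delta> h))"

lemma com_balanced:
  "balanced K PP (\<lambda>x a. a \<odot>\<^bsub>PP\<^esub> x) H (\<lambda>a y. a \<odot>\<^bsub>H\<^esub> y) PPHH (\<lambda>v h. com_in v (\<Delta> h))"
  by (rule balancedI)
    (simp_all add: ahom_comp[OF com_in_hom \<Delta>_hom] com_in_param_hom com_in_smult \<Delta>_smult)

lemma com_hom: "com \<in> ahom PPH PPHH"
  unfolding com_def by (rule PPm.MH.lift_hom[OF PPHm.MH.T.abelian_group_axioms com_balanced])

lemma com_pure: "v \<in> carrier PP \<Longrightarrow> h \<in> carrier H \<Longrightarrow> com (v \<boxtimes>\<^bsub>PPH\<^esub> h) = com_in v (\<Delta> h)"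
  unfolding com_def by (rule PPm.MH.lift_pure[OF PPHm.MH.T.abelian_group_axioms com_balanced])

definition coa where "coa = tensor_lift PPHH (\<lambda>v h. diag v \<boxtimes>\<^bsub>PPHH\<^esub> h)"

lemma diag_smult:
  assumes "k \<in> carrier K" "v \<in> carrier PP"
  shows "diag (k \<odot>\<^bsub>PP\<^esub> v) = k \<odot>\<^bsub>PPH\<^esub> diag v"
  using diag_act[of "k \<odot>\<^bsub>P\<^esub> \<one>\<^bsub>P\<^esub>" v] assms by (simp add: PPm.act_scalar PPm.\<theta>_scalar)

lemma coa_balanced:
  "balanced K PP (\<lambda>x a. a \<odot>\<^bsub>PP\<^esub> x) H (\<lambda>a y. a \<odot>\<^bsub>H\<^esub> y) PPHH (\<lambda>v h. diag v \<boxtimes>\<^bsub>PPHH\<^esub> h)"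
  by (rule balancedI)
    (simp_all add: PPHm.MH.pure_hom_right PPHm.MH.pure_left_comp diag_hom diag_smult PPHm.MH.smult_balance)

lemma coa_hom: "coa \<in> ahom PPH PPHH"
  unfolding coa_def by (rule PPm.MH.lift_hom[OF PPHm.MH.T.abelian_group_axioms coa_balanced])

lemma coa_pure: "v \<in> carrier PP \<Longrightarrow> h \<in> carrier H \<Longrightarrow> coa (v \<boxtimes>\<^bsub>PPH\<^esub> h) = diag v \<boxtimes>\<^bsub>PPHH\<^esub> h"
  unfolding coa_def by (rule PPm.MH.lift_pure[OF PPHm.MH.T.abelian_group_axioms coa_balanced])

text \<open>As \<Delta> is multiplicative, \<open>com\<close> sends
  \<open>v y_0 \<otimes> h y_1\<close> to \<open>v y_0 \<otimes> \<Delta>(h) \<Delta>(y_1)\<close>.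
  Acting by \<open>y\<close> after \<open>com\<close> produces the iterated coaction of
  \<open>y\<close>, and coassociativity of \<delta> identifies the two.\<close>

lemma com_\<theta>:
  assumes y: "y \<in> carrier P" and Z: "Z \<in> carrier PPH"
  shows "com (PPm.\<theta> y Z) = PPHm.\<theta> y (com Z)"
proof (rule PPm.MH.hom_ext[OF PPHm.MH.T.abelian_group_axioms ahom_comp[OF com_hom PPm.\<theta>_hom[OF y]] ahom_comp[OF PPHm.\<theta>_hom[OF y] com_hom] _ Z])
  note ag = PPHm.MH.T.abelian_group_axioms
  fix v h assume v: "v \<in> carrier PP" and h: "h \<in> carrier H"
  \<comment> \<open>The common value \<open>v y_0 \<otimes> W \<Delta>(y_1)\<close>, with
    \<Delta>(h) replaced by a variable \<open>W\<close> so that the comparison can be made on pure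
    tensors of \<open>H \<otimes> H\<close>.\<close>
  define F where "F W = tensor_lift PPHH (\<lambda>y0 y1. com_in (tgt y0 \<otimes>\<^bsub>PP\<^esub> v) (W \<otimes>\<^bsub>HH\<^esub> \<Delta> y1)) (\<delta> y)" for W
  have F: "F \<in> ahom HH PPHH"
    unfolding F_def
    by (rule PH.lift_param_hom[OF ag \<delta>_closed[OF y]]) (use v in \<open>auto intro!: ahom_comp[OF com_in_hom] HH.mult_right_hom\<close>)
  have 1: "PPHm.\<theta> y (com_in v W) = F W" if W: "W \<in> carrier HH" for W
  proof (rule HH.hom_ext[OF ag ahom_comp[OF PPHm.\<theta>_hom[OF y] com_in_hom[OF v]] F _ W])
    fix g g' assume g: "g \<in> carrier H" "g' \<in> carrier H"
    let ?f = "\<lambda>p k k'. ((tgt p \<otimes>\<^bsub>PP\<^esub> v) \<boxtimes>\<^bsub>PPH\<^esub> (g \<otimes>\<^bsub>H\<^esub> k)) \<boxtimes>\<^bsub>PPHH\<^esub> (g' \<otimes>\<^bsub>H\<^esub> k')"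
    have hz: "(\<lambda>Z. Z \<boxtimes>\<^bsub>PPHH\<^esub> g) \<in> ahom PPH PPHH" if "g \<in> carrier H" for g
      by (rule PPHm.MH.pure_hom_left[OF that])
    have in_eq: "PPm.\<theta> y0 (v \<boxtimes>\<^bsub>PPH\<^esub> g) \<boxtimes>\<^bsub>PPHH\<^esub> (g' \<otimes>\<^bsub>H\<^esub> y1) = tensor_lift PPHH (\<lambda>y00 y01. ?f y00 y01 y1) (\<delta> y0)"
      if "y0 \<in> carrier P" "y1 \<in> carrier H" for y0 y1
      unfolding PPm.\<theta>_pure_lift[OF that(1) v g(1)]
      by (rule PH.hom_lift[OF PPm.MH.T.abelian_group_axioms ag hz]) (use that v g in auto)
    have fcl: "tensor_lift PPHH (\<lambda>y00 y01. ?f y00 y01 y1) (\<delta> y0) \<in> carrier PPHH" if "y0 \<in> carrier P" "y1 \<in> carrier H" for y0 y1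
      by (rule PH.lift_closed[OF ag]) (use that v g in auto)
    have "PPHm.\<theta> y (com_in v (g \<boxtimes>\<^bsub>HH\<^esub> g')) = PPHm.\<theta> y ((v \<boxtimes>\<^bsub>PPH\<^esub> g) \<boxtimes>\<^bsub>PPHH\<^esub> g')"
      using v g by (simp add: com_in_pure)
    also have "\<dots> = tensor_lift PPHH (\<lambda>y0 y1. PPm.\<theta> y0 (v \<boxtimes>\<^bsub>PPH\<^esub> g) \<boxtimes>\<^bsub>PPHH\<^esub> (g' \<otimes>\<^bsub>H\<^esub> y1)) (\<delta> y)"
      by (rule PPHm.\<theta>_pure_lift[OF y _ g(2)]) (use v g in simp)
    also have "\<dots> = tensor_lift PPHH (\<lambda>y0 y1. tensor_lift PPHH (\<lambda>y00 y01. ?f y00 y01 y1) (\<delta> y0)) (\<delta> y)"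
      by (rule PH.lift_cong[OF ag \<delta>_closed[OF y] in_eq fcl])
    also have "\<dots> = tensor_lift PPHH (\<lambda>y0 y1. tensor_lift PPHH (\<lambda>k k'. ?f y0 k k') (\<Delta> y1)) (\<delta> y)"
    proof (rule coassoc_lift[OF ag _ _ _ _ _ y])
      show "(\<lambda>p. ?f p k k') \<in> ahom P PPHH" if "k \<in> carrier H" "k' \<in> carrier H" for k k'
        by (intro PPHm.MH.pure_left_comp PPm.MH.pure_left_comp ahom_comp[OF PP.mult_right_hom[OF v]] PP_pure_hom)
          (use that g in auto)
      show "(\<lambda>k. ?f p k k') \<in> ahom H PPHH" if "p \<in> carrier P" "k' \<in> carrier H" for p k'
        by (intro PPHm.MH.pure_left_comp PPm.MH.pure_right_comp ring_mult_left_hom[OF A.ring_axioms] ahom_ident)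
          (use that g v in auto)
      show "(\<lambda>k'. ?f p k k') \<in> ahom H PPHH" if "p \<in> carrier P" "k \<in> carrier H" for p k
        by (intro PPHm.MH.pure_right_comp ring_mult_left_hom[OF A.ring_axioms] ahom_ident)
          (use that g v in auto)
      show "?f (a \<odot>\<^bsub>P\<^esub> p) k k' = ?f p (a \<odot>\<^bsub>H\<^esub> k) k'"
        if "a \<in> carrier K" "p \<in> carrier P" "k \<in> carrier H" "k' \<in> carrier H" for a p k k'
        using that v g by (simp add: PPm.act_smult smult_mult_right PPm.MH.smult_balance)
      show "?f p (a \<odot>\<^bsub>H\<^esub> k) k' = ?f p k (a \<odot>\<^bsub>H\<^esub> k')"
        if "a \<in> carrier K" "p \<in> carrier P" "k \<in> carrier H" "k' \<in> carrier H" for a p k k'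
        using that v g by (simp add: smult_mult_right PPHm.MH.smult_balance PPm.MH.smult_pure PPm.MH.smult_balance)
    qed
    also have "\<dots> = F (g \<boxtimes>\<^bsub>HH\<^esub> g')"
      unfolding F_def
    proof (rule PH.lift_cong[OF ag \<delta>_closed[OF y]])
      fix y0 y1 assume a: "y0 \<in> carrier P" "y1 \<in> carrier H"
      have vc: "tgt y0 \<otimes>\<^bsub>PP\<^esub> v \<in> carrier PP" using a v by simp
      have "com_in (tgt y0 \<otimes>\<^bsub>PP\<^esub> v) ((g \<boxtimes>\<^bsub>HH\<^esub> g') \<otimes>\<^bsub>HH\<^esub> \<Delta> y1) =
        tensor_lift PPHH (\<lambda>k k'. com_in (tgt y0 \<otimes>\<^bsub>PP\<^esub> v) ((g \<boxtimes>\<^bsub>HH\<^esub> g') \<otimes>\<^bsub>HH\<^esub> (k \<boxtimes>\<^bsub>HH\<^esub> k'))) (\<Delta> y1)"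
        by (rule HH.hom_eq_lift[OF ag ahom_comp[OF com_in_hom[OF vc] HH.mult_left_hom] \<Delta>_closed[OF a(2)]]) (use g in simp)
      also have "\<dots> = tensor_lift PPHH (\<lambda>k k'. ?f y0 k k') (\<Delta> y1)"
        by (rule HH.lift_cong[OF ag \<Delta>_closed[OF a(2)]]) (use g a v in \<open>simp_all add: com_in_pure\<close>)
      finally show "tensor_lift PPHH (\<lambda>k k'. ?f y0 k k') (\<Delta> y1) = com_in (tgt y0 \<otimes>\<^bsub>PP\<^esub> v) ((g \<boxtimes>\<^bsub>HH\<^esub> g') \<otimes>\<^bsub>HH\<^esub> \<Delta> y1)" ..
      show "com_in (tgt y0 \<otimes>\<^bsub>PP\<^esub> v) ((g \<boxtimes>\<^bsub>HH\<^esub> g') \<otimes>\<^bsub>HH\<^esub> \<Delta> y1) \<in> carrier PPHH"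
        using g a v by simp
    qed
    finally show "PPHm.\<theta> y (com_in v (g \<boxtimes>\<^bsub>HH\<^esub> g')) = F (g \<boxtimes>\<^bsub>HH\<^esub> g')" .
  qed
  have "com (PPm.\<theta> y (v \<boxtimes>\<^bsub>PPH\<^esub> h)) = tensor_lift PPHH (\<lambda>y0 y1. com ((tgt y0 \<otimes>\<^bsub>PP\<^esub> v) \<boxtimes>\<^bsub>PPH\<^esub> (h \<otimes>\<^bsub>H\<^esub> y1))) (\<delta> y)"
    unfolding PPm.\<theta>_pure_lift[OF y v h]
    by (rule PH.hom_lift[OF PPm.MH.T.abelian_group_axioms ag com_hom \<delta>_closed[OF y]]) (use v h in auto)
  also have "\<dots> = F (\<Delta> h)"
    unfolding F_def by (rule PH.lift_cong[OF ag \<delta>_closed[OF y]]) (use v h in \<open>simp_all add: com_pure \<Delta>_mult\<close>)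
  finally show "com (PPm.\<theta> y (v \<boxtimes>\<^bsub>PPH\<^esub> h)) = PPHm.\<theta> y (com (v \<boxtimes>\<^bsub>PPH\<^esub> h))"
    using 1 v h by (simp add: com_pure)
qed

text \<open>The action on the first factor passes through \<open>diag\<close> by
  \<open>diag_act\<close>, and the remaining \<open>H\<close>-factor is multiplied as
  before.\<close>

lemma coa_\<theta>:
  assumes y: "y \<in> carrier P" and Z: "Z \<in> carrier PPH"
  shows "coa (PPm.\<theta> y Z) = PPHm.\<theta> y (coa Z)"
proof (rule PPm.MH.hom_ext[OF PPHm.MH.T.abelian_group_axioms ahom_comp[OF coa_hom PPm.\<theta>_hom[OF y]] ahom_comp[OF PPHm.\<theta>_hom[OF y] coa_hom] _ Z])
  note ag = PPHm.MH.T.abelian_group_axioms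
  fix v h assume v: "v \<in> carrier PP" and h: "h \<in> carrier H"
  have "coa (PPm.\<theta> y (v \<boxtimes>\<^bsub>PPH\<^esub> h)) = tensor_lift PPHH (\<lambda>y0 y1. coa ((tgt y0 \<otimes>\<^bsub>PP\<^esub> v) \<boxtimes>\<^bsub>PPH\<^esub> (h \<otimes>\<^bsub>H\<^esub> y1))) (\<delta> y)"
    unfolding PPm.\<theta>_pure_lift[OF y v h]
    by (rule PH.hom_lift[OF PPm.MH.T.abelian_group_axioms ag coa_hom \<delta>_closed[OF y]]) (use v h in auto)
  also have "\<dots> = tensor_lift PPHH (\<lambda>y0 y1. PPm.\<theta> y0 (diag v) \<boxtimes>\<^bsub>PPHH\<^esub> (h \<otimes>\<^bsub>H\<^esub> y1)) (\<delta> y)"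
    by (rule PH.lift_cong[OF ag \<delta>_closed[OF y]]) (use v h in \<open>simp_all add: coa_pure diag_act\<close>)
  finally show "coa (PPm.\<theta> y (v \<boxtimes>\<^bsub>PPH\<^esub> h)) = PPHm.\<theta> y (coa (v \<boxtimes>\<^bsub>PPH\<^esub> h))"
    using v h y by (simp add: coa_pure PPHm.\<theta>_pure_lift)
qed

text \<open>For \<open>p \<otimes> 1\<close> the claim is coassociativity of the coaction \<delta>
  itself.\<close>

lemma com_eq_coa_src_ext:
  assumes p: "p \<in> carrier P"
  shows "com (src_ext (\<delta> p)) = coa (src_ext (\<delta> p))"
proof -
  note ag = PPHm.MH.T.abelian_group_axioms
  let ?f = "\<lambda>p h h'. (src p \<boxtimes>\<^bsub>PPH\<^esub> h) \<boxtimes>\<^bsub>PPHH\<^esub> h'"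
  have "coa (src_ext (\<delta> p)) = tensor_lift PPHH (\<lambda>p0 p1. coa (src p0 \<boxtimes>\<^bsub>PPH\<^esub> p1)) (\<delta> p)"
    unfolding src_ext_def
    by (rule PH.hom_lift[OF PPm.MH.T.abelian_group_axioms ag coa_hom \<delta>_closed[OF p]]) auto
  also have "\<dots> = tensor_lift PPHH (\<lambda>p0 p1. tensor_lift PPHH (\<lambda>p00 p01. ?f p00 p01 p1) (\<delta> p0)) (\<delta> p)"
  proof (rule PH.lift_cong[OF ag \<delta>_closed[OF p]])
    fix p0 p1 assume a: "p0 \<in> carrier P" "p1 \<in> carrier H"
    have "coa (src p0 \<boxtimes>\<^bsub>PPH\<^esub> p1) = src_ext (\<delta> p0) \<boxtimes>\<^bsub>PPHH\<^esub> p1"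
      using a by (simp add: coa_pure diag_pure PPm.\<theta>_one)
    also have "\<dots> = tensor_lift PPHH (\<lambda>p00 p01. ?f p00 p01 p1) (\<delta> p0)"
      unfolding src_ext_def
      by (rule PH.hom_lift[OF PPm.MH.T.abelian_group_axioms ag PPHm.MH.pure_hom_left[OF a(2)]]) (use a in auto)
    finally show "coa (src p0 \<boxtimes>\<^bsub>PPH\<^esub> p1) = tensor_lift PPHH (\<lambda>p00 p01. ?f p00 p01 p1) (\<delta> p0)" .
    show "tensor_lift PPHH (\<lambda>p00 p01. ?f p00 p01 p1) (\<delta> p0) \<in> carrier PPHH"
      by (rule PH.lift_closed[OF ag]) (use a in auto)
  qed
  also have "\<dots> = tensor_lift PPHH (\<lambda>p0 p1. tensor_lift PPHH (\<lambda>k k'. ?f p0 k k') (\<Delta> p1)) (\<delta> p)"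
    by (rule coassoc_lift[OF ag _ _ _ _ _ p])
      (auto intro!: PPHm.MH.pure_left_comp PPm.MH.pure_left_comp PPm.MH.pure_hom_right PPHm.MH.pure_hom_right PP_pure_hom
        simp: PPHm.MH.smult_balance PPm.MH.smult_pure PPm.MH.smult_balance PP.smult_pure)
  also have "\<dots> = tensor_lift PPHH (\<lambda>p0 p1. com (src p0 \<boxtimes>\<^bsub>PPH\<^esub> p1)) (\<delta> p)"
  proof (rule PH.lift_cong[OF ag \<delta>_closed[OF p]])
    fix p0 p1 assume a: "p0 \<in> carrier P" "p1 \<in> carrier H"
    then show "tensor_lift PPHH (\<lambda>k k'. ?f p0 k k') (\<Delta> p1) = com (src p0 \<boxtimes>\<^bsub>PPH\<^esub> p1)"
      by (simp add: com_pure com_in_def)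
    show "com (src p0 \<boxtimes>\<^bsub>PPH\<^esub> p1) \<in> carrier PPHH" using a by (simp add: com_pure)
  qed
  also have "\<dots> = com (src_ext (\<delta> p))"
    unfolding src_ext_def
    by (rule PH.hom_lift[OF PPm.MH.T.abelian_group_axioms ag com_hom \<delta>_closed[OF p], symmetric]) auto
  finally show ?thesis ..
qed

text \<open>Both composites commute with the action of \<open>q\<close>, so the case
  \<open>p \<otimes> 1\<close> decides.\<close>

lemma diag_coassoc:
  assumes "v \<in> carrier PP" shows "coa (diag v) = com (diag v)"
  by (rule PP_hom_ext[OF PPHm.MH.T.abelian_group_axioms ahom_comp[OF coa_hom diag_hom] ahom_comp[OF com_hom diag_hom] _ assms])
    (simp add: diag_pure com_\<theta> coa_\<theta> com_eq_coa_src_ext)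

end

lemma (in abelian_group) minus_eq_zero_iff:
  assumes "x \<in> carrier G" "y \<in> carrier G" shows "x \<ominus> y = \<zero> \<longleftrightarrow> x = y"
proof
  assume "x \<ominus> y = \<zero>"
  then have "x \<ominus> y \<oplus> y = y" using assms by simp
  then show "x = y" using assms by (simp add: minus_eq a_assoc l_neg)
qed (use assms in \<open>simp add: minus_eq r_neg\<close>)

section \<open>The coinvariant algebra \<open>L\<close> and its description as a kernel\<close>

context comodule_algebra
begin

lemma com_one: "v \<in> carrier PP \<Longrightarrow> com (v \<boxtimes>\<^bsub>PPH\<^esub> \<one>\<^bsub>H\<^esub>) = (v \<boxtimes>\<^bsub>PPH\<^esub> \<one>\<^bsub>H\<^esub>) \<boxtimes>\<^bsub>PPHH\<^esub> \<one>\<^bsub>H\<^esub>"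
  by (simp add: com_pure \<Delta>_one com_in_pure)

abbreviation L where "L \<equiv> ES_algebra K H P \<delta>"

lemma L_simps [simp]:
  "ring.add L = ring.add PP" "\<zero>\<^bsub>L\<^esub> = \<zero>\<^bsub>PP\<^esub>" "monoid.mult L = monoid.mult PP" "\<one>\<^bsub>L\<^esub> = \<one>\<^bsub>PP\<^esub>"
  "smult L = smult PP"
  by (simp_all add: ES_algebra_def ES_ambient_eq Let_def)

lemma L_iff: "X \<in> carrier L \<longleftrightarrow> X \<in> carrier PP \<and> diag X = X \<boxtimes>\<^bsub>PPH\<^esub> \<one>\<^bsub>H\<^esub>"
  unfolding ES_algebra_def ES_ambient_eq Let_def by (simp add: diagonal_coaction_eq cong: conj_cong)

lemma L_closed: "X \<in> carrier L \<Longrightarrow> X \<in> carrier PP"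
  by (simp add: L_iff)

lemma L_eq: "L = PP\<lparr>carrier := carrier L\<rparr>"
  by (simp add: ES_algebra_def ES_ambient_eq Let_def)

lemma src_ext_mult:
  assumes "X \<in> carrier PH" "Y \<in> carrier PH"
  shows "src_ext (X \<otimes>\<^bsub>PH\<^esub> Y) = src_ext X \<otimes>\<^bsub>PPH\<^esub> src_ext Y"
  by (rule PH.hom_ext2[OF PPm.MH.T.abelian_group_axioms, where X=X and Y=Y])
    (use assms in \<open>simp_all add: ahom_comp[OF src_ext_hom PH.mult_left_hom] ahom_comp[OF src_ext_hom PH.mult_right_hom]
      ahom_comp[OF PPm.MH.mult_left_hom src_ext_hom] ahom_comp[OF PPm.MH.mult_right_hom src_ext_hom] src_ext_pure\<close>)

lemma src_tgt_commute: "p \<in> carrier P \<Longrightarrow> q \<in> carrier P \<Longrightarrow> src p \<otimes>\<^bsub>PP\<^esub> tgt q = tgt q \<otimes>\<^bsub>PP\<^esub> src p"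
  by simp

text \<open>The multiplication acts on the first leg and on \<open>H\<close> from the left, the
  action of \<open>u\<close> on the second leg and on \<open>H\<close> from the right, so the two
  commute.\<close>

lemma \<theta>_src_ext_mult:
  assumes u: "u \<in> carrier P" and X: "X \<in> carrier PH" and Z: "Z \<in> carrier PPH"
  shows "PPm.\<theta> u (src_ext X \<otimes>\<^bsub>PPH\<^esub> Z) = src_ext X \<otimes>\<^bsub>PPH\<^esub> PPm.\<theta> u Z"
proof (rule PH.hom_ext[OF PPm.MH.T.abelian_group_axioms
      ahom_comp[OF PPm.\<theta>_hom[OF u] ahom_comp[OF PPm.MH.mult_right_hom[OF Z] src_ext_hom]]
      ahom_comp[OF PPm.MH.mult_right_hom src_ext_hom] _ X])
  show "PPm.\<theta> u Z \<in> carrier PPH" using u Z by simp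
  fix p h assume ph: "p \<in> carrier P" "h \<in> carrier H"
  have ph': "src p \<boxtimes>\<^bsub>PPH\<^esub> h \<in> carrier PPH" using ph by simp
  have "PPm.\<theta> u ((src p \<boxtimes>\<^bsub>PPH\<^esub> h) \<otimes>\<^bsub>PPH\<^esub> Z) = (src p \<boxtimes>\<^bsub>PPH\<^esub> h) \<otimes>\<^bsub>PPH\<^esub> PPm.\<theta> u Z"
  proof (rule PPm.MH.hom_ext[OF PPm.MH.T.abelian_group_axioms
      ahom_comp[OF PPm.\<theta>_hom[OF u] PPm.MH.mult_left_hom[OF ph']] ahom_comp[OF PPm.MH.mult_left_hom[OF ph'] PPm.\<theta>_hom[OF u]] _ Z])
    fix v g assume v: "v \<in> carrier PP" "g \<in> carrier H"
    have "PPm.c (src p \<otimes>\<^bsub>PP\<^esub> v) ((\<one>\<^bsub>P\<^esub> \<boxtimes>\<^bsub>PH\<^esub> (h \<otimes>\<^bsub>H\<^esub> g)) \<otimes>\<^bsub>PH\<^esub> W) =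
      (src p \<boxtimes>\<^bsub>PPH\<^esub> h) \<otimes>\<^bsub>PPH\<^esub> PPm.c v ((\<one>\<^bsub>P\<^esub> \<boxtimes>\<^bsub>PH\<^esub> g) \<otimes>\<^bsub>PH\<^esub> W)" if W: "W \<in> carrier PH" for W
    proof (rule PH.hom_ext[OF PPm.MH.T.abelian_group_axioms ahom_comp[OF PPm.c_hom PH.mult_left_hom]
          ahom_comp[OF PPm.MH.mult_left_hom[OF ph'] ahom_comp[OF PPm.c_hom PH.mult_left_hom]] _ W])
      fix x k assume x: "x \<in> carrier P" "k \<in> carrier H"
      have "tgt x \<otimes>\<^bsub>PP\<^esub> (src p \<otimes>\<^bsub>PP\<^esub> v) = src p \<otimes>\<^bsub>PP\<^esub> (tgt x \<otimes>\<^bsub>PP\<^esub> v)"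
        using x ph v src_tgt_commute[of p x] by (simp del: PP.mult_pure flip: PP.AB.A.m_assoc)
      then show "PPm.c (src p \<otimes>\<^bsub>PP\<^esub> v) ((\<one>\<^bsub>P\<^esub> \<boxtimes>\<^bsub>PH\<^esub> (h \<otimes>\<^bsub>H\<^esub> g)) \<otimes>\<^bsub>PH\<^esub> (x \<boxtimes>\<^bsub>PH\<^esub> k)) =
        (src p \<boxtimes>\<^bsub>PPH\<^esub> h) \<otimes>\<^bsub>PPH\<^esub> PPm.c v ((\<one>\<^bsub>P\<^esub> \<boxtimes>\<^bsub>PH\<^esub> g) \<otimes>\<^bsub>PH\<^esub> (x \<boxtimes>\<^bsub>PH\<^esub> k))"
        using x ph v by (simp add: A.m_assoc)
    qed (use ph v in auto)
    then show "PPm.\<theta> u ((src p \<boxtimes>\<^bsub>PPH\<^esub> h) \<otimes>\<^bsub>PPH\<^esub> (v \<boxtimes>\<^bsub>PPH\<^esub> g)) = (src p \<boxtimes>\<^bsub>PPH\<^esub> h) \<otimes>\<^bsub>PPH\<^esub> PPm.\<theta> u (v \<boxtimes>\<^bsub>PPH\<^esub> g)"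
      using ph v u by (simp add: PPm.\<theta>_pure)
  qed
  then show "PPm.\<theta> u (src_ext (p \<boxtimes>\<^bsub>PH\<^esub> h) \<otimes>\<^bsub>PPH\<^esub> Z) = src_ext (p \<boxtimes>\<^bsub>PH\<^esub> h) \<otimes>\<^bsub>PPH\<^esub> PPm.\<theta> u Z"
    using ph by (simp add: src_ext_pure)
qed

lemma \<theta>_mult_right:
  assumes q: "q \<in> carrier P" and Z: "Z \<in> carrier PPH" and Y: "Y \<in> carrier PP"
  shows "PPm.\<theta> q (Z \<otimes>\<^bsub>PPH\<^esub> (Y \<boxtimes>\<^bsub>PPH\<^esub> \<one>\<^bsub>H\<^esub>)) = PPm.\<theta> q Z \<otimes>\<^bsub>PPH\<^esub> (Y \<boxtimes>\<^bsub>PPH\<^esub> \<one>\<^bsub>H\<^esub>)"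
proof (rule PPm.MH.hom_ext[OF PPm.MH.T.abelian_group_axioms ahom_comp[OF PPm.\<theta>_hom[OF q] PPm.MH.mult_right_hom]
      ahom_comp[OF PPm.MH.mult_right_hom PPm.\<theta>_hom[OF q]] _ Z])
  fix v h assume v: "v \<in> carrier PP" "h \<in> carrier H"
  have "PPm.c (v \<otimes>\<^bsub>PP\<^esub> Y) ((\<one>\<^bsub>P\<^esub> \<boxtimes>\<^bsub>PH\<^esub> h) \<otimes>\<^bsub>PH\<^esub> W) =
      PPm.c v ((\<one>\<^bsub>P\<^esub> \<boxtimes>\<^bsub>PH\<^esub> h) \<otimes>\<^bsub>PH\<^esub> W) \<otimes>\<^bsub>PPH\<^esub> (Y \<boxtimes>\<^bsub>PPH\<^esub> \<one>\<^bsub>H\<^esub>)" if W: "W \<in> carrier PH" for W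
    by (rule PH.hom_ext[OF PPm.MH.T.abelian_group_axioms ahom_comp[OF PPm.c_hom PH.mult_left_hom]
          ahom_comp[OF PPm.MH.mult_right_hom ahom_comp[OF PPm.c_hom PH.mult_left_hom]] _ W])
      (use v Y in \<open>simp_all add: PP.AB.A.m_assoc\<close>)
  then show "PPm.\<theta> q ((v \<boxtimes>\<^bsub>PPH\<^esub> h) \<otimes>\<^bsub>PPH\<^esub> (Y \<boxtimes>\<^bsub>PPH\<^esub> \<one>\<^bsub>H\<^esub>)) = PPm.\<theta> q (v \<boxtimes>\<^bsub>PPH\<^esub> h) \<otimes>\<^bsub>PPH\<^esub> (Y \<boxtimes>\<^bsub>PPH\<^esub> \<one>\<^bsub>H\<^esub>)"
    using v Y q by (simp add: PPm.\<theta>_pure)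
qed (use Y in auto)

text \<open>For \<open>X = p \<otimes> q\<close> and \<open>Y = r \<otimes> u\<close> the
  \<open>H\<close>-factor is \<open>p_1 (r_1 u_1) q_1\<close>. The part belonging to
  \<open>Y\<close> stands together and collapses to \<open>1\<close> when \<open>Y\<close> is
  coinvariant; without this, noncommutativity of \<open>H\<close> obstructs
  multiplicativity.\<close>

lemma diag_mult:
  assumes X: "X \<in> carrier PP" and Y: "Y \<in> carrier L"
  shows "diag (X \<otimes>\<^bsub>PP\<^esub> Y) = diag X \<otimes>\<^bsub>PPH\<^esub> (Y \<boxtimes>\<^bsub>PPH\<^esub> \<one>\<^bsub>H\<^esub>)"
proof -
  have Y': "Y \<in> carrier PP" using Y by (rule L_closed)
  note ag = PPm.MH.T.abelian_group_axioms
  \<comment> \<open>The coactions of \<open>p\<close> and \<open>q\<close> enclose the whole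
    coaction of \<open>Z\<close>.\<close>
  have 1: "diag ((p \<boxtimes>\<^bsub>PP\<^esub> q) \<otimes>\<^bsub>PP\<^esub> Z) = PPm.\<theta> q (src_ext (\<delta> p) \<otimes>\<^bsub>PPH\<^esub> diag Z)"
    if "p \<in> carrier P" "q \<in> carrier P" "Z \<in> carrier PP" for p q Z
    by (rule PP_hom_ext[OF ag ahom_comp[OF diag_hom PP.mult_left_hom]
          ahom_comp[OF PPm.\<theta>_hom ahom_comp[OF PPm.MH.mult_left_hom diag_hom]] _ that(3)])
      (use that in \<open>simp_all add: diag_pure \<delta>_mult src_ext_mult PPm.\<theta>_mult \<theta>_src_ext_mult\<close>)
  show ?thesis
  proof (rule PP_hom_ext[OF ag ahom_comp[OF diag_hom PP.mult_right_hom[OF Y']] ahom_comp[OF PPm.MH.mult_right_hom diag_hom] _ X])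
    fix p q assume pq: "p \<in> carrier P" "q \<in> carrier P"
    then show "diag ((p \<boxtimes>\<^bsub>PP\<^esub> q) \<otimes>\<^bsub>PP\<^esub> Y) = diag (p \<boxtimes>\<^bsub>PP\<^esub> q) \<otimes>\<^bsub>PPH\<^esub> (Y \<boxtimes>\<^bsub>PPH\<^esub> \<one>\<^bsub>H\<^esub>)"
      using 1[OF pq Y'] Y Y' by (simp add: L_iff \<theta>_mult_right diag_pure)
  qed (use Y' in simp)
qed

lemma src_in_L: "b \<in> carrier B \<Longrightarrow> src b \<in> carrier L"
  using B_closed[of b] by (simp add: L_iff diag_pure PPm.\<theta>_one) (simp add: B_iff src_ext_pure)

lemma tgt_in_L: "b \<in> carrier B \<Longrightarrow> tgt b \<in> carrier L"
  using B_closed[of b] by (simp add: L_iff diag_pure \<delta>_one src_ext_pure PPm.\<theta>_coinvariant)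

lemma L_algebra: "algebra_over_field K L"
proof (subst L_eq, rule subalgebra_algebra[OF PP.AB.algebra_over_field_axioms])
  show "\<one>\<^bsub>PP\<^esub> \<in> carrier L" using src_in_L[OF B.A.one_closed] by (simp add: PP.one_eq)
  fix X Y assume XY: "X \<in> carrier L" "Y \<in> carrier L"
  show "X \<otimes>\<^bsub>PP\<^esub> Y \<in> carrier L"
    using XY diag_mult[OF L_closed[OF XY(1)] XY(2)] by (simp add: L_iff)
  show "X \<oplus>\<^bsub>PP\<^esub> Y \<in> carrier L"
    using XY by (simp add: L_iff ahom_add[OF diag_hom] ahom_add[OF PPm.MH.pure_hom_left])
qed (auto simp: L_iff diag_smult PPm.MH.smult_pure)

sublocale L: algebra_over_field K L by (rule L_algebra)

abbreviation tact where "tact \<equiv> (\<lambda>X b. tgt b \<otimes>\<^bsub>PP\<^esub> X)"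

text \<open>Turns the equation defining \<open>L\<close> into the kernel of a
  \<open>B\<close>-linear map, to which flatness applies.\<close>

definition gap where "gap v = diag v \<ominus>\<^bsub>PPH\<^esub> (v \<boxtimes>\<^bsub>PPH\<^esub> \<one>\<^bsub>H\<^esub>)"

lemma gap_hom: "gap \<in> right_module_hom B PP tact PPH (\<lambda>Z x. PPm.\<theta> x Z)"
proof (rule right_module_homI)
  show "gap \<in> ahom PP PPH"
    unfolding gap_def
    by (rule ahomI)
      (auto simp: ahom_add[OF diag_hom] ahom_add[OF PPm.MH.pure_hom_left] PPm.MH.T.minus_eq PPm.MH.T.minus_add PPm.MH.T.a_ac)
  fix v b assume v: "v \<in> carrier PP" and b: "b \<in> carrier B"
  show "gap (tgt b \<otimes>\<^bsub>PP\<^esub> v) = PPm.\<theta> b (gap v)"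
    using v b B_closed[OF b] unfolding gap_def
    by (simp add: ahom_minus[OF PPm.\<theta>_hom PPm.MH.T.abelian_group_axioms PPm.MH.T.abelian_group_axioms] diag_act PPm.\<theta>_coinvariant)
qed

text \<open>An equality of records, since the kernel lemma for flat modules speaks about
  \<open>PP\<close> with a restricted carrier.\<close>

lemma L_kernel: "L = PP\<lparr>carrier := a_kernel PP PPH gap\<rparr>"
proof -
  have "gap X = \<zero>\<^bsub>PPH\<^esub> \<longleftrightarrow> diag X = X \<boxtimes>\<^bsub>PPH\<^esub> \<one>\<^bsub>H\<^esub>" if "X \<in> carrier PP" for X
    using that by (simp add: gap_def PPm.MH.T.minus_eq_zero_iff)
  then have kern: "X \<in> carrier L \<longleftrightarrow> X \<in> a_kernel PP PPH gap" for X
    unfolding L_iff a_kernel_def kernel_def by (simp cong: conj_cong)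
  have "carrier L = a_kernel PP PPH gap" by (rule Set.set_eqI, rule kern)
  then show ?thesis using L_eq by metis
qed

lemma L_right_module: "right_module B L tact"
  unfolding L_kernel
  by (rule kernel_right_module[OF right_module_restrict[OF tgt_right_module] right_module_restrict[OF PPm.\<theta>_right_module] gap_hom])

abbreviation LP where "LP \<equiv> tensor B L tact P (\<lambda>b p. b \<otimes>\<^bsub>P\<^esub> p)"

sublocale LP: tensor_product B L tact P "\<lambda>b p. b \<otimes>\<^bsub>P\<^esub> p" LP
  by (rule tensor_productI[OF L_right_module P_left_B_module])

text \<open>The map \<open>\<B> \<otimes>\<^sub>B P \<rightarrow> P \<otimes> P\<close>, \<open>p \<otimes> q \<otimes> x \<mapsto> p \<otimes> qx\<close>.\<close>

definition \<mu> where "\<mu> = tensor_lift PP (\<lambda>X x. tgt x \<otimes>\<^bsub>PP\<^esub> X)"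

lemma \<mu>_balanced: "balanced B L tact P (\<lambda>b p. b \<otimes>\<^bsub>P\<^esub> p) PP (\<lambda>X x. tgt x \<otimes>\<^bsub>PP\<^esub> X)"
proof (rule balancedI)
  show "(\<lambda>x. tgt x \<otimes>\<^bsub>PP\<^esub> X) \<in> ahom P PP" if "X \<in> carrier L" for X
    by (rule ahom_comp[OF PP.mult_right_hom[OF L_closed[OF that]]]) auto
  show "(\<lambda>X. tgt x \<otimes>\<^bsub>PP\<^esub> X) \<in> ahom L PP" if "x \<in> carrier P" for x
    using that by (intro ahomI) (auto simp: L_closed PP.AB.A.r_distr)
  show "tgt x \<otimes>\<^bsub>PP\<^esub> (tgt b \<otimes>\<^bsub>PP\<^esub> X) = tgt (b \<otimes>\<^bsub>P\<^esub> x) \<otimes>\<^bsub>PP\<^esub> X"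
    if "X \<in> carrier L" "b \<in> carrier B" "x \<in> carrier P" for X b x
    using that by (simp add: L_closed B_closed flip: PP.AB.A.m_assoc)
qed

lemma \<mu>_hom: "\<mu> \<in> ahom LP PP"
  unfolding \<mu>_def by (rule LP.lift_hom[OF PP.T.abelian_group_axioms \<mu>_balanced])

lemma \<mu>_pure: "X \<in> carrier L \<Longrightarrow> x \<in> carrier P \<Longrightarrow> \<mu> (X \<boxtimes>\<^bsub>LP\<^esub> x) = tgt x \<otimes>\<^bsub>PP\<^esub> X"
  unfolding \<mu>_def by (rule LP.lift_pure[OF PP.T.abelian_group_axioms \<mu>_balanced])

abbreviation incl where "incl \<equiv> tensor_right_map B PP tact P (\<lambda>b p. b \<otimes>\<^bsub>P\<^esub> p) (\<lambda>x. x)"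

lemma tensor_functor_P: "tensor_functor B P (\<lambda>b p. b \<otimes>\<^bsub>P\<^esub> p)"
  unfolding tensor_functor_def by (rule P_left_B_module)

lemma L_incl_hom: "(\<lambda>x. x) \<in> right_module_hom B L tact PP tact"
  by (subst L_eq, rule inclusion_right_module_hom) (auto simp: L_closed)

lemmas incl_hom = tensor_functor.map_hom[OF tensor_functor_P L_right_module right_module_restrict[OF tgt_right_module] L_incl_hom]
  and incl_pure = tensor_functor.map_pure[OF tensor_functor_P L_right_module right_module_restrict[OF tgt_right_module] L_incl_hom]

text \<open>For coinvariant \<open>X\<close> the element \<open>X \<otimes> 1\<close> equals
  \<open>diag X\<close>, so acting by \<open>x\<close> gives \<open>diag\<close> of
  \<open>Xx\<close>. Read through \<open>C\<close>, the inclusion of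
  \<open>L \<otimes>\<^sub>B P\<close> is therefore \<open>diag\<close> after \<mu>.\<close>

lemma C_incl:
  assumes "\<xi> \<in> carrier LP" shows "PPm.C (incl \<xi>) = diag (\<mu> \<xi>)"
  by (rule LP.hom_ext[OF PPm.MH.T.abelian_group_axioms ahom_comp[OF PPm.C_hom incl_hom] ahom_comp[OF diag_hom \<mu>_hom] _ assms])
    (simp_all add: \<mu>_pure incl_pure L_closed PPm.C_pure_\<theta> diag_act, simp add: L_iff)

text \<open>Read through \<open>C\<close>, the tensored map \<open>gap \<otimes>\<^sub>B P\<close>
  measures the failure of coassociativity. On \<open>v \<otimes> y\<close> both terms come from the
  action of \<open>y\<close>, with which \<open>coa\<close> and \<open>com\<close> commute.\<close>

lemma gap_map:
  assumes "\<xi> \<in> carrier PPm.MP"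
  shows "PPHm.C (tensor_right_map B PPH (\<lambda>Z x. PPm.\<theta> x Z) P (\<lambda>b p. b \<otimes>\<^bsub>P\<^esub> p) gap \<xi>) =
    coa (PPm.C \<xi>) \<ominus>\<^bsub>PPHH\<^esub> com (PPm.C \<xi>)"
proof -
  note R = right_module_restrict[OF tgt_right_module] right_module_restrict[OF PPm.\<theta>_right_module]
  note map = tensor_functor.map_hom[OF tensor_functor_P R gap_hom] tensor_functor.map_pure[OF tensor_functor_P R gap_hom]
  note ag = PPHm.MH.T.abelian_group_axioms
  have h: "(\<lambda>\<xi>. coa (PPm.C \<xi>) \<ominus>\<^bsub>PPHH\<^esub> com (PPm.C \<xi>)) \<in> ahom PPm.MP PPHH"
    using ahom_comp[OF coa_hom PPm.C_hom] ahom_comp[OF com_hom PPm.C_hom]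
    by (intro ahomI) (auto simp: hom_def Pi_def PPHm.MH.T.minus_eq PPHm.MH.T.minus_add PPHm.MH.T.a_ac)
  show ?thesis
  proof (rule PPm.MP.hom_ext[OF ag ahom_comp[OF PPHm.C_hom map(1)] h _ assms])
    fix v y assume v: "v \<in> carrier PP" and y: "y \<in> carrier P"
    have coa1: "PPHm.\<theta> y (diag v \<boxtimes>\<^bsub>PPHH\<^esub> \<one>\<^bsub>H\<^esub>) = coa (PPm.C (v \<boxtimes>\<^bsub>PPm.MP\<^esub> y))"
      using v y by (simp add: PPm.C_pure_\<theta> coa_\<theta> coa_pure)
    have com1: "PPHm.\<theta> y ((v \<boxtimes>\<^bsub>PPH\<^esub> \<one>\<^bsub>H\<^esub>) \<boxtimes>\<^bsub>PPHH\<^esub> \<one>\<^bsub>H\<^esub>) = com (PPm.C (v \<boxtimes>\<^bsub>PPm.MP\<^esub> y))"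
      using v y by (simp add: PPm.C_pure_\<theta> com_\<theta> com_one)
    have gc: "gap v \<in> carrier PPH" using v by (simp add: gap_def)
    have "PPHm.C (tensor_right_map B PPH (\<lambda>Z x. PPm.\<theta> x Z) P (\<lambda>b p. b \<otimes>\<^bsub>P\<^esub> p) gap (v \<boxtimes>\<^bsub>PPm.MP\<^esub> y)) =
      PPHm.\<theta> y (gap v \<boxtimes>\<^bsub>PPHH\<^esub> \<one>\<^bsub>H\<^esub>)"
      using v y gc by (simp add: map(2) PPHm.C_pure_\<theta>)
    also have "gap v \<boxtimes>\<^bsub>PPHH\<^esub> \<one>\<^bsub>H\<^esub> = (diag v \<boxtimes>\<^bsub>PPHH\<^esub> \<one>\<^bsub>H\<^esub>) \<ominus>\<^bsub>PPHH\<^esub> ((v \<boxtimes>\<^bsub>PPH\<^esub> \<one>\<^bsub>H\<^esub>) \<boxtimes>\<^bsub>PPHH\<^esub> \<one>\<^bsub>H\<^esub>)"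
      unfolding gap_def
      by (rule ahom_minus[OF PPHm.MH.pure_hom_left[OF A.one_closed] PPm.MH.T.abelian_group_axioms ag]) (use v in simp_all)
    also have "PPHm.\<theta> y \<dots> = PPHm.\<theta> y (diag v \<boxtimes>\<^bsub>PPHH\<^esub> \<one>\<^bsub>H\<^esub>) \<ominus>\<^bsub>PPHH\<^esub> PPHm.\<theta> y ((v \<boxtimes>\<^bsub>PPH\<^esub> \<one>\<^bsub>H\<^esub>) \<boxtimes>\<^bsub>PPHH\<^esub> \<one>\<^bsub>H\<^esub>)"
      by (rule ahom_minus[OF PPHm.\<theta>_hom[OF y] ag ag]) (use v in simp_all)
    finally show "PPHm.C (tensor_right_map B PPH (\<lambda>Z x. PPm.\<theta> x Z) P (\<lambda>b p. b \<otimes>\<^bsub>P\<^esub> p) gap (v \<boxtimes>\<^bsub>PPm.MP\<^esub> y)) =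
      coa (PPm.C (v \<boxtimes>\<^bsub>PPm.MP\<^esub> y)) \<ominus>\<^bsub>PPHH\<^esub> com (PPm.C (v \<boxtimes>\<^bsub>PPm.MP\<^esub> y))"
      by (simp add: coa1 com1)
  qed
qed

end

section \<open>Galois descent for the diagonal coaction\<close>

sublocale hopf_galois_extension \<subseteq> PPg: galois_module K H \<Delta> \<epsilon> S P \<delta> PP "\<lambda>v x. tgt x \<otimes>\<^bsub>PP\<^esub> v"
  by unfold_locales

sublocale hopf_galois_extension \<subseteq> PPHg: galois_module K H \<Delta> \<epsilon> S P \<delta> PPH "\<lambda>Z x. PPm.\<theta> x Z"
  by unfold_locales

text \<open>The universe type contains copies of the carriers of \<open>H\<close> and
  \<open>P\<close>; being infinite, it also receives every tensor product built from them, over the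
  field or over \<open>B\<close>.\<close>

locale faithfully_flat_galois = hopf_galois_extension K H \<Delta> \<epsilon> S P \<delta>
  for K :: "('k, 'c) ring_scheme" (structure) and H :: "('k, 'h, 'd) module_scheme" (structure) and \<Delta> \<epsilon> S
    and P :: "('k, 'p, 'e) module_scheme" (structure) and \<delta> +
  assumes FF: "faithfully_flat_left TYPE(('h + 'p) list) B P (\<lambda>b p. b \<otimes>\<^bsub>P\<^esub> p)"
begin

lemma infinite_universe: "infinite (UNIV :: ('h + 'p) list set)"
  by (rule infinite_UNIV_listI)

lemma embeds_P: "embeds TYPE(('h + 'p) list) (carrier P)"
  unfolding embeds_def by (rule exI[of _ "\<lambda>p. [Inr p]"]) (simp add: inj_on_def)

lemma embeds_H: "embeds TYPE(('h + 'p) list) (carrier H)"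
  unfolding embeds_def by (rule exI[of _ "\<lambda>h. [Inl h]"]) (simp add: inj_on_def)

lemma embeds_PP: "embeds TYPE(('h + 'p) list) (carrier PP)"
  by (rule PP.embeds_tensor[OF infinite_universe]) (simp_all add: embeds_P)

lemma embeds_PPH: "embeds TYPE(('h + 'p) list) (carrier PPH)"
  by (rule PPm.MH.embeds_tensor[OF infinite_universe embeds_PP embeds_H])

lemma embeds_L: "embeds TYPE(('h + 'p) list) (carrier L)"
  by (rule embeds_subset[OF embeds_PP]) (auto simp: L_closed)

lemma incl_inj: "inj_on incl (carrier LP)"
  using faithfully_flat_inj[OF FF L_right_module right_module_restrict[OF tgt_right_module] embeds_L embeds_PP L_incl_hom]
  by simp

text \<open>Coassociativity makes \<open>coa\<close> and \<open>com\<close> agree at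
  \<open>diag v\<close>. As \<open>C\<close> is injective with coefficients in \<open>PPH\<close>,
  the tensor \<open>D (diag v)\<close> is killed by \<open>gap \<otimes>\<^sub>B P\<close>, and
  flatness puts it into the image of \<open>L \<otimes>\<^sub>B P\<close>.\<close>

lemma incl_onto:
  assumes v: "v \<in> carrier PP"
  shows "\<exists>\<xi>\<in>carrier LP. incl \<xi> = PPg.D (diag v)"
proof -
  note R = right_module_restrict[OF tgt_right_module] right_module_restrict[OF PPm.\<theta>_right_module]
  let ?g = "tensor_right_map B PPH (\<lambda>Z x. PPm.\<theta> x Z) P (\<lambda>b p. b \<otimes>\<^bsub>P\<^esub> p) gap"
  have D: "PPg.D (diag v) \<in> carrier PPm.MP" using v by simp
  have g: "?g (PPg.D (diag v)) \<in> carrier PPHm.MP"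
    by (rule tensor_functor.map_closed[OF tensor_functor_P R gap_hom D])
  have "PPHm.C (?g (PPg.D (diag v))) = coa (diag v) \<ominus>\<^bsub>PPHH\<^esub> com (diag v)"
    using gap_map[OF D] v by (simp add: PPg.C_D)
  also have "\<dots> = \<zero>\<^bsub>PPHH\<^esub>"
    using v ahom_closed[OF com_hom diag_closed[OF v]] by (simp add: diag_coassoc PPHm.MH.T.minus_eq PPHm.MH.T.r_neg)
  also have "\<dots> = PPHm.C \<zero>\<^bsub>PPHm.MP\<^esub>"
    using ahom_zero[OF PPHm.C_hom PPHm.MP.T.abelian_group_axioms PPHm.MH.T.abelian_group_axioms] by simp
  finally have "?g (PPg.D (diag v)) = \<zero>\<^bsub>PPHm.MP\<^esub>"
    by (rule PPHg.C_inj[OF g PPHm.MP.T.zero_closed])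
  then have "PPg.D (diag v) \<in> incl ` carrier (tensor B (PP\<lparr>carrier := a_kernel PP PPH gap\<rparr>) tact P (\<lambda>b p. b \<otimes>\<^bsub>P\<^esub> p))"
    by (rule faithfully_flat_kernel[OF FF R embeds_PP embeds_PPH gap_hom D])
  then show ?thesis unfolding L_kernel[symmetric] by auto
qed

text \<open>Both halves use \<open>C_incl\<close>. Since \<open>incl\<close> and \<open>C\<close>
  are injective, so is \<mu>; and \<open>incl\<close> reaches \<open>D (diag v)\<close>, whose value
  under \<open>C\<close> is \<open>diag v\<close>, from which \<eta> recovers
  \<open>v\<close>.\<close>

lemma \<mu>_bij: "bij_betw \<mu> (carrier LP) (carrier PP)"
  unfolding bij_betw_def
proof
  show "inj_on \<mu> (carrier LP)"
  proof (rule inj_onI)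
    fix \<xi> \<zeta> assume a: "\<xi> \<in> carrier LP" "\<zeta> \<in> carrier LP" "\<mu> \<xi> = \<mu> \<zeta>"
    then have "PPm.C (incl \<xi>) = PPm.C (incl \<zeta>)" by (simp add: C_incl)
    then have "incl \<xi> = incl \<zeta>" using a ahom_closed[OF incl_hom] PPg.C_inj by blast
    then show "\<xi> = \<zeta>" using incl_inj a by (auto dest: inj_onD)
  qed
  show "\<mu> ` carrier LP = carrier PP"
  proof (intro equalityI subsetI)
    fix v assume v: "v \<in> carrier PP"
    obtain \<xi> where \<xi>: "\<xi> \<in> carrier LP" "incl \<xi> = PPg.D (diag v)" using incl_onto[OF v] by blast
    have "diag (\<mu> \<xi>) = diag v" using C_incl[OF \<xi>(1)] \<xi>(2) v by (simp add: PPg.C_D)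
    then have "\<mu> \<xi> = v" using \<eta>_diag v ahom_closed[OF \<mu>_hom \<xi>(1)] by metis
    then show "v \<in> \<mu> ` carrier LP" using \<xi>(1) by blast
  qed (auto intro: ahom_closed[OF \<mu>_hom])
qed

end

section \<open>Faithfully flat descent for \<open>\<B> \<otimes>\<^sub>B N\<close>\<close>

text \<open>
  \<open>N\<close> is a \<open>B\<close>-bimodule, here \<open>\<B>\<close> or \<open>\<B> \<otimes>\<^sub>B \<B>\<close>, for which \<open>E \<cong> N \<otimes>\<^sub>B P\<close> is already known; the maps
  \<open>e\<close> exhibit \<open>E\<close> as a quotient of \<open>P \<otimes> U\<close> compatibly with the left action of \<open>B\<close>.
\<close>

locale descent_step = faithfully_flat_galois K H \<Delta> \<epsilon> S P \<delta> + Nr: right_module B N rn + Nl: left_module B N ln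
    + E: abelian_group E + U: abelian_group U
  for K :: "('k, 'c) ring_scheme" (structure) and H :: "('k, 'h, 'd) module_scheme" (structure) and \<Delta> \<epsilon> S
    and P :: "('k, 'p, 'e) module_scheme" (structure) and \<delta>
    and N :: "('n, 'a1) ring_scheme" and rn ln and E :: "('e1, 'a2) ring_scheme" and U :: "('k, 'u1, 'a3) module_scheme" +
  fixes \<nu> :: "(('n \<times> 'p) \<Rightarrow>\<^sub>0 int) set \<Rightarrow> 'e1" and e :: "'p \<Rightarrow> 'u1 \<Rightarrow> 'e1" and lE :: "'p \<Rightarrow> 'e1 \<Rightarrow> 'e1"
  assumes actions_commute: "\<And>a n b. \<lbrakk>a \<in> carrier B; n \<in> carrier N; b \<in> carrier B\<rbrakk> \<Longrightarrow> rn (ln a n) b = ln a (rn n b)"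
    and \<nu>_hom: "\<nu> \<in> ahom (tensor B N rn P (\<lambda>b p. b \<otimes>\<^bsub>P\<^esub> p)) E"
    and \<nu>_bij: "bij_betw \<nu> (carrier (tensor B N rn P (\<lambda>b p. b \<otimes>\<^bsub>P\<^esub> p))) (carrier E)"
    and U_smult: "\<And>k u. \<lbrakk>k \<in> carrier K; u \<in> carrier U\<rbrakk> \<Longrightarrow> k \<odot>\<^bsub>U\<^esub> u \<in> carrier U"
    and e_hom_left: "\<And>u. u \<in> carrier U \<Longrightarrow> (\<lambda>x. e x u) \<in> ahom P E"
    and e_hom_right: "\<And>x. x \<in> carrier P \<Longrightarrow> (\<lambda>u. e x u) \<in> ahom U E"
    and e_smult: "\<And>k x u. \<lbrakk>k \<in> carrier K; x \<in> carrier P; u \<in> carrier U\<rbrakk> \<Longrightarrow> e (k \<odot>\<^bsub>P\<^esub> x) u = e x (k \<odot>\<^bsub>U\<^esub> u)"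
    and lE_hom: "\<And>b. b \<in> carrier B \<Longrightarrow> lE b \<in> ahom E E"
    and lE_e: "\<And>b x u. \<lbrakk>b \<in> carrier B; x \<in> carrier P; u \<in> carrier U\<rbrakk> \<Longrightarrow> lE b (e x u) = e (b \<otimes>\<^bsub>P\<^esub> x) u"
    and lE_\<nu>: "\<And>b n z. \<lbrakk>b \<in> carrier B; n \<in> carrier N; z \<in> carrier P\<rbrakk> \<Longrightarrow>
        \<nu> (ln b n \<boxtimes>\<^bsub>tensor B N rn P (\<lambda>b p. b \<otimes>\<^bsub>P\<^esub> p)\<^esub> z) = lE b (\<nu> (n \<boxtimes>\<^bsub>tensor B N rn P (\<lambda>b p. b \<otimes>\<^bsub>P\<^esub> p)\<^esub> z))"
begin

abbreviation NP where "NP \<equiv> tensor B N rn P (\<lambda>b p. b \<otimes>\<^bsub>P\<^esub> p)"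

interpretation NP: tensor_product B N rn P "\<lambda>b p. b \<otimes>\<^bsub>P\<^esub> p" NP
  by (rule tensor_productI[OF Nr.right_module_axioms P_left_B_module])

abbreviation LN where "LN \<equiv> tensor B L tact N ln"

interpretation LN: tensor_product B L tact N ln LN
  by (rule tensor_productI[OF L_right_module Nl.left_module_axioms])

abbreviation rLN where "rLN \<equiv> (\<lambda>X b. tensor_lift LN (\<lambda>x y. x \<boxtimes>\<^bsub>LN\<^esub> rn y b) X)"

lemma LN_comm: "a \<in> carrier B \<Longrightarrow> b \<in> carrier B \<Longrightarrow> n \<in> carrier N \<Longrightarrow> rn (ln a n) b = ln a (rn n b)"
  by (simp add: actions_commute)

lemma rLN_pure: "\<lbrakk>X \<in> carrier L; n \<in> carrier N; b \<in> carrier B\<rbrakk> \<Longrightarrow> rLN (X \<boxtimes>\<^bsub>LN\<^esub> n) b = X \<boxtimes>\<^bsub>LN\<^esub> rn n b"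
  using LN.right_act_pure[OF Nr.right_module_axioms LN_comm] by (simp add: LN.right_act_def)

lemma rLN_module: "right_module B LN rLN"
  using LN.right_act_module[OF Nr.right_module_axioms LN_comm] by (simp add: LN.right_act_def[abs_def])

abbreviation LNP where "LNP \<equiv> tensor B LN rLN P (\<lambda>b p. b \<otimes>\<^bsub>P\<^esub> p)"

interpretation LNP: tensor_product B LN rLN P "\<lambda>b p. b \<otimes>\<^bsub>P\<^esub> p" LNP
  by (rule tensor_productI[OF rLN_module P_left_B_module])

text \<open>Tensoring with \<open>X\<close> on the left, with the result rebracketed as
  \<open>(L \<otimes>\<^sub>B N) \<otimes>\<^sub>B P\<close>.\<close>

definition ext where "ext X = tensor_lift LNP (\<lambda>n z. (X \<boxtimes>\<^bsub>LN\<^esub> n) \<boxtimes>\<^bsub>LNP\<^esub> z)"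

lemma ext_balanced:
  assumes "X \<in> carrier L"
  shows "balanced B N rn P (\<lambda>b p. b \<otimes>\<^bsub>P\<^esub> p) LNP (\<lambda>n z. (X \<boxtimes>\<^bsub>LN\<^esub> n) \<boxtimes>\<^bsub>LNP\<^esub> z)"
proof (rule balancedI)
  show "(\<lambda>z. (X \<boxtimes>\<^bsub>LN\<^esub> n) \<boxtimes>\<^bsub>LNP\<^esub> z) \<in> ahom P LNP" if "n \<in> carrier N" for n
    by (rule LNP.pure_hom_right) (use assms that in simp)
  show "(\<lambda>n. (X \<boxtimes>\<^bsub>LN\<^esub> n) \<boxtimes>\<^bsub>LNP\<^esub> z) \<in> ahom N LNP" if "z \<in> carrier P" for z
    by (rule LNP.pure_left_comp[OF that LN.pure_hom_right[OF assms]])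
  show "(X \<boxtimes>\<^bsub>LN\<^esub> rn n b) \<boxtimes>\<^bsub>LNP\<^esub> z = (X \<boxtimes>\<^bsub>LN\<^esub> n) \<boxtimes>\<^bsub>LNP\<^esub> (b \<otimes>\<^bsub>P\<^esub> z)"
    if "n \<in> carrier N" "b \<in> carrier B" "z \<in> carrier P" for n b z
    using LNP.pure_balance[of "X \<boxtimes>\<^bsub>LN\<^esub> n" b z] that assms by (simp add: rLN_pure)
qed

lemma ext_hom: "X \<in> carrier L \<Longrightarrow> ext X \<in> ahom NP LNP"
  unfolding ext_def by (rule NP.lift_hom[OF LNP.T.abelian_group_axioms ext_balanced])

lemma ext_pure: "X \<in> carrier L \<Longrightarrow> n \<in> carrier N \<Longrightarrow> z \<in> carrier P \<Longrightarrow>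
    ext X (n \<boxtimes>\<^bsub>NP\<^esub> z) = (X \<boxtimes>\<^bsub>LN\<^esub> n) \<boxtimes>\<^bsub>LNP\<^esub> z"
  unfolding ext_def by (rule NP.lift_pure[OF LNP.T.abelian_group_axioms ext_balanced])

lemma ext_param_hom: "\<zeta> \<in> carrier NP \<Longrightarrow> (\<lambda>X. ext X \<zeta>) \<in> ahom L LNP"
  unfolding ext_def
  by (rule NP.lift_param_hom[OF LNP.T.abelian_group_axioms], assumption)
    (intro LNP.pure_left_comp LN.pure_hom_left)

abbreviation \<nu>' where "\<nu>' \<equiv> inv_into (carrier NP) \<nu>"

lemma \<nu>'_hom: "\<nu>' \<in> ahom E NP"
  by (rule ahom_inv_into[OF \<nu>_hom \<nu>_bij NP.T.abelian_group_axioms])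

lemma \<nu>_\<nu>': "y \<in> carrier E \<Longrightarrow> \<nu> (\<nu>' y) = y"
  using \<nu>_bij by (simp add: bij_betw_inv_into_right)

lemma \<nu>'_\<nu>: "\<zeta> \<in> carrier NP \<Longrightarrow> \<nu>' (\<nu> \<zeta>) = \<zeta>"
  using \<nu>_bij by (simp add: bij_betw_inv_into_left)

lemma e_closed: "x \<in> carrier P \<Longrightarrow> u \<in> carrier U \<Longrightarrow> e x u \<in> carrier E"
  using e_hom_left by (rule ahom_closed)

text \<open>Transports the left \<open>B\<close>-action of \<open>N\<close> through \<nu>. It
  supplies the balancing condition under which \<open>G\<close> is well defined on
  \<open>L \<otimes>\<^sub>B P\<close>.\<close>

lemma ext_lE:
  assumes X: "X \<in> carrier L" and b: "b \<in> carrier B" and y: "y \<in> carrier E"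
  shows "ext X (\<nu>' (lE b y)) = ext (tgt b \<otimes>\<^bsub>PP\<^esub> X) (\<nu>' y)"
proof -
  have tX: "tgt b \<otimes>\<^bsub>PP\<^esub> X \<in> carrier L"
    using X b right_module.closed[OF L_right_module] by simp
  have 1: "lE b (\<nu> \<zeta>) \<in> carrier E" if "\<zeta> \<in> carrier NP" for \<zeta>
    using ahom_closed[OF lE_hom[OF b]] ahom_closed[OF \<nu>_hom that] by blast
  have "ext X (\<nu>' (lE b (\<nu> \<zeta>))) = ext (tgt b \<otimes>\<^bsub>PP\<^esub> X) \<zeta>" if \<zeta>: "\<zeta> \<in> carrier NP" for \<zeta>
  proof (rule NP.hom_ext[OF LNP.T.abelian_group_axioms ahom_comp[OF ext_hom[OF X] ahom_comp[OF \<nu>'_hom ahom_comp[OF lE_hom[OF b] \<nu>_hom]]] ext_hom[OF tX] _ \<zeta>])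
    fix n z assume nz: "n \<in> carrier N" "z \<in> carrier P"
    have "ext X (\<nu>' (lE b (\<nu> (n \<boxtimes>\<^bsub>NP\<^esub> z)))) = ext X (ln b n \<boxtimes>\<^bsub>NP\<^esub> z)"
      using nz b by (simp add: Nl.closed \<nu>'_\<nu> flip: lE_\<nu>)
    also have "\<dots> = ext (tgt b \<otimes>\<^bsub>PP\<^esub> X) (n \<boxtimes>\<^bsub>NP\<^esub> z)"
      using nz b X tX LN.pure_balance[OF X b nz(1)] by (simp add: ext_pure Nl.closed)
    finally show "ext X (\<nu>' (lE b (\<nu> (n \<boxtimes>\<^bsub>NP\<^esub> z)))) = ext (tgt b \<otimes>\<^bsub>PP\<^esub> X) (n \<boxtimes>\<^bsub>NP\<^esub> z)" .
  qed
  from this[OF ahom_closed[OF \<nu>'_hom y]] show ?thesis using y by (simp add: \<nu>_\<nu>')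
qed

text \<open>For fixed \<open>u\<close> this is
  \<open>X \<otimes> x \<mapsto> X \<otimes> \<nu>'(e x u)\<close>. Precomposed with the inverse of
  \<mu>, it gives the future inverse map on \<open>P \<otimes> P\<close> with \<open>u\<close> as a
  parameter.\<close>

definition G where "G u = tensor_lift LNP (\<lambda>X x. ext X (\<nu>' (e x u)))"

lemma G_balanced:
  assumes u: "u \<in> carrier U"
  shows "balanced B L tact P (\<lambda>b p. b \<otimes>\<^bsub>P\<^esub> p) LNP (\<lambda>X x. ext X (\<nu>' (e x u)))"
proof (rule balancedI)
  show "(\<lambda>x. ext X (\<nu>' (e x u))) \<in> ahom P LNP" if "X \<in> carrier L" for X
    by (rule ahom_comp[OF ext_hom[OF that] ahom_comp[OF \<nu>'_hom e_hom_left[OF u]]])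
  show "(\<lambda>X. ext X (\<nu>' (e x u))) \<in> ahom L LNP" if "x \<in> carrier P" for x
    by (rule ext_param_hom[OF ahom_closed[OF \<nu>'_hom e_closed[OF that u]]])
  show "ext (tgt b \<otimes>\<^bsub>PP\<^esub> X) (\<nu>' (e x u)) = ext X (\<nu>' (e (b \<otimes>\<^bsub>P\<^esub> x) u))"
    if "X \<in> carrier L" "b \<in> carrier B" "x \<in> carrier P" for X b x
    using that u by (simp add: ext_lE e_closed flip: lE_e)
qed

lemma G_hom: "u \<in> carrier U \<Longrightarrow> G u \<in> ahom LP LNP"
  unfolding G_def by (rule LP.lift_hom[OF LNP.T.abelian_group_axioms G_balanced])

lemma G_pure: "u \<in> carrier U \<Longrightarrow> X \<in> carrier L \<Longrightarrow> x \<in> carrier P \<Longrightarrow> G u (X \<boxtimes>\<^bsub>LP\<^esub> x) = ext X (\<nu>' (e x u))"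
  unfolding G_def by (rule LP.lift_pure[OF LNP.T.abelian_group_axioms G_balanced])

lemma G_param_hom: "\<xi> \<in> carrier LP \<Longrightarrow> (\<lambda>u. G u \<xi>) \<in> ahom U LNP"
  unfolding G_def
  by (rule LP.lift_param_hom[OF LNP.T.abelian_group_axioms], assumption)
    (intro ahom_comp[OF ext_hom] ahom_comp[OF \<nu>'_hom] e_hom_right)

abbreviation \<mu>' where "\<mu>' \<equiv> inv_into (carrier LP) \<mu>"

lemma \<mu>'_hom: "\<mu>' \<in> ahom PP LP"
  by (rule ahom_inv_into[OF \<mu>_hom \<mu>_bij LP.T.abelian_group_axioms])

lemma \<mu>_\<mu>': "y \<in> carrier PP \<Longrightarrow> \<mu> (\<mu>' y) = y"
  using \<mu>_bij by (simp add: bij_betw_inv_into_right)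

lemma \<mu>'_\<mu>: "\<zeta> \<in> carrier LP \<Longrightarrow> \<mu>' (\<mu> \<zeta>) = \<zeta>"
  using \<mu>_bij by (simp add: bij_betw_inv_into_left)

text \<open>Lets the assignment \<open>(v, u) \<mapsto> G u (\<mu>' v)\<close> descend to a tensor
  product over the field.\<close>

lemma G_smult:
  assumes "k \<in> carrier K" "v \<in> carrier PP" "u \<in> carrier U"
  shows "G u (\<mu>' (k \<odot>\<^bsub>PP\<^esub> v)) = G (k \<odot>\<^bsub>U\<^esub> u) (\<mu>' v)"
proof -
  have "G u (\<mu>' (k \<odot>\<^bsub>PP\<^esub> \<mu> \<xi>)) = G (k \<odot>\<^bsub>U\<^esub> u) \<xi>" if \<xi>: "\<xi> \<in> carrier LP" for \<xi>
  proof (rule LP.hom_ext[OF LNP.T.abelian_group_axioms ahom_comp[OF G_hom[OF assms(3)] ahom_comp[OF \<mu>'_hom ahom_comp[OF PP.smult_hom[OF assms(1)] \<mu>_hom]]]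
        G_hom[OF U_smult[OF assms(1,3)]] _ \<xi>])
    fix X x assume Xx: "X \<in> carrier L" "x \<in> carrier P"
    have "k \<odot>\<^bsub>PP\<^esub> \<mu> (X \<boxtimes>\<^bsub>LP\<^esub> x) = \<mu> (X \<boxtimes>\<^bsub>LP\<^esub> (k \<odot>\<^bsub>P\<^esub> x))"
      using Xx assms(1) by (simp add: \<mu>_pure L_closed PPm.act_smult)
    then show "G u (\<mu>' (k \<odot>\<^bsub>PP\<^esub> \<mu> (X \<boxtimes>\<^bsub>LP\<^esub> x))) = G (k \<odot>\<^bsub>U\<^esub> u) (X \<boxtimes>\<^bsub>LP\<^esub> x)"
      using Xx assms by (simp add: \<mu>'_\<mu> G_pure e_smult U_smult)
  qed
  from this[OF ahom_closed[OF \<mu>'_hom assms(2)]] show ?thesis using assms(2) by (simp add: \<mu>_\<mu>')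
qed

end

text \<open>
  \<open>\<gamma>\<close> is the composite \<open>E' \<cong> (\<B> \<otimes>\<^sub>B P) \<otimes> U \<cong> \<B> \<otimes>\<^sub>B E \<cong> \<B> \<otimes>\<^sub>B (N \<otimes>\<^sub>B P) \<cong> (\<B> \<otimes>\<^sub>B N) \<otimes>\<^sub>B P\<close>, inverse to
  \<open>n' \<otimes> z \<mapsto> f(n') z\<close>.
\<close>

locale descent_map = descent_step K H \<Delta> \<epsilon> S P \<delta> N rn ln E U \<nu> e lE + E': right_module P E' aE
  for K :: "('k, 'c) ring_scheme" (structure) and H :: "('k, 'h, 'd) module_scheme" (structure) and \<Delta> \<epsilon> S
    and P :: "('k, 'p, 'e) module_scheme" (structure) and \<delta>
    and N :: "('n, 'a1) ring_scheme" and rn ln and E :: "('e1, 'a2) ring_scheme" and U :: "('k, 'u1, 'a3) module_scheme"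
    and \<nu> e lE and E' :: "('e2, 'a4) ring_scheme" and aE +
  fixes e' :: "(('p \<times> 'p) \<Rightarrow>\<^sub>0 int) set \<Rightarrow> 'u1 \<Rightarrow> 'e2" and \<kappa> :: "(('p \<times> 'p) \<Rightarrow>\<^sub>0 int) set \<Rightarrow> 'e1 \<Rightarrow> 'e2"
    and f :: "(((('p \<times> 'p) \<Rightarrow>\<^sub>0 int) set \<times> 'n) \<Rightarrow>\<^sub>0 int) set \<Rightarrow> 'e2"
    and \<gamma> :: "'e2 \<Rightarrow> (((((('p \<times> 'p) \<Rightarrow>\<^sub>0 int) set \<times> 'n) \<Rightarrow>\<^sub>0 int) set \<times> 'p) \<Rightarrow>\<^sub>0 int) set"
  assumes E_generated: "\<And>g h y. \<lbrakk>g \<in> ahom E LNP; h \<in> ahom E LNP;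
        \<And>x u. x \<in> carrier P \<Longrightarrow> u \<in> carrier U \<Longrightarrow> g (e x u) = h (e x u); y \<in> carrier E\<rbrakk> \<Longrightarrow> g y = h y"
    and E'_generated: "\<And>g y. \<lbrakk>g \<in> ahom E' E'; \<And>v u. v \<in> carrier PP \<Longrightarrow> u \<in> carrier U \<Longrightarrow> g (e' v u) = e' v u;
        y \<in> carrier E'\<rbrakk> \<Longrightarrow> g y = y"
    and \<gamma>_hom: "\<gamma> \<in> ahom E' LNP"
    and \<gamma>_e': "\<And>v u. \<lbrakk>v \<in> carrier PP; u \<in> carrier U\<rbrakk> \<Longrightarrow> \<gamma> (e' v u) = G u (\<mu>' v)"
    and \<kappa>_hom: "\<And>X. X \<in> carrier L \<Longrightarrow> \<kappa> X \<in> ahom E E'"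
    and \<kappa>_e: "\<And>X x u. \<lbrakk>X \<in> carrier L; x \<in> carrier P; u \<in> carrier U\<rbrakk> \<Longrightarrow> \<kappa> X (e x u) = e' (tgt x \<otimes>\<^bsub>PP\<^esub> X) u"
    and f_hom: "f \<in> right_module_hom B LN rLN E' aE"
    and f_\<kappa>: "\<And>X n z. \<lbrakk>X \<in> carrier L; n \<in> carrier N; z \<in> carrier P\<rbrakk> \<Longrightarrow>
        aE (f (X \<boxtimes>\<^bsub>LN\<^esub> n)) z = \<kappa> X (\<nu> (n \<boxtimes>\<^bsub>NP\<^esub> z))"
    and embeds_N: "embeds TYPE(('h + 'p) list) (carrier N)"
    and embeds_E': "embeds TYPE(('h + 'p) list) (carrier E')"
begin

interpretation NP: tensor_product B N rn P "\<lambda>b p. b \<otimes>\<^bsub>P\<^esub> p" NP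
  by (rule tensor_productI[OF Nr.right_module_axioms P_left_B_module])

interpretation LN: tensor_product B L tact N ln LN
  by (rule tensor_productI[OF L_right_module Nl.left_module_axioms])

interpretation LNP: tensor_product B LN rLN P "\<lambda>b p. b \<otimes>\<^bsub>P\<^esub> p" LNP
  by (rule tensor_productI[OF rLN_module P_left_B_module])

lemmas f_closed = right_module_homD(3)[OF f_hom]

lemma E'_right_B_module: "right_module B E' aE"
  by (rule right_module_restrict[OF E'.right_module_axioms])

definition \<alpha> where "\<alpha> = tensor_lift E' (\<lambda>n z. aE (f n) z)"

lemma \<alpha>_balanced: "balanced B LN rLN P (\<lambda>b p. b \<otimes>\<^bsub>P\<^esub> p) E' (\<lambda>n z. aE (f n) z)"
proof (rule balancedI)
  show "(\<lambda>z. aE (f n) z) \<in> ahom P E'" if "n \<in> carrier LN" for n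
    by (rule right_module_scalar_hom[OF E'.right_module_axioms f_closed[OF that]])
  show "(\<lambda>n. aE (f n) z) \<in> ahom LN E'" if "z \<in> carrier P" for z
    by (rule ahom_comp[OF right_module_mult_hom[OF E'.right_module_axioms that] right_module_homD(1)[OF f_hom]])
  show "aE (f (rLN n b)) z = aE (f n) (b \<otimes>\<^bsub>P\<^esub> z)" if "n \<in> carrier LN" "b \<in> carrier B" "z \<in> carrier P" for n b z
    using that right_module_homD(2)[OF f_hom that(1,2)] by (simp add: E'.assoc B_closed f_closed)
qed

lemma \<alpha>_hom: "\<alpha> \<in> ahom LNP E'"
  unfolding \<alpha>_def by (rule LNP.lift_hom[OF E'.M.abelian_group_axioms \<alpha>_balanced])

lemma \<alpha>_pure: "n \<in> carrier LN \<Longrightarrow> z \<in> carrier P \<Longrightarrow> \<alpha> (n \<boxtimes>\<^bsub>LNP\<^esub> z) = aE (f n) z"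
  unfolding \<alpha>_def by (rule LNP.lift_pure[OF E'.M.abelian_group_axioms \<alpha>_balanced])

text \<open>\<open>\<kappa> X\<close> extends \<open>f\<close> at \<open>X\<close> linearly to
  \<open>N \<otimes>\<^sub>B P \<cong> E\<close>. On a generator \<open>e x u\<close> the claim
  holds because \<mu> sends \<open>X \<otimes> x\<close> to \<open>tgt x\<close> times
  \<open>X\<close>.\<close>

lemma \<gamma>_\<kappa>:
  assumes X: "X \<in> carrier L" and y: "y \<in> carrier E"
  shows "\<gamma> (\<kappa> X y) = ext X (\<nu>' y)"
proof (rule E_generated[OF ahom_comp[OF \<gamma>_hom \<kappa>_hom[OF X]] ahom_comp[OF ext_hom[OF X] \<nu>'_hom] _ y])
  fix x u assume xu: "x \<in> carrier P" "u \<in> carrier U"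
  have "\<mu>' (tgt x \<otimes>\<^bsub>PP\<^esub> X) = X \<boxtimes>\<^bsub>LP\<^esub> x"
    using \<mu>'_\<mu>[of "X \<boxtimes>\<^bsub>LP\<^esub> x"] X xu by (simp add: \<mu>_pure)
  then show "\<gamma> (\<kappa> X (e x u)) = ext X (\<nu>' (e x u))"
    using xu X by (simp add: \<kappa>_e \<gamma>_e' L_closed G_pure)
qed

lemma \<gamma>_\<alpha>: assumes "\<xi> \<in> carrier LNP" shows "\<gamma> (\<alpha> \<xi>) = \<xi>"
proof (rule LNP.hom_ext[OF LNP.T.abelian_group_axioms ahom_comp[OF \<gamma>_hom \<alpha>_hom] ahom_ident _ assms])
  fix n z assume n: "n \<in> carrier LN" and z: "z \<in> carrier P"
  have h1: "(\<lambda>n. \<gamma> (\<alpha> (n \<boxtimes>\<^bsub>LNP\<^esub> z))) \<in> ahom LN LNP"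
    by (rule ahom_comp[OF \<gamma>_hom ahom_comp[OF \<alpha>_hom LNP.pure_hom_left[OF z]]])
  show "\<gamma> (\<alpha> (n \<boxtimes>\<^bsub>LNP\<^esub> z)) = n \<boxtimes>\<^bsub>LNP\<^esub> z"
  proof (rule LN.hom_ext[OF LNP.T.abelian_group_axioms h1 LNP.pure_hom_left[OF z] _ n])
    fix X m assume a: "X \<in> carrier L" "m \<in> carrier N"
    then show "\<gamma> (\<alpha> ((X \<boxtimes>\<^bsub>LN\<^esub> m) \<boxtimes>\<^bsub>LNP\<^esub> z)) = (X \<boxtimes>\<^bsub>LN\<^esub> m) \<boxtimes>\<^bsub>LNP\<^esub> z"
      using z ahom_closed[OF \<nu>_hom, of "m \<boxtimes>\<^bsub>NP\<^esub> z"] by (simp add: \<alpha>_pure f_\<kappa> \<gamma>_\<kappa> \<nu>'_\<nu> ext_pure)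
  qed
qed

lemma \<alpha>_ext:
  assumes X: "X \<in> carrier L" and \<zeta>: "\<zeta> \<in> carrier NP"
  shows "\<alpha> (ext X \<zeta>) = \<kappa> X (\<nu> \<zeta>)"
  by (rule NP.hom_ext[OF E'.M.abelian_group_axioms ahom_comp[OF \<alpha>_hom ext_hom[OF X]] ahom_comp[OF \<kappa>_hom[OF X] \<nu>_hom] _ \<zeta>])
    (use X in \<open>simp add: ext_pure \<alpha>_pure f_\<kappa>\<close>)

text \<open>As \<mu> is onto, \<open>v\<close> may be replaced by \<open>\<mu> \<xi>\<close>, and
  then by the image of \<open>X \<otimes> x\<close>; there \<open>\<alpha>_ext\<close> and the
  description of \<kappa> on generators apply.\<close>

lemma \<alpha>_\<gamma>:
  assumes e'l: "\<And>u. u \<in> carrier U \<Longrightarrow> (\<lambda>v. e' v u) \<in> ahom PP E'" and y: "y \<in> carrier E'"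
  shows "\<alpha> (\<gamma> y) = y"
proof (rule E'_generated[OF ahom_comp[OF \<alpha>_hom \<gamma>_hom] _ y])
  fix v u assume v: "v \<in> carrier PP" and u: "u \<in> carrier U"
  have "\<alpha> (G u \<xi>) = e' (\<mu> \<xi>) u" if \<xi>: "\<xi> \<in> carrier LP" for \<xi>
    by (rule LP.hom_ext[OF E'.M.abelian_group_axioms ahom_comp[OF \<alpha>_hom G_hom[OF u]] ahom_comp[OF e'l[OF u] \<mu>_hom] _ \<xi>])
      (use u in \<open>simp add: G_pure \<alpha>_ext ahom_closed[OF \<nu>'_hom] e_closed \<nu>_\<nu>' \<kappa>_e \<mu>_pure\<close>)
  from this[OF ahom_closed[OF \<mu>'_hom v]] show "\<alpha> (\<gamma> (e' v u)) = e' v u"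
    using v u by (simp add: \<gamma>_e' \<mu>_\<mu>')
qed

lemma \<alpha>_inj: "inj_on \<alpha> (carrier LNP)"
  by (rule inj_on_inverseI[of _ \<gamma>]) (rule \<gamma>_\<alpha>)

lemma \<alpha>_bij:
  assumes "\<And>u. u \<in> carrier U \<Longrightarrow> (\<lambda>v. e' v u) \<in> ahom PP E'"
  shows "bij_betw \<alpha> (carrier LNP) (carrier E')"
  by (rule bij_betw_byWitness[of _ \<gamma>])
    (use \<gamma>_\<alpha> \<alpha>_\<gamma>[OF assms] ahom_closed[OF \<alpha>_hom] ahom_closed[OF \<gamma>_hom] in auto)

lemma embeds_LN: "embeds TYPE(('h + 'p) list) (carrier LN)"
  by (rule LN.embeds_tensor[OF infinite_universe embeds_L embeds_N])

abbreviation fP where "fP \<equiv> tensor_right_map B E' aE P (\<lambda>b p. b \<otimes>\<^bsub>P\<^esub> p) f"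

abbreviation E'P where "E'P \<equiv> tensor B E' aE P (\<lambda>b p. b \<otimes>\<^bsub>P\<^esub> p)"

interpretation E'P: tensor_product B E' aE P "\<lambda>b p. b \<otimes>\<^bsub>P\<^esub> p" E'P
  by (rule tensor_productI[OF E'_right_B_module P_left_B_module])

lemmas fP_hom = tensor_functor.map_hom[OF tensor_functor_P rLN_module E'_right_B_module f_hom]
  and fP_pure = tensor_functor.map_pure[OF tensor_functor_P rLN_module E'_right_B_module f_hom]

text \<open>The bijection \<alpha> is \<open>f \<otimes>\<^sub>B P\<close> followed by the action
  map of \<open>E'\<close>, so \<open>f \<otimes>\<^sub>B P\<close> is injective; faithfulness
  removes the factor \<open>P\<close>.\<close>

lemma f_inj: "inj_on f (carrier LN)"
proof -
  define mult where "mult = tensor_lift E' (\<lambda>y z. aE y z)"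
  have b: "balanced B E' aE P (\<lambda>b p. b \<otimes>\<^bsub>P\<^esub> p) E' (\<lambda>y z. aE y z)"
    by (rule balancedI)
      (simp_all add: right_module_scalar_hom[OF E'.right_module_axioms] right_module_mult_hom[OF E'.right_module_axioms] E'.assoc B_closed)
  have mult: "mult \<in> ahom E'P E'" "\<And>y z. y \<in> carrier E' \<Longrightarrow> z \<in> carrier P \<Longrightarrow> mult (y \<boxtimes>\<^bsub>E'P\<^esub> z) = aE y z"
    unfolding mult_def using E'P.lift_hom[OF E'.M.abelian_group_axioms b] E'P.lift_pure[OF E'.M.abelian_group_axioms b] by simp_all
  have "mult (fP \<xi>) = \<alpha> \<xi>" if "\<xi> \<in> carrier LNP" for \<xi>
  proof (rule LNP.hom_ext[OF E'.M.abelian_group_axioms ahom_comp[OF mult(1) fP_hom] \<alpha>_hom _ that])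
    fix n z assume nz: "n \<in> carrier LN" "z \<in> carrier P"
    show "mult (fP (n \<boxtimes>\<^bsub>LNP\<^esub> z)) = \<alpha> (n \<boxtimes>\<^bsub>LNP\<^esub> z)"
      unfolding fP_pure[OF nz] \<alpha>_pure[OF nz] by (rule mult(2)[OF f_closed[OF nz(1)] nz(2)])
  qed
  then have "inj_on (mult \<circ> fP) (carrier LNP)"
    using \<alpha>_inj inj_on_cong[of "carrier LNP" "mult \<circ> fP" \<alpha>] by simp
  then have "inj_on fP (carrier LNP)"
    by (rule inj_on_imageI2)
  then show ?thesis
    using faithfully_flat_inj[OF FF rLN_module E'_right_B_module embeds_LN embeds_E' f_hom] by simp
qed

text \<open>Since the action map after \<open>f \<otimes>\<^sub>B P\<close> is \<alpha>, the only
  possible preimage of \<open>w \<otimes> 1\<close> is \<open>\<gamma> w\<close>. If it works,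
  membership descends with test element \<open>1\<close>, which right multiplications carry to every
  element of \<open>P\<close>.\<close>

lemma f_image:
  assumes w: "w \<in> carrier E'" and eq: "fP (\<gamma> w) = w \<boxtimes>\<^bsub>E'P\<^esub> \<one>\<^bsub>P\<^esub>"
  shows "w \<in> f ` carrier LN"
proof (rule faithfully_flat_image[OF FF rLN_module E'_right_B_module embeds_LN embeds_E' f_hom, where e = "\<one>\<^bsub>P\<^esub>" and \<rho> = "\<lambda>z y. y \<otimes>\<^bsub>P\<^esub> z"])
  show "(\<lambda>y. y \<otimes>\<^bsub>P\<^esub> z) \<in> ahom P P" if "z \<in> carrier P" for z
    by (rule ring_mult_right_hom[OF P.A.ring_axioms that ahom_ident])
  show "w \<boxtimes>\<^bsub>E'P\<^esub> \<one>\<^bsub>P\<^esub> \<in> fP ` carrier LNP"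
    using eq[symmetric] ahom_closed[OF \<gamma>_hom w] by blast
qed (use w in \<open>simp_all add: P.A.m_assoc B_closed\<close>)

text \<open>The converse of \<open>f_image\<close> in usable form: for \<open>w = f n\<close> the
  candidate is \<open>n \<otimes> 1\<close>, which \<open>f \<otimes>\<^sub>B P\<close> sends to
  \<open>w \<otimes> 1\<close>.\<close>

lemma \<gamma>_f:
  assumes "n \<in> carrier LN" shows "\<gamma> (f n) = n \<boxtimes>\<^bsub>LNP\<^esub> \<one>\<^bsub>P\<^esub>"
  using \<gamma>_\<alpha>[of "n \<boxtimes>\<^bsub>LNP\<^esub> \<one>\<^bsub>P\<^esub>"] assms by (simp add: \<alpha>_pure E'.unit f_closed)

end

section \<open>Embedding the tensor powers of \<open>\<B>\<close> into those of \<open>P\<close>\<close>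

context faithfully_flat_galois
begin

lemma PP_smult_balance: "\<lbrakk>x \<in> carrier P; k \<in> carrier K; y \<in> carrier P\<rbrakk> \<Longrightarrow> x \<boxtimes>\<^bsub>PP\<^esub> (k \<odot>\<^bsub>P\<^esub> y) = (k \<odot>\<^bsub>P\<^esub> x) \<boxtimes>\<^bsub>PP\<^esub> y"
  using PP.smult_balance[of x k y] by simp

sublocale PPP: algebra_pair K PP "opposite P"
  by (intro algebra_pairI opposite_algebra P.algebra_over_field_axioms PP.AB.algebra_over_field_axioms)

abbreviation PPP where "PPP \<equiv> tensor_algebra K PP (opposite P)"

abbreviation inl where "inl v \<equiv> v \<boxtimes>\<^bsub>PPP\<^esub> \<one>\<^bsub>P\<^esub>"
abbreviation inr where "inr x \<equiv> \<one>\<^bsub>PP\<^esub> \<boxtimes>\<^bsub>PPP\<^esub> x"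

lemma PPP_pure_hom [intro]: "v \<in> carrier PP \<Longrightarrow> (\<lambda>y. v \<boxtimes>\<^bsub>PPP\<^esub> y) \<in> ahom P PPP"
  "y \<in> carrier P \<Longrightarrow> (\<lambda>v. v \<boxtimes>\<^bsub>PPP\<^esub> y) \<in> ahom PP PPP"
  using PPP.pure_hom_left[of y] PPP.pure_hom_right[of v] by (simp_all add: hom_def)

lemma PPP_pure_closed [simp]: "v \<in> carrier PP \<Longrightarrow> y \<in> carrier P \<Longrightarrow> v \<boxtimes>\<^bsub>PPP\<^esub> y \<in> carrier PPP"
  by (rule PPP.pure_closed) simp_all

lemma PPP_smult_balance: "\<lbrakk>v \<in> carrier PP; k \<in> carrier K; y \<in> carrier P\<rbrakk> \<Longrightarrow> v \<boxtimes>\<^bsub>PPP\<^esub> (k \<odot>\<^bsub>P\<^esub> y) = (k \<odot>\<^bsub>PP\<^esub> v) \<boxtimes>\<^bsub>PPP\<^esub> y"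
  using PPP.smult_balance[of v k y] by simp

lemma PPP_balancedI:
  assumes "\<And>v. v \<in> carrier PP \<Longrightarrow> (\<lambda>y. f v y) \<in> ahom P G"
    and "\<And>y. y \<in> carrier P \<Longrightarrow> (\<lambda>v. f v y) \<in> ahom PP G"
    and "\<And>v a y. v \<in> carrier PP \<Longrightarrow> a \<in> carrier K \<Longrightarrow> y \<in> carrier P \<Longrightarrow> f (a \<odot>\<^bsub>PP\<^esub> v) y = f v (a \<odot>\<^bsub>P\<^esub> y)"
  shows "balanced K PP (\<lambda>x a. a \<odot>\<^bsub>PP\<^esub> x) (opposite P) (\<lambda>a y. a \<odot>\<^bsub>opposite P\<^esub> y) G f"
  using assms by (intro balancedI) (simp_all add: hom_def)

lemma PPP_hom_ext:
  assumes "abelian_group G" "g \<in> ahom PPP G" "h \<in> ahom PPP G"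
    and "\<And>v y. v \<in> carrier PP \<Longrightarrow> y \<in> carrier P \<Longrightarrow> g (v \<boxtimes>\<^bsub>PPP\<^esub> y) = h (v \<boxtimes>\<^bsub>PPP\<^esub> y)"
    and "X \<in> carrier PPP"
  shows "g X = h X"
  by (rule PPP.hom_ext[OF assms(1-3) _ assms(5)]) (use assms(4) in simp)

lemma PPP_hom_ext':
  assumes G: "abelian_group G" and gh: "g \<in> ahom PPP G" "h \<in> ahom PPP G"
    and eq: "\<And>p x y. \<lbrakk>p \<in> carrier P; x \<in> carrier P; y \<in> carrier P\<rbrakk> \<Longrightarrow>
      g ((p \<boxtimes>\<^bsub>PP\<^esub> x) \<boxtimes>\<^bsub>PPP\<^esub> y) = h ((p \<boxtimes>\<^bsub>PP\<^esub> x) \<boxtimes>\<^bsub>PPP\<^esub> y)"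
    and X: "X \<in> carrier PPP"
  shows "g X = h X"
proof (rule PPP_hom_ext[OF G gh _ X])
  fix v y assume v: "v \<in> carrier PP" and y: "y \<in> carrier P"
  show "g (v \<boxtimes>\<^bsub>PPP\<^esub> y) = h (v \<boxtimes>\<^bsub>PPP\<^esub> y)"
    by (rule PP_hom_ext[OF G ahom_comp[OF gh(1) PPP_pure_hom(2)[OF y]] ahom_comp[OF gh(2) PPP_pure_hom(2)[OF y]] eq v])
      (use y in simp_all)
qed

lemma PPP_right_module: "right_module P PPP (\<lambda>w x. inr x \<otimes>\<^bsub>PPP\<^esub> w)"
proof (rule right_module.intro[OF P.A.ring_axioms PPP.T.abelian_group_axioms], unfold right_module_axioms_def, intro conjI allI impI)
  fix a b w assume ab: "a \<in> carrier P" "b \<in> carrier P" and w: "w \<in> carrier PPP"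
  show "inr (a \<oplus>\<^bsub>P\<^esub> b) \<otimes>\<^bsub>PPP\<^esub> w = (inr a \<otimes>\<^bsub>PPP\<^esub> w) \<oplus>\<^bsub>PPP\<^esub> (inr b \<otimes>\<^bsub>PPP\<^esub> w)"
    using ab w by (simp add: ahom_add[OF PPP_pure_hom(1)] PPP.AB.A.l_distr)
  have "inr (a \<otimes>\<^bsub>P\<^esub> b) = inr b \<otimes>\<^bsub>PPP\<^esub> inr a" using ab by simp
  then show "inr (a \<otimes>\<^bsub>P\<^esub> b) \<otimes>\<^bsub>PPP\<^esub> w = inr b \<otimes>\<^bsub>PPP\<^esub> (inr a \<otimes>\<^bsub>PPP\<^esub> w)"
    using ab w by (simp add: PPP.AB.A.m_assoc del: PPP.mult_pure)
next
  show "inr \<one>\<^bsub>P\<^esub> \<otimes>\<^bsub>PPP\<^esub> w = w" if "w \<in> carrier PPP" for w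
    using that PPP.one_eq by (metis PPP.AB.A.l_one opposite_simps(4))
qed (simp_all add: PPP.AB.A.r_distr)

end

sublocale faithfully_flat_galois \<subseteq> PPPg: galois_module K H \<Delta> \<epsilon> S P \<delta> PPP "\<lambda>w x. inr x \<otimes>\<^bsub>PPP\<^esub> w"
proof -
  interpret r: right_module P PPP "\<lambda>w x. inr x \<otimes>\<^bsub>PPP\<^esub> w" by (rule PPP_right_module)
  have "comodule_algebra_module K H \<Delta> \<epsilon> S P \<delta> PPP (\<lambda>w x. inr x \<otimes>\<^bsub>PPP\<^esub> w)"
  proof
    fix w k assume w: "w \<in> carrier PPP" "k \<in> carrier K"
    have "inr (k \<odot>\<^bsub>P\<^esub> \<one>\<^bsub>P\<^esub>) = k \<odot>\<^bsub>PPP\<^esub> \<one>\<^bsub>PPP\<^esub>"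
      using w(2) PPP.smult_pure[of "\<one>\<^bsub>PP\<^esub>" k "\<one>\<^bsub>P\<^esub>"] by (simp add: PPP_smult_balance PPP.one_eq)
    then show "inr (k \<odot>\<^bsub>P\<^esub> \<one>\<^bsub>P\<^esub>) \<otimes>\<^bsub>PPP\<^esub> w = k \<odot>\<^bsub>PPP\<^esub> w"
      using w by (simp add: PPP.AB.smult_mult_left)
  qed
  then show "galois_module K H \<Delta> \<epsilon> S P \<delta> PPP (\<lambda>w x. inr x \<otimes>\<^bsub>PPP\<^esub> w)"
    by (simp add: galois_module_def hopf_galois_extension_axioms)
qed

context faithfully_flat_galois
begin

abbreviation PPPH where "PPPH \<equiv> tensor_algebra K PPP H"

lemma embeds_PPP: "embeds TYPE(('h + 'p) list) (carrier PPP)"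
  by (rule PPP.embeds_tensor[OF infinite_universe embeds_PP]) (simp add: embeds_P)

text \<open>\<open>J\<close> fills the last two legs and \<open>j\<close> the outer two. The middle
  leg of \<open>PPP\<close> multiplies in opposite order, so \<open>j\<close> is multiplicative
  while \<open>J\<close> reverses products of first legs; this is why multiplication by
  \<open>src z\<close> changes sides in \<open>J_src\<close> and \<open>J_src_right\<close>.\<close>

definition J where "J = tensor_lift PPP (\<lambda>r w. tgt r \<boxtimes>\<^bsub>PPP\<^esub> w)"
definition j where "j = tensor_lift PPP (\<lambda>p q. src p \<boxtimes>\<^bsub>PPP\<^esub> q)"

lemma J_balanced: "balanced K P (\<lambda>x a. a \<odot>\<^bsub>P\<^esub> x) (opposite P) (\<lambda>a y. a \<odot>\<^bsub>opposite P\<^esub> y) PPP (\<lambda>r w. tgt r \<boxtimes>\<^bsub>PPP\<^esub> w)"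
  by (rule PP_balancedI)
    (auto intro!: PPP_pure_hom ahom_comp[OF PPP_pure_hom(2)] PP_pure_hom simp: PPP_smult_balance PP_smult_balance PP.smult_pure)

lemma J_hom: "J \<in> ahom PP PPP"
  unfolding J_def by (rule PP.lift_hom[OF PPP.T.abelian_group_axioms J_balanced])

lemma J_closed [simp]: "X \<in> carrier PP \<Longrightarrow> J X \<in> carrier PPP"
  using J_hom by (rule ahom_closed)

lemma J_pure: "r \<in> carrier P \<Longrightarrow> w \<in> carrier P \<Longrightarrow> J (r \<boxtimes>\<^bsub>PP\<^esub> w) = tgt r \<boxtimes>\<^bsub>PPP\<^esub> w"
  unfolding J_def by (rule PP.lift_pure[OF PPP.T.abelian_group_axioms J_balanced]) simp_all

lemma j_balanced: "balanced K P (\<lambda>x a. a \<odot>\<^bsub>P\<^esub> x) (opposite P) (\<lambda>a y. a \<odot>\<^bsub>opposite P\<^esub> y) PPP (\<lambda>p q. src p \<boxtimes>\<^bsub>PPP\<^esub> q)"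
  by (rule PP_balancedI)
    (auto intro!: PPP_pure_hom ahom_comp[OF PPP_pure_hom(2)] PP_pure_hom simp: PPP_smult_balance PP.smult_pure)

lemma j_hom: "j \<in> ahom PP PPP"
  unfolding j_def by (rule PP.lift_hom[OF PPP.T.abelian_group_axioms j_balanced])

lemma j_closed [simp]: "X \<in> carrier PP \<Longrightarrow> j X \<in> carrier PPP"
  using j_hom by (rule ahom_closed)

lemma j_pure: "p \<in> carrier P \<Longrightarrow> q \<in> carrier P \<Longrightarrow> j (p \<boxtimes>\<^bsub>PP\<^esub> q) = src p \<boxtimes>\<^bsub>PPP\<^esub> q"
  unfolding j_def by (rule PP.lift_pure[OF PPP.T.abelian_group_axioms j_balanced]) simp_all

lemma
  assumes z: "z \<in> carrier P" and Y: "Y \<in> carrier PP"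
  shows J_tgt: "J (tgt z \<otimes>\<^bsub>PP\<^esub> Y) = inr z \<otimes>\<^bsub>PPP\<^esub> J Y"
    and J_src: "J (src z \<otimes>\<^bsub>PP\<^esub> Y) = J Y \<otimes>\<^bsub>PPP\<^esub> inl (tgt z)"
    and J_src_right: "J (Y \<otimes>\<^bsub>PP\<^esub> src z) = inl (tgt z) \<otimes>\<^bsub>PPP\<^esub> J Y"
    and J_tgt_right: "J (Y \<otimes>\<^bsub>PP\<^esub> tgt z) = J Y \<otimes>\<^bsub>PPP\<^esub> inr z"
    and J_inl_src: "J Y \<otimes>\<^bsub>PPP\<^esub> inl (src z) = inl (src z) \<otimes>\<^bsub>PPP\<^esub> J Y"
    and j_tgt: "j (tgt z \<otimes>\<^bsub>PP\<^esub> Y) = inr z \<otimes>\<^bsub>PPP\<^esub> j Y"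
    and j_inl_tgt: "j Y \<otimes>\<^bsub>PPP\<^esub> inl (tgt z) = inl (tgt z) \<otimes>\<^bsub>PPP\<^esub> j Y"
proof -
  have tz: "tgt z \<in> carrier PP" "src z \<in> carrier PP" using z by simp_all
  have iz: "inl (tgt z) \<in> carrier PPP" "inl (src z) \<in> carrier PPP" "inr z \<in> carrier PPP" using z by simp_all
  note ag = PPP.T.abelian_group_axioms
  note homs = ahom_comp[OF J_hom PP.mult_left_hom[OF tz(1)]] ahom_comp[OF J_hom PP.mult_left_hom[OF tz(2)]]
    ahom_comp[OF J_hom PP.mult_right_hom[OF tz(1)]] ahom_comp[OF J_hom PP.mult_right_hom[OF tz(2)]]
    ahom_comp[OF PPP.mult_left_hom[OF iz(3)] J_hom] ahom_comp[OF PPP.mult_right_hom[OF iz(3)] J_hom]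
    ahom_comp[OF PPP.mult_left_hom[OF iz(1)] J_hom] ahom_comp[OF PPP.mult_right_hom[OF iz(1)] J_hom]
    ahom_comp[OF PPP.mult_left_hom[OF iz(2)] J_hom] ahom_comp[OF PPP.mult_right_hom[OF iz(2)] J_hom]
  show "J (tgt z \<otimes>\<^bsub>PP\<^esub> Y) = inr z \<otimes>\<^bsub>PPP\<^esub> J Y"
    by (rule PP_hom_ext[OF ag homs(1,5) _ Y]) (use z in \<open>simp add: J_pure\<close>)
  show "J (src z \<otimes>\<^bsub>PP\<^esub> Y) = J Y \<otimes>\<^bsub>PPP\<^esub> inl (tgt z)"
    by (rule PP_hom_ext[OF ag homs(2,8) _ Y]) (use z in \<open>simp add: J_pure\<close>)
  show "J (Y \<otimes>\<^bsub>PP\<^esub> src z) = inl (tgt z) \<otimes>\<^bsub>PPP\<^esub> J Y"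
    by (rule PP_hom_ext[OF ag homs(4,7) _ Y]) (use z in \<open>simp add: J_pure\<close>)
  show "J (Y \<otimes>\<^bsub>PP\<^esub> tgt z) = J Y \<otimes>\<^bsub>PPP\<^esub> inr z"
    by (rule PP_hom_ext[OF ag homs(3,6) _ Y]) (use z in \<open>simp add: J_pure\<close>)
  show "J Y \<otimes>\<^bsub>PPP\<^esub> inl (src z) = inl (src z) \<otimes>\<^bsub>PPP\<^esub> J Y"
    by (rule PP_hom_ext[OF ag homs(10,9) _ Y]) (use z in \<open>simp add: J_pure\<close>)
  show "j (tgt z \<otimes>\<^bsub>PP\<^esub> Y) = inr z \<otimes>\<^bsub>PPP\<^esub> j Y"
    by (rule PP_hom_ext[OF ag ahom_comp[OF j_hom PP.mult_left_hom[OF tz(1)]] ahom_comp[OF PPP.mult_left_hom[OF iz(3)] j_hom] _ Y])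
      (use z in \<open>simp add: j_pure\<close>)
  show "j Y \<otimes>\<^bsub>PPP\<^esub> inl (tgt z) = inl (tgt z) \<otimes>\<^bsub>PPP\<^esub> j Y"
    by (rule PP_hom_ext[OF ag ahom_comp[OF PPP.mult_right_hom[OF iz(1)] j_hom] ahom_comp[OF PPP.mult_left_hom[OF iz(1)] j_hom] _ Y])
      (use z in \<open>simp add: j_pure\<close>)
qed

lemma j_mult:
  assumes "X \<in> carrier PP" "Y \<in> carrier PP" shows "j (X \<otimes>\<^bsub>PP\<^esub> Y) = j X \<otimes>\<^bsub>PPP\<^esub> j Y"
  by (rule PP.hom_ext2[OF PPP.T.abelian_group_axioms, where X=X and Y=Y])
    (use assms in \<open>simp_all add: ahom_comp[OF j_hom PP.mult_left_hom] ahom_comp[OF j_hom PP.mult_right_hom]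
      ahom_comp[OF PPP.mult_left_hom j_hom] ahom_comp[OF PPP.mult_right_hom j_hom] j_pure\<close>)

lemma j_src: "p \<in> carrier P \<Longrightarrow> j (src p) = inl (src p)" and J_src_one: "p \<in> carrier P \<Longrightarrow> J (src p) = inl (tgt p)"
  by (simp_all add: j_pure J_pure)

lemma j_one: "j \<one>\<^bsub>PP\<^esub> = \<one>\<^bsub>PPP\<^esub>" and J_one: "J \<one>\<^bsub>PP\<^esub> = \<one>\<^bsub>PPP\<^esub>"
  by (simp_all add: PP.one_eq PPP.one_eq j_pure J_pure)

section \<open>Maps from \<open>P \<otimes> P\<close> to \<open>P \<otimes> P \<otimes> P\<close>,
  extended by the factor \<open>H\<close>\<close>

definition hmap where "hmap \<phi> = tensor_lift PPPH (\<lambda>v h. \<phi> v \<boxtimes>\<^bsub>PPPH\<^esub> h)"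

definition K_linear where
  "K_linear \<phi> \<longleftrightarrow> \<phi> \<in> ahom PP PPP \<and> (\<forall>k\<in>carrier K. \<forall>v\<in>carrier PP. \<phi> (k \<odot>\<^bsub>PP\<^esub> v) = k \<odot>\<^bsub>PPP\<^esub> \<phi> v)"

definition P_linear where
  "P_linear \<phi> \<longleftrightarrow> \<phi> \<in> ahom PP PPP \<and> (\<forall>z\<in>carrier P. \<forall>v\<in>carrier PP. \<phi> (tgt z \<otimes>\<^bsub>PP\<^esub> v) = inr z \<otimes>\<^bsub>PPP\<^esub> \<phi> v)"

lemma P_linear_imp_K_linear: assumes "P_linear \<phi>" shows "K_linear \<phi>"
  unfolding K_linear_def
proof (intro conjI ballI)
  fix k v assume k: "k \<in> carrier K" and v: "v \<in> carrier PP"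
  have "\<phi> v \<in> carrier PPP" using assms v unfolding P_linear_def by (blast intro: ahom_closed)
  then show "\<phi> (k \<odot>\<^bsub>PP\<^esub> v) = k \<odot>\<^bsub>PPP\<^esub> \<phi> v"
    using assms k v unfolding P_linear_def by (simp flip: PPm.act_scalar PPPg.act_scalar)
qed (use assms in \<open>simp add: P_linear_def\<close>)

context
  fixes \<phi> assumes \<phi>: "K_linear \<phi>"
begin

lemma \<phi>_hom: "\<phi> \<in> ahom PP PPP" using \<phi> by (simp add: K_linear_def)

lemma \<phi>_closed: "v \<in> carrier PP \<Longrightarrow> \<phi> v \<in> carrier PPP"
  using \<phi>_hom by (rule ahom_closed)

lemma hmap_balanced: "balanced K PP (\<lambda>x a. a \<odot>\<^bsub>PP\<^esub> x) H (\<lambda>a y. a \<odot>\<^bsub>H\<^esub> y) PPPH (\<lambda>v h. \<phi> v \<boxtimes>\<^bsub>PPPH\<^esub> h)"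
  by (rule balancedI)
    (use \<phi> in \<open>simp_all add: PPPg.MH.pure_hom_right \<phi>_closed PPPg.MH.pure_left_comp[OF _ \<phi>_hom] PPPg.MH.smult_balance K_linear_def\<close>)

lemma hmap_hom: "hmap \<phi> \<in> ahom PPH PPPH"
  unfolding hmap_def by (rule PPm.MH.lift_hom[OF PPPg.MH.T.abelian_group_axioms hmap_balanced])

lemma hmap_closed: "Z \<in> carrier PPH \<Longrightarrow> hmap \<phi> Z \<in> carrier PPPH"
  using hmap_hom by (rule ahom_closed)

lemma hmap_pure: "v \<in> carrier PP \<Longrightarrow> h \<in> carrier H \<Longrightarrow> hmap \<phi> (v \<boxtimes>\<^bsub>PPH\<^esub> h) = \<phi> v \<boxtimes>\<^bsub>PPPH\<^esub> h"
  unfolding hmap_def by (rule PPm.MH.lift_pure[OF PPPg.MH.T.abelian_group_axioms hmap_balanced])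

end

text \<open>Linearity in the last leg is what the action \<theta> uses of its coefficients. Diagonal
  coactions on \<open>PPP\<close> are thus computed from those on \<open>PP\<close>.\<close>

lemma hmap_\<theta>:
  assumes \<phi>: "P_linear \<phi>" and z: "z \<in> carrier P" and Z: "Z \<in> carrier PPH"
  shows "hmap \<phi> (PPm.\<theta> z Z) = PPPg.\<theta> z (hmap \<phi> Z)"
proof -
  note K = P_linear_imp_K_linear[OF \<phi>]
  note hom = hmap_hom[OF K]
  show ?thesis
  proof (rule PPm.MH.hom_ext[OF PPPg.MH.T.abelian_group_axioms ahom_comp[OF hom PPm.\<theta>_hom[OF z]] ahom_comp[OF PPPg.\<theta>_hom[OF z] hom] _ Z])
    fix v h assume v: "v \<in> carrier PP" and h: "h \<in> carrier H"
    have pv: "\<phi> v \<in> carrier PPP" by (rule \<phi>_closed[OF K v])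
    have "hmap \<phi> (PPm.c v W) = PPPg.c (\<phi> v) W" if W: "W \<in> carrier PH" for W
      by (rule PH.hom_ext[OF PPPg.MH.T.abelian_group_axioms ahom_comp[OF hom PPm.c_hom[OF v]] PPPg.c_hom[OF pv] _ W])
        (use v pv \<phi> in \<open>simp add: hmap_pure[OF K] P_linear_def\<close>)
    then show "hmap \<phi> (PPm.\<theta> z (v \<boxtimes>\<^bsub>PPH\<^esub> h)) = PPPg.\<theta> z (hmap \<phi> (v \<boxtimes>\<^bsub>PPH\<^esub> h))"
      using v h z pv by (simp add: PPm.\<theta>_pure PPPg.\<theta>_pure hmap_pure[OF K])
  qed
qed

lemma P_linear_J: "P_linear J" and P_linear_j: "P_linear j"
  by (simp_all add: P_linear_def J_hom j_hom J_tgt j_tgt)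

lemma P_linear_mult_right:
  assumes "P_linear \<phi>" "W \<in> carrier PPP" shows "P_linear (\<lambda>v. \<phi> v \<otimes>\<^bsub>PPP\<^esub> W)"
  using assms \<phi>_closed[OF P_linear_imp_K_linear[OF assms(1)]]
  by (simp add: P_linear_def ahom_comp[OF PPP.mult_right_hom] PPP.AB.A.m_assoc)

lemma K_linear_inl: "K_linear (\<lambda>v. inl v)"
  by (simp add: K_linear_def PPP_pure_hom PPP.smult_pure)

abbreviation (input) hinl where "hinl \<equiv> hmap (\<lambda>v. inl v)"

text \<open>With \<open>X = p \<otimes> q\<close>, both sides are
  \<open>p \<otimes> q x_0 \<otimes> 1 \<otimes> x_1\<close>.\<close>

lemma hmap_J_inl_src_ext:
  assumes X: "X \<in> carrier PP" and x: "x \<in> carrier P"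
  shows "hmap (\<lambda>v. J v \<otimes>\<^bsub>PPP\<^esub> inl X) (src_ext (\<delta> x)) = hinl (PPm.\<theta> x (X \<boxtimes>\<^bsub>PPH\<^esub> \<one>\<^bsub>H\<^esub>))"
proof -
  have iX: "inl X \<in> carrier PPP" using X by simp
  note K = P_linear_imp_K_linear[OF P_linear_mult_right[OF P_linear_J iX]]
  have "hmap (\<lambda>v. J v \<otimes>\<^bsub>PPP\<^esub> inl X) (src_ext W) = hinl (PPm.c X W)" if W: "W \<in> carrier PH" for W
    by (rule PH.hom_ext[OF PPPg.MH.T.abelian_group_axioms ahom_comp[OF hmap_hom[OF K] src_ext_hom]
        ahom_comp[OF hmap_hom[OF K_linear_inl] PPm.c_hom[OF X]] _ W])
      (use X in \<open>simp add: src_ext_pure hmap_pure[OF K] hmap_pure[OF K_linear_inl] J_pure\<close>)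
  then show ?thesis
    using X x by (simp add: PPm.C_pure[symmetric] PPm.C_pure_\<theta>[symmetric])
qed

lemma hmap_j_J_src_ext:
  assumes Y: "Y \<in> carrier PP" and W: "W \<in> carrier PH"
  shows "hmap (\<lambda>v. j v \<otimes>\<^bsub>PPP\<^esub> J Y) (src_ext W) = hinl (src_ext W) \<otimes>\<^bsub>PPPH\<^esub> (J Y \<boxtimes>\<^bsub>PPPH\<^esub> \<one>\<^bsub>H\<^esub>)"
proof -
  have JY: "J Y \<in> carrier PPP" using Y by simp
  note K = P_linear_imp_K_linear[OF P_linear_mult_right[OF P_linear_j JY]]
  show ?thesis
    by (rule PH.hom_ext[OF PPPg.MH.T.abelian_group_axioms ahom_comp[OF hmap_hom[OF K] src_ext_hom]
        ahom_comp[OF PPPg.MH.mult_right_hom ahom_comp[OF hmap_hom[OF K_linear_inl] src_ext_hom]] _ W])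
      (use Y in \<open>simp_all add: src_ext_pure hmap_pure[OF K] hmap_pure[OF K_linear_inl] j_pure\<close>)
qed

text \<open>As in \<open>\<theta>_src_ext_mult\<close>: the first leg and the left side of
  \<open>H\<close> are independent of the last leg and the right side of \<open>H\<close>.\<close>

lemma \<theta>_hinl_mult:
  assumes u: "u \<in> carrier P" and X: "X \<in> carrier PH" and Z: "Z \<in> carrier PPPH"
  shows "PPPg.\<theta> u (hinl (src_ext X) \<otimes>\<^bsub>PPPH\<^esub> Z) = hinl (src_ext X) \<otimes>\<^bsub>PPPH\<^esub> PPPg.\<theta> u Z"
proof (rule PH.hom_ext[OF PPPg.MH.T.abelian_group_axioms
      ahom_comp[OF PPPg.\<theta>_hom[OF u] ahom_comp[OF PPPg.MH.mult_right_hom[OF Z] ahom_comp[OF hmap_hom[OF K_linear_inl] src_ext_hom]]]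
      ahom_comp[OF PPPg.MH.mult_right_hom ahom_comp[OF hmap_hom[OF K_linear_inl] src_ext_hom]] _ X])
  show "PPPg.\<theta> u Z \<in> carrier PPPH" using u Z by simp
  fix p h assume ph: "p \<in> carrier P" "h \<in> carrier H"
  have ph': "inl (src p) \<boxtimes>\<^bsub>PPPH\<^esub> h \<in> carrier PPPH" using ph by simp
  have "PPPg.\<theta> u ((inl (src p) \<boxtimes>\<^bsub>PPPH\<^esub> h) \<otimes>\<^bsub>PPPH\<^esub> Z) = (inl (src p) \<boxtimes>\<^bsub>PPPH\<^esub> h) \<otimes>\<^bsub>PPPH\<^esub> PPPg.\<theta> u Z"
  proof (rule PPPg.MH.hom_ext[OF PPPg.MH.T.abelian_group_axioms
      ahom_comp[OF PPPg.\<theta>_hom[OF u] PPPg.MH.mult_left_hom[OF ph']] ahom_comp[OF PPPg.MH.mult_left_hom[OF ph'] PPPg.\<theta>_hom[OF u]] _ Z])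
    fix v g assume v: "v \<in> carrier PPP" "g \<in> carrier H"
    have "PPPg.c (inl (src p) \<otimes>\<^bsub>PPP\<^esub> v) ((\<one>\<^bsub>P\<^esub> \<boxtimes>\<^bsub>PH\<^esub> (h \<otimes>\<^bsub>H\<^esub> g)) \<otimes>\<^bsub>PH\<^esub> W) =
      (inl (src p) \<boxtimes>\<^bsub>PPPH\<^esub> h) \<otimes>\<^bsub>PPPH\<^esub> PPPg.c v ((\<one>\<^bsub>P\<^esub> \<boxtimes>\<^bsub>PH\<^esub> g) \<otimes>\<^bsub>PH\<^esub> W)" if W: "W \<in> carrier PH" for W
    proof (rule PH.hom_ext[OF PPPg.MH.T.abelian_group_axioms ahom_comp[OF PPPg.c_hom PH.mult_left_hom]
          ahom_comp[OF PPPg.MH.mult_left_hom[OF ph'] ahom_comp[OF PPPg.c_hom PH.mult_left_hom]] _ W])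
      fix x k assume x: "x \<in> carrier P" "k \<in> carrier H"
      have "inr x \<otimes>\<^bsub>PPP\<^esub> inl (src p) = inl (src p) \<otimes>\<^bsub>PPP\<^esub> inr x"
        using x ph by simp
      then have "inr x \<otimes>\<^bsub>PPP\<^esub> (inl (src p) \<otimes>\<^bsub>PPP\<^esub> v) = inl (src p) \<otimes>\<^bsub>PPP\<^esub> (inr x \<otimes>\<^bsub>PPP\<^esub> v)"
        using x ph v by (simp del: PPP.mult_pure flip: PPP.AB.A.m_assoc)
      then show "PPPg.c (inl (src p) \<otimes>\<^bsub>PPP\<^esub> v) ((\<one>\<^bsub>P\<^esub> \<boxtimes>\<^bsub>PH\<^esub> (h \<otimes>\<^bsub>H\<^esub> g)) \<otimes>\<^bsub>PH\<^esub> (x \<boxtimes>\<^bsub>PH\<^esub> k)) =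
        (inl (src p) \<boxtimes>\<^bsub>PPPH\<^esub> h) \<otimes>\<^bsub>PPPH\<^esub> PPPg.c v ((\<one>\<^bsub>P\<^esub> \<boxtimes>\<^bsub>PH\<^esub> g) \<otimes>\<^bsub>PH\<^esub> (x \<boxtimes>\<^bsub>PH\<^esub> k))"
        using x ph v by (simp add: A.m_assoc)
    qed (use ph v in auto)
    then show "PPPg.\<theta> u ((inl (src p) \<boxtimes>\<^bsub>PPPH\<^esub> h) \<otimes>\<^bsub>PPPH\<^esub> (v \<boxtimes>\<^bsub>PPPH\<^esub> g)) =
        (inl (src p) \<boxtimes>\<^bsub>PPPH\<^esub> h) \<otimes>\<^bsub>PPPH\<^esub> PPPg.\<theta> u (v \<boxtimes>\<^bsub>PPPH\<^esub> g)"
      using ph v u by (simp add: PPPg.\<theta>_pure)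
  qed
  then show "PPPg.\<theta> u (hinl (src_ext (p \<boxtimes>\<^bsub>PH\<^esub> h)) \<otimes>\<^bsub>PPPH\<^esub> Z) = hinl (src_ext (p \<boxtimes>\<^bsub>PH\<^esub> h)) \<otimes>\<^bsub>PPPH\<^esub> PPPg.\<theta> u Z"
    using ph by (simp add: src_ext_pure hmap_pure[OF K_linear_inl])
qed

text \<open>With \<open>W = p \<otimes> h\<close>, both sides are
  \<open>p \<otimes> x_0 \<otimes> 1 \<otimes> h x_1\<close>. The right side displays the coaction
  split after the first leg, as the second embedding produces it.\<close>

lemma hinl_\<theta>_src_ext:
  assumes x: "x \<in> carrier P" and W: "W \<in> carrier PH"
  shows "hinl (PPm.\<theta> x (src_ext W)) = hinl (src_ext W) \<otimes>\<^bsub>PPPH\<^esub> hmap J (src_ext (\<delta> x))"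
proof (rule PH.hom_ext[OF PPPg.MH.T.abelian_group_axioms
      ahom_comp[OF hmap_hom[OF K_linear_inl] ahom_comp[OF PPm.\<theta>_hom[OF x] src_ext_hom]]
      ahom_comp[OF PPPg.MH.mult_right_hom ahom_comp[OF hmap_hom[OF K_linear_inl] src_ext_hom]] _ W])
  note KJ = P_linear_imp_K_linear[OF P_linear_J]
  show "hmap J (src_ext (\<delta> x)) \<in> carrier PPPH" using x by (intro hmap_closed[OF KJ]) simp
  fix p h assume ph: "p \<in> carrier P" "h \<in> carrier H"
  have ph': "inl (src p) \<boxtimes>\<^bsub>PPPH\<^esub> h \<in> carrier PPPH" using ph by simp
  have "hinl (PPm.c (src p) ((\<one>\<^bsub>P\<^esub> \<boxtimes>\<^bsub>PH\<^esub> h) \<otimes>\<^bsub>PH\<^esub> V)) = (inl (src p) \<boxtimes>\<^bsub>PPPH\<^esub> h) \<otimes>\<^bsub>PPPH\<^esub> hmap J (src_ext V)"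
    if V: "V \<in> carrier PH" for V
    by (rule PH.hom_ext[OF PPPg.MH.T.abelian_group_axioms ahom_comp[OF hmap_hom[OF K_linear_inl] ahom_comp[OF PPm.c_hom PH.mult_left_hom]]
          ahom_comp[OF PPPg.MH.mult_left_hom[OF ph'] ahom_comp[OF hmap_hom[OF KJ] src_ext_hom]] _ V])
      (use ph in \<open>simp_all add: src_ext_pure hmap_pure[OF KJ] hmap_pure[OF K_linear_inl] J_pure\<close>)
  then show "hinl (PPm.\<theta> x (src_ext (p \<boxtimes>\<^bsub>PH\<^esub> h))) = hinl (src_ext (p \<boxtimes>\<^bsub>PH\<^esub> h)) \<otimes>\<^bsub>PPPH\<^esub> hmap J (src_ext (\<delta> x))"
    using ph x by (simp add: src_ext_pure hmap_pure[OF K_linear_inl] PPm.\<theta>_pure)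
qed

lemma hmap_j_src_ext:
  assumes W: "W \<in> carrier PH" shows "hmap j (src_ext W) = hinl (src_ext W)"
proof -
  note Kj = P_linear_imp_K_linear[OF P_linear_j]
  show ?thesis
    by (rule PH.hom_ext[OF PPPg.MH.T.abelian_group_axioms ahom_comp[OF hmap_hom[OF Kj] src_ext_hom]
          ahom_comp[OF hmap_hom[OF K_linear_inl] src_ext_hom] _ W])
      (simp add: src_ext_pure hmap_pure[OF Kj] hmap_pure[OF K_linear_inl] j_pure)
qed

section \<open>The embedding of \<open>L \<otimes>\<^sub>B L\<close> into
  \<open>P \<otimes> P \<otimes> P\<close> and its image\<close>

abbreviation sact where "sact \<equiv> (\<lambda>b X. src b \<otimes>\<^bsub>PP\<^esub> X)"
abbreviation tact' where "tact' \<equiv> (\<lambda>b X. X \<otimes>\<^bsub>PP\<^esub> tgt b)"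

lemma L_mult_closed: "X \<in> carrier L \<Longrightarrow> Y \<in> carrier L \<Longrightarrow> X \<otimes>\<^bsub>PP\<^esub> Y \<in> carrier L"
  using L.A.m_closed[of X Y] by simp

lemma src_mult: "a \<in> carrier P \<Longrightarrow> b \<in> carrier P \<Longrightarrow> src (a \<otimes>\<^bsub>P\<^esub> b) = src a \<otimes>\<^bsub>PP\<^esub> src b"
  and tgt_mult: "a \<in> carrier P \<Longrightarrow> b \<in> carrier P \<Longrightarrow> tgt (a \<otimes>\<^bsub>P\<^esub> b) = tgt b \<otimes>\<^bsub>PP\<^esub> tgt a"
  by simp_all

lemma L_left_module: "left_module B L sact"
proof (rule left_module.intro[OF B.A.ring_axioms L.abelian_group_axioms], unfold left_module_axioms_def, intro conjI allI impI)
  fix a b X assume a: "a \<in> carrier B" "b \<in> carrier B" and X: "X \<in> carrier L"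
  note c = B_closed[OF a(1)] B_closed[OF a(2)] L_closed[OF X]
  show "src (a \<oplus>\<^bsub>B\<^esub> b) \<otimes>\<^bsub>PP\<^esub> X = (src a \<otimes>\<^bsub>PP\<^esub> X) \<oplus>\<^bsub>L\<^esub> (src b \<otimes>\<^bsub>PP\<^esub> X)"
    using c by (simp add: ahom_add[OF PP_pure_hom(2)] PP.AB.A.l_distr)
  show "src (a \<otimes>\<^bsub>B\<^esub> b) \<otimes>\<^bsub>PP\<^esub> X = src a \<otimes>\<^bsub>PP\<^esub> (src b \<otimes>\<^bsub>PP\<^esub> X)"
    using c by (simp add: src_mult PP.AB.A.m_assoc del: PP.mult_pure)
next
  show "src \<one>\<^bsub>B\<^esub> \<otimes>\<^bsub>PP\<^esub> X = X" if "X \<in> carrier L" for X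
    using that PP.one_eq PP.AB.A.l_one[OF L_closed[OF that]] by simp
qed (simp_all add: L_mult_closed src_in_L L_closed B_closed PP.AB.A.r_distr)

lemma L_left_module': "left_module B L tact'"
proof (rule left_module.intro[OF B.A.ring_axioms L.abelian_group_axioms], unfold left_module_axioms_def, intro conjI allI impI)
  fix a b X assume a: "a \<in> carrier B" "b \<in> carrier B" and X: "X \<in> carrier L"
  note c = B_closed[OF a(1)] B_closed[OF a(2)] L_closed[OF X]
  show "X \<otimes>\<^bsub>PP\<^esub> tgt (a \<oplus>\<^bsub>B\<^esub> b) = (X \<otimes>\<^bsub>PP\<^esub> tgt a) \<oplus>\<^bsub>L\<^esub> (X \<otimes>\<^bsub>PP\<^esub> tgt b)"
    using c by (simp add: ahom_add[OF PP_pure_hom(1)] PP.AB.A.r_distr)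
  show "X \<otimes>\<^bsub>PP\<^esub> tgt (a \<otimes>\<^bsub>B\<^esub> b) = X \<otimes>\<^bsub>PP\<^esub> tgt b \<otimes>\<^bsub>PP\<^esub> tgt a"
    using c by (simp add: tgt_mult PP.AB.A.m_assoc del: PP.mult_pure)
next
  show "X \<otimes>\<^bsub>PP\<^esub> tgt \<one>\<^bsub>B\<^esub> = X" if "X \<in> carrier L" for X
    using that PP.one_eq PP.AB.A.r_one[OF L_closed[OF that]] by simp
qed (simp_all add: L_mult_closed tgt_in_L L_closed B_closed PP.AB.A.l_distr)

lemma tact_sact: "a \<in> carrier P \<Longrightarrow> b \<in> carrier P \<Longrightarrow> X \<in> carrier PP \<Longrightarrow>
    tgt b \<otimes>\<^bsub>PP\<^esub> (src a \<otimes>\<^bsub>PP\<^esub> X) = src a \<otimes>\<^bsub>PP\<^esub> (tgt b \<otimes>\<^bsub>PP\<^esub> X)"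
  using src_tgt_commute[of a b] by (simp del: PP.mult_pure flip: PP.AB.A.m_assoc)

text \<open>First descent: \<open>N\<close> is \<open>L\<close>, and Galois descent provides \<mu>
  as the known isomorphism.\<close>

interpretation I: descent_step K H \<Delta> \<epsilon> S P \<delta> L tact sact PP P \<mu> "\<lambda>x u. x \<boxtimes>\<^bsub>PP\<^esub> u" "\<lambda>b v. src b \<otimes>\<^bsub>PP\<^esub> v"
proof (rule descent_step.intro[OF faithfully_flat_galois_axioms L_right_module L_left_module PP.T.abelian_group_axioms P.abelian_group_axioms],
    rule descent_step_axioms.intro)
  show "\<mu> \<in> ahom LP PP" by (rule \<mu>_hom)
  show "bij_betw \<mu> (carrier LP) (carrier PP)" by (rule \<mu>_bij)
  show "(\<lambda>v. src b \<otimes>\<^bsub>PP\<^esub> v) \<in> ahom PP PP" if "b \<in> carrier B" for b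
    using that by (intro PP.mult_left_hom) (simp add: B_closed)
qed (auto simp: tact_sact B_closed L_closed PP_smult_balance \<mu>_pure L_mult_closed src_in_L)

abbreviation LL where "LL \<equiv> tensor B L tact L sact"

sublocale LL: tensor_product B L tact L sact LL
  by (rule tensor_productI[OF L_right_module L_left_module])

text \<open>\<open>\<iota>\<close> is \<open>(p \<otimes> q) \<otimes> (r \<otimes> u) \<mapsto> p \<otimes> qr \<otimes> u\<close>.\<close>

definition \<iota> where "\<iota> = tensor_lift PPP (\<lambda>X Y. J Y \<otimes>\<^bsub>PPP\<^esub> inl X)"

lemma L_into_PP: "h \<in> ahom PP G \<Longrightarrow> h \<in> ahom L G"
  by (auto simp: hom_def L_closed)

lemma inl_mult: "X \<in> carrier PP \<Longrightarrow> Y \<in> carrier PP \<Longrightarrow> inl (X \<otimes>\<^bsub>PP\<^esub> Y) = inl X \<otimes>\<^bsub>PPP\<^esub> inl Y"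
  by simp

lemma \<iota>_balanced: "balanced B L tact L sact PPP (\<lambda>X Y. J Y \<otimes>\<^bsub>PPP\<^esub> inl X)"
proof (rule balancedI)
  show "(\<lambda>Y. J Y \<otimes>\<^bsub>PPP\<^esub> inl X) \<in> ahom L PPP" if "X \<in> carrier L" for X
    by (rule L_into_PP, rule ahom_comp[OF PPP.mult_right_hom J_hom]) (use that in \<open>simp add: L_closed\<close>)
  show "(\<lambda>X. J Y \<otimes>\<^bsub>PPP\<^esub> inl X) \<in> ahom L PPP" if "Y \<in> carrier L" for Y
    by (rule L_into_PP, rule ahom_comp[OF PPP.mult_left_hom PPP_pure_hom(2)]) (use that in \<open>simp_all add: L_closed\<close>)
  show "J Y \<otimes>\<^bsub>PPP\<^esub> inl (tgt b \<otimes>\<^bsub>PP\<^esub> X) = J (src b \<otimes>\<^bsub>PP\<^esub> Y) \<otimes>\<^bsub>PPP\<^esub> inl X"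
    if "X \<in> carrier L" "b \<in> carrier B" "Y \<in> carrier L" for X b Y
    using that by (simp add: L_closed B_closed J_src inl_mult PPP.AB.A.m_assoc del: PPP.mult_pure)
qed

lemma \<iota>_hom: "\<iota> \<in> ahom LL PPP"
  unfolding \<iota>_def by (rule LL.lift_hom[OF PPP.T.abelian_group_axioms \<iota>_balanced])

lemma \<iota>_closed [simp]: "Z \<in> carrier LL \<Longrightarrow> \<iota> Z \<in> carrier PPP"
  using \<iota>_hom by (rule ahom_closed)

lemma \<iota>_pure: "X \<in> carrier L \<Longrightarrow> Y \<in> carrier L \<Longrightarrow> \<iota> (X \<boxtimes>\<^bsub>LL\<^esub> Y) = J Y \<otimes>\<^bsub>PPP\<^esub> inl X"
  unfolding \<iota>_def by (rule LL.lift_pure[OF PPP.T.abelian_group_axioms \<iota>_balanced])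

abbreviation rLL where "rLL \<equiv> (\<lambda>X b. tensor_lift LL (\<lambda>x y. x \<boxtimes>\<^bsub>LL\<^esub> (tgt b \<otimes>\<^bsub>PP\<^esub> y)) X)"
abbreviation lLL where "lLL \<equiv> (\<lambda>b. tensor_lift LL (\<lambda>x y. (src b \<otimes>\<^bsub>PP\<^esub> x) \<boxtimes>\<^bsub>LL\<^esub> y))"

lemma rLL_hom: "b \<in> carrier B \<Longrightarrow> (\<lambda>Z. rLL Z b) \<in> ahom LL LL"
  using right_module_mult_hom[OF I.rLN_module] by simp

lemma sact_tact: "a \<in> carrier B \<Longrightarrow> b \<in> carrier B \<Longrightarrow> X \<in> carrier L \<Longrightarrow>
    src b \<otimes>\<^bsub>PP\<^esub> (tgt a \<otimes>\<^bsub>PP\<^esub> X) = tgt a \<otimes>\<^bsub>PP\<^esub> (src b \<otimes>\<^bsub>PP\<^esub> X)"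
  by (simp add: tact_sact B_closed L_closed)

lemma lLL_pure: "X \<in> carrier L \<Longrightarrow> Y \<in> carrier L \<Longrightarrow> b \<in> carrier B \<Longrightarrow> lLL b (X \<boxtimes>\<^bsub>LL\<^esub> Y) = (src b \<otimes>\<^bsub>PP\<^esub> X) \<boxtimes>\<^bsub>LL\<^esub> Y"
  using LL.left_act_pure[OF L_left_module sact_tact] by (simp add: LL.left_act_def)

lemma lLL_module: "left_module B LL lLL"
  using LL.left_act_module[OF L_left_module sact_tact] by (simp add: LL.left_act_def[abs_def])

lemma lLL_hom: "b \<in> carrier B \<Longrightarrow> (\<lambda>Z. lLL b Z) \<in> ahom LL LL"
  using left_module_mult_hom[OF lLL_module] by simp

lemma \<iota>_rLL: assumes Z: "Z \<in> carrier LL" and b: "b \<in> carrier B" shows "\<iota> (rLL Z b) = inr b \<otimes>\<^bsub>PPP\<^esub> \<iota> Z"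
proof (rule LL.hom_ext[OF PPP.T.abelian_group_axioms ahom_comp[OF \<iota>_hom rLL_hom[OF b]] ahom_comp[OF PPP.mult_left_hom \<iota>_hom] _ Z])
  fix X Y assume "X \<in> carrier L" "Y \<in> carrier L"
  then show "\<iota> (rLL (X \<boxtimes>\<^bsub>LL\<^esub> Y) b) = inr b \<otimes>\<^bsub>PPP\<^esub> \<iota> (X \<boxtimes>\<^bsub>LL\<^esub> Y)"
    using b by (simp add: I.rLN_pure \<iota>_pure L_mult_closed tgt_in_L J_tgt L_closed B_closed PPP.AB.A.m_assoc del: PPP.mult_pure)
qed (use b in \<open>simp add: B_closed\<close>)

lemma \<iota>_lLL: assumes Z: "Z \<in> carrier LL" and b: "b \<in> carrier B" shows "\<iota> (lLL b Z) = inl (src b) \<otimes>\<^bsub>PPP\<^esub> \<iota> Z"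
proof (rule LL.hom_ext[OF PPP.T.abelian_group_axioms ahom_comp[OF \<iota>_hom lLL_hom[OF b]] ahom_comp[OF PPP.mult_left_hom \<iota>_hom] _ Z])
  fix X Y assume XY: "X \<in> carrier L" "Y \<in> carrier L"
  have "J Y \<otimes>\<^bsub>PPP\<^esub> (inl (src b) \<otimes>\<^bsub>PPP\<^esub> inl X) = inl (src b) \<otimes>\<^bsub>PPP\<^esub> (J Y \<otimes>\<^bsub>PPP\<^esub> inl X)"
    using XY b J_inl_src[of b Y] by (simp add: L_closed B_closed del: PPP.mult_pure flip: PPP.AB.A.m_assoc)
  then show "\<iota> (lLL b (X \<boxtimes>\<^bsub>LL\<^esub> Y)) = inl (src b) \<otimes>\<^bsub>PPP\<^esub> \<iota> (X \<boxtimes>\<^bsub>LL\<^esub> Y)"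
    using XY b by (simp add: lLL_pure \<iota>_pure L_mult_closed src_in_L inl_mult L_closed B_closed del: PPP.mult_pure)
qed (use b in \<open>simp add: B_closed\<close>)

lemma I_LNP: "abelian_group I.LNP"
  by (rule tensor_functor.TN_abelian_group[OF tensor_functor_P I.rLN_module])

definition \<gamma>1 where "\<gamma>1 = tensor_lift I.LNP (\<lambda>v u. I.G u (I.\<mu>' v))"

lemma \<gamma>1_balanced:
  "balanced K PP (\<lambda>x a. a \<odot>\<^bsub>PP\<^esub> x) (opposite P) (\<lambda>a y. a \<odot>\<^bsub>opposite P\<^esub> y) I.LNP (\<lambda>v u. I.G u (I.\<mu>' v))"
proof (rule PPP_balancedI)
  show "(\<lambda>u. I.G u (I.\<mu>' v)) \<in> ahom P I.LNP" if "v \<in> carrier PP" for v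
    by (rule I.G_param_hom[OF ahom_closed[OF I.\<mu>'_hom that]])
  show "(\<lambda>v. I.G u (I.\<mu>' v)) \<in> ahom PP I.LNP" if "u \<in> carrier P" for u
    by (rule ahom_comp[OF I.G_hom[OF that] I.\<mu>'_hom])
qed (rule I.G_smult)

lemma \<gamma>1_hom: "\<gamma>1 \<in> ahom PPP I.LNP"
  unfolding \<gamma>1_def by (rule PPP.lift_hom[OF I_LNP \<gamma>1_balanced])

lemma \<gamma>1_pure: "v \<in> carrier PP \<Longrightarrow> u \<in> carrier P \<Longrightarrow> \<gamma>1 (v \<boxtimes>\<^bsub>PPP\<^esub> u) = I.G u (I.\<mu>' v)"
  unfolding \<gamma>1_def by (rule PPP.lift_pure[OF I_LNP \<gamma>1_balanced]) simp_all

lemma J_mult_inl_hom: "X \<in> carrier PP \<Longrightarrow> (\<lambda>V. J V \<otimes>\<^bsub>PPP\<^esub> inl X) \<in> ahom PP PPP"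
  by (rule ahom_comp[OF PPP.mult_right_hom J_hom]) simp

interpretation IM: descent_map K H \<Delta> \<epsilon> S P \<delta> L tact sact PP P \<mu> "\<lambda>x u. x \<boxtimes>\<^bsub>PP\<^esub> u" "\<lambda>b v. src b \<otimes>\<^bsub>PP\<^esub> v"
  PPP "\<lambda>w x. inr x \<otimes>\<^bsub>PPP\<^esub> w" "\<lambda>v u. v \<boxtimes>\<^bsub>PPP\<^esub> u" "\<lambda>X V. J V \<otimes>\<^bsub>PPP\<^esub> inl X" \<iota> \<gamma>1
proof (rule descent_map.intro[OF I.descent_step_axioms PPP_right_module], rule descent_map_axioms.intro)
  show "g y = h y" if "g \<in> ahom PP I.LNP" "h \<in> ahom PP I.LNP"
    "\<And>x u. x \<in> carrier P \<Longrightarrow> u \<in> carrier P \<Longrightarrow> g (x \<boxtimes>\<^bsub>PP\<^esub> u) = h (x \<boxtimes>\<^bsub>PP\<^esub> u)" "y \<in> carrier PP" for g h y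
    by (rule PP_hom_ext[OF I_LNP that])
  show "g y = y" if "g \<in> ahom PPP PPP"
    "\<And>v u. v \<in> carrier PP \<Longrightarrow> u \<in> carrier P \<Longrightarrow> g (v \<boxtimes>\<^bsub>PPP\<^esub> u) = v \<boxtimes>\<^bsub>PPP\<^esub> u" "y \<in> carrier PPP" for g y
    by (rule PPP_hom_ext[OF PPP.T.abelian_group_axioms that(1) ahom_ident that(2,3)])
  show "\<gamma>1 \<in> ahom PPP I.LNP" by (rule \<gamma>1_hom)
  show "\<gamma>1 (v \<boxtimes>\<^bsub>PPP\<^esub> u) = I.G u (I.\<mu>' v)" if "v \<in> carrier PP" "u \<in> carrier P" for v u
    using that by (rule \<gamma>1_pure)
  show "(\<lambda>V. J V \<otimes>\<^bsub>PPP\<^esub> inl X) \<in> ahom PP PPP" if "X \<in> carrier L" for X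
    by (rule J_mult_inl_hom[OF L_closed[OF that]])
  show "J (x \<boxtimes>\<^bsub>PP\<^esub> u) \<otimes>\<^bsub>PPP\<^esub> inl X = (tgt x \<otimes>\<^bsub>PP\<^esub> X) \<boxtimes>\<^bsub>PPP\<^esub> u"
    if "X \<in> carrier L" "x \<in> carrier P" "u \<in> carrier P" for X x u
    using that by (simp add: J_pure L_closed)
  show "\<iota> \<in> right_module_hom B LL I.rLN PPP (\<lambda>w x. inr x \<otimes>\<^bsub>PPP\<^esub> w)"
    by (rule right_module_homI) (rule \<iota>_hom, erule \<iota>_rLL, assumption)
  show "inr z \<otimes>\<^bsub>PPP\<^esub> \<iota> (X \<boxtimes>\<^bsub>LL\<^esub> Y) = J (\<mu> (Y \<boxtimes>\<^bsub>LP\<^esub> z)) \<otimes>\<^bsub>PPP\<^esub> inl X"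
    if "X \<in> carrier L" "Y \<in> carrier L" "z \<in> carrier P" for X Y z
    using that by (simp add: \<iota>_pure \<mu>_pure J_tgt L_closed PPP.AB.A.m_assoc)
qed (rule embeds_L embeds_PPP)+

lemmas \<iota>_inj = IM.f_inj

text \<open>For coinvariant \<open>Y\<close> the value is
  \<open>\<iota> (X \<otimes> Y) \<otimes> 1\<close>, which is \<open>hmap\<close> applied to
  \<open>diag Y\<close>. Linearity in the last leg extends this to
  \<open>L \<otimes>\<^sub>B P\<close>.\<close>

lemma C_\<iota>_ext:
  assumes X: "X \<in> carrier L" and \<zeta>: "\<zeta> \<in> carrier LP"
  shows "PPPg.C (IM.fP (I.ext X \<zeta>)) = hmap (\<lambda>V. J V \<otimes>\<^bsub>PPP\<^esub> inl X) (diag (\<mu> \<zeta>))"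
proof -
  have iX: "inl X \<in> carrier PPP" using X by (simp add: L_closed)
  note lin = P_linear_mult_right[OF P_linear_J iX]
  note K = P_linear_imp_K_linear[OF lin]
  show ?thesis
  proof (rule LP.hom_ext[OF PPPg.MH.T.abelian_group_axioms
        ahom_comp[OF PPPg.C_hom ahom_comp[OF IM.fP_hom I.ext_hom[OF X]]] ahom_comp[OF hmap_hom[OF K] ahom_comp[OF diag_hom \<mu>_hom]] _ \<zeta>])
    fix Y z assume Y: "Y \<in> carrier L" and z: "z \<in> carrier P"
    have XY: "X \<boxtimes>\<^bsub>LL\<^esub> Y \<in> carrier LL" using X Y by simp
    have "PPPg.C (IM.fP (I.ext X (Y \<boxtimes>\<^bsub>LP\<^esub> z))) = PPPg.\<theta> z (\<iota> (X \<boxtimes>\<^bsub>LL\<^esub> Y) \<boxtimes>\<^bsub>PPPH\<^esub> \<one>\<^bsub>H\<^esub>)"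
      using XY z by (simp add: I.ext_pure[OF X Y z] IM.fP_pure[OF XY z] PPPg.C_pure_\<theta>)
    also have "\<dots> = PPPg.\<theta> z (hmap (\<lambda>V. J V \<otimes>\<^bsub>PPP\<^esub> inl X) (diag Y))"
      using Y L_closed[OF Y] by (simp add: L_iff \<iota>_pure[OF X Y] hmap_pure[OF K])
    also have "\<dots> = hmap (\<lambda>V. J V \<otimes>\<^bsub>PPP\<^esub> inl X) (diag (\<mu> (Y \<boxtimes>\<^bsub>LP\<^esub> z)))"
      using Y z L_closed[OF Y] by (simp add: \<mu>_pure diag_act hmap_\<theta>[OF lin])
    finally show "PPPg.C (IM.fP (I.ext X (Y \<boxtimes>\<^bsub>LP\<^esub> z))) = hmap (\<lambda>V. J V \<otimes>\<^bsub>PPP\<^esub> inl X) (diag (\<mu> (Y \<boxtimes>\<^bsub>LP\<^esub> z)))" .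
  qed
qed

text \<open>The right-hand side is
  \<open>p_0 \<otimes> q_0 \<otimes> u_0 \<otimes> p_1 q_1 u_1\<close> for
  \<open>v = p \<otimes> q\<close>. Hence the criterion of \<open>f_image\<close> says that
  \<open>w\<close> is coinvariant for the diagonal coaction of
  \<open>P \<otimes> P \<otimes> P\<close>.\<close>

lemma C_\<iota>_\<gamma>1:
  assumes v: "v \<in> carrier PP" and u: "u \<in> carrier P"
  shows "PPPg.C (IM.fP (\<gamma>1 (v \<boxtimes>\<^bsub>PPP\<^esub> u))) = PPPg.\<theta> u (hinl (diag v))"
proof -
  have "PPPg.C (IM.fP (I.G u \<xi>)) = PPPg.\<theta> u (hinl (diag (\<mu> \<xi>)))" if \<xi>: "\<xi> \<in> carrier LP" for \<xi>
  proof (rule LP.hom_ext[OF PPPg.MH.T.abelian_group_axioms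
        ahom_comp[OF PPPg.C_hom ahom_comp[OF IM.fP_hom I.G_hom[OF u]]]
        ahom_comp[OF PPPg.\<theta>_hom[OF u] ahom_comp[OF hmap_hom[OF K_linear_inl] ahom_comp[OF diag_hom \<mu>_hom]]] _ \<xi>])
    fix X x assume X: "X \<in> carrier L" and x: "x \<in> carrier P"
    have iX: "inl X \<in> carrier PPP" using X by (simp add: L_closed)
    have xu: "x \<boxtimes>\<^bsub>PP\<^esub> u \<in> carrier PP" using x u by simp
    have "PPPg.C (IM.fP (I.G u (X \<boxtimes>\<^bsub>LP\<^esub> x))) = hmap (\<lambda>V. J V \<otimes>\<^bsub>PPP\<^esub> inl X) (diag (x \<boxtimes>\<^bsub>PP\<^esub> u))"
      using C_\<iota>_ext[OF X ahom_closed[OF I.\<nu>'_hom xu]] I.\<nu>_\<nu>'[OF xu] by (simp add: I.G_pure[OF u X x])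
    also have "\<dots> = PPPg.\<theta> u (hinl (PPm.\<theta> x (X \<boxtimes>\<^bsub>PPH\<^esub> \<one>\<^bsub>H\<^esub>)))"
      using x u by (simp add: diag_pure hmap_\<theta>[OF P_linear_mult_right[OF P_linear_J iX]] hmap_J_inl_src_ext[OF L_closed[OF X] x])
    also have "\<dots> = PPPg.\<theta> u (hinl (diag (\<mu> (X \<boxtimes>\<^bsub>LP\<^esub> x))))"
      using X x L_closed[OF X] by (simp add: \<mu>_pure diag_act) (simp add: L_iff)
    finally show "PPPg.C (IM.fP (I.G u (X \<boxtimes>\<^bsub>LP\<^esub> x))) = PPPg.\<theta> u (hinl (diag (\<mu> (X \<boxtimes>\<^bsub>LP\<^esub> x))))" .
  qed
  from this[OF ahom_closed[OF I.\<mu>'_hom v]] show ?thesis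
    using v u by (simp add: \<gamma>1_pure I.\<mu>_\<mu>')
qed

lemma C_\<iota>_hom: "(\<lambda>w. PPPg.C (IM.fP (\<gamma>1 w))) \<in> ahom PPP PPPH"
  by (rule ahom_comp[OF PPPg.C_hom ahom_comp[OF IM.fP_hom \<gamma>1_hom]])

text \<open>The element \<open>p \<otimes> 1 \<otimes> q\<close> has coaction
  \<open>p_0 \<otimes> 1 \<otimes> q_0 \<otimes> p_1 q_1\<close>, so it inherits coinvariance from
  \<open>p \<otimes> q\<close>. Its preimage under \<iota> will be the coproduct.\<close>

lemma j_image:
  assumes X: "X \<in> carrier L" shows "j X \<in> \<iota> ` carrier LL"
proof (rule IM.f_image)
  have X': "X \<in> carrier PP" by (rule L_closed[OF X])
  note Kj = P_linear_imp_K_linear[OF P_linear_j]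
  show jX: "j X \<in> carrier PPP" using X' by simp
  \<comment> \<open>Established on all of \<open>PP\<close>, where pure tensors may be used;
    coinvariance of \<open>X\<close> enters afterwards.\<close>
  have "PPPg.C (IM.fP (\<gamma>1 (j V))) = hmap j (diag V)" if V: "V \<in> carrier PP" for V
    by (rule PP_hom_ext[OF PPPg.MH.T.abelian_group_axioms ahom_comp[OF C_\<iota>_hom j_hom] ahom_comp[OF hmap_hom[OF Kj] diag_hom] _ V])
      (simp add: j_pure C_\<iota>_\<gamma>1 diag_pure PPm.\<theta>_one hmap_\<theta>[OF P_linear_j] hmap_j_src_ext)
  then have "PPPg.C (IM.fP (\<gamma>1 (j X))) = j X \<boxtimes>\<^bsub>PPPH\<^esub> \<one>\<^bsub>H\<^esub>"
    using X X' by (simp add: L_iff hmap_pure[OF Kj])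
  also have "\<dots> = PPPg.C (j X \<boxtimes>\<^bsub>PPPg.MP\<^esub> \<one>\<^bsub>P\<^esub>)"
    using jX by (simp add: PPPg.C_pure_\<theta> PPPg.\<theta>_one)
  finally show "IM.fP (\<gamma>1 (j X)) = j X \<boxtimes>\<^bsub>PPPg.MP\<^esub> \<one>\<^bsub>P\<^esub>"
    by (rule PPPg.C_inj[rotated 2]) (use jX ahom_closed[OF ahom_comp[OF IM.fP_hom \<gamma>1_hom] jX] in simp_all)
qed

text \<open>Conversely, every element of the image is coinvariant.\<close>

lemma C_\<iota>_\<gamma>1_image:
  assumes Z: "Z \<in> carrier LL"
  shows "PPPg.C (IM.fP (\<gamma>1 (\<iota> Z))) = \<iota> Z \<boxtimes>\<^bsub>PPPH\<^esub> \<one>\<^bsub>H\<^esub>"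
  using Z by (simp add: IM.\<gamma>_f[OF Z] IM.fP_pure[OF Z] PPPg.C_pure_\<theta> PPPg.\<theta>_one)

text \<open>The domain \<open>\<B> \<otimes>\<^bsub>B\<^sup>o\<^sup>p\<^esub> \<B>\<close> of \<open>\<lambda>\<close>, with the factors interchanged so that it is a tensor product over \<open>B\<close>.\<close>

abbreviation LL' where "LL' \<equiv> tensor B L tact L tact'"

sublocale LL': tensor_product B L tact L tact' LL'
  by (rule tensor_productI[OF L_right_module L_left_module'])

text \<open>Here \<open>b\<close> multiplies the second leg of the inner factor from the left, so
  the variable \<open>x\<close> on which \<open>B\<close> acts occupies the second leg and the
  parameter \<open>u\<close> the first.\<close>

interpretation I': descent_step K H \<Delta> \<epsilon> S P \<delta> L tact tact' PP P \<mu> "\<lambda>x u. u \<boxtimes>\<^bsub>PP\<^esub> x" "\<lambda>b v. v \<otimes>\<^bsub>PP\<^esub> tgt b"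
proof (rule descent_step.intro[OF faithfully_flat_galois_axioms L_right_module L_left_module' PP.T.abelian_group_axioms P.abelian_group_axioms],
    rule descent_step_axioms.intro)
  show "\<mu> \<in> ahom LP PP" by (rule \<mu>_hom)
  show "bij_betw \<mu> (carrier LP) (carrier PP)" by (rule \<mu>_bij)
  show "(\<lambda>v. v \<otimes>\<^bsub>PP\<^esub> tgt b) \<in> ahom PP PP" if "b \<in> carrier B" for b
    using that by (intro PP.mult_right_hom) (simp add: B_closed)
qed (auto simp: B_closed L_closed PP_smult_balance \<mu>_pure L_mult_closed tgt_in_L PP.AB.A.m_assoc)

text \<open>\<open>\<iota>'\<close> is \<open>(r \<otimes> u) \<otimes> (p \<otimes> q) \<mapsto> p \<otimes> r \<otimes> uq\<close>.\<close>

definition \<iota>' where "\<iota>' = tensor_lift PPP (\<lambda>Y X. j X \<otimes>\<^bsub>PPP\<^esub> J Y)"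

lemma j_tgt_right: "z \<in> carrier P \<Longrightarrow> Y \<in> carrier PP \<Longrightarrow> j (Y \<otimes>\<^bsub>PP\<^esub> tgt z) = j Y \<otimes>\<^bsub>PPP\<^esub> inr z"
  by (simp add: j_mult j_pure PP.one_eq)

lemma \<iota>'_balanced: "balanced B L tact L tact' PPP (\<lambda>Y X. j X \<otimes>\<^bsub>PPP\<^esub> J Y)"
proof (rule balancedI)
  show "(\<lambda>X. j X \<otimes>\<^bsub>PPP\<^esub> J Y) \<in> ahom L PPP" if "Y \<in> carrier L" for Y
    by (rule L_into_PP, rule ahom_comp[OF PPP.mult_right_hom j_hom]) (use that in \<open>simp add: L_closed\<close>)
  show "(\<lambda>Y. j X \<otimes>\<^bsub>PPP\<^esub> J Y) \<in> ahom L PPP" if "X \<in> carrier L" for X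
    by (rule L_into_PP, rule ahom_comp[OF PPP.mult_left_hom J_hom]) (use that in \<open>simp add: L_closed\<close>)
  show "j X \<otimes>\<^bsub>PPP\<^esub> J (tgt b \<otimes>\<^bsub>PP\<^esub> Y) = j (X \<otimes>\<^bsub>PP\<^esub> tgt b) \<otimes>\<^bsub>PPP\<^esub> J Y"
    if "Y \<in> carrier L" "b \<in> carrier B" "X \<in> carrier L" for Y b X
    using that by (simp add: J_tgt j_tgt_right L_closed B_closed PPP.AB.A.m_assoc)
qed

lemma \<iota>'_hom: "\<iota>' \<in> ahom LL' PPP"
  unfolding \<iota>'_def by (rule LL'.lift_hom[OF PPP.T.abelian_group_axioms \<iota>'_balanced])

lemma \<iota>'_pure: "Y \<in> carrier L \<Longrightarrow> X \<in> carrier L \<Longrightarrow> \<iota>' (Y \<boxtimes>\<^bsub>LL'\<^esub> X) = j X \<otimes>\<^bsub>PPP\<^esub> J Y"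
  unfolding \<iota>'_def by (rule LL'.lift_pure[OF PPP.T.abelian_group_axioms \<iota>'_balanced])

lemma \<iota>'_right: assumes Z: "Z \<in> carrier LL'" and b: "b \<in> carrier B" shows "\<iota>' (I'.rLN Z b) = inr b \<otimes>\<^bsub>PPP\<^esub> \<iota>' Z"
proof (rule LL'.hom_ext[OF PPP.T.abelian_group_axioms ahom_comp[OF \<iota>'_hom right_module_mult_hom[OF I'.rLN_module b]]
      ahom_comp[OF PPP.mult_left_hom \<iota>'_hom] _ Z])
  fix Y X assume "Y \<in> carrier L" "X \<in> carrier L"
  then show "\<iota>' (I'.rLN (Y \<boxtimes>\<^bsub>LL'\<^esub> X) b) = inr b \<otimes>\<^bsub>PPP\<^esub> \<iota>' (Y \<boxtimes>\<^bsub>LL'\<^esub> X)"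
    using b by (simp add: I'.rLN_pure \<iota>'_pure L_mult_closed tgt_in_L j_tgt L_closed B_closed PPP.AB.A.m_assoc del: PPP.mult_pure)
qed (use b in \<open>simp add: B_closed\<close>)

lemma I'_LNP: "abelian_group I'.LNP"
  by (rule tensor_functor.TN_abelian_group[OF tensor_functor_P I'.rLN_module])

text \<open>The generators are now \<open>u \<otimes> (r \<otimes> w)\<close>, against the
  bracketing of \<open>PPP\<close>; nesting two lifts performs the rebracketing.\<close>

definition \<gamma>2 where "\<gamma>2 = tensor_lift I'.LNP (\<lambda>v w. tensor_lift I'.LNP (\<lambda>p r. I'.G p (I'.\<mu>' (r \<boxtimes>\<^bsub>PP\<^esub> w))) v)"

lemma \<gamma>2_balanced_inner:
  assumes w: "w \<in> carrier P"
  shows "balanced K P (\<lambda>x a. a \<odot>\<^bsub>P\<^esub> x) (opposite P) (\<lambda>a y. a \<odot>\<^bsub>opposite P\<^esub> y) I'.LNP (\<lambda>p r. I'.G p (I'.\<mu>' (r \<boxtimes>\<^bsub>PP\<^esub> w)))"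
proof (rule PP_balancedI)
  show "(\<lambda>r. I'.G p (I'.\<mu>' (r \<boxtimes>\<^bsub>PP\<^esub> w))) \<in> ahom P I'.LNP" if "p \<in> carrier P" for p
    by (rule ahom_comp[OF I'.G_hom[OF that] ahom_comp[OF I'.\<mu>'_hom PP_pure_hom(2)[OF w]]])
  show "(\<lambda>p. I'.G p (I'.\<mu>' (r \<boxtimes>\<^bsub>PP\<^esub> w))) \<in> ahom P I'.LNP" if "r \<in> carrier P" for r
    by (rule I'.G_param_hom[OF ahom_closed[OF I'.\<mu>'_hom]]) (use that w in simp)
  show "I'.G (k \<odot>\<^bsub>P\<^esub> p) (I'.\<mu>' (r \<boxtimes>\<^bsub>PP\<^esub> w)) = I'.G p (I'.\<mu>' ((k \<odot>\<^bsub>P\<^esub> r) \<boxtimes>\<^bsub>PP\<^esub> w))"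
    if "p \<in> carrier P" "k \<in> carrier K" "r \<in> carrier P" for p k r
    using I'.G_smult[of k "r \<boxtimes>\<^bsub>PP\<^esub> w" p] that w by (simp add: PP.smult_pure)
qed

lemma \<gamma>2_inner_pure: "p \<in> carrier P \<Longrightarrow> r \<in> carrier P \<Longrightarrow> w \<in> carrier P \<Longrightarrow>
    tensor_lift I'.LNP (\<lambda>p r. I'.G p (I'.\<mu>' (r \<boxtimes>\<^bsub>PP\<^esub> w))) (p \<boxtimes>\<^bsub>PP\<^esub> r) = I'.G p (I'.\<mu>' (r \<boxtimes>\<^bsub>PP\<^esub> w))"
  by (rule PP.lift_pure[OF I'_LNP \<gamma>2_balanced_inner]) simp_all

lemma \<gamma>2_balanced:
  "balanced K PP (\<lambda>x a. a \<odot>\<^bsub>PP\<^esub> x) (opposite P) (\<lambda>a y. a \<odot>\<^bsub>opposite P\<^esub> y) I'.LNP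
    (\<lambda>v w. tensor_lift I'.LNP (\<lambda>p r. I'.G p (I'.\<mu>' (r \<boxtimes>\<^bsub>PP\<^esub> w))) v)"
proof (rule PPP_balancedI)
  show "(\<lambda>w. tensor_lift I'.LNP (\<lambda>p r. I'.G p (I'.\<mu>' (r \<boxtimes>\<^bsub>PP\<^esub> w))) v) \<in> ahom P I'.LNP" if "v \<in> carrier PP" for v
  proof (rule PP.lift_param_hom[OF I'_LNP that])
    fix p r assume "p \<in> carrier P" "r \<in> carrier (opposite P)"
    then show "(\<lambda>w. I'.G p (I'.\<mu>' (r \<boxtimes>\<^bsub>PP\<^esub> w))) \<in> ahom P I'.LNP"
      by (intro ahom_comp[OF I'.G_hom] ahom_comp[OF I'.\<mu>'_hom] PP_pure_hom(1)) simp_all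
  qed
  show "(\<lambda>v. tensor_lift I'.LNP (\<lambda>p r. I'.G p (I'.\<mu>' (r \<boxtimes>\<^bsub>PP\<^esub> w))) v) \<in> ahom PP I'.LNP" if "w \<in> carrier P" for w
    by (rule PP.lift_hom[OF I'_LNP \<gamma>2_balanced_inner[OF that]])
  fix v k w assume a: "v \<in> carrier PP" "k \<in> carrier K" "w \<in> carrier P"
  have kw: "k \<odot>\<^bsub>P\<^esub> w \<in> carrier P" using a by simp
  show "tensor_lift I'.LNP (\<lambda>p r. I'.G p (I'.\<mu>' (r \<boxtimes>\<^bsub>PP\<^esub> w))) (k \<odot>\<^bsub>PP\<^esub> v) =
    tensor_lift I'.LNP (\<lambda>p r. I'.G p (I'.\<mu>' (r \<boxtimes>\<^bsub>PP\<^esub> (k \<odot>\<^bsub>P\<^esub> w)))) v"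
  proof (rule PP_hom_ext[OF I'_LNP ahom_comp[OF PP.lift_hom[OF I'_LNP \<gamma>2_balanced_inner[OF a(3)]] PP.smult_hom[OF a(2)]]
        PP.lift_hom[OF I'_LNP \<gamma>2_balanced_inner[OF kw]] _ a(1)])
    fix p r assume pr: "p \<in> carrier P" "r \<in> carrier P"
    then show "tensor_lift I'.LNP (\<lambda>p r. I'.G p (I'.\<mu>' (r \<boxtimes>\<^bsub>PP\<^esub> w))) (k \<odot>\<^bsub>PP\<^esub> (p \<boxtimes>\<^bsub>PP\<^esub> r)) =
      tensor_lift I'.LNP (\<lambda>p r. I'.G p (I'.\<mu>' (r \<boxtimes>\<^bsub>PP\<^esub> (k \<odot>\<^bsub>P\<^esub> w)))) (p \<boxtimes>\<^bsub>PP\<^esub> r)"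
      using I'.G_smult[of k "r \<boxtimes>\<^bsub>PP\<^esub> w" p] a by (simp add: PP.smult_pure \<gamma>2_inner_pure PP_smult_balance)
  qed
qed

lemma \<gamma>2_hom: "\<gamma>2 \<in> ahom PPP I'.LNP"
  unfolding \<gamma>2_def by (rule PPP.lift_hom[OF I'_LNP \<gamma>2_balanced])

lemma \<gamma>2_e':
  assumes v: "v \<in> carrier PP" and u: "u \<in> carrier P"
  shows "\<gamma>2 (inl (src u) \<otimes>\<^bsub>PPP\<^esub> J v) = I'.G u (I'.\<mu>' v)"
proof (rule PP_hom_ext[OF I'_LNP ahom_comp[OF \<gamma>2_hom ahom_comp[OF PPP.mult_left_hom J_hom]] ahom_comp[OF I'.G_hom[OF u] I'.\<mu>'_hom] _ v])
  fix r w assume rw: "r \<in> carrier P" "w \<in> carrier P"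
  have "\<gamma>2 ((u \<boxtimes>\<^bsub>PP\<^esub> r) \<boxtimes>\<^bsub>PPP\<^esub> w) = I'.G u (I'.\<mu>' (r \<boxtimes>\<^bsub>PP\<^esub> w))"
    unfolding \<gamma>2_def using rw u by (simp add: PPP.lift_pure[OF I'_LNP \<gamma>2_balanced] \<gamma>2_inner_pure)
  then show "\<gamma>2 (inl (src u) \<otimes>\<^bsub>PPP\<^esub> J (r \<boxtimes>\<^bsub>PP\<^esub> w)) = I'.G u (I'.\<mu>' (r \<boxtimes>\<^bsub>PP\<^esub> w))"
    using rw u by (simp add: J_pure)
qed (use u in simp)

interpretation IM': descent_map K H \<Delta> \<epsilon> S P \<delta> L tact tact' PP P \<mu> "\<lambda>x u. u \<boxtimes>\<^bsub>PP\<^esub> x" "\<lambda>b v. v \<otimes>\<^bsub>PP\<^esub> tgt b"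
  PPP "\<lambda>w x. inr x \<otimes>\<^bsub>PPP\<^esub> w" "\<lambda>v u. inl (src u) \<otimes>\<^bsub>PPP\<^esub> J v" "\<lambda>Y V. j V \<otimes>\<^bsub>PPP\<^esub> J Y" \<iota>' \<gamma>2
proof (rule descent_map.intro[OF I'.descent_step_axioms PPP_right_module], rule descent_map_axioms.intro)
  show "g y = h y" if "g \<in> ahom PP I'.LNP" "h \<in> ahom PP I'.LNP"
    "\<And>x u. x \<in> carrier P \<Longrightarrow> u \<in> carrier P \<Longrightarrow> g (u \<boxtimes>\<^bsub>PP\<^esub> x) = h (u \<boxtimes>\<^bsub>PP\<^esub> x)" "y \<in> carrier PP" for g h y
    by (rule PP_hom_ext[OF I'_LNP that(1,2) that(3) that(4)])
  show "g y = y" if "g \<in> ahom PPP PPP"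
    "\<And>v u. v \<in> carrier PP \<Longrightarrow> u \<in> carrier P \<Longrightarrow> g (inl (src u) \<otimes>\<^bsub>PPP\<^esub> J v) = inl (src u) \<otimes>\<^bsub>PPP\<^esub> J v" "y \<in> carrier PPP" for g y
  proof (rule PPP_hom_ext'[OF PPP.T.abelian_group_axioms that(1) ahom_ident _ that(3)])
    fix p x y assume "p \<in> carrier P" "x \<in> carrier P" "y \<in> carrier P"
    then show "g ((p \<boxtimes>\<^bsub>PP\<^esub> x) \<boxtimes>\<^bsub>PPP\<^esub> y) = (p \<boxtimes>\<^bsub>PP\<^esub> x) \<boxtimes>\<^bsub>PPP\<^esub> y"
      using that(2)[of "x \<boxtimes>\<^bsub>PP\<^esub> y" p] by (simp add: J_pure)
  qed
  show "\<gamma>2 \<in> ahom PPP I'.LNP" by (rule \<gamma>2_hom)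
  show "\<gamma>2 (inl (src u) \<otimes>\<^bsub>PPP\<^esub> J v) = I'.G u (I'.\<mu>' v)" if "v \<in> carrier PP" "u \<in> carrier P" for v u
    using that by (rule \<gamma>2_e')
  show "(\<lambda>V. j V \<otimes>\<^bsub>PPP\<^esub> J Y) \<in> ahom PP PPP" if "Y \<in> carrier L" for Y
    by (rule ahom_comp[OF PPP.mult_right_hom j_hom]) (use that in \<open>simp add: L_closed\<close>)
  show "j (u \<boxtimes>\<^bsub>PP\<^esub> x) \<otimes>\<^bsub>PPP\<^esub> J Y = inl (src u) \<otimes>\<^bsub>PPP\<^esub> J (tgt x \<otimes>\<^bsub>PP\<^esub> Y)"
    if "Y \<in> carrier L" "x \<in> carrier P" "u \<in> carrier P" for Y x u
  proof -
    have "src u \<boxtimes>\<^bsub>PPP\<^esub> x = inl (src u) \<otimes>\<^bsub>PPP\<^esub> inr x" using that by simp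
    then show ?thesis
      using that by (simp add: j_pure J_tgt L_closed PPP.AB.A.m_assoc del: PPP.mult_pure)
  qed
  show "\<iota>' \<in> right_module_hom B LL' I'.rLN PPP (\<lambda>w x. inr x \<otimes>\<^bsub>PPP\<^esub> w)"
    by (rule right_module_homI) (rule \<iota>'_hom, erule \<iota>'_right, assumption)
  show "inr z \<otimes>\<^bsub>PPP\<^esub> \<iota>' (Y \<boxtimes>\<^bsub>LL'\<^esub> X) = j (\<mu> (X \<boxtimes>\<^bsub>LP\<^esub> z)) \<otimes>\<^bsub>PPP\<^esub> J Y"
    if "Y \<in> carrier L" "X \<in> carrier L" "z \<in> carrier P" for X Y z
    using that by (simp add: \<iota>'_pure \<mu>_pure j_tgt L_closed PPP.AB.A.m_assoc)
qed (rule embeds_L embeds_PPP)+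

lemmas \<iota>'_inj = IM'.f_inj

lemma C_\<iota>'_ext:
  assumes Y: "Y \<in> carrier L" and \<zeta>: "\<zeta> \<in> carrier LP"
  shows "PPPg.C (IM'.fP (I'.ext Y \<zeta>)) = hmap (\<lambda>V. j V \<otimes>\<^bsub>PPP\<^esub> J Y) (diag (\<mu> \<zeta>))"
proof -
  have JY: "J Y \<in> carrier PPP" using Y by (simp add: L_closed)
  note lin = P_linear_mult_right[OF P_linear_j JY]
  note K = P_linear_imp_K_linear[OF lin]
  show ?thesis
  proof (rule LP.hom_ext[OF PPPg.MH.T.abelian_group_axioms
        ahom_comp[OF PPPg.C_hom ahom_comp[OF IM'.fP_hom I'.ext_hom[OF Y]]] ahom_comp[OF hmap_hom[OF K] ahom_comp[OF diag_hom \<mu>_hom]] _ \<zeta>])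
    fix X z assume X: "X \<in> carrier L" and z: "z \<in> carrier P"
    have YX: "Y \<boxtimes>\<^bsub>LL'\<^esub> X \<in> carrier LL'" using X Y by simp
    have "PPPg.C (IM'.fP (I'.ext Y (X \<boxtimes>\<^bsub>LP\<^esub> z))) = PPPg.\<theta> z (\<iota>' (Y \<boxtimes>\<^bsub>LL'\<^esub> X) \<boxtimes>\<^bsub>PPPH\<^esub> \<one>\<^bsub>H\<^esub>)"
      using ahom_closed[OF \<iota>'_hom YX] z by (simp add: I'.ext_pure[OF Y X z] IM'.fP_pure[OF YX z] PPPg.C_pure_\<theta>)
    also have "\<dots> = PPPg.\<theta> z (hmap (\<lambda>V. j V \<otimes>\<^bsub>PPP\<^esub> J Y) (diag X))"
      using X L_closed[OF X] by (simp add: L_iff \<iota>'_pure[OF Y X] hmap_pure[OF K])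
    also have "\<dots> = hmap (\<lambda>V. j V \<otimes>\<^bsub>PPP\<^esub> J Y) (diag (\<mu> (X \<boxtimes>\<^bsub>LP\<^esub> z)))"
      using X z L_closed[OF X] by (simp add: \<mu>_pure diag_act hmap_\<theta>[OF lin])
    finally show "PPPg.C (IM'.fP (I'.ext Y (X \<boxtimes>\<^bsub>LP\<^esub> z))) = hmap (\<lambda>V. j V \<otimes>\<^bsub>PPP\<^esub> J Y) (diag (\<mu> (X \<boxtimes>\<^bsub>LP\<^esub> z)))" .
  qed
qed

text \<open>The right-hand side is
  \<open>u_0 \<otimes> r_0 \<otimes> w_0 \<otimes> u_1 (r_1 w_1)\<close> for
  \<open>v = r \<otimes> w\<close>, again the diagonal coaction.\<close>

lemma C_\<iota>'_\<gamma>2: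
  assumes v: "v \<in> carrier PP" and u: "u \<in> carrier P"
  shows "PPPg.C (IM'.fP (\<gamma>2 (inl (src u) \<otimes>\<^bsub>PPP\<^esub> J v))) = hinl (src_ext (\<delta> u)) \<otimes>\<^bsub>PPPH\<^esub> hmap J (diag v)"
proof -
  note KJ = P_linear_imp_K_linear[OF P_linear_J]
  have Iu: "hinl (src_ext (\<delta> u)) \<in> carrier PPPH" using u by (intro hmap_closed[OF K_linear_inl]) simp
  have "PPPg.C (IM'.fP (I'.G u \<xi>)) = hinl (src_ext (\<delta> u)) \<otimes>\<^bsub>PPPH\<^esub> hmap J (diag (\<mu> \<xi>))" if \<xi>: "\<xi> \<in> carrier LP" for \<xi>
  proof (rule LP.hom_ext[OF PPPg.MH.T.abelian_group_axioms
        ahom_comp[OF PPPg.C_hom ahom_comp[OF IM'.fP_hom I'.G_hom[OF u]]]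
        ahom_comp[OF PPPg.MH.mult_left_hom[OF Iu] ahom_comp[OF hmap_hom[OF KJ] ahom_comp[OF diag_hom \<mu>_hom]]] _ \<xi>])
    fix Y x assume Y: "Y \<in> carrier L" and x: "x \<in> carrier P"
    have Y': "Y \<in> carrier PP" by (rule L_closed[OF Y])
    have JY: "J Y \<in> carrier PPP" using Y' by simp
    have ux: "u \<boxtimes>\<^bsub>PP\<^esub> x \<in> carrier PP" using x u by simp
    have "PPPg.C (IM'.fP (I'.G u (Y \<boxtimes>\<^bsub>LP\<^esub> x))) = hmap (\<lambda>V. j V \<otimes>\<^bsub>PPP\<^esub> J Y) (diag (u \<boxtimes>\<^bsub>PP\<^esub> x))"
      using C_\<iota>'_ext[OF Y ahom_closed[OF I'.\<nu>'_hom ux]] I'.\<nu>_\<nu>'[OF ux] by (simp add: I'.G_pure[OF u Y x])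
    also have "\<dots> = PPPg.\<theta> x (hinl (src_ext (\<delta> u)) \<otimes>\<^bsub>PPPH\<^esub> (J Y \<boxtimes>\<^bsub>PPPH\<^esub> \<one>\<^bsub>H\<^esub>))"
      using x u by (simp add: diag_pure hmap_\<theta>[OF P_linear_mult_right[OF P_linear_j JY]] hmap_j_J_src_ext[OF Y'])
    also have "\<dots> = hinl (src_ext (\<delta> u)) \<otimes>\<^bsub>PPPH\<^esub> PPPg.\<theta> x (J Y \<boxtimes>\<^bsub>PPPH\<^esub> \<one>\<^bsub>H\<^esub>)"
      using x u JY by (simp add: \<theta>_hinl_mult)
    also have "PPPg.\<theta> x (J Y \<boxtimes>\<^bsub>PPPH\<^esub> \<one>\<^bsub>H\<^esub>) = hmap J (diag (\<mu> (Y \<boxtimes>\<^bsub>LP\<^esub> x)))"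
      using Y Y' x by (simp add: \<mu>_pure diag_act hmap_\<theta>[OF P_linear_J]) (simp add: L_iff hmap_pure[OF KJ])
    finally show "PPPg.C (IM'.fP (I'.G u (Y \<boxtimes>\<^bsub>LP\<^esub> x))) = hinl (src_ext (\<delta> u)) \<otimes>\<^bsub>PPPH\<^esub> hmap J (diag (\<mu> (Y \<boxtimes>\<^bsub>LP\<^esub> x)))" .
  qed
  from this[OF ahom_closed[OF I'.\<mu>'_hom v]] show ?thesis
    using v u by (simp add: \<gamma>2_e' I'.\<mu>_\<mu>')
qed

text \<open>Both criteria test coinvariance under the same coaction, and elements of the image of
  \<iota> are coinvariant.\<close>

lemma \<iota>_image:
  assumes Z: "Z \<in> carrier LL" shows "\<iota> Z \<in> \<iota>' ` carrier LL'"
proof (rule IM'.f_image)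
  show w: "\<iota> Z \<in> carrier PPP" using Z by simp
  \<comment> \<open>On \<open>p \<otimes> x \<otimes> z\<close> the two coactions differ only in the
    bracketing of \<open>p_1 x_1 z_1\<close>.\<close>
  have "PPPg.C (IM'.fP (\<gamma>2 W)) = PPPg.C (IM.fP (\<gamma>1 W))" if W: "W \<in> carrier PPP" for W
  proof (rule PPP_hom_ext'[OF PPPg.MH.T.abelian_group_axioms ahom_comp[OF PPPg.C_hom ahom_comp[OF IM'.fP_hom \<gamma>2_hom]] C_\<iota>_hom _ W])
    fix p x z assume a: "p \<in> carrier P" "x \<in> carrier P" "z \<in> carrier P"
    note KJ = P_linear_imp_K_linear[OF P_linear_J]
    have "PPPg.C (IM'.fP (\<gamma>2 ((p \<boxtimes>\<^bsub>PP\<^esub> x) \<boxtimes>\<^bsub>PPP\<^esub> z))) = hinl (src_ext (\<delta> p)) \<otimes>\<^bsub>PPPH\<^esub> PPPg.\<theta> z (hmap J (src_ext (\<delta> x)))"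
      using a C_\<iota>'_\<gamma>2[of "x \<boxtimes>\<^bsub>PP\<^esub> z" p] by (simp add: J_pure diag_pure hmap_\<theta>[OF P_linear_J])
    also have "\<dots> = PPPg.\<theta> z (hinl (PPm.\<theta> x (src_ext (\<delta> p))))"
      using a hmap_closed[OF KJ, of "src_ext (\<delta> x)"] by (simp add: \<theta>_hinl_mult hinl_\<theta>_src_ext)
    also have "\<dots> = PPPg.C (IM.fP (\<gamma>1 ((p \<boxtimes>\<^bsub>PP\<^esub> x) \<boxtimes>\<^bsub>PPP\<^esub> z)))"
      using a by (simp add: C_\<iota>_\<gamma>1 diag_pure)
    finally show "PPPg.C (IM'.fP (\<gamma>2 ((p \<boxtimes>\<^bsub>PP\<^esub> x) \<boxtimes>\<^bsub>PPP\<^esub> z))) = PPPg.C (IM.fP (\<gamma>1 ((p \<boxtimes>\<^bsub>PP\<^esub> x) \<boxtimes>\<^bsub>PPP\<^esub> z)))" .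
  qed
  from this[OF w] have "PPPg.C (IM'.fP (\<gamma>2 (\<iota> Z))) = \<iota> Z \<boxtimes>\<^bsub>PPPH\<^esub> \<one>\<^bsub>H\<^esub>"
    using C_\<iota>_\<gamma>1_image[OF Z] by simp
  also have "\<dots> = PPPg.C (\<iota> Z \<boxtimes>\<^bsub>PPPg.MP\<^esub> \<one>\<^bsub>P\<^esub>)"
    using w by (simp add: PPPg.C_pure_\<theta> PPPg.\<theta>_one)
  finally show "IM'.fP (\<gamma>2 (\<iota> Z)) = \<iota> Z \<boxtimes>\<^bsub>PPPg.MP\<^esub> \<one>\<^bsub>P\<^esub>"
    by (rule PPPg.C_inj[rotated 2]) (use w ahom_closed[OF ahom_comp[OF IM'.fP_hom \<gamma>2_hom] w] in simp_all)
qed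

section \<open>The embedding of the triple tensor product of \<open>L\<close>\<close>

sublocale PPPP: algebra_pair K PP PP
  by (intro algebra_pairI PP.AB.algebra_over_field_axioms)

abbreviation PPPP where "PPPP \<equiv> tensor_algebra K PP PP"

definition tau where "tau u = tensor_lift PPPP (\<lambda>v y. v \<boxtimes>\<^bsub>PPPP\<^esub> (y \<boxtimes>\<^bsub>PP\<^esub> u))"

lemma tau_balanced:
  assumes "u \<in> carrier P"
  shows "balanced K PP (\<lambda>x a. a \<odot>\<^bsub>PP\<^esub> x) (opposite P) (\<lambda>a y. a \<odot>\<^bsub>opposite P\<^esub> y) PPPP (\<lambda>v y. v \<boxtimes>\<^bsub>PPPP\<^esub> (y \<boxtimes>\<^bsub>PP\<^esub> u))"
proof (rule PPP_balancedI)
  show "(\<lambda>y. v \<boxtimes>\<^bsub>PPPP\<^esub> (y \<boxtimes>\<^bsub>PP\<^esub> u)) \<in> ahom P PPPP" if "v \<in> carrier PP" for v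
    by (rule PPPP.pure_right_comp[OF that PP_pure_hom(2)[OF assms]])
  show "(\<lambda>v. v \<boxtimes>\<^bsub>PPPP\<^esub> (y \<boxtimes>\<^bsub>PP\<^esub> u)) \<in> ahom PP PPPP" if "y \<in> carrier P" for y
    by (rule PPPP.pure_hom_left) (use that assms in simp)
  show "(k \<odot>\<^bsub>PP\<^esub> v) \<boxtimes>\<^bsub>PPPP\<^esub> (y \<boxtimes>\<^bsub>PP\<^esub> u) = v \<boxtimes>\<^bsub>PPPP\<^esub> ((k \<odot>\<^bsub>P\<^esub> y) \<boxtimes>\<^bsub>PP\<^esub> u)"
    if "v \<in> carrier PP" "k \<in> carrier K" "y \<in> carrier P" for v k y
    using PPPP.smult_balance[of v k "y \<boxtimes>\<^bsub>PP\<^esub> u"] that assms by (simp add: PP.smult_pure)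
qed

lemma tau_hom: "u \<in> carrier P \<Longrightarrow> tau u \<in> ahom PPP PPPP"
  unfolding tau_def by (rule PPP.lift_hom[OF PPPP.T.abelian_group_axioms tau_balanced])

lemma tau_closed [simp]: "u \<in> carrier P \<Longrightarrow> w \<in> carrier PPP \<Longrightarrow> tau u w \<in> carrier PPPP"
  using tau_hom by (rule ahom_closed)

lemma tau_pure: "u \<in> carrier P \<Longrightarrow> v \<in> carrier PP \<Longrightarrow> y \<in> carrier P \<Longrightarrow>
    tau u (v \<boxtimes>\<^bsub>PPP\<^esub> y) = v \<boxtimes>\<^bsub>PPPP\<^esub> (y \<boxtimes>\<^bsub>PP\<^esub> u)"
  unfolding tau_def by (rule PPP.lift_pure[OF PPPP.T.abelian_group_axioms tau_balanced]) simp_all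

lemma tau_param_hom: "w \<in> carrier PPP \<Longrightarrow> (\<lambda>u. tau u w) \<in> ahom P PPPP"
  unfolding tau_def
proof (rule PPP.lift_param_hom[OF PPPP.T.abelian_group_axioms], assumption)
  fix v y assume "v \<in> carrier PP" "y \<in> carrier (opposite P)"
  then show "(\<lambda>u. v \<boxtimes>\<^bsub>PPPP\<^esub> (y \<boxtimes>\<^bsub>PP\<^esub> u)) \<in> ahom P PPPP"
    by (intro PPPP.pure_right_comp PP_pure_hom(1)) simp_all
qed

lemma tau_smult:
  assumes "u \<in> carrier P" "k \<in> carrier K" "w \<in> carrier PPP"
  shows "tau u (k \<odot>\<^bsub>PPP\<^esub> w) = tau (k \<odot>\<^bsub>P\<^esub> u) w"
proof (rule PPP_hom_ext[OF PPPP.T.abelian_group_axioms ahom_comp[OF tau_hom[OF assms(1)] PPP.smult_hom[OF assms(2)]] tau_hom _ assms(3)])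
  fix v y assume "v \<in> carrier PP" "y \<in> carrier P"
  then show "tau u (k \<odot>\<^bsub>PPP\<^esub> (v \<boxtimes>\<^bsub>PPP\<^esub> y)) = tau (k \<odot>\<^bsub>P\<^esub> u) (v \<boxtimes>\<^bsub>PPP\<^esub> y)"
    using PPPP.smult_balance[of v k "y \<boxtimes>\<^bsub>PP\<^esub> u"] assms by (simp add: PPP.smult_pure tau_pure PP_smult_balance PP.smult_pure)
qed (use assms in simp)

lemma tau_mult_inl:
  assumes u: "u \<in> carrier P" and X: "X \<in> carrier PP" and w: "w \<in> carrier PPP"
  shows "tau u (w \<otimes>\<^bsub>PPP\<^esub> inl X) = tau u w \<otimes>\<^bsub>PPPP\<^esub> (X \<boxtimes>\<^bsub>PPPP\<^esub> \<one>\<^bsub>PP\<^esub>)"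
  by (rule PPP_hom_ext[OF PPPP.T.abelian_group_axioms ahom_comp[OF tau_hom[OF u] PPP.mult_right_hom]
        ahom_comp[OF PPPP.mult_right_hom tau_hom[OF u]] _ w])
    (use u X in \<open>simp_all add: tau_pure\<close>)

lemma tau_mult_tgt:
  assumes u: "u \<in> carrier P" and z: "z \<in> carrier P" and w: "w \<in> carrier PPP"
  shows "tau (u \<otimes>\<^bsub>P\<^esub> z) w = (\<one>\<^bsub>PP\<^esub> \<boxtimes>\<^bsub>PPPP\<^esub> tgt z) \<otimes>\<^bsub>PPPP\<^esub> tau u w"
  by (rule PPP_hom_ext[OF PPPP.T.abelian_group_axioms tau_hom ahom_comp[OF PPPP.mult_left_hom tau_hom[OF u]] _ w])
    (use u z in \<open>simp_all add: tau_pure\<close>)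

text \<open>Applies \<phi> to the first two legs and keeps the last, rebracketing the four resulting
  legs as \<open>(P \<otimes> P) \<otimes> (P \<otimes> P)\<close>.\<close>

definition ll where "ll \<phi> = tensor_lift PPPP (\<lambda>V u. tau u (\<phi> V))"

lemma ll_balanced:
  assumes \<phi>: "K_linear \<phi>"
  shows "balanced K PP (\<lambda>x a. a \<odot>\<^bsub>PP\<^esub> x) (opposite P) (\<lambda>a y. a \<odot>\<^bsub>opposite P\<^esub> y) PPPP (\<lambda>V u. tau u (\<phi> V))"
proof (rule PPP_balancedI)
  show "(\<lambda>u. tau u (\<phi> V)) \<in> ahom P PPPP" if "V \<in> carrier PP" for V
    by (rule tau_param_hom[OF \<phi>_closed[OF \<phi> that]])
  show "(\<lambda>V. tau u (\<phi> V)) \<in> ahom PP PPPP" if "u \<in> carrier P" for u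
    by (rule ahom_comp[OF tau_hom[OF that] \<phi>_hom[OF \<phi>]])
  show "tau u (\<phi> (k \<odot>\<^bsub>PP\<^esub> V)) = tau (k \<odot>\<^bsub>P\<^esub> u) (\<phi> V)" if "V \<in> carrier PP" "k \<in> carrier K" "u \<in> carrier P" for V k u
    using \<phi> that \<phi>_closed[OF \<phi> that(1)] by (simp add: K_linear_def tau_smult)
qed

lemma ll_hom: "K_linear \<phi> \<Longrightarrow> ll \<phi> \<in> ahom PPP PPPP"
  unfolding ll_def by (rule PPP.lift_hom[OF PPPP.T.abelian_group_axioms ll_balanced])

lemma ll_pure: "K_linear \<phi> \<Longrightarrow> V \<in> carrier PP \<Longrightarrow> u \<in> carrier P \<Longrightarrow> ll \<phi> (V \<boxtimes>\<^bsub>PPP\<^esub> u) = tau u (\<phi> V)"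
  unfolding ll_def by (rule PPP.lift_pure[OF PPPP.T.abelian_group_axioms ll_balanced]) simp_all

lemmas J_K_linear = P_linear_imp_K_linear[OF P_linear_J]
  and j_K_linear = P_linear_imp_K_linear[OF P_linear_j]

lemma ll_J_inr:
  assumes z: "z \<in> carrier P" and w: "w \<in> carrier PPP"
  shows "ll J (inr z \<otimes>\<^bsub>PPP\<^esub> w) = (\<one>\<^bsub>PP\<^esub> \<boxtimes>\<^bsub>PPPP\<^esub> tgt z) \<otimes>\<^bsub>PPPP\<^esub> ll J w"
  by (rule PPP_hom_ext[OF PPPP.T.abelian_group_axioms ahom_comp[OF ll_hom[OF J_K_linear] PPP.mult_left_hom]
        ahom_comp[OF PPPP.mult_left_hom ll_hom[OF J_K_linear]] _ w])
    (use z in \<open>simp_all add: ll_pure[OF J_K_linear] tau_mult_tgt\<close>)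

lemma ll_J_inl:
  assumes b: "b \<in> carrier P" and w: "w \<in> carrier PPP"
  shows "ll J (inl (src b) \<otimes>\<^bsub>PPP\<^esub> w) = ll J w \<otimes>\<^bsub>PPPP\<^esub> (tgt b \<boxtimes>\<^bsub>PPPP\<^esub> \<one>\<^bsub>PP\<^esub>)"
  by (rule PPP_hom_ext[OF PPPP.T.abelian_group_axioms ahom_comp[OF ll_hom[OF J_K_linear] PPP.mult_left_hom]
        ahom_comp[OF PPPP.mult_right_hom ll_hom[OF J_K_linear]] _ w])
    (use b in \<open>simp_all add: ll_pure[OF J_K_linear] J_src tau_mult_inl\<close>)

lemma ll_J_e:
  assumes x: "x \<in> carrier P" and V: "V \<in> carrier PP"
  shows "ll J (inl (src x) \<otimes>\<^bsub>PPP\<^esub> J V) = tgt x \<boxtimes>\<^bsub>PPPP\<^esub> V"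
  by (rule PP_hom_ext[OF PPPP.T.abelian_group_axioms ahom_comp[OF ll_hom[OF J_K_linear] ahom_comp[OF PPP.mult_left_hom J_hom]]
        PPPP.pure_hom_right _ V])
    (use x in \<open>simp_all add: J_pure ll_pure[OF J_K_linear] tau_pure\<close>)

lemma PPPP_right_module: "right_module P PPPP (\<lambda>w z. (\<one>\<^bsub>PP\<^esub> \<boxtimes>\<^bsub>PPPP\<^esub> tgt z) \<otimes>\<^bsub>PPPP\<^esub> w)"
proof (rule right_module.intro[OF P.A.ring_axioms PPPP.T.abelian_group_axioms], unfold right_module_axioms_def, intro conjI allI impI)
  fix a b w assume ab: "a \<in> carrier P" "b \<in> carrier P" and w: "w \<in> carrier PPPP"
  show "(\<one>\<^bsub>PP\<^esub> \<boxtimes>\<^bsub>PPPP\<^esub> tgt (a \<oplus>\<^bsub>P\<^esub> b)) \<otimes>\<^bsub>PPPP\<^esub> w =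
    ((\<one>\<^bsub>PP\<^esub> \<boxtimes>\<^bsub>PPPP\<^esub> tgt a) \<otimes>\<^bsub>PPPP\<^esub> w) \<oplus>\<^bsub>PPPP\<^esub> ((\<one>\<^bsub>PP\<^esub> \<boxtimes>\<^bsub>PPPP\<^esub> tgt b) \<otimes>\<^bsub>PPPP\<^esub> w)"
    using ab w by (simp add: ahom_add[OF PP_pure_hom(1)] ahom_add[OF PPPP.pure_hom_right] PPPP.AB.A.l_distr)
  have "\<one>\<^bsub>PP\<^esub> \<boxtimes>\<^bsub>PPPP\<^esub> tgt (a \<otimes>\<^bsub>P\<^esub> b) = (\<one>\<^bsub>PP\<^esub> \<boxtimes>\<^bsub>PPPP\<^esub> tgt b) \<otimes>\<^bsub>PPPP\<^esub> (\<one>\<^bsub>PP\<^esub> \<boxtimes>\<^bsub>PPPP\<^esub> tgt a)" using ab by simp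
  then show "(\<one>\<^bsub>PP\<^esub> \<boxtimes>\<^bsub>PPPP\<^esub> tgt (a \<otimes>\<^bsub>P\<^esub> b)) \<otimes>\<^bsub>PPPP\<^esub> w =
    (\<one>\<^bsub>PP\<^esub> \<boxtimes>\<^bsub>PPPP\<^esub> tgt b) \<otimes>\<^bsub>PPPP\<^esub> ((\<one>\<^bsub>PP\<^esub> \<boxtimes>\<^bsub>PPPP\<^esub> tgt a) \<otimes>\<^bsub>PPPP\<^esub> w)"
    using ab w by (simp add: PPPP.AB.A.m_assoc del: PPPP.mult_pure)
next
  show "(\<one>\<^bsub>PP\<^esub> \<boxtimes>\<^bsub>PPPP\<^esub> tgt \<one>\<^bsub>P\<^esub>) \<otimes>\<^bsub>PPPP\<^esub> w = w" if "w \<in> carrier PPPP" for w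
    using that PPPP.AB.A.l_one[OF that] by (simp add: PPPP.one_eq PP.one_eq)
qed (simp_all add: PPPP.AB.A.r_distr)

text \<open>The isomorphism \<open>(L \<otimes>\<^sub>B L) \<otimes>\<^sub>B P \<cong> P \<otimes> P
  \<otimes> P\<close> obtained from the first descent. In the next one it takes the place of \<mu>,
  with \<open>L \<otimes>\<^sub>B L\<close> as the module \<open>N\<close>.\<close>

abbreviation \<alpha> where "\<alpha> \<equiv> tensor_lift PPP (\<lambda>n z. inr z \<otimes>\<^bsub>PPP\<^esub> \<iota> n)"

lemma \<alpha>_eq: "IM.\<alpha> = \<alpha>"
  by (simp add: IM.\<alpha>_def)

lemma rLL_lLL:
  assumes a: "a \<in> carrier B" and b: "b \<in> carrier B" and Z: "Z \<in> carrier LL"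
  shows "rLL (lLL a Z) b = lLL a (rLL Z b)"
  by (rule LL.hom_ext[OF LL.T.abelian_group_axioms ahom_comp[OF rLL_hom[OF b] lLL_hom[OF a]] ahom_comp[OF lLL_hom[OF a] rLL_hom[OF b]] _ Z])
    (use a b in \<open>simp add: I.rLN_pure lLL_pure L_mult_closed src_in_L tgt_in_L\<close>)

interpretation I3: descent_step K H \<Delta> \<epsilon> S P \<delta> LL rLL lLL PPP PP \<alpha> "\<lambda>x u. inl (src x) \<otimes>\<^bsub>PPP\<^esub> J u" "\<lambda>b w. inl (src b) \<otimes>\<^bsub>PPP\<^esub> w"
proof (rule descent_step.intro[OF faithfully_flat_galois_axioms I.rLN_module lLL_module PPP.T.abelian_group_axioms PP.T.abelian_group_axioms],
    rule descent_step_axioms.intro)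
  show "rLL (lLL a n) b = lLL a (rLL n b)" if "a \<in> carrier B" "n \<in> carrier LL" "b \<in> carrier B" for a n b
    using that by (simp add: rLL_lLL)
  show "\<alpha> \<in> ahom I.LNP PPP"
    using IM.\<alpha>_hom by (simp only: \<alpha>_eq)
  show "bij_betw \<alpha> (carrier I.LNP) (carrier PPP)"
    using IM.\<alpha>_bij[OF PPP_pure_hom(2)] by (simp only: \<alpha>_eq)
  show "(\<lambda>x. inl (src x) \<otimes>\<^bsub>PPP\<^esub> J u) \<in> ahom P PPP" if "u \<in> carrier PP" for u
    by (rule ahom_comp[OF PPP.mult_right_hom ahom_comp[OF PPP_pure_hom(2) PP_pure_hom(2)]]) (use that in simp_all)
  show "(\<lambda>u. inl (src x) \<otimes>\<^bsub>PPP\<^esub> J u) \<in> ahom PP PPP" if "x \<in> carrier P" for x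
    by (rule ahom_comp[OF PPP.mult_left_hom J_hom]) (use that in simp_all)
  show "inl (src (k \<odot>\<^bsub>P\<^esub> x)) \<otimes>\<^bsub>PPP\<^esub> J u = inl (src x) \<otimes>\<^bsub>PPP\<^esub> J (k \<odot>\<^bsub>PP\<^esub> u)"
    if "k \<in> carrier K" "x \<in> carrier P" "u \<in> carrier PP" for k x u
    using that J_K_linear by (simp add: K_linear_def PPP.AB.smult_mult_right PPP.AB.smult_mult_left[symmetric] PPP.smult_pure PP.smult_pure)
  show "(\<lambda>w. inl (src b) \<otimes>\<^bsub>PPP\<^esub> w) \<in> ahom PPP PPP" if "b \<in> carrier B" for b
    by (rule PPP.mult_left_hom) (use that in \<open>simp add: B_closed\<close>)
  show "inl (src b) \<otimes>\<^bsub>PPP\<^esub> (inl (src x) \<otimes>\<^bsub>PPP\<^esub> J u) = inl (src (b \<otimes>\<^bsub>P\<^esub> x)) \<otimes>\<^bsub>PPP\<^esub> J u"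
    if "b \<in> carrier B" "x \<in> carrier P" "u \<in> carrier PP" for b x u
    using that by (simp add: B_closed flip: PPP.AB.A.m_assoc)
  fix b n z assume a: "b \<in> carrier B" "n \<in> carrier LL" "z \<in> carrier P"
  have "lLL b n \<in> carrier LL" using left_module.closed[OF lLL_module a(1,2)] .
  moreover have "inr z \<otimes>\<^bsub>PPP\<^esub> (inl (src b) \<otimes>\<^bsub>PPP\<^esub> \<iota> n) = inl (src b) \<otimes>\<^bsub>PPP\<^esub> (inr z \<otimes>\<^bsub>PPP\<^esub> \<iota> n)"
    using a by (simp add: B_closed flip: PPP.AB.A.m_assoc)
  ultimately show "\<alpha> (lLL b n \<boxtimes>\<^bsub>I.LNP\<^esub> z) = inl (src b) \<otimes>\<^bsub>PPP\<^esub> \<alpha> (n \<boxtimes>\<^bsub>I.LNP\<^esub> z)"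
    using a IM.\<alpha>_pure[of "lLL b n" z] IM.\<alpha>_pure[of n z] by (simp only: \<alpha>_eq \<iota>_lLL)
qed (simp_all add: PP.AB.smult_closed)

abbreviation LLL where "LLL \<equiv> tensor B L tact LL lLL"

sublocale LLL: tensor_product B L tact LL lLL LLL
  by (rule tensor_productI[OF L_right_module lLL_module])

text \<open>\<open>\<iota>3\<close> is \<open>(p \<otimes> q) \<otimes> (r \<otimes> u) \<otimes> (v \<otimes> w) \<mapsto> p \<otimes> qr \<otimes> uv \<otimes> w\<close>.\<close>

definition \<iota>3 where "\<iota>3 = tensor_lift PPPP (\<lambda>X Z. ll J (\<iota> Z) \<otimes>\<^bsub>PPPP\<^esub> (X \<boxtimes>\<^bsub>PPPP\<^esub> \<one>\<^bsub>PP\<^esub>))"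

lemma ll_J_closed [simp]: "w \<in> carrier PPP \<Longrightarrow> ll J w \<in> carrier PPPP"
  using ll_hom[OF J_K_linear] by (rule ahom_closed)

lemma \<iota>3_balanced: "balanced B L tact LL lLL PPPP (\<lambda>X Z. ll J (\<iota> Z) \<otimes>\<^bsub>PPPP\<^esub> (X \<boxtimes>\<^bsub>PPPP\<^esub> \<one>\<^bsub>PP\<^esub>))"
proof (rule balancedI)
  show "(\<lambda>Z. ll J (\<iota> Z) \<otimes>\<^bsub>PPPP\<^esub> (X \<boxtimes>\<^bsub>PPPP\<^esub> \<one>\<^bsub>PP\<^esub>)) \<in> ahom LL PPPP" if "X \<in> carrier L" for X
    by (rule ahom_comp[OF PPPP.mult_right_hom ahom_comp[OF ll_hom[OF J_K_linear] \<iota>_hom]]) (use that in \<open>simp add: L_closed\<close>)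
  show "(\<lambda>X. ll J (\<iota> Z) \<otimes>\<^bsub>PPPP\<^esub> (X \<boxtimes>\<^bsub>PPPP\<^esub> \<one>\<^bsub>PP\<^esub>)) \<in> ahom L PPPP" if "Z \<in> carrier LL" for Z
    by (rule L_into_PP, rule ahom_comp[OF PPPP.mult_left_hom PPPP.pure_hom_left]) (use that in simp_all)
  show "ll J (\<iota> Z) \<otimes>\<^bsub>PPPP\<^esub> ((tgt b \<otimes>\<^bsub>PP\<^esub> X) \<boxtimes>\<^bsub>PPPP\<^esub> \<one>\<^bsub>PP\<^esub>) = ll J (\<iota> (lLL b Z)) \<otimes>\<^bsub>PPPP\<^esub> (X \<boxtimes>\<^bsub>PPPP\<^esub> \<one>\<^bsub>PP\<^esub>)"
    if "X \<in> carrier L" "b \<in> carrier B" "Z \<in> carrier LL" for X b Z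
    using that by (simp add: \<iota>_lLL ll_J_inl B_closed L_closed PPPP.AB.A.m_assoc)
qed

lemma \<iota>3_hom: "\<iota>3 \<in> ahom LLL PPPP"
  unfolding \<iota>3_def by (rule LLL.lift_hom[OF PPPP.T.abelian_group_axioms \<iota>3_balanced])

lemma \<iota>3_pure: "X \<in> carrier L \<Longrightarrow> Z \<in> carrier LL \<Longrightarrow> \<iota>3 (X \<boxtimes>\<^bsub>LLL\<^esub> Z) = ll J (\<iota> Z) \<otimes>\<^bsub>PPPP\<^esub> (X \<boxtimes>\<^bsub>PPPP\<^esub> \<one>\<^bsub>PP\<^esub>)"
  unfolding \<iota>3_def by (rule LLL.lift_pure[OF PPPP.T.abelian_group_axioms \<iota>3_balanced])

lemma rLL_closed: "Z \<in> carrier LL \<Longrightarrow> b \<in> carrier B \<Longrightarrow> rLL Z b \<in> carrier LL"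
  using right_module.closed[OF I.rLN_module, of b Z] by simp

lemma \<iota>3_right:
  assumes W: "W \<in> carrier LLL" and b: "b \<in> carrier B"
  shows "\<iota>3 (I3.rLN W b) = (\<one>\<^bsub>PP\<^esub> \<boxtimes>\<^bsub>PPPP\<^esub> tgt b) \<otimes>\<^bsub>PPPP\<^esub> \<iota>3 W"
proof (rule LLL.hom_ext[OF PPPP.T.abelian_group_axioms ahom_comp[OF \<iota>3_hom right_module_mult_hom[OF I3.rLN_module b]]
      ahom_comp[OF PPPP.mult_left_hom \<iota>3_hom] _ W])
  fix X Z assume XZ: "X \<in> carrier L" "Z \<in> carrier LL"
  show "\<iota>3 (I3.rLN (X \<boxtimes>\<^bsub>LLL\<^esub> Z) b) = (\<one>\<^bsub>PP\<^esub> \<boxtimes>\<^bsub>PPPP\<^esub> tgt b) \<otimes>\<^bsub>PPPP\<^esub> \<iota>3 (X \<boxtimes>\<^bsub>LLL\<^esub> Z)"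
    unfolding I3.rLN_pure[OF XZ b] \<iota>3_pure[OF XZ(1) rLL_closed[OF XZ(2) b]] \<iota>3_pure[OF XZ] \<iota>_rLL[OF XZ(2) b]
    using XZ b by (simp add: ll_J_inr B_closed L_closed PPPP.AB.A.m_assoc)
qed (use b in \<open>simp add: B_closed\<close>)

lemma I3_LNP: "abelian_group I3.LNP"
  by (rule tensor_functor.TN_abelian_group[OF tensor_functor_P I3.rLN_module])

definition \<gamma>3 where "\<gamma>3 = tensor_lift I3.LNP (\<lambda>v u. I3.G u (I3.\<mu>' v))"

lemma \<gamma>3_balanced:
  "balanced K PP (\<lambda>x a. a \<odot>\<^bsub>PP\<^esub> x) PP (\<lambda>a y. a \<odot>\<^bsub>PP\<^esub> y) I3.LNP (\<lambda>v u. I3.G u (I3.\<mu>' v))"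
proof (rule balancedI)
  show "(\<lambda>u. I3.G u (I3.\<mu>' v)) \<in> ahom PP I3.LNP" if "v \<in> carrier PP" for v
    by (rule I3.G_param_hom[OF ahom_closed[OF I3.\<mu>'_hom that]])
  show "(\<lambda>v. I3.G u (I3.\<mu>' v)) \<in> ahom PP I3.LNP" if "u \<in> carrier PP" for u
    by (rule ahom_comp[OF I3.G_hom[OF that] I3.\<mu>'_hom])
qed (rule I3.G_smult)

lemma \<gamma>3_hom: "\<gamma>3 \<in> ahom PPPP I3.LNP"
  unfolding \<gamma>3_def by (rule PPPP.lift_hom[OF I3_LNP \<gamma>3_balanced])

lemma \<gamma>3_pure: "v \<in> carrier PP \<Longrightarrow> u \<in> carrier PP \<Longrightarrow> \<gamma>3 (v \<boxtimes>\<^bsub>PPPP\<^esub> u) = I3.G u (I3.\<mu>' v)"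
  unfolding \<gamma>3_def by (rule PPPP.lift_pure[OF I3_LNP \<gamma>3_balanced])

lemma \<iota>3_inj: "inj_on \<iota>3 (carrier LLL)"
proof -
  interpret IM3: descent_map K H \<Delta> \<epsilon> S P \<delta> LL rLL lLL PPP PP \<alpha> "\<lambda>x u. inl (src x) \<otimes>\<^bsub>PPP\<^esub> J u" "\<lambda>b w. inl (src b) \<otimes>\<^bsub>PPP\<^esub> w"
    PPPP "\<lambda>w z. (\<one>\<^bsub>PP\<^esub> \<boxtimes>\<^bsub>PPPP\<^esub> tgt z) \<otimes>\<^bsub>PPPP\<^esub> w" "\<lambda>v u. v \<boxtimes>\<^bsub>PPPP\<^esub> u" "\<lambda>X w. ll J w \<otimes>\<^bsub>PPPP\<^esub> (X \<boxtimes>\<^bsub>PPPP\<^esub> \<one>\<^bsub>PP\<^esub>)" \<iota>3 \<gamma>3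
  proof (rule descent_map.intro[OF I3.descent_step_axioms PPPP_right_module], rule descent_map_axioms.intro)
    show "g y = h y" if "g \<in> ahom PPP I3.LNP" "h \<in> ahom PPP I3.LNP"
      "\<And>x u. x \<in> carrier P \<Longrightarrow> u \<in> carrier PP \<Longrightarrow> g (inl (src x) \<otimes>\<^bsub>PPP\<^esub> J u) = h (inl (src x) \<otimes>\<^bsub>PPP\<^esub> J u)" "y \<in> carrier PPP" for g h y
    proof (rule PPP_hom_ext'[OF I3_LNP that(1,2) _ that(4)])
      fix p x z assume "p \<in> carrier P" "x \<in> carrier P" "z \<in> carrier P"
      then show "g ((p \<boxtimes>\<^bsub>PP\<^esub> x) \<boxtimes>\<^bsub>PPP\<^esub> z) = h ((p \<boxtimes>\<^bsub>PP\<^esub> x) \<boxtimes>\<^bsub>PPP\<^esub> z)"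
        using that(3)[of p "x \<boxtimes>\<^bsub>PP\<^esub> z"] by (simp add: J_pure)
    qed
    show "g y = y" if "g \<in> ahom PPPP PPPP"
      "\<And>v u. v \<in> carrier PP \<Longrightarrow> u \<in> carrier PP \<Longrightarrow> g (v \<boxtimes>\<^bsub>PPPP\<^esub> u) = v \<boxtimes>\<^bsub>PPPP\<^esub> u" "y \<in> carrier PPPP" for g y
      by (rule PPPP.hom_ext[OF PPPP.T.abelian_group_axioms that(1) ahom_ident that(2,3)])
    show "\<gamma>3 \<in> ahom PPPP I3.LNP" by (rule \<gamma>3_hom)
    show "\<gamma>3 (v \<boxtimes>\<^bsub>PPPP\<^esub> u) = I3.G u (I3.\<mu>' v)" if "v \<in> carrier PP" "u \<in> carrier PP" for v u
      using that by (rule \<gamma>3_pure)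
    show "(\<lambda>w. ll J w \<otimes>\<^bsub>PPPP\<^esub> (X \<boxtimes>\<^bsub>PPPP\<^esub> \<one>\<^bsub>PP\<^esub>)) \<in> ahom PPP PPPP" if "X \<in> carrier L" for X
      by (rule ahom_comp[OF PPPP.mult_right_hom ll_hom[OF J_K_linear]]) (use that in \<open>simp add: L_closed\<close>)
    show "ll J (inl (src x) \<otimes>\<^bsub>PPP\<^esub> J u) \<otimes>\<^bsub>PPPP\<^esub> (X \<boxtimes>\<^bsub>PPPP\<^esub> \<one>\<^bsub>PP\<^esub>) = (tgt x \<otimes>\<^bsub>PP\<^esub> X) \<boxtimes>\<^bsub>PPPP\<^esub> u"
      if "X \<in> carrier L" "x \<in> carrier P" "u \<in> carrier PP" for X x u
      using that by (simp add: ll_J_e L_closed)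
    show "\<iota>3 \<in> right_module_hom B LLL I3.rLN PPPP (\<lambda>w z. (\<one>\<^bsub>PP\<^esub> \<boxtimes>\<^bsub>PPPP\<^esub> tgt z) \<otimes>\<^bsub>PPPP\<^esub> w)"
      by (rule right_module_homI) (rule \<iota>3_hom, erule \<iota>3_right, assumption)
    show "(\<one>\<^bsub>PP\<^esub> \<boxtimes>\<^bsub>PPPP\<^esub> tgt z) \<otimes>\<^bsub>PPPP\<^esub> \<iota>3 (X \<boxtimes>\<^bsub>LLL\<^esub> n) = ll J (\<alpha> (n \<boxtimes>\<^bsub>I.LNP\<^esub> z)) \<otimes>\<^bsub>PPPP\<^esub> (X \<boxtimes>\<^bsub>PPPP\<^esub> \<one>\<^bsub>PP\<^esub>)"
      if "X \<in> carrier L" "n \<in> carrier LL" "z \<in> carrier P" for X n z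
    proof -
      have "\<alpha> (n \<boxtimes>\<^bsub>I.LNP\<^esub> z) = inr z \<otimes>\<^bsub>PPP\<^esub> \<iota> n"
        using IM.\<alpha>_pure[OF that(2,3)] by (simp only: \<alpha>_eq)
      then show ?thesis
        using that by (simp add: \<iota>3_pure ll_J_inr L_closed PPPP.AB.A.m_assoc)
    qed
    show "embeds TYPE(('h + 'p) list) (carrier LL)" by (rule IM.embeds_LN)
    show "embeds TYPE(('h + 'p) list) (carrier PPPP)"
      by (rule PPPP.embeds_tensor[OF infinite_universe embeds_PP embeds_PP])
  qed
  show ?thesis by (rule IM3.f_inj)
qed

section \<open>The coproduct\<close>

lemma ES_source_eq: "ES_source K P = (\<lambda>b. src b)" and ES_target_eq: "ES_target K P = (\<lambda>b. tgt b)"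
  by (simp_all add: fun_eq_iff ES_source_def ES_target_def ES_ambient_eq)

lemma bimodule_square_eq: "bimodule_square B L (ES_source K P) (ES_target K P) = LL"
  by (simp add: bimodule_square_def ES_source_eq ES_target_eq)

lemma bimodule_cube_eq: "bimodule_cube B L (ES_source K P) (ES_target K P) = LLL"
  unfolding bimodule_cube_def bimodule_square_eq Let_def by (simp add: ES_source_eq ES_target_eq)

lemma ES_square_eq: "ES_square K H P \<delta> = LL"
  by (simp add: ES_square_def bimodule_square_eq)

lemma PP_left_module: "left_module B PP sact"
proof (rule left_module.intro[OF B.A.ring_axioms PP.T.abelian_group_axioms], unfold left_module_axioms_def, intro conjI allI impI)
  fix a b X assume a: "a \<in> carrier B" "b \<in> carrier B" and X: "X \<in> carrier PP"
  note c = B_closed[OF a(1)] B_closed[OF a(2)] X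
  show "src (a \<oplus>\<^bsub>B\<^esub> b) \<otimes>\<^bsub>PP\<^esub> X = (src a \<otimes>\<^bsub>PP\<^esub> X) \<oplus>\<^bsub>PP\<^esub> (src b \<otimes>\<^bsub>PP\<^esub> X)"
    using c by (simp add: ahom_add[OF PP_pure_hom(2)] PP.AB.A.l_distr)
  show "src (a \<otimes>\<^bsub>B\<^esub> b) \<otimes>\<^bsub>PP\<^esub> X = src a \<otimes>\<^bsub>PP\<^esub> (src b \<otimes>\<^bsub>PP\<^esub> X)"
    using c by (simp add: src_mult PP.AB.A.m_assoc del: PP.mult_pure)
next
  show "src \<one>\<^bsub>B\<^esub> \<otimes>\<^bsub>PP\<^esub> X = X" if "X \<in> carrier PP" for X
    using that PP.one_eq PP.AB.A.l_one[OF that] by simp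
qed (simp_all add: B_closed PP.AB.A.r_distr)

lemma PP_right_B_module: "right_module B PP tact"
  by (rule right_module_restrict[OF tgt_right_module])

abbreviation AS where "AS \<equiv> tensor B PP tact PP sact"

sublocale AS: tensor_product B PP tact PP sact AS
  by (rule tensor_productI[OF PP_right_B_module PP_left_module])

lemma ES_ambient_square_eq: "ES_ambient_square K H P \<delta> = AS"
  by (simp add: ES_ambient_square_def bimodule_square_def ES_source_eq ES_target_eq ES_ambient_eq)

definition incl2 where "incl2 = tensor_lift AS (\<lambda>X Y. X \<boxtimes>\<^bsub>AS\<^esub> Y)"

lemma ES_inclusion_eq: "ES_inclusion K H P \<delta> = incl2"
  by (simp add: ES_inclusion_def ES_ambient_square_eq Let_def incl2_def)

lemma incl2_balanced: "balanced B L tact L sact AS (\<lambda>X Y. X \<boxtimes>\<^bsub>AS\<^esub> Y)"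
proof (rule balancedI)
  show "(\<lambda>Y. X \<boxtimes>\<^bsub>AS\<^esub> Y) \<in> ahom L AS" if "X \<in> carrier L" for X
    by (rule L_into_PP[OF AS.pure_hom_right[OF L_closed[OF that]]])
  show "(\<lambda>X. X \<boxtimes>\<^bsub>AS\<^esub> Y) \<in> ahom L AS" if "Y \<in> carrier L" for Y
    by (rule L_into_PP[OF AS.pure_hom_left[OF L_closed[OF that]]])
  show "(tgt b \<otimes>\<^bsub>PP\<^esub> X) \<boxtimes>\<^bsub>AS\<^esub> Y = X \<boxtimes>\<^bsub>AS\<^esub> (src b \<otimes>\<^bsub>PP\<^esub> Y)"
    if "X \<in> carrier L" "b \<in> carrier B" "Y \<in> carrier L" for X b Y
    by (rule AS.pure_balance[OF L_closed[OF that(1)] that(2) L_closed[OF that(3)]])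
qed

lemma incl2_hom: "incl2 \<in> ahom LL AS"
  unfolding incl2_def by (rule LL.lift_hom[OF AS.T.abelian_group_axioms incl2_balanced])

lemma incl2_pure: "X \<in> carrier L \<Longrightarrow> Y \<in> carrier L \<Longrightarrow> incl2 (X \<boxtimes>\<^bsub>LL\<^esub> Y) = X \<boxtimes>\<^bsub>AS\<^esub> Y"
  unfolding incl2_def by (rule LL.lift_pure[OF AS.T.abelian_group_axioms incl2_balanced])

text \<open>The formula of \<iota> is already balanced on the ambient tensor product, so \<iota>
  factors through \<open>incl2\<close>, which is therefore injective.\<close>

definition \<iota>_AS where "\<iota>_AS = tensor_lift PPP (\<lambda>X Y. J Y \<otimes>\<^bsub>PPP\<^esub> inl X)"

lemma \<iota>_AS_balanced: "balanced B PP tact PP sact PPP (\<lambda>X Y. J Y \<otimes>\<^bsub>PPP\<^esub> inl X)"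
proof (rule balancedI)
  show "(\<lambda>Y. J Y \<otimes>\<^bsub>PPP\<^esub> inl X) \<in> ahom PP PPP" if "X \<in> carrier PP" for X
    by (rule J_mult_inl_hom[OF that])
  show "(\<lambda>X. J Y \<otimes>\<^bsub>PPP\<^esub> inl X) \<in> ahom PP PPP" if "Y \<in> carrier PP" for Y
    by (rule ahom_comp[OF PPP.mult_left_hom PPP_pure_hom(2)]) (use that in simp_all)
  show "J Y \<otimes>\<^bsub>PPP\<^esub> inl (tgt b \<otimes>\<^bsub>PP\<^esub> X) = J (src b \<otimes>\<^bsub>PP\<^esub> Y) \<otimes>\<^bsub>PPP\<^esub> inl X"
    if "X \<in> carrier PP" "b \<in> carrier B" "Y \<in> carrier PP" for X b Y
    using that by (simp add: B_closed J_src inl_mult PPP.AB.A.m_assoc del: PPP.mult_pure)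
qed

lemma \<iota>_AS_incl2:
  assumes "Z \<in> carrier LL" shows "\<iota>_AS (incl2 Z) = \<iota> Z"
  by (rule LL.hom_ext[OF PPP.T.abelian_group_axioms
        ahom_comp[OF AS.lift_hom[OF PPP.T.abelian_group_axioms \<iota>_AS_balanced, folded \<iota>_AS_def] incl2_hom] \<iota>_hom _ assms])
    (simp add: incl2_pure \<iota>_pure \<iota>_AS_def AS.lift_pure[OF PPP.T.abelian_group_axioms \<iota>_AS_balanced] L_closed)

lemma incl2_inj: "inj_on incl2 (carrier LL)"
proof (rule inj_onI)
  fix Z W assume Z: "Z \<in> carrier LL" and W: "W \<in> carrier LL" and eq: "incl2 Z = incl2 W"
  have "\<iota> Z = \<iota> W" unfolding \<iota>_AS_incl2[OF Z, symmetric] \<iota>_AS_incl2[OF W, symmetric] eq ..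
  then show "Z = W" by (rule inj_onD[OF \<iota>_inj _ Z W])
qed

definition glue where "glue u = tensor_lift AS (\<lambda>V y. V \<boxtimes>\<^bsub>AS\<^esub> (y \<boxtimes>\<^bsub>PP\<^esub> u))"

lemma glue_balanced:
  assumes u: "u \<in> carrier P"
  shows "balanced B PP tact P (\<lambda>b p. b \<otimes>\<^bsub>P\<^esub> p) AS (\<lambda>V y. V \<boxtimes>\<^bsub>AS\<^esub> (y \<boxtimes>\<^bsub>PP\<^esub> u))"
proof (rule balancedI)
  show "(\<lambda>y. V \<boxtimes>\<^bsub>AS\<^esub> (y \<boxtimes>\<^bsub>PP\<^esub> u)) \<in> ahom P AS" if "V \<in> carrier PP" for V
    by (rule AS.pure_right_comp[OF that PP_pure_hom(2)[OF u]])
  show "(\<lambda>V. V \<boxtimes>\<^bsub>AS\<^esub> (y \<boxtimes>\<^bsub>PP\<^esub> u)) \<in> ahom PP AS" if "y \<in> carrier P" for y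
    by (rule AS.pure_hom_left) (use that u in simp)
  show "(tgt b \<otimes>\<^bsub>PP\<^esub> V) \<boxtimes>\<^bsub>AS\<^esub> (y \<boxtimes>\<^bsub>PP\<^esub> u) = V \<boxtimes>\<^bsub>AS\<^esub> ((b \<otimes>\<^bsub>P\<^esub> y) \<boxtimes>\<^bsub>PP\<^esub> u)"
    if "V \<in> carrier PP" "b \<in> carrier B" "y \<in> carrier P" for V b y
    using AS.pure_balance[of V b "y \<boxtimes>\<^bsub>PP\<^esub> u"] that u by (simp add: B_closed)
qed

lemma glue_hom: "u \<in> carrier P \<Longrightarrow> glue u \<in> ahom PPm.MP AS"
  unfolding glue_def by (rule PPm.MP.lift_hom[OF AS.T.abelian_group_axioms glue_balanced])

lemma glue_pure: "u \<in> carrier P \<Longrightarrow> V \<in> carrier PP \<Longrightarrow> y \<in> carrier P \<Longrightarrow>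
    glue u (V \<boxtimes>\<^bsub>PPm.MP\<^esub> y) = V \<boxtimes>\<^bsub>AS\<^esub> (y \<boxtimes>\<^bsub>PP\<^esub> u)"
  unfolding glue_def by (rule PPm.MP.lift_pure[OF AS.T.abelian_group_axioms glue_balanced])

lemma glue_param_hom: "\<xi> \<in> carrier PPm.MP \<Longrightarrow> (\<lambda>u. glue u \<xi>) \<in> ahom P AS"
  unfolding glue_def
  by (rule PPm.MP.lift_param_hom[OF AS.T.abelian_group_axioms], assumption)
    (erule AS.pure_right_comp, erule PP_pure_hom(1))

text \<open>The scalar travels through \<open>diag\<close> and \<open>D\<close> as the action of
  \<open>k 1\<close> on the last leg, because \<open>C\<close> is \<open>P\<close>-linear; in the
  ambient square it can then be moved to \<open>u\<close>.\<close>

lemma glue_smult: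
  assumes k: "k \<in> carrier K" and u: "u \<in> carrier P" and v: "v \<in> carrier PP"
  shows "glue u (PPg.D (diag (k \<odot>\<^bsub>PP\<^esub> v))) = glue (k \<odot>\<^bsub>P\<^esub> u) (PPg.D (diag v))"
proof -
  have k1: "k \<odot>\<^bsub>P\<^esub> \<one>\<^bsub>P\<^esub> \<in> carrier P" "k \<odot>\<^bsub>P\<^esub> u \<in> carrier P" using k u by simp_all
  let ?Z = "PPg.D (diag v)"
  have Z: "?Z \<in> carrier PPm.MP" using v by simp
  have mh: "(\<lambda>X. PPm.mulP X (k \<odot>\<^bsub>P\<^esub> \<one>\<^bsub>P\<^esub>)) \<in> ahom PPm.MP PPm.MP"
    by (rule PPm.mulP_hom) (rule k1(1) | assumption)+
  have "diag (k \<odot>\<^bsub>PP\<^esub> v) = PPm.\<theta> (k \<odot>\<^bsub>P\<^esub> \<one>\<^bsub>P\<^esub>) (diag v)"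
    using diag_act[OF k1(1) v] PPm.act_scalar[OF v k] by simp
  also have "\<dots> = PPm.C (PPm.mulP ?Z (k \<odot>\<^bsub>P\<^esub> \<one>\<^bsub>P\<^esub>))"
    using PPm.C_mulP[OF Z k1(1)] PPg.C_D[of "diag v"] v by simp
  finally have "PPg.D (diag (k \<odot>\<^bsub>PP\<^esub> v)) = PPm.mulP ?Z (k \<odot>\<^bsub>P\<^esub> \<one>\<^bsub>P\<^esub>)"
    using PPg.D_C[OF ahom_closed[OF mh Z]] by simp
  moreover have "glue u (PPm.mulP ?Z (k \<odot>\<^bsub>P\<^esub> \<one>\<^bsub>P\<^esub>)) = glue (k \<odot>\<^bsub>P\<^esub> u) ?Z"
  proof (rule PPm.MP.hom_ext[OF AS.T.abelian_group_axioms ahom_comp[OF glue_hom[OF u] mh] glue_hom[OF k1(2)] _ Z])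
    fix V y assume "V \<in> carrier PP" "y \<in> carrier P"
    then show "glue u (PPm.mulP (V \<boxtimes>\<^bsub>PPm.MP\<^esub> y) (k \<odot>\<^bsub>P\<^esub> \<one>\<^bsub>P\<^esub>)) = glue (k \<odot>\<^bsub>P\<^esub> u) (V \<boxtimes>\<^bsub>PPm.MP\<^esub> y)"
      using k u k1 by (simp add: PPm.mulP_pure glue_pure P.smult_mult_right PP_smult_balance)
  qed
  ultimately show ?thesis by simp
qed

text \<open>\<open>spread\<close> is \<open>p \<otimes> q \<otimes> u \<mapsto> p\<^sub>0 \<otimes> \<tau>(p\<^sub>1) q \<otimes> u\<close>.\<close>

definition spread where "spread = tensor_lift AS (\<lambda>v u. glue u (PPg.D (diag v)))"

lemma spread_balanced:
  "balanced K PP (\<lambda>x a. a \<odot>\<^bsub>PP\<^esub> x) (opposite P) (\<lambda>a y. a \<odot>\<^bsub>opposite P\<^esub> y) AS (\<lambda>v u. glue u (PPg.D (diag v)))"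
proof (rule PPP_balancedI)
  show "(\<lambda>u. glue u (PPg.D (diag v))) \<in> ahom P AS" if "v \<in> carrier PP" for v
    by (rule glue_param_hom) (use that in simp)
  show "(\<lambda>v. glue u (PPg.D (diag v))) \<in> ahom PP AS" if "u \<in> carrier P" for u
    by (rule ahom_comp[OF glue_hom[OF that] ahom_comp[OF PPg.D_hom diag_hom]])
qed (rule glue_smult)

lemma spread_hom: "spread \<in> ahom PPP AS"
  unfolding spread_def by (rule PPP.lift_hom[OF AS.T.abelian_group_axioms spread_balanced])

lemma spread_pure: "v \<in> carrier PP \<Longrightarrow> u \<in> carrier P \<Longrightarrow> spread (v \<boxtimes>\<^bsub>PPP\<^esub> u) = glue u (PPg.D (diag v))"
  unfolding spread_def by (rule PPP.lift_pure[OF AS.T.abelian_group_axioms spread_balanced]) simp_all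

text \<open>For coinvariant \<open>X\<close> the isomorphism \<open>D\<close> sends
  \<open>diag (tgt r X)\<close> back to \<open>X \<otimes>\<^sub>B r\<close>. Thus
  \<open>spread\<close> undoes the product \<open>qr\<close> that \<iota> has formed.\<close>

lemma incl2_eq_spread:
  assumes Z: "Z \<in> carrier LL" shows "incl2 Z = spread (\<iota> Z)"
proof (rule LL.hom_ext[OF AS.T.abelian_group_axioms incl2_hom ahom_comp[OF spread_hom \<iota>_hom] _ Z])
  fix X Y assume X: "X \<in> carrier L" and Y: "Y \<in> carrier L"
  have XP: "X \<in> carrier PP" "diag X = X \<boxtimes>\<^bsub>PPH\<^esub> \<one>\<^bsub>H\<^esub>" using X by (simp_all add: L_iff)
  have "spread (J V \<otimes>\<^bsub>PPP\<^esub> inl X) = X \<boxtimes>\<^bsub>AS\<^esub> V" if V: "V \<in> carrier PP" for V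
  proof (rule PP_hom_ext[OF AS.T.abelian_group_axioms ahom_comp[OF spread_hom J_mult_inl_hom[OF XP(1)]] AS.pure_hom_right[OF XP(1)] _ V])
    fix r u assume r: "r \<in> carrier P" and u: "u \<in> carrier P"
    have "diag (tgt r \<otimes>\<^bsub>PP\<^esub> X) = PPm.C (X \<boxtimes>\<^bsub>PPm.MP\<^esub> r)"
      using r XP by (simp add: diag_act PPm.C_pure_\<theta>)
    then have "PPg.D (diag (tgt r \<otimes>\<^bsub>PP\<^esub> X)) = X \<boxtimes>\<^bsub>PPm.MP\<^esub> r"
      using r XP(1) by (simp add: PPg.D_C)
    then show "spread (J (r \<boxtimes>\<^bsub>PP\<^esub> u) \<otimes>\<^bsub>PPP\<^esub> inl X) = X \<boxtimes>\<^bsub>AS\<^esub> (r \<boxtimes>\<^bsub>PP\<^esub> u)"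
      using r u XP(1) by (simp add: J_pure spread_pure glue_pure)
  qed
  then show "incl2 (X \<boxtimes>\<^bsub>LL\<^esub> Y) = spread (\<iota> (X \<boxtimes>\<^bsub>LL\<^esub> Y))"
    using X Y by (simp add: incl2_pure \<iota>_pure L_closed)
qed

text \<open>For \<open>p \<otimes> 1 \<otimes> q\<close> the coaction of
  \<open>p \<otimes> 1\<close> is \<open>p_0 \<otimes> 1 \<otimes> p_1\<close>, and \<open>D\<close>
  replaces \<open>p_1\<close> by \<open>\<tau>(p_1)\<close>. Together with
  \<open>incl2_eq_spread\<close> this reduces the coproduct formula to the element
  \<open>j X\<close>.\<close>

lemma ES_coproduct_formula_eq:
  assumes X: "X \<in> carrier PP" shows "ES_coproduct_formula K H P \<delta> X = spread (j X)"
proof -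
  have *: "tensor_lift AS (\<lambda>p0 p1. tensor_lift AS (\<lambda>u v. (p0 \<boxtimes>\<^bsub>PP\<^esub> u) \<boxtimes>\<^bsub>AS\<^esub> (v \<boxtimes>\<^bsub>PP\<^esub> q)) (translation_map K H P \<delta> p1)) (\<delta> p)
    = spread (j (p \<boxtimes>\<^bsub>PP\<^esub> q))" if p: "p \<in> carrier P" and q: "q \<in> carrier P" for p q
  proof -
    have h: "(\<lambda>W. glue q (PPg.D (src_ext W))) \<in> ahom PH AS"
      by (rule ahom_comp[OF glue_hom[OF q] ahom_comp[OF PPg.D_hom src_ext_hom]])
    have "diag (src p) = src_ext (\<delta> p)"
      using p by (simp add: diag_pure PPm.\<theta>_one)
    then have "spread (j (p \<boxtimes>\<^bsub>PP\<^esub> q)) = glue q (PPg.D (src_ext (\<delta> p)))"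
      using p q by (simp add: j_pure spread_pure)
    also have "\<dots> = tensor_lift AS (\<lambda>p0 p1. glue q (PPg.D (src_ext (p0 \<boxtimes>\<^bsub>PH\<^esub> p1)))) (\<delta> p)"
      by (rule PH.hom_eq_lift[OF AS.T.abelian_group_axioms h]) (use p in simp)
    also have "\<dots> = tensor_lift AS (\<lambda>p0 p1. tensor_lift AS (\<lambda>u v. (p0 \<boxtimes>\<^bsub>PP\<^esub> u) \<boxtimes>\<^bsub>AS\<^esub> (v \<boxtimes>\<^bsub>PP\<^esub> q)) (translation_map K H P \<delta> p1)) (\<delta> p)"
    proof (rule PH.lift_cong[OF AS.T.abelian_group_axioms])
      fix p0 p1 assume p0: "p0 \<in> carrier P" and p1: "p1 \<in> carrier H"
      let ?t = "E (\<one>\<^bsub>P\<^esub> \<boxtimes>\<^bsub>PH\<^esub> p1)"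
      have t: "?t \<in> carrier Pm.MP" using p1 by simp
      have s: "src p0 \<in> carrier PP" using p0 by simp
      have "glue q (PPg.D (src_ext (p0 \<boxtimes>\<^bsub>PH\<^esub> p1))) = glue q (PPg.ins (src p0) ?t)"
        using p0 p1 by (simp add: src_ext_pure PPg.D_pure)
      also have "\<dots> = tensor_lift AS (\<lambda>u v. glue q (PPg.ins (src p0) (u \<boxtimes>\<^bsub>Pm.MP\<^esub> v))) ?t"
        by (rule Pm.MP.hom_eq_lift[OF AS.T.abelian_group_axioms ahom_comp[OF glue_hom[OF q] PPg.ins_hom[OF s]] t])
      also have "\<dots> = tensor_lift AS (\<lambda>u v. (p0 \<boxtimes>\<^bsub>PP\<^esub> u) \<boxtimes>\<^bsub>AS\<^esub> (v \<boxtimes>\<^bsub>PP\<^esub> q)) ?t"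
        by (rule Pm.MP.lift_cong[OF AS.T.abelian_group_axioms t])
          (use p0 q in \<open>simp_all add: PPg.ins_pure glue_pure\<close>)
      finally show "glue q (PPg.D (src_ext (p0 \<boxtimes>\<^bsub>PH\<^esub> p1))) =
        tensor_lift AS (\<lambda>u v. (p0 \<boxtimes>\<^bsub>PP\<^esub> u) \<boxtimes>\<^bsub>AS\<^esub> (v \<boxtimes>\<^bsub>PP\<^esub> q)) (translation_map K H P \<delta> p1)"
        by (simp only: translation_map_eq)
      then show "tensor_lift AS (\<lambda>u v. (p0 \<boxtimes>\<^bsub>PP\<^esub> u) \<boxtimes>\<^bsub>AS\<^esub> (v \<boxtimes>\<^bsub>PP\<^esub> q)) (translation_map K H P \<delta> p1) \<in> carrier AS"
        using ahom_closed[OF h, of "p0 \<boxtimes>\<^bsub>PH\<^esub> p1"] p0 p1 by simp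
    qed (use p in simp)
    finally show ?thesis ..
  qed
  have "spread (j X) = tensor_lift AS (\<lambda>p q. spread (j (p \<boxtimes>\<^bsub>PP\<^esub> q))) X"
    by (rule PP.hom_eq_lift[OF AS.T.abelian_group_axioms ahom_comp[OF spread_hom j_hom] X])
  also have "\<dots> = ES_coproduct_formula K H P \<delta> X"
    unfolding ES_coproduct_formula_def Let_def ES_ambient_square_eq ES_ambient_eq
    by (rule PP.lift_cong[OF AS.T.abelian_group_axioms X])
      (use ahom_closed[OF ahom_comp[OF spread_hom j_hom]] in \<open>simp_all add: *\<close>)
  finally show ?thesis ..
qed

abbreviation Cop where "Cop \<equiv> ES_coproduct K H P \<delta>"

lemma coproduct_ex1:
  assumes X: "X \<in> carrier L"
  shows "\<exists>!Y. Y \<in> carrier LL \<and> incl2 Y = ES_coproduct_formula K H P \<delta> X"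
proof -
  from j_image[OF X] obtain Y where Y: "Y \<in> carrier LL" and jX: "j X = \<iota> Y" by (rule imageE)
  show ?thesis
  proof (rule ex1I[of _ Y])
    show e: "Y \<in> carrier LL \<and> incl2 Y = ES_coproduct_formula K H P \<delta> X"
      using Y by (simp add: incl2_eq_spread ES_coproduct_formula_eq[OF L_closed[OF X]] jX)
    fix Z assume Z: "Z \<in> carrier LL \<and> incl2 Z = ES_coproduct_formula K H P \<delta> X"
    then have "incl2 Z = incl2 Y" using e by simp
    then show "Z = Y" by (rule inj_onD[OF incl2_inj _ conjunct1[OF Z] Y])
  qed
qed

text \<open>From here on the coproduct is used only through \<open>\<iota> (Cop X) = j X\<close>;
  the translation map no longer occurs.\<close>

lemma
  assumes X: "X \<in> carrier L"
  shows Cop_closed: "Cop X \<in> carrier LL" and \<iota>_Cop: "\<iota> (Cop X) = j X"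
proof -
  have *: "Cop X \<in> carrier LL \<and> incl2 (Cop X) = ES_coproduct_formula K H P \<delta> X"
    unfolding ES_coproduct_def ES_square_eq ES_inclusion_eq by (rule theI'[OF coproduct_ex1[OF X]])
  then show c: "Cop X \<in> carrier LL" by simp
  from j_image[OF X] obtain Y where Y: "Y \<in> carrier LL" and jX: "j X = \<iota> Y" by (rule imageE)
  have "incl2 (Cop X) = incl2 Y"
    using * Y by (simp add: incl2_eq_spread ES_coproduct_formula_eq[OF L_closed[OF X]] jX)
  then have "Cop X = Y" by (rule inj_onD[OF incl2_inj _ c Y])
  then show "\<iota> (Cop X) = j X" by (simp add: jX)
qed

section \<open>The bialgebroid axioms\<close>

definition ce where "ce = tensor_lift P (\<lambda>p q. p \<otimes>\<^bsub>P\<^esub> q)"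

lemma ES_counit_eq: "ES_counit P = ce"
  by (simp add: ES_counit_def ce_def)

lemma ce_balanced: "balanced K P (\<lambda>x a. a \<odot>\<^bsub>P\<^esub> x) (opposite P) (\<lambda>a y. a \<odot>\<^bsub>opposite P\<^esub> y) P (\<lambda>p q. p \<otimes>\<^bsub>P\<^esub> q)"
  by (rule PP_balancedI)
    (simp_all add: ring_mult_left_hom[OF P.A.ring_axioms _ ahom_ident] ring_mult_right_hom[OF P.A.ring_axioms _ ahom_ident]
      P.smult_mult_left P.smult_mult_right)

lemma ce_hom: "ce \<in> ahom PP P"
  unfolding ce_def by (rule PP.lift_hom[OF P.abelian_group_axioms ce_balanced])

lemma ce_closed [simp]: "X \<in> carrier PP \<Longrightarrow> ce X \<in> carrier P"
  using ce_hom by (rule ahom_closed)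

lemma ce_pure: "p \<in> carrier P \<Longrightarrow> q \<in> carrier P \<Longrightarrow> ce (p \<boxtimes>\<^bsub>PP\<^esub> q) = p \<otimes>\<^bsub>P\<^esub> q"
  unfolding ce_def by (rule PP.lift_pure[OF P.abelian_group_axioms ce_balanced]) simp_all

lemma
  assumes r: "r \<in> carrier P" and X: "X \<in> carrier PP"
  shows ce_tgt: "ce (tgt r \<otimes>\<^bsub>PP\<^esub> X) = ce X \<otimes>\<^bsub>P\<^esub> r"
    and ce_src: "ce (src r \<otimes>\<^bsub>PP\<^esub> X) = r \<otimes>\<^bsub>P\<^esub> ce X"
proof -
  have s: "src r \<in> carrier PP" "tgt r \<in> carrier PP" using r by simp_all
  show "ce (tgt r \<otimes>\<^bsub>PP\<^esub> X) = ce X \<otimes>\<^bsub>P\<^esub> r"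
    by (rule PP_hom_ext[OF P.abelian_group_axioms ahom_comp[OF ce_hom PP.mult_left_hom[OF s(2)]]
          ring_mult_right_hom[OF P.A.ring_axioms r ce_hom] _ X]) (use r in \<open>simp add: ce_pure P.A.m_assoc\<close>)
  show "ce (src r \<otimes>\<^bsub>PP\<^esub> X) = r \<otimes>\<^bsub>P\<^esub> ce X"
    by (rule PP_hom_ext[OF P.abelian_group_axioms ahom_comp[OF ce_hom PP.mult_left_hom[OF s(1)]]
          ring_mult_left_hom[OF P.A.ring_axioms r ce_hom] _ X]) (use r in \<open>simp add: ce_pure P.A.m_assoc\<close>)
qed

lemma ce_mult:
  assumes p: "p \<in> carrier P" and q: "q \<in> carrier P" and Y: "Y \<in> carrier PP"
  shows "ce ((p \<boxtimes>\<^bsub>PP\<^esub> q) \<otimes>\<^bsub>PP\<^esub> Y) = p \<otimes>\<^bsub>P\<^esub> (ce Y \<otimes>\<^bsub>P\<^esub> q)"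
proof -
  have pq: "p \<boxtimes>\<^bsub>PP\<^esub> q \<in> carrier PP" using p q by simp
  show ?thesis
    by (rule PP_hom_ext[OF P.abelian_group_axioms ahom_comp[OF ce_hom PP.mult_left_hom[OF pq]]
          ring_mult_left_hom[OF P.A.ring_axioms p ring_mult_right_hom[OF P.A.ring_axioms q ce_hom]] _ Y])
      (use p q in \<open>simp add: ce_pure P.A.m_assoc\<close>)
qed

text \<open>With \<open>X = p \<otimes> q\<close>, all three counits equal
  \<open>p (ce Y) q\<close>.\<close>

lemma
  assumes X: "X \<in> carrier PP" and Y: "Y \<in> carrier PP"
  shows ce_mult_source: "ce (X \<otimes>\<^bsub>PP\<^esub> src (ce Y)) = ce (X \<otimes>\<^bsub>PP\<^esub> Y)"
    and ce_mult_target: "ce (X \<otimes>\<^bsub>PP\<^esub> tgt (ce Y)) = ce (X \<otimes>\<^bsub>PP\<^esub> Y)"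
proof -
  have c: "src (ce Y) \<in> carrier PP" "tgt (ce Y) \<in> carrier PP" using Y by simp_all
  have e: "ce (src (ce Y)) = ce Y" "ce (tgt (ce Y)) = ce Y" using Y by (simp_all add: ce_pure)
  note h = ahom_comp[OF ce_hom PP.mult_right_hom[OF Y]]
  show "ce (X \<otimes>\<^bsub>PP\<^esub> src (ce Y)) = ce (X \<otimes>\<^bsub>PP\<^esub> Y)"
    by (rule PP_hom_ext[OF P.abelian_group_axioms ahom_comp[OF ce_hom PP.mult_right_hom[OF c(1)]] h _ X])
      (use Y c in \<open>simp add: ce_mult e del: PP.mult_pure\<close>)
  show "ce (X \<otimes>\<^bsub>PP\<^esub> tgt (ce Y)) = ce (X \<otimes>\<^bsub>PP\<^esub> Y)"
    by (rule PP_hom_ext[OF P.abelian_group_axioms ahom_comp[OF ce_hom PP.mult_right_hom[OF c(2)]] h _ X])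
      (use Y c in \<open>simp add: ce_mult e del: PP.mult_pure\<close>)
qed

definition ceH where "ceH = tensor_lift PH (\<lambda>V h. ce V \<boxtimes>\<^bsub>PH\<^esub> h)"

lemma ce_smult: assumes k: "k \<in> carrier K" and V: "V \<in> carrier PP" shows "ce (k \<odot>\<^bsub>PP\<^esub> V) = k \<odot>\<^bsub>P\<^esub> ce V"
  by (rule PP_hom_ext[OF P.abelian_group_axioms ahom_comp[OF ce_hom PP.smult_hom[OF k]]
        module_smult_hom[OF P.module_axioms k ce_hom] _ V])
    (use k in \<open>simp add: PP.smult_pure ce_pure P.smult_mult_left\<close>)

lemma ceH_balanced: "balanced K PP (\<lambda>x a. a \<odot>\<^bsub>PP\<^esub> x) H (\<lambda>a y. a \<odot>\<^bsub>H\<^esub> y) PH (\<lambda>V h. ce V \<boxtimes>\<^bsub>PH\<^esub> h)"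
proof (rule balancedI)
  show "(\<lambda>h. ce V \<boxtimes>\<^bsub>PH\<^esub> h) \<in> ahom H PH" if "V \<in> carrier PP" for V
    by (rule PH.pure_hom_right) (use that in simp)
  show "(\<lambda>V. ce V \<boxtimes>\<^bsub>PH\<^esub> h) \<in> ahom PP PH" if "h \<in> carrier H" for h
    by (rule PH.pure_left_comp[OF that ce_hom])
qed (simp add: ce_smult PH.smult_balance)

lemma ceH_hom: "ceH \<in> ahom PPH PH"
  unfolding ceH_def by (rule PPm.MH.lift_hom[OF PH.T.abelian_group_axioms ceH_balanced])

lemma ceH_pure: "V \<in> carrier PP \<Longrightarrow> h \<in> carrier H \<Longrightarrow> ceH (V \<boxtimes>\<^bsub>PPH\<^esub> h) = ce V \<boxtimes>\<^bsub>PH\<^esub> h"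
  unfolding ceH_def by (rule PPm.MH.lift_pure[OF PH.T.abelian_group_axioms ceH_balanced])

lemma ceH_\<theta>_src_ext:
  assumes q: "q \<in> carrier P" and W: "W \<in> carrier PH"
  shows "ceH (PPm.\<theta> q (src_ext W)) = W \<otimes>\<^bsub>PH\<^esub> \<delta> q"
proof (rule PH.hom_ext[OF PH.T.abelian_group_axioms ahom_comp[OF ceH_hom ahom_comp[OF PPm.\<theta>_hom[OF q] src_ext_hom]]
      PH.mult_right_hom[OF \<delta>_closed[OF q]] _ W])
  fix p h assume ph: "p \<in> carrier P" "h \<in> carrier H"
  have ph': "p \<boxtimes>\<^bsub>PH\<^esub> h \<in> carrier PH" "\<one>\<^bsub>P\<^esub> \<boxtimes>\<^bsub>PH\<^esub> h \<in> carrier PH" "src p \<in> carrier PP" using ph by simp_all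
  have "ceH (PPm.c (src p) ((\<one>\<^bsub>P\<^esub> \<boxtimes>\<^bsub>PH\<^esub> h) \<otimes>\<^bsub>PH\<^esub> V)) = (p \<boxtimes>\<^bsub>PH\<^esub> h) \<otimes>\<^bsub>PH\<^esub> V" if V: "V \<in> carrier PH" for V
    by (rule PH.hom_ext[OF PH.T.abelian_group_axioms
          ahom_comp[OF ceH_hom ahom_comp[OF PPm.c_hom[OF ph'(3)] PH.mult_left_hom[OF ph'(2)]]] PH.mult_left_hom[OF ph'(1)] _ V])
      (use ph in \<open>simp add: ceH_pure ce_pure\<close>)
  then show "ceH (PPm.\<theta> q (src_ext (p \<boxtimes>\<^bsub>PH\<^esub> h))) = (p \<boxtimes>\<^bsub>PH\<^esub> h) \<otimes>\<^bsub>PH\<^esub> \<delta> q"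
    using ph q by (simp add: src_ext_pure PPm.\<theta>_pure)
qed

text \<open>Multiplication of \<open>P\<close> is colinear because \<delta> is multiplicative.
  Applied to coinvariants, this places the values of the counit in \<open>B\<close>.\<close>

lemma ceH_diag:
  assumes X: "X \<in> carrier PP" shows "ceH (diag X) = \<delta> (ce X)"
  by (rule PP_hom_ext[OF PH.T.abelian_group_axioms ahom_comp[OF ceH_hom diag_hom] ahom_comp[OF \<delta>_hom ce_hom] _ X])
    (simp add: diag_pure ceH_\<theta>_src_ext ce_pure \<delta>_mult)

lemma ce_in_B: "X \<in> carrier L \<Longrightarrow> ce X \<in> carrier B"
  using ceH_diag[of X] by (simp add: B_iff L_iff ceH_pure)

text \<open>Evaluates a Sweedler sum whose terms, after \<open>g\<close>, see
  \<open>X \<otimes> Y\<close> only through its image under \<iota>. For a coproduct the result is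
  \<open>h\<close> at \<open>p \<otimes> 1 \<otimes> q\<close>, which is how the axioms become
  identities over the field.\<close>

lemma lift_via_\<iota>:
  assumes G: "abelian_group G" "abelian_group G'" and g: "g \<in> ahom G G'" and h: "h \<in> ahom PPP G'" and Z: "Z \<in> carrier LL"
    and f: "\<And>X Y. X \<in> carrier L \<Longrightarrow> Y \<in> carrier L \<Longrightarrow> f X Y \<in> carrier G"
    and eq: "\<And>X Y. X \<in> carrier L \<Longrightarrow> Y \<in> carrier L \<Longrightarrow> g (f X Y) = h (J Y \<otimes>\<^bsub>PPP\<^esub> inl X)"
  shows "g (tensor_lift G f Z) = h (\<iota> Z)"
proof -
  have c: "h (J Y \<otimes>\<^bsub>PPP\<^esub> inl X) \<in> carrier G'" if "X \<in> carrier L" "Y \<in> carrier L" for X Y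
    using ahom_closed[OF g f[OF that]] by (simp only: eq[OF that])
  have "g (tensor_lift G f Z) = tensor_lift G' (\<lambda>X Y. g (f X Y)) Z"
    by (rule LL.hom_lift[OF G g Z f])
  also have "\<dots> = tensor_lift G' (\<lambda>X Y. h (\<iota> (X \<boxtimes>\<^bsub>LL\<^esub> Y))) Z"
    by (rule LL.lift_cong[OF G(2) Z]) (simp_all add: eq \<iota>_pure c)
  also have "\<dots> = h (\<iota> Z)"
    by (rule LL.hom_eq_lift[OF G(2) ahom_comp[OF h \<iota>_hom] Z, symmetric])
  finally show ?thesis .
qed

lemma \<iota>_eqI: "\<iota> Z = \<iota> W \<Longrightarrow> Z \<in> carrier LL \<Longrightarrow> W \<in> carrier LL \<Longrightarrow> Z = W"
  by (rule inj_onD[OF \<iota>_inj])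

lemma \<iota>_lift:
  assumes h: "h \<in> ahom PPP PPP" and Z: "Z \<in> carrier LL"
    and f: "\<And>X Y. X \<in> carrier L \<Longrightarrow> Y \<in> carrier L \<Longrightarrow> f X Y \<in> carrier LL"
    and eq: "\<And>X Y. X \<in> carrier L \<Longrightarrow> Y \<in> carrier L \<Longrightarrow> \<iota> (f X Y) = h (J Y \<otimes>\<^bsub>PPP\<^esub> inl X)"
  shows "\<iota> (tensor_lift LL f Z) = h (\<iota> Z)" and "tensor_lift LL f Z \<in> carrier LL"
proof -
  show "\<iota> (tensor_lift LL f Z) = h (\<iota> Z)"
    by (rule lift_via_\<iota>[OF LL.T.abelian_group_axioms PPP.T.abelian_group_axioms \<iota>_hom h Z]) (rule f eq, assumption+)+
  show "tensor_lift LL f Z \<in> carrier LL"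
    by (rule LL.lift_closed[OF LL.T.abelian_group_axioms Z f])
qed

lemma Cop_hom: "Cop \<in> ahom L LL"
proof (rule ahomI)
  fix X Y assume XY: "X \<in> carrier L" "Y \<in> carrier L"
  then have s: "X \<oplus>\<^bsub>L\<^esub> Y \<in> carrier L" by (rule ring.ring_simprules(1)[OF L.A.ring_axioms])
  show "Cop (X \<oplus>\<^bsub>L\<^esub> Y) = Cop X \<oplus>\<^bsub>LL\<^esub> Cop Y"
  proof (rule \<iota>_eqI)
    have "\<iota> (Cop (X \<oplus>\<^bsub>L\<^esub> Y)) = j (X \<oplus>\<^bsub>PP\<^esub> Y)" using \<iota>_Cop[OF s] by simp
    also have "\<dots> = j X \<oplus>\<^bsub>PPP\<^esub> j Y" by (rule ahom_add[OF j_hom L_closed[OF XY(1)] L_closed[OF XY(2)]])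
    also have "\<dots> = \<iota> (Cop X \<oplus>\<^bsub>LL\<^esub> Cop Y)"
      unfolding ahom_add[OF \<iota>_hom Cop_closed[OF XY(1)] Cop_closed[OF XY(2)]] \<iota>_Cop[OF XY(1)] \<iota>_Cop[OF XY(2)] ..
    finally show "\<iota> (Cop (X \<oplus>\<^bsub>L\<^esub> Y)) = \<iota> (Cop X \<oplus>\<^bsub>LL\<^esub> Cop Y)" .
  qed (use XY s in \<open>simp_all add: Cop_closed\<close>)
qed (rule Cop_closed)

text \<open>With \<open>X = p \<otimes> q\<close>, both sides become
  \<open>bp \<otimes> 1 \<otimes> qc\<close> under \<iota>.\<close>

lemma Cop_bimodule:
  assumes b: "b \<in> carrier B" and c: "c \<in> carrier B" and X: "X \<in> carrier L"
  shows "Cop (src b \<otimes>\<^bsub>PP\<^esub> (tgt c \<otimes>\<^bsub>PP\<^esub> X)) =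
    tensor_lift LL (\<lambda>X1 X2. (src b \<otimes>\<^bsub>PP\<^esub> X1) \<boxtimes>\<^bsub>LL\<^esub> (tgt c \<otimes>\<^bsub>PP\<^esub> X2)) (Cop X)"
proof -
  let ?h = "\<lambda>w. inl (src b) \<otimes>\<^bsub>PPP\<^esub> (inr c \<otimes>\<^bsub>PPP\<^esub> w)"
  have bc: "b \<in> carrier P" "c \<in> carrier P" using b c by (simp_all add: B_closed)
  have h: "?h \<in> ahom PPP PPP"
    by (rule ahom_comp[OF PPP.mult_left_hom PPP.mult_left_hom]) (use bc in simp_all)
  have cl: "(src b \<otimes>\<^bsub>PP\<^esub> X1) \<boxtimes>\<^bsub>LL\<^esub> (tgt c \<otimes>\<^bsub>PP\<^esub> X2) \<in> carrier LL" if "X1 \<in> carrier L" "X2 \<in> carrier L" for X1 X2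
    using that b c by (intro LL.pure_closed) (simp_all add: L_mult_closed src_in_L tgt_in_L)
  have eq: "\<iota> ((src b \<otimes>\<^bsub>PP\<^esub> X1) \<boxtimes>\<^bsub>LL\<^esub> (tgt c \<otimes>\<^bsub>PP\<^esub> X2)) = ?h (J X2 \<otimes>\<^bsub>PPP\<^esub> inl X1)"
    if X12: "X1 \<in> carrier L" "X2 \<in> carrier L" for X1 X2
  proof -
    have p: "J X2 \<in> carrier PPP" "inl X1 \<in> carrier PPP" "inl (src b) \<in> carrier PPP" "inr c \<in> carrier PPP"
      using X12 bc by (simp_all add: L_closed)
    have e1: "J X2 \<otimes>\<^bsub>PPP\<^esub> inl (src b) = inl (src b) \<otimes>\<^bsub>PPP\<^esub> J X2" using J_inl_src[OF bc(1) L_closed[OF X12(2)]] .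
    have e2: "inr c \<otimes>\<^bsub>PPP\<^esub> inl (src b) = inl (src b) \<otimes>\<^bsub>PPP\<^esub> inr c" using bc by simp
    have "inr c \<otimes>\<^bsub>PPP\<^esub> J X2 \<otimes>\<^bsub>PPP\<^esub> (inl (src b) \<otimes>\<^bsub>PPP\<^esub> inl X1) =
        inr c \<otimes>\<^bsub>PPP\<^esub> (J X2 \<otimes>\<^bsub>PPP\<^esub> inl (src b)) \<otimes>\<^bsub>PPP\<^esub> inl X1"
      using p by (simp add: PPP.AB.A.m_assoc del: PPP.mult_pure)
    also have "\<dots> = (inr c \<otimes>\<^bsub>PPP\<^esub> inl (src b)) \<otimes>\<^bsub>PPP\<^esub> (J X2 \<otimes>\<^bsub>PPP\<^esub> inl X1)"
      unfolding e1 using p by (simp add: PPP.AB.A.m_assoc del: PPP.mult_pure)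
    also have "\<dots> = ?h (J X2 \<otimes>\<^bsub>PPP\<^esub> inl X1)"
      unfolding e2 using p by (simp add: PPP.AB.A.m_assoc del: PPP.mult_pure)
    finally show ?thesis
      using X12 b c bc by (simp add: \<iota>_pure L_mult_closed src_in_L tgt_in_L J_tgt L_closed inl_mult del: PPP.mult_pure)
  qed
  have Y: "src b \<otimes>\<^bsub>PP\<^esub> (tgt c \<otimes>\<^bsub>PP\<^esub> X) \<in> carrier L" using b c X by (simp add: L_mult_closed src_in_L tgt_in_L)
  note * = \<iota>_lift[OF h Cop_closed[OF X] cl eq]
  show ?thesis
  proof (rule \<iota>_eqI[OF _ Cop_closed[OF Y] *(2)])
    have "j (src b \<otimes>\<^bsub>PP\<^esub> (tgt c \<otimes>\<^bsub>PP\<^esub> X)) = ?h (j X)"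
      using X bc by (simp add: j_mult[of "src b"] j_tgt j_src L_closed del: PP.mult_pure)
    then show "\<iota> (Cop (src b \<otimes>\<^bsub>PP\<^esub> (tgt c \<otimes>\<^bsub>PP\<^esub> X))) =
      \<iota> (tensor_lift LL (\<lambda>X1 X2. (src b \<otimes>\<^bsub>PP\<^esub> X1) \<boxtimes>\<^bsub>LL\<^esub> (tgt c \<otimes>\<^bsub>PP\<^esub> X2)) (Cop X))"
      by (simp only: *(1) \<iota>_Cop[OF X] \<iota>_Cop[OF Y])
  qed
qed

definition ce12 where "ce12 = tensor_lift PP (\<lambda>v u. ce v \<boxtimes>\<^bsub>PP\<^esub> u)"

lemma ce12_balanced: "balanced K PP (\<lambda>x a. a \<odot>\<^bsub>PP\<^esub> x) (opposite P) (\<lambda>a y. a \<odot>\<^bsub>opposite P\<^esub> y) PP (\<lambda>v u. ce v \<boxtimes>\<^bsub>PP\<^esub> u)"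
proof (rule PPP_balancedI)
  show "(\<lambda>u. ce v \<boxtimes>\<^bsub>PP\<^esub> u) \<in> ahom P PP" if "v \<in> carrier PP" for v
    by (rule PP_pure_hom(1)) (use that in simp)
  show "(\<lambda>v. ce v \<boxtimes>\<^bsub>PP\<^esub> u) \<in> ahom PP PP" if "u \<in> carrier P" for u
    by (rule ahom_comp[OF PP_pure_hom(2)[OF that] ce_hom])
qed (simp add: ce_smult PP_smult_balance)

lemma ce12_hom: "ce12 \<in> ahom PPP PP"
  unfolding ce12_def by (rule PPP.lift_hom[OF PP.T.abelian_group_axioms ce12_balanced])

lemma ce12_pure: "v \<in> carrier PP \<Longrightarrow> u \<in> carrier P \<Longrightarrow> ce12 (v \<boxtimes>\<^bsub>PPP\<^esub> u) = ce v \<boxtimes>\<^bsub>PP\<^esub> u"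
  unfolding ce12_def by (rule PPP.lift_pure[OF PP.T.abelian_group_axioms ce12_balanced]) simp_all

definition mul23 where "mul23 = tensor_lift PP (\<lambda>v u. tgt u \<otimes>\<^bsub>PP\<^esub> v)"

lemma mul23_balanced: "balanced K PP (\<lambda>x a. a \<odot>\<^bsub>PP\<^esub> x) (opposite P) (\<lambda>a y. a \<odot>\<^bsub>opposite P\<^esub> y) PP (\<lambda>v u. tgt u \<otimes>\<^bsub>PP\<^esub> v)"
proof (rule PPP_balancedI)
  show "(\<lambda>u. tgt u \<otimes>\<^bsub>PP\<^esub> v) \<in> ahom P PP" if "v \<in> carrier PP" for v
    by (rule ahom_comp[OF PP.mult_right_hom[OF that] PP_pure_hom(1)]) simp
  show "(\<lambda>v. tgt u \<otimes>\<^bsub>PP\<^esub> v) \<in> ahom PP PP" if "u \<in> carrier P" for u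
    by (rule PP.mult_left_hom) (use that in simp)
  show "tgt u \<otimes>\<^bsub>PP\<^esub> (k \<odot>\<^bsub>PP\<^esub> v) = tgt (k \<odot>\<^bsub>P\<^esub> u) \<otimes>\<^bsub>PP\<^esub> v"
    if "v \<in> carrier PP" "k \<in> carrier K" "u \<in> carrier P" for v k u
    using that by (simp add: PP.AB.smult_mult_right PP_smult_balance flip: PP.smult_pure PP.AB.smult_mult_left)
qed

lemma mul23_hom: "mul23 \<in> ahom PPP PP"
  unfolding mul23_def by (rule PPP.lift_hom[OF PP.T.abelian_group_axioms mul23_balanced])

lemma mul23_pure: "v \<in> carrier PP \<Longrightarrow> u \<in> carrier P \<Longrightarrow> mul23 (v \<boxtimes>\<^bsub>PPP\<^esub> u) = tgt u \<otimes>\<^bsub>PP\<^esub> v"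
  unfolding mul23_def by (rule PPP.lift_pure[OF PP.T.abelian_group_axioms mul23_balanced]) simp_all

lemma L_incl: "(\<lambda>X. X) \<in> ahom L PP"
  by (rule L_into_PP[OF ahom_ident])

text \<open>The sum multiplies the first two legs together, and
  \<open>p \<otimes> 1 \<otimes> q\<close> goes to \<open>p \<otimes> q\<close>.\<close>

lemma Cop_counit_left:
  assumes X: "X \<in> carrier L"
  shows "tensor_lift L (\<lambda>X1 X2. src (ce X1) \<otimes>\<^bsub>PP\<^esub> X2) (Cop X) = X"
proof -
  have eq: "src (ce X1) \<otimes>\<^bsub>PP\<^esub> X2 = ce12 (J X2 \<otimes>\<^bsub>PPP\<^esub> inl X1)" if X12: "X1 \<in> carrier L" "X2 \<in> carrier L" for X1 X2
  proof -
    have X1: "X1 \<in> carrier PP" "src (ce X1) \<in> carrier PP" using X12(1) by (simp_all add: L_closed)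
    show ?thesis
      by (rule PP_hom_ext[OF PP.T.abelian_group_axioms PP.mult_left_hom[OF X1(2)] ahom_comp[OF ce12_hom J_mult_inl_hom[OF X1(1)]] _ L_closed[OF X12(2)]])
        (use X1 in \<open>simp add: J_pure ce12_pure ce_tgt\<close>)
  qed
  have "tensor_lift L (\<lambda>X1 X2. src (ce X1) \<otimes>\<^bsub>PP\<^esub> X2) (Cop X) = ce12 (\<iota> (Cop X))"
    by (rule lift_via_\<iota>[OF L.abelian_group_axioms PP.T.abelian_group_axioms L_incl ce12_hom Cop_closed[OF X] _ eq])
      (simp_all add: L_mult_closed src_in_L ce_in_B)
  also have "\<dots> = ce12 (j X)" by (simp add: \<iota>_Cop X)
  also have "\<dots> = X"
    by (rule PP_hom_ext[OF PP.T.abelian_group_axioms ahom_comp[OF ce12_hom j_hom] ahom_ident _ L_closed[OF X]])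
      (simp add: j_pure ce12_pure ce_pure)
  finally show ?thesis .
qed

text \<open>The mirror image: the last two legs are multiplied.\<close>

lemma Cop_counit_right:
  assumes X: "X \<in> carrier L"
  shows "tensor_lift L (\<lambda>X1 X2. tgt (ce X2) \<otimes>\<^bsub>PP\<^esub> X1) (Cop X) = X"
proof -
  have eq: "tgt (ce X2) \<otimes>\<^bsub>PP\<^esub> X1 = mul23 (J X2 \<otimes>\<^bsub>PPP\<^esub> inl X1)" if X12: "X1 \<in> carrier L" "X2 \<in> carrier L" for X1 X2
  proof -
    have X1: "X1 \<in> carrier PP" using X12(1) by (rule L_closed)
    show ?thesis
    proof (rule PP_hom_ext[OF PP.T.abelian_group_axioms ahom_comp[OF PP.mult_right_hom[OF X1] ahom_comp[OF PP_pure_hom(1) ce_hom]]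
            ahom_comp[OF mul23_hom J_mult_inl_hom[OF X1]] _ L_closed[OF X12(2)]])
      fix r w assume "r \<in> carrier P" "w \<in> carrier P"
      then show "tgt (ce (r \<boxtimes>\<^bsub>PP\<^esub> w)) \<otimes>\<^bsub>PP\<^esub> X1 = mul23 (J (r \<boxtimes>\<^bsub>PP\<^esub> w) \<otimes>\<^bsub>PPP\<^esub> inl X1)"
        using X1 by (simp add: J_pure mul23_pure ce_pure tgt_mult PP.AB.A.m_assoc del: PP.mult_pure)
    qed simp
  qed
  have "tensor_lift L (\<lambda>X1 X2. tgt (ce X2) \<otimes>\<^bsub>PP\<^esub> X1) (Cop X) = mul23 (\<iota> (Cop X))"
    by (rule lift_via_\<iota>[OF L.abelian_group_axioms PP.T.abelian_group_axioms L_incl mul23_hom Cop_closed[OF X] _ eq])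
      (simp_all add: L_mult_closed tgt_in_L ce_in_B)
  also have "\<dots> = mul23 (j X)" by (simp add: \<iota>_Cop X)
  also have "\<dots> = X"
    by (rule PP_hom_ext[OF PP.T.abelian_group_axioms ahom_comp[OF mul23_hom j_hom] ahom_ident _ L_closed[OF X]])
      (simp add: j_pure mul23_pure)
  finally show ?thesis .
qed

text \<open>Under \<iota> the two sides multiply the middle leg by \<open>b\<close> on the left and
  on the right. They agree because the middle leg of \<open>j X\<close> is \<open>1\<close>.\<close>

lemma Cop_takeuchi:
  assumes X: "X \<in> carrier L" and b: "b \<in> carrier B"
  shows "tensor_lift LL (\<lambda>X1 X2. (X1 \<otimes>\<^bsub>PP\<^esub> tgt b) \<boxtimes>\<^bsub>LL\<^esub> X2) (Cop X) =
    tensor_lift LL (\<lambda>X1 X2. X1 \<boxtimes>\<^bsub>LL\<^esub> (X2 \<otimes>\<^bsub>PP\<^esub> src b)) (Cop X)"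
proof -
  have bP: "b \<in> carrier P" using b by (rule B_closed)
  have ib: "inl (tgt b) \<in> carrier PPP" using bP by simp
  have c1: "(X1 \<otimes>\<^bsub>PP\<^esub> tgt b) \<boxtimes>\<^bsub>LL\<^esub> X2 \<in> carrier LL" if "X1 \<in> carrier L" "X2 \<in> carrier L" for X1 X2
    using that b by (intro LL.pure_closed) (simp_all add: L_mult_closed tgt_in_L)
  have c2: "X1 \<boxtimes>\<^bsub>LL\<^esub> (X2 \<otimes>\<^bsub>PP\<^esub> src b) \<in> carrier LL" if "X1 \<in> carrier L" "X2 \<in> carrier L" for X1 X2
    using that b by (intro LL.pure_closed) (simp_all add: L_mult_closed src_in_L)
  have e1: "\<iota> ((X1 \<otimes>\<^bsub>PP\<^esub> tgt b) \<boxtimes>\<^bsub>LL\<^esub> X2) = (J X2 \<otimes>\<^bsub>PPP\<^esub> inl X1) \<otimes>\<^bsub>PPP\<^esub> inl (tgt b)"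
    if "X1 \<in> carrier L" "X2 \<in> carrier L" for X1 X2
    using that b bP by (simp add: \<iota>_pure L_mult_closed tgt_in_L inl_mult L_closed PPP.AB.A.m_assoc del: PPP.mult_pure)
  have e2: "\<iota> (X1 \<boxtimes>\<^bsub>LL\<^esub> (X2 \<otimes>\<^bsub>PP\<^esub> src b)) = inl (tgt b) \<otimes>\<^bsub>PPP\<^esub> (J X2 \<otimes>\<^bsub>PPP\<^esub> inl X1)"
    if "X1 \<in> carrier L" "X2 \<in> carrier L" for X1 X2
    using that b bP by (simp add: \<iota>_pure L_mult_closed src_in_L J_src_right L_closed PPP.AB.A.m_assoc del: PPP.mult_pure)
  note l1 = \<iota>_lift[OF PPP.mult_right_hom[OF ib] Cop_closed[OF X] c1 e1]
    and l2 = \<iota>_lift[OF PPP.mult_left_hom[OF ib] Cop_closed[OF X] c2 e2]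
  show ?thesis
    by (rule \<iota>_eqI[OF _ l1(2) l2(2)]) (simp only: l1(1) l2(1) \<iota>_Cop[OF X] j_inl_tgt[OF bP L_closed[OF X]])
qed

lemma one_in_L: "\<one>\<^bsub>PP\<^esub> \<in> carrier L"
  using L.A.one_closed by simp

lemma Cop_one: "Cop \<one>\<^bsub>PP\<^esub> = \<one>\<^bsub>PP\<^esub> \<boxtimes>\<^bsub>LL\<^esub> \<one>\<^bsub>PP\<^esub>"
proof (rule \<iota>_eqI[OF _ Cop_closed[OF one_in_L] LL.pure_closed[OF one_in_L one_in_L]])
  have "inl \<one>\<^bsub>PP\<^esub> = \<one>\<^bsub>PPP\<^esub>" by (simp add: PPP.one_eq)
  then show "\<iota> (Cop \<one>\<^bsub>PP\<^esub>) = \<iota> (\<one>\<^bsub>PP\<^esub> \<boxtimes>\<^bsub>LL\<^esub> \<one>\<^bsub>PP\<^esub>)"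
    unfolding \<iota>_pure[OF one_in_L one_in_L] \<iota>_Cop[OF one_in_L] by (simp add: j_one J_one)
qed

section \<open>Multiplicativity of the coproduct\<close>

lemma tgt_pure_split: "r \<in> carrier P \<Longrightarrow> u \<in> carrier P \<Longrightarrow> Y \<in> carrier PP \<Longrightarrow>
    Y \<otimes>\<^bsub>PP\<^esub> (r \<boxtimes>\<^bsub>PP\<^esub> u) = Y \<otimes>\<^bsub>PP\<^esub> src r \<otimes>\<^bsub>PP\<^esub> tgt u"
  by (simp add: PP.AB.A.m_assoc)

text \<open>Multiplication by \<open>a' \<otimes>\<^sub>B b'\<close> on \<open>\<B> \<otimes>\<^sub>B \<B>\<close>, transported along \<open>\<iota>\<close>.\<close>

definition shuffle where
  "shuffle a' b' w = tensor_lift PPP (\<lambda>r u. inl (tgt r) \<otimes>\<^bsub>PPP\<^esub> (w \<otimes>\<^bsub>PPP\<^esub> (a' \<boxtimes>\<^bsub>PPP\<^esub> u))) b'"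

lemma shuffle_hom:
  assumes a': "a' \<in> carrier PP" and b': "b' \<in> carrier PP"
  shows "(\<lambda>w. shuffle a' b' w) \<in> ahom PPP PPP"
  unfolding shuffle_def
proof (rule PP.lift_param_hom[OF PPP.T.abelian_group_axioms b'])
  fix r u assume "r \<in> carrier P" "u \<in> carrier (opposite P)"
  then show "(\<lambda>w. inl (tgt r) \<otimes>\<^bsub>PPP\<^esub> (w \<otimes>\<^bsub>PPP\<^esub> (a' \<boxtimes>\<^bsub>PPP\<^esub> u))) \<in> ahom PPP PPP"
    using a' by (intro ahom_comp[OF PPP.mult_left_hom PPP.mult_right_hom]) simp_all
qed

lemma shuffle_eq:
  assumes a': "a' \<in> carrier PP" and b': "b' \<in> carrier PP" and w: "w \<in> carrier PPP" and \<phi>: "(\<lambda>b. \<phi> b) \<in> ahom PP PPP"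
    and eq: "\<And>r u. r \<in> carrier P \<Longrightarrow> u \<in> carrier P \<Longrightarrow> \<phi> (r \<boxtimes>\<^bsub>PP\<^esub> u) = inl (tgt r) \<otimes>\<^bsub>PPP\<^esub> (w \<otimes>\<^bsub>PPP\<^esub> (a' \<boxtimes>\<^bsub>PPP\<^esub> u))"
  shows "\<phi> b' = shuffle a' b' w"
proof -
  have "\<phi> b' = tensor_lift PPP (\<lambda>r u. \<phi> (r \<boxtimes>\<^bsub>PP\<^esub> u)) b'"
    by (rule PP.hom_eq_lift[OF PPP.T.abelian_group_axioms \<phi> b'])
  also have "\<dots> = shuffle a' b' w"
    unfolding shuffle_def by (rule PP.lift_cong[OF PPP.T.abelian_group_axioms b']) (use a' w in \<open>simp_all add: eq\<close>)
  finally show ?thesis .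
qed

text \<open>With \<open>w = p \<otimes> y \<otimes> z\<close>, \<open>a' = p' \<otimes> q'\<close>
  and \<open>b' = r \<otimes> u\<close> the shuffle is
  \<open>pp' \<otimes> q'yr \<otimes> uz\<close>. The factorwise product by
  \<open>a' \<otimes> b'\<close> thus depends on \<open>a \<otimes> b\<close> only through its image
  under \<iota>.\<close>

lemma J_mult_inl_eq_shuffle:
  assumes a: "a \<in> carrier PP" and b: "b \<in> carrier PP" and a': "a' \<in> carrier PP" and b': "b' \<in> carrier PP"
  shows "J (b \<otimes>\<^bsub>PP\<^esub> b') \<otimes>\<^bsub>PPP\<^esub> inl (a \<otimes>\<^bsub>PP\<^esub> a') = shuffle a' b' (J b \<otimes>\<^bsub>PPP\<^esub> inl a)"
proof (rule shuffle_eq[OF a' b'])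
  show "J b \<otimes>\<^bsub>PPP\<^esub> inl a \<in> carrier PPP" using a b by simp
  have aa: "a \<otimes>\<^bsub>PP\<^esub> a' \<in> carrier PP" using a a' by simp
  show "(\<lambda>b'. J (b \<otimes>\<^bsub>PP\<^esub> b') \<otimes>\<^bsub>PPP\<^esub> inl (a \<otimes>\<^bsub>PP\<^esub> a')) \<in> ahom PP PPP"
    by (rule ahom_comp[OF J_mult_inl_hom[OF aa] PP.mult_left_hom[OF b]])
  fix r u assume r: "r \<in> carrier P" and u: "u \<in> carrier P"
  have p: "J b \<in> carrier PPP" "inl a \<in> carrier PPP" "inl a' \<in> carrier PPP" "inr u \<in> carrier PPP" "inl (tgt r) \<in> carrier PPP"
    using a b a' r u by simp_all
  have c: "inr u \<otimes>\<^bsub>PPP\<^esub> inl a = inl a \<otimes>\<^bsub>PPP\<^esub> inr u" using a u by simp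
  have s: "a' \<boxtimes>\<^bsub>PPP\<^esub> u = inr u \<otimes>\<^bsub>PPP\<^esub> inl a'" using a' u by simp
  have bs: "b \<otimes>\<^bsub>PP\<^esub> src r \<in> carrier PP" using b r by simp
  have "J (b \<otimes>\<^bsub>PP\<^esub> (r \<boxtimes>\<^bsub>PP\<^esub> u)) = inl (tgt r) \<otimes>\<^bsub>PPP\<^esub> J b \<otimes>\<^bsub>PPP\<^esub> inr u"
    unfolding tgt_pure_split[OF r u b] J_tgt_right[OF u bs] J_src_right[OF r b] ..
  then have "J (b \<otimes>\<^bsub>PP\<^esub> (r \<boxtimes>\<^bsub>PP\<^esub> u)) \<otimes>\<^bsub>PPP\<^esub> inl (a \<otimes>\<^bsub>PP\<^esub> a') =
      inl (tgt r) \<otimes>\<^bsub>PPP\<^esub> (J b \<otimes>\<^bsub>PPP\<^esub> ((inr u \<otimes>\<^bsub>PPP\<^esub> inl a) \<otimes>\<^bsub>PPP\<^esub> inl a'))"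
    unfolding inl_mult[OF a a'] using p by (simp add: PPP.AB.A.m_assoc del: PPP.mult_pure)
  also have "\<dots> = inl (tgt r) \<otimes>\<^bsub>PPP\<^esub> ((J b \<otimes>\<^bsub>PPP\<^esub> inl a) \<otimes>\<^bsub>PPP\<^esub> (a' \<boxtimes>\<^bsub>PPP\<^esub> u))"
    unfolding c s using p by (simp add: PPP.AB.A.m_assoc del: PPP.mult_pure)
  finally show "J (b \<otimes>\<^bsub>PP\<^esub> (r \<boxtimes>\<^bsub>PP\<^esub> u)) \<otimes>\<^bsub>PPP\<^esub> inl (a \<otimes>\<^bsub>PP\<^esub> a') =
      inl (tgt r) \<otimes>\<^bsub>PPP\<^esub> ((J b \<otimes>\<^bsub>PPP\<^esub> inl a) \<otimes>\<^bsub>PPP\<^esub> (a' \<boxtimes>\<^bsub>PPP\<^esub> u))" .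
qed

text \<open>The shuffle encloses the middle leg, which is \<open>1\<close> for \<open>j X\<close>;
  both sides are then \<open>pp' \<otimes> q'r \<otimes> uq\<close> with
  \<open>X = p \<otimes> q\<close>. This is the Takeuchi property seen in
  \<open>PPP\<close>.\<close>

lemma shuffle_j:
  assumes X: "X \<in> carrier PP" and a': "a' \<in> carrier PP" and b': "b' \<in> carrier PP"
  shows "j X \<otimes>\<^bsub>PPP\<^esub> (J b' \<otimes>\<^bsub>PPP\<^esub> inl a') = shuffle a' b' (j X)"
proof (rule shuffle_eq[OF a' b'])
  show jX: "j X \<in> carrier PPP" using X by simp
  show "(\<lambda>b'. j X \<otimes>\<^bsub>PPP\<^esub> (J b' \<otimes>\<^bsub>PPP\<^esub> inl a')) \<in> ahom PP PPP"
    by (rule ahom_comp[OF PPP.mult_left_hom[OF jX] J_mult_inl_hom[OF a']])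
  fix r u assume r: "r \<in> carrier P" and u: "u \<in> carrier P"
  have t: "inl (tgt r) \<in> carrier PPP" "a' \<boxtimes>\<^bsub>PPP\<^esub> u \<in> carrier PPP" using r u a' by simp_all
  have "J (r \<boxtimes>\<^bsub>PP\<^esub> u) \<otimes>\<^bsub>PPP\<^esub> inl a' = inl (tgt r) \<otimes>\<^bsub>PPP\<^esub> (a' \<boxtimes>\<^bsub>PPP\<^esub> u)"
    using r u a' by (simp add: J_pure)
  then have "j X \<otimes>\<^bsub>PPP\<^esub> (J (r \<boxtimes>\<^bsub>PP\<^esub> u) \<otimes>\<^bsub>PPP\<^esub> inl a') = (j X \<otimes>\<^bsub>PPP\<^esub> inl (tgt r)) \<otimes>\<^bsub>PPP\<^esub> (a' \<boxtimes>\<^bsub>PPP\<^esub> u)"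
    by (simp only: PPP.AB.A.m_assoc[OF jX t])
  also have "\<dots> = inl (tgt r) \<otimes>\<^bsub>PPP\<^esub> (j X \<otimes>\<^bsub>PPP\<^esub> (a' \<boxtimes>\<^bsub>PPP\<^esub> u))"
    unfolding j_inl_tgt[OF r X] by (rule PPP.AB.A.m_assoc[OF t(1) jX t(2)])
  finally show "j X \<otimes>\<^bsub>PPP\<^esub> (J (r \<boxtimes>\<^bsub>PP\<^esub> u) \<otimes>\<^bsub>PPP\<^esub> inl a') = inl (tgt r) \<otimes>\<^bsub>PPP\<^esub> (j X \<otimes>\<^bsub>PPP\<^esub> (a' \<boxtimes>\<^bsub>PPP\<^esub> u))" .
qed

text \<open>Under \<iota> the claim becomes the multiplicativity of \<open>j\<close>.\<close>

lemma Cop_mult: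
  assumes X: "X \<in> carrier L" and Y: "Y \<in> carrier L"
  shows "Cop (X \<otimes>\<^bsub>PP\<^esub> Y) = factorwise_mult LL L L (Cop X) (Cop Y)"
proof (rule \<iota>_eqI[OF _ Cop_closed[OF L_mult_closed[OF X Y]]])
  note XP = L_closed[OF X] and YP = L_closed[OF Y]
  note CX = Cop_closed[OF X] and CY = Cop_closed[OF Y]
  let ?f = "\<lambda>a b a' b'. (a \<otimes>\<^bsub>L\<^esub> a') \<boxtimes>\<^bsub>LL\<^esub> (b \<otimes>\<^bsub>L\<^esub> b')"
  have cl: "?f a b a' b' \<in> carrier LL" if "a \<in> carrier L" "b \<in> carrier L" "a' \<in> carrier L" "b' \<in> carrier L" for a b a' b'
    using that by (intro LL.pure_closed) (simp_all add: L_mult_closed)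
  have cl': "tensor_lift LL (?f a b) (Cop Y) \<in> carrier LL" if "a \<in> carrier L" "b \<in> carrier L" for a b
    by (rule LL.lift_closed[OF LL.T.abelian_group_axioms CY cl[OF that]])
  show "factorwise_mult LL L L (Cop X) (Cop Y) \<in> carrier LL"
    unfolding factorwise_mult_def by (rule LL.lift_closed[OF LL.T.abelian_group_axioms CX cl'])
  have g: "\<iota> (?f a b a' b') = shuffle a' b' (J b \<otimes>\<^bsub>PPP\<^esub> inl a)"
    if "a \<in> carrier L" "b \<in> carrier L" "a' \<in> carrier L" "b' \<in> carrier L" for a b a' b'
    using that J_mult_inl_eq_shuffle[of a b a' b'] by (simp add: \<iota>_pure L_mult_closed L_closed)
  have gc: "\<iota> (?f a b a' b') \<in> carrier PPP" if "a \<in> carrier L" "b \<in> carrier L" "a' \<in> carrier L" "b' \<in> carrier L" for a b a' b'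
    by (rule \<iota>_closed[OF cl[OF that]])
  have "\<iota> (factorwise_mult LL L L (Cop X) (Cop Y)) = tensor_lift PPP (\<lambda>a b. \<iota> (tensor_lift LL (?f a b) (Cop Y))) (Cop X)"
    unfolding factorwise_mult_def
    by (rule LL.hom_lift[OF LL.T.abelian_group_axioms PPP.T.abelian_group_axioms \<iota>_hom CX cl'])
  also have "\<dots> = tensor_lift PPP (\<lambda>a b. tensor_lift PPP (\<lambda>a' b'. \<iota> (?f a b a' b')) (Cop Y)) (Cop X)"
  proof (rule LL.lift_cong[OF PPP.T.abelian_group_axioms CX])
    fix a b assume ab: "a \<in> carrier L" "b \<in> carrier L"
    show "\<iota> (tensor_lift LL (?f a b) (Cop Y)) = tensor_lift PPP (\<lambda>a' b'. \<iota> (?f a b a' b')) (Cop Y)"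
      by (rule LL.hom_lift[OF LL.T.abelian_group_axioms PPP.T.abelian_group_axioms \<iota>_hom CY cl[OF ab]])
    show "tensor_lift PPP (\<lambda>a' b'. \<iota> (?f a b a' b')) (Cop Y) \<in> carrier PPP"
      by (rule LL.lift_closed[OF PPP.T.abelian_group_axioms CY gc[OF ab]])
  qed
  \<comment> \<open>For fixed \<open>a\<close> and \<open>b\<close> the summand need not be balanced
    in \<open>a'\<close> and \<open>b'\<close>, but for fixed \<open>a'\<close> and
    \<open>b'\<close> it factors through \<iota>. Hence the sum over the coproduct of
    \<open>X\<close> has to be evaluated first.\<close>
  also have "\<dots> = tensor_lift PPP (\<lambda>a' b'. tensor_lift PPP (\<lambda>a b. \<iota> (?f a b a' b')) (Cop X)) (Cop Y)"
    by (rule LL.lift_swap[OF LL.tensor_product_axioms PPP.T.abelian_group_axioms CX CY gc])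
  also have "\<dots> = tensor_lift PPP (\<lambda>a' b'. j X \<otimes>\<^bsub>PPP\<^esub> \<iota> (a' \<boxtimes>\<^bsub>LL\<^esub> b')) (Cop Y)"
  proof (rule LL.lift_cong[OF PPP.T.abelian_group_axioms CY])
    fix a' b' assume ab: "a' \<in> carrier L" "b' \<in> carrier L"
    note abP = L_closed[OF ab(1)] L_closed[OF ab(2)]
    have "tensor_lift PPP (\<lambda>a b. \<iota> (?f a b a' b')) (Cop X) = shuffle a' b' (\<iota> (Cop X))"
      by (rule lift_via_\<iota>[OF PPP.T.abelian_group_axioms PPP.T.abelian_group_axioms ahom_ident shuffle_hom[OF abP] CX])
        (rule gc[OF _ _ ab] g[OF _ _ ab]; assumption)+
    then show "tensor_lift PPP (\<lambda>a b. \<iota> (?f a b a' b')) (Cop X) = j X \<otimes>\<^bsub>PPP\<^esub> \<iota> (a' \<boxtimes>\<^bsub>LL\<^esub> b')"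
      unfolding \<iota>_Cop[OF X] \<iota>_pure[OF ab] shuffle_j[OF XP abP] .
    show "j X \<otimes>\<^bsub>PPP\<^esub> \<iota> (a' \<boxtimes>\<^bsub>LL\<^esub> b') \<in> carrier PPP" using XP ab by simp
  qed
  also have "\<dots> = j X \<otimes>\<^bsub>PPP\<^esub> \<iota> (Cop Y)"
    by (rule LL.hom_eq_lift[OF PPP.T.abelian_group_axioms ahom_comp[OF PPP.mult_left_hom \<iota>_hom] CY, symmetric])
      (use XP in simp)
  also have "\<dots> = \<iota> (Cop (X \<otimes>\<^bsub>PP\<^esub> Y))"
    unfolding \<iota>_Cop[OF Y] \<iota>_Cop[OF L_mult_closed[OF X Y]] j_mult[OF XP YP] ..
  finally show "\<iota> (Cop (X \<otimes>\<^bsub>PP\<^esub> Y)) = \<iota> (factorwise_mult LL L L (Cop X) (Cop Y))" ..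
qed

text \<open>With \<open>w = p \<otimes> q \<otimes> z\<close> and \<open>Y = r \<otimes> u\<close>
  this is \<open>p \<otimes> q \<otimes> zr \<otimes> u\<close>: a further factor \<open>Y\<close>
  is joined to \<open>w\<close> in the way \<open>\<iota>3\<close> joins it to
  \<open>\<iota> (X11 \<otimes> X12)\<close>.\<close>

definition tau_inr where "tau_inr Y w = tensor_lift PPPP (\<lambda>r u. tau u (inr r \<otimes>\<^bsub>PPP\<^esub> w)) Y"

lemma tau_inr_hom:
  assumes Y: "Y \<in> carrier PP" shows "(\<lambda>w. tau_inr Y w) \<in> ahom PPP PPPP"
  unfolding tau_inr_def
proof (rule PP.lift_param_hom[OF PPPP.T.abelian_group_axioms Y])
  fix r u assume "r \<in> carrier P" "u \<in> carrier (opposite P)"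
  then show "(\<lambda>w. tau u (inr r \<otimes>\<^bsub>PPP\<^esub> w)) \<in> ahom PPP PPPP"
    by (intro ahom_comp[OF tau_hom PPP.mult_left_hom]) simp_all
qed

lemma tau_inr_eq:
  assumes Y: "Y \<in> carrier PP" and w: "w \<in> carrier PPP" and \<phi>: "(\<lambda>b. \<phi> b) \<in> ahom PP PPPP"
    and eq: "\<And>r u. r \<in> carrier P \<Longrightarrow> u \<in> carrier P \<Longrightarrow> \<phi> (r \<boxtimes>\<^bsub>PP\<^esub> u) = tau u (inr r \<otimes>\<^bsub>PPP\<^esub> w)"
  shows "\<phi> Y = tau_inr Y w"
proof -
  have "\<phi> Y = tensor_lift PPPP (\<lambda>r u. \<phi> (r \<boxtimes>\<^bsub>PP\<^esub> u)) Y"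
    by (rule PP.hom_eq_lift[OF PPPP.T.abelian_group_axioms \<phi> Y])
  also have "\<dots> = tau_inr Y w"
    unfolding tau_inr_def by (rule PP.lift_cong[OF PPPP.T.abelian_group_axioms Y]) (use w in \<open>simp_all add: eq\<close>)
  finally show ?thesis .
qed

lemma ll_J_eq_tau_inr:
  assumes A: "A \<in> carrier PP" and C: "C \<in> carrier PP" and Y: "Y \<in> carrier PP"
  shows "ll J (J Y \<otimes>\<^bsub>PPP\<^esub> inl C) \<otimes>\<^bsub>PPPP\<^esub> (A \<boxtimes>\<^bsub>PPPP\<^esub> \<one>\<^bsub>PP\<^esub>) = tau_inr Y (J C \<otimes>\<^bsub>PPP\<^esub> inl A)"
proof (rule tau_inr_eq[OF Y])
  have A1: "A \<boxtimes>\<^bsub>PPPP\<^esub> \<one>\<^bsub>PP\<^esub> \<in> carrier PPPP" using A by simp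
  show "(\<lambda>Y. ll J (J Y \<otimes>\<^bsub>PPP\<^esub> inl C) \<otimes>\<^bsub>PPPP\<^esub> (A \<boxtimes>\<^bsub>PPPP\<^esub> \<one>\<^bsub>PP\<^esub>)) \<in> ahom PP PPPP"
    by (rule ahom_comp[OF PPPP.mult_right_hom[OF A1] ahom_comp[OF ll_hom[OF J_K_linear] J_mult_inl_hom[OF C]]])
  show "J C \<otimes>\<^bsub>PPP\<^esub> inl A \<in> carrier PPP" using A C by simp
  fix r u assume r: "r \<in> carrier P" and u: "u \<in> carrier P"
  have p: "inr r \<in> carrier PPP" "J C \<in> carrier PPP" "inl A \<in> carrier PPP" using A C r by simp_all
  have "ll J (J (r \<boxtimes>\<^bsub>PP\<^esub> u) \<otimes>\<^bsub>PPP\<^esub> inl C) = tau u (inr r \<otimes>\<^bsub>PPP\<^esub> J C)"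
    using r u C by (simp add: J_pure ll_pure[OF J_K_linear] J_tgt)
  then have "ll J (J (r \<boxtimes>\<^bsub>PP\<^esub> u) \<otimes>\<^bsub>PPP\<^esub> inl C) \<otimes>\<^bsub>PPPP\<^esub> (A \<boxtimes>\<^bsub>PPPP\<^esub> \<one>\<^bsub>PP\<^esub>) = tau u ((inr r \<otimes>\<^bsub>PPP\<^esub> J C) \<otimes>\<^bsub>PPP\<^esub> inl A)"
    using tau_mult_inl[OF u A, of "inr r \<otimes>\<^bsub>PPP\<^esub> J C"] p by simp
  then show "ll J (J (r \<boxtimes>\<^bsub>PP\<^esub> u) \<otimes>\<^bsub>PPP\<^esub> inl C) \<otimes>\<^bsub>PPPP\<^esub> (A \<boxtimes>\<^bsub>PPPP\<^esub> \<one>\<^bsub>PP\<^esub>) = tau u (inr r \<otimes>\<^bsub>PPP\<^esub> (J C \<otimes>\<^bsub>PPP\<^esub> inl A))"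
    by (simp only: PPP.AB.A.m_assoc[OF p])
qed

lemma ll_j_eq_tau_inr:
  assumes X: "X \<in> carrier PP" and Y: "Y \<in> carrier PP"
  shows "ll j (J Y \<otimes>\<^bsub>PPP\<^esub> inl X) = tau_inr Y (j X)"
proof (rule tau_inr_eq[OF Y])
  show "(\<lambda>Y. ll j (J Y \<otimes>\<^bsub>PPP\<^esub> inl X)) \<in> ahom PP PPPP"
    by (rule ahom_comp[OF ll_hom[OF j_K_linear] J_mult_inl_hom[OF X]])
  show "j X \<in> carrier PPP" using X by simp
  fix r u assume r: "r \<in> carrier P" and u: "u \<in> carrier P"
  show "ll j (J (r \<boxtimes>\<^bsub>PP\<^esub> u) \<otimes>\<^bsub>PPP\<^esub> inl X) = tau u (inr r \<otimes>\<^bsub>PPP\<^esub> j X)"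
    using r u X by (simp add: J_pure ll_pure[OF j_K_linear] j_tgt)
qed

lemma ll_inl_J:
  assumes X: "X \<in> carrier PP" and Y: "Y \<in> carrier PP"
  shows "ll J (j Y) \<otimes>\<^bsub>PPPP\<^esub> (X \<boxtimes>\<^bsub>PPPP\<^esub> \<one>\<^bsub>PP\<^esub>) = ll (\<lambda>v. inl v) (J Y \<otimes>\<^bsub>PPP\<^esub> inl X)"
proof -
  have X1: "X \<boxtimes>\<^bsub>PPPP\<^esub> \<one>\<^bsub>PP\<^esub> \<in> carrier PPPP" using X by simp
  show ?thesis
  proof (rule PP_hom_ext[OF PPPP.T.abelian_group_axioms
        ahom_comp[OF PPPP.mult_right_hom[OF X1] ahom_comp[OF ll_hom[OF J_K_linear] j_hom]]
        ahom_comp[OF ll_hom[OF K_linear_inl] J_mult_inl_hom[OF X]] _ Y])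
    fix r u assume r: "r \<in> carrier P" and u: "u \<in> carrier P"
    show "ll J (j (r \<boxtimes>\<^bsub>PP\<^esub> u)) \<otimes>\<^bsub>PPPP\<^esub> (X \<boxtimes>\<^bsub>PPPP\<^esub> \<one>\<^bsub>PP\<^esub>) = ll (\<lambda>v. inl v) (J (r \<boxtimes>\<^bsub>PP\<^esub> u) \<otimes>\<^bsub>PPP\<^esub> inl X)"
      using r u X by (simp add: J_pure j_pure ll_pure[OF J_K_linear] ll_pure[OF K_linear_inl] J_src_one tau_pure)
  qed
qed

lemma ll_j_j:
  assumes X: "X \<in> carrier PP" shows "ll j (j X) = ll (\<lambda>v. inl v) (j X)"
  by (rule PP_hom_ext[OF PPPP.T.abelian_group_axioms ahom_comp[OF ll_hom[OF j_K_linear] j_hom]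
        ahom_comp[OF ll_hom[OF K_linear_inl] j_hom] _ X])
    (simp add: j_pure ll_pure[OF j_K_linear] ll_pure[OF K_linear_inl] j_src)

text \<open>With \<open>X = p \<otimes> q\<close>, both sides become
  \<open>p \<otimes> 1 \<otimes> 1 \<otimes> q\<close> under the injective map
  \<open>\<iota>3\<close>.\<close>

lemma Cop_coassoc:
  assumes X: "X \<in> carrier L"
  shows "tensor_lift LLL (\<lambda>X1 X2. tensor_lift LLL (\<lambda>X11 X12. X11 \<boxtimes>\<^bsub>LLL\<^esub> (X12 \<boxtimes>\<^bsub>LL\<^esub> X2)) (Cop X1)) (Cop X) =
    tensor_lift LLL (\<lambda>X1 X2. X1 \<boxtimes>\<^bsub>LLL\<^esub> Cop X2) (Cop X)"
proof (rule inj_onD[OF \<iota>3_inj])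
  note CX = Cop_closed[OF X]
  let ?f = "\<lambda>X2 X11 X12. X11 \<boxtimes>\<^bsub>LLL\<^esub> (X12 \<boxtimes>\<^bsub>LL\<^esub> X2)"
  have cl: "?f X2 X11 X12 \<in> carrier LLL" if "X11 \<in> carrier L" "X12 \<in> carrier L" "X2 \<in> carrier L" for X11 X12 X2
    by (rule LLL.pure_closed[OF that(1) LL.pure_closed[OF that(2,3)]])
  have cl1: "tensor_lift LLL (?f X2) (Cop X1) \<in> carrier LLL" if "X1 \<in> carrier L" "X2 \<in> carrier L" for X1 X2
    by (rule LL.lift_closed[OF LLL.T.abelian_group_axioms Cop_closed[OF that(1)]]) (rule cl[OF _ _ that(2)])
  have cl2: "X1 \<boxtimes>\<^bsub>LLL\<^esub> Cop X2 \<in> carrier LLL" if "X1 \<in> carrier L" "X2 \<in> carrier L" for X1 X2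
    by (rule LLL.pure_closed[OF that(1) Cop_closed[OF that(2)]])
  show "tensor_lift LLL (\<lambda>X1 X2. tensor_lift LLL (?f X2) (Cop X1)) (Cop X) \<in> carrier LLL"
    by (rule LL.lift_closed[OF LLL.T.abelian_group_axioms CX cl1])
  show "tensor_lift LLL (\<lambda>X1 X2. X1 \<boxtimes>\<^bsub>LLL\<^esub> Cop X2) (Cop X) \<in> carrier LLL"
    by (rule LL.lift_closed[OF LLL.T.abelian_group_axioms CX cl2])
  \<comment> \<open>The inner coproduct enters only as \<open>j X1\<close>, so the result depends on
    \<open>X1 \<otimes> X2\<close> through \<iota> and the outer sum can be evaluated in the same
    way.\<close>
  have e1: "\<iota>3 (tensor_lift LLL (?f X2) (Cop X1)) = ll j (J X2 \<otimes>\<^bsub>PPP\<^esub> inl X1)" if X1: "X1 \<in> carrier L" and X2: "X2 \<in> carrier L" for X1 X2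
  proof -
    have "\<iota>3 (tensor_lift LLL (?f X2) (Cop X1)) = tau_inr X2 (\<iota> (Cop X1))"
    proof (rule lift_via_\<iota>[OF LLL.T.abelian_group_axioms PPPP.T.abelian_group_axioms \<iota>3_hom tau_inr_hom[OF L_closed[OF X2]] Cop_closed[OF X1]])
      fix X11 X12 assume a: "X11 \<in> carrier L" "X12 \<in> carrier L"
      show "?f X2 X11 X12 \<in> carrier LLL" by (rule cl[OF a X2])
      show "\<iota>3 (?f X2 X11 X12) = tau_inr X2 (J X12 \<otimes>\<^bsub>PPP\<^esub> inl X11)"
        unfolding \<iota>3_pure[OF a(1) LL.pure_closed[OF a(2) X2]] \<iota>_pure[OF a(2) X2]
        by (rule ll_J_eq_tau_inr[OF L_closed[OF a(1)] L_closed[OF a(2)] L_closed[OF X2]])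
    qed
    then show ?thesis
      unfolding \<iota>_Cop[OF X1] ll_j_eq_tau_inr[OF L_closed[OF X1] L_closed[OF X2]] .
  qed
  have e2: "\<iota>3 (X1 \<boxtimes>\<^bsub>LLL\<^esub> Cop X2) = ll (\<lambda>v. inl v) (J X2 \<otimes>\<^bsub>PPP\<^esub> inl X1)" if X1: "X1 \<in> carrier L" and X2: "X2 \<in> carrier L" for X1 X2
    unfolding \<iota>3_pure[OF X1 Cop_closed[OF X2]] \<iota>_Cop[OF X2] by (rule ll_inl_J[OF L_closed[OF X1] L_closed[OF X2]])
  have "\<iota>3 (tensor_lift LLL (\<lambda>X1 X2. tensor_lift LLL (?f X2) (Cop X1)) (Cop X)) = ll j (\<iota> (Cop X))"
    by (rule lift_via_\<iota>[OF LLL.T.abelian_group_axioms PPPP.T.abelian_group_axioms \<iota>3_hom ll_hom[OF j_K_linear] CX])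
      (rule cl1 e1; assumption)+
  also have "\<dots> = ll (\<lambda>v. inl v) (\<iota> (Cop X))"
    unfolding \<iota>_Cop[OF X] by (rule ll_j_j[OF L_closed[OF X]])
  also have "\<dots> = \<iota>3 (tensor_lift LLL (\<lambda>X1 X2. X1 \<boxtimes>\<^bsub>LLL\<^esub> Cop X2) (Cop X))"
    by (rule lift_via_\<iota>[OF LLL.T.abelian_group_axioms PPPP.T.abelian_group_axioms \<iota>3_hom ll_hom[OF K_linear_inl] CX, symmetric])
      (rule cl2 e2; assumption)+
  finally show "\<iota>3 (tensor_lift LLL (\<lambda>X1 X2. tensor_lift LLL (?f X2) (Cop X1)) (Cop X)) =
    \<iota>3 (tensor_lift LLL (\<lambda>X1 X2. X1 \<boxtimes>\<^bsub>LLL\<^esub> Cop X2) (Cop X))" .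
qed

section \<open>The map \<open>\<lambda>\<close>\<close>

abbreviation OS where "OS \<equiv> tensor (opposite B) L (\<lambda>X b. X \<otimes>\<^bsub>PP\<^esub> tgt b) L (\<lambda>b Y. tgt b \<otimes>\<^bsub>PP\<^esub> Y)"

sublocale OS: tensor_product "opposite B" L "\<lambda>X b. X \<otimes>\<^bsub>PP\<^esub> tgt b" L "\<lambda>b Y. tgt b \<otimes>\<^bsub>PP\<^esub> Y" OS
  by (rule tensor_productI[OF right_module_opposite[OF L_left_module'] left_module_opposite[OF L_right_module]])

lemma opposite_square_eq: "opposite_square B L (ES_target K P) = OS"
  by (simp add: opposite_square_def ES_target_eq)

lemmas OS_flip = OS.flip_hom[OF LL'.tensor_product_axioms opposite_simps(1)[symmetric] refl refl]
    OS.flip_pure[OF LL'.tensor_product_axioms opposite_simps(1)[symmetric] refl refl]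
  and LL'_flip = LL'.flip_hom[OF OS.tensor_product_axioms opposite_simps(1) refl refl]
    LL'.flip_pure[OF OS.tensor_product_axioms opposite_simps(1) refl refl]

abbreviation hopf_formula where "hopf_formula X Y \<equiv> tensor_lift LL (\<lambda>X1 X2. X1 \<boxtimes>\<^bsub>LL\<^esub> (X2 \<otimes>\<^bsub>PP\<^esub> Y)) (Cop X)"

lemma hopf_map_eq: "hopf_map B L (ES_source K P) (ES_target K P) Cop = tensor_lift LL hopf_formula"
  by (simp add: hopf_map_def bimodule_square_eq Let_def)

text \<open>Multiplication by \<open>1 \<otimes> Y\<close> is a shuffle with \<open>a' = 1\<close>;
  at \<open>j X\<close> it is the product with \<open>J Y\<close>, that is
  \<open>p \<otimes> r \<otimes> uq\<close> for \<open>X = p \<otimes> q\<close> and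
  \<open>Y = r \<otimes> u\<close>.\<close>

lemma
  assumes X: "X \<in> carrier L" and Y: "Y \<in> carrier L"
  shows \<iota>_hopf_formula: "\<iota> (hopf_formula X Y) = j X \<otimes>\<^bsub>PPP\<^esub> J Y" and hopf_formula_closed: "hopf_formula X Y \<in> carrier LL"
proof -
  have one: "\<one>\<^bsub>PP\<^esub> \<in> carrier PP" by simp
  have cl: "X1 \<boxtimes>\<^bsub>LL\<^esub> (X2 \<otimes>\<^bsub>PP\<^esub> Y) \<in> carrier LL" if "X1 \<in> carrier L" "X2 \<in> carrier L" for X1 X2
    by (rule LL.pure_closed[OF that(1) L_mult_closed[OF that(2) Y]])
  have eq: "\<iota> (X1 \<boxtimes>\<^bsub>LL\<^esub> (X2 \<otimes>\<^bsub>PP\<^esub> Y)) = shuffle \<one>\<^bsub>PP\<^esub> Y (J X2 \<otimes>\<^bsub>PPP\<^esub> inl X1)" if "X1 \<in> carrier L" "X2 \<in> carrier L" for X1 X2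
    using J_mult_inl_eq_shuffle[OF L_closed[OF that(1)] L_closed[OF that(2)] one L_closed[OF Y]]
    unfolding \<iota>_pure[OF that(1) L_mult_closed[OF that(2) Y]] PP.AB.A.r_one[OF L_closed[OF that(1)]] .
  note l = \<iota>_lift[OF shuffle_hom[OF one L_closed[OF Y]] Cop_closed[OF X] cl eq]
  show "hopf_formula X Y \<in> carrier LL" by (rule l(2))
  have "J Y \<otimes>\<^bsub>PPP\<^esub> inl \<one>\<^bsub>PP\<^esub> = J Y"
    using PPP.AB.A.r_one[of "J Y"] Y by (simp add: PPP.one_eq L_closed)
  then show "\<iota> (hopf_formula X Y) = j X \<otimes>\<^bsub>PPP\<^esub> J Y"
    using shuffle_j[OF L_closed[OF X] one L_closed[OF Y]] by (simp only: l(1) \<iota>_Cop[OF X])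
qed

lemma \<iota>'_flip: "X \<in> carrier L \<Longrightarrow> Y \<in> carrier L \<Longrightarrow>
    \<iota>' (tensor_lift LL' (\<lambda>x y. y \<boxtimes>\<^bsub>LL'\<^esub> x) (X \<boxtimes>\<^bsub>OS\<^esub> Y)) = j X \<otimes>\<^bsub>PPP\<^esub> J Y"
  by (simp only: OS_flip(2) \<iota>'_pure)

text \<open>Balancing over the opposite ring is tested after \<iota>, where the formula is a product
  of \<open>j X\<close> and \<open>J Y\<close> and \<open>tgt b\<close> passes from one factor to
  the other.\<close>

lemma hopf_formula_balanced:
  "balanced (opposite B) L (\<lambda>X b. X \<otimes>\<^bsub>PP\<^esub> tgt b) L (\<lambda>b Y. tgt b \<otimes>\<^bsub>PP\<^esub> Y) LL hopf_formula"
proof (rule balanced_reflect[OF hopf_formula_closed \<iota>_hom \<iota>_inj _ LL.T.abelian_group_axioms OS.M.right_module_axioms OS.N.left_module_axioms])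
  note h = ahom_comp[OF \<iota>'_hom OS_flip(1)]
  have c: "X \<otimes>\<^bsub>PP\<^esub> tgt b \<in> carrier L" "tgt b \<otimes>\<^bsub>PP\<^esub> X \<in> carrier L" if "X \<in> carrier L" "b \<in> carrier B" for X b
    using that by (simp_all add: L_mult_closed tgt_in_L)
  show "balanced (opposite B) L (\<lambda>X b. X \<otimes>\<^bsub>PP\<^esub> tgt b) L (\<lambda>b Y. tgt b \<otimes>\<^bsub>PP\<^esub> Y) PPP (\<lambda>X Y. \<iota> (hopf_formula X Y))"
  proof (rule balancedI)
    fix X assume X: "X \<in> carrier L"
    have "(\<lambda>Y. j X \<otimes>\<^bsub>PPP\<^esub> J Y) \<in> ahom L PPP"
      by (rule L_into_PP[OF ahom_comp[OF PPP.mult_left_hom J_hom]]) (use X in \<open>simp add: L_closed\<close>)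
    then show "(\<lambda>Y. \<iota> (hopf_formula X Y)) \<in> ahom L PPP"
      by (rule ahom_cong[OF _ _ L.abelian_group_axioms]) (simp add: \<iota>_hopf_formula X)
  next
    fix Y assume Y: "Y \<in> carrier L"
    have "(\<lambda>X. j X \<otimes>\<^bsub>PPP\<^esub> J Y) \<in> ahom L PPP"
      by (rule L_into_PP[OF ahom_comp[OF PPP.mult_right_hom j_hom]]) (use Y in \<open>simp add: L_closed\<close>)
    then show "(\<lambda>X. \<iota> (hopf_formula X Y)) \<in> ahom L PPP"
      by (rule ahom_cong[OF _ _ L.abelian_group_axioms]) (simp add: \<iota>_hopf_formula Y)
  next
    fix X b Y assume X: "X \<in> carrier L" and b: "b \<in> carrier (opposite B)" and Y: "Y \<in> carrier L"
    have b': "b \<in> carrier B" "b \<in> carrier P" using b by (simp_all add: B_closed)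
    have "j (X \<otimes>\<^bsub>PP\<^esub> tgt b) \<otimes>\<^bsub>PPP\<^esub> J Y = j X \<otimes>\<^bsub>PPP\<^esub> J (tgt b \<otimes>\<^bsub>PP\<^esub> Y)"
      using X Y b'(2) by (simp add: j_tgt_right J_tgt L_closed PPP.AB.A.m_assoc)
    then show "\<iota> (hopf_formula (X \<otimes>\<^bsub>PP\<^esub> tgt b) Y) = \<iota> (hopf_formula X (tgt b \<otimes>\<^bsub>PP\<^esub> Y))"
      by (simp only: \<iota>_hopf_formula X Y c b'(1))
  qed
qed

lemmas hopf_hom = OS.lift_hom[OF LL.T.abelian_group_axioms hopf_formula_balanced]

lemma \<iota>_hopf:
  assumes Z: "Z \<in> carrier OS"
  shows "\<iota> (tensor_lift LL hopf_formula Z) = \<iota>' (tensor_lift LL' (\<lambda>x y. y \<boxtimes>\<^bsub>LL'\<^esub> x) Z)"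
  by (rule OS.hom_ext[OF PPP.T.abelian_group_axioms ahom_comp[OF \<iota>_hom hopf_hom] ahom_comp[OF \<iota>'_hom OS_flip(1)] _ Z])
    (simp only: OS.lift_pure[OF LL.T.abelian_group_axioms hopf_formula_balanced] \<iota>_hopf_formula \<iota>'_flip)

lemma flip_flop:
  assumes Z: "Z \<in> carrier OS"
  shows "tensor_lift OS (\<lambda>x y. y \<boxtimes>\<^bsub>OS\<^esub> x) (tensor_lift LL' (\<lambda>x y. y \<boxtimes>\<^bsub>LL'\<^esub> x) Z) = Z"
  by (rule OS.hom_ext[OF OS.T.abelian_group_axioms ahom_comp[OF LL'_flip(1) OS_flip(1)] ahom_ident _ Z])
    (simp only: OS_flip(2) LL'_flip(2))

lemma flop_flip:
  assumes Z: "Z \<in> carrier LL'"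
  shows "tensor_lift LL' (\<lambda>x y. y \<boxtimes>\<^bsub>LL'\<^esub> x) (tensor_lift OS (\<lambda>x y. y \<boxtimes>\<^bsub>OS\<^esub> x) Z) = Z"
  by (rule LL'.hom_ext[OF LL'.T.abelian_group_axioms ahom_comp[OF OS_flip(1) LL'_flip(1)] ahom_ident _ Z])
    (simp only: OS_flip(2) LL'_flip(2))

text \<open>After the flip, \<lambda> followed by \<iota> is the second embedding. Its injectivity
  gives injectivity of \<lambda>, and \<open>\<iota>_image\<close> supplies a preimage for every
  element of \<open>L \<otimes>\<^sub>B L\<close>.\<close>

lemma hopf_bij: "bij_betw (tensor_lift LL hopf_formula) (carrier OS) (carrier LL)"
proof (rule bij_betw_imageI)
  let ?flip = "tensor_lift LL' (\<lambda>x y. y \<boxtimes>\<^bsub>LL'\<^esub> x)" and ?flop = "tensor_lift OS (\<lambda>x y. y \<boxtimes>\<^bsub>OS\<^esub> x)"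
  show "inj_on (tensor_lift LL hopf_formula) (carrier OS)"
  proof (rule inj_onI)
    fix Z W assume Z: "Z \<in> carrier OS" and W: "W \<in> carrier OS"
      and eq: "tensor_lift LL hopf_formula Z = tensor_lift LL hopf_formula W"
    have "\<iota>' (?flip Z) = \<iota>' (?flip W)"
      unfolding \<iota>_hopf[OF Z, symmetric] \<iota>_hopf[OF W, symmetric] eq ..
    then have "?flip Z = ?flip W"
      by (rule inj_onD[OF \<iota>'_inj _ ahom_closed[OF OS_flip(1) Z] ahom_closed[OF OS_flip(1) W]])
    then have "?flop (?flip Z) = ?flop (?flip W)" by (rule arg_cong)
    then show "Z = W" by (simp only: flip_flop[OF Z] flip_flop[OF W])
  qed
  show "tensor_lift LL hopf_formula ` carrier OS = carrier LL"
  proof (rule subset_antisym; rule subsetI)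
    fix V assume "V \<in> tensor_lift LL hopf_formula ` carrier OS"
    then obtain Z where Z: "Z \<in> carrier OS" and V: "V = tensor_lift LL hopf_formula Z" by (rule imageE)
    show "V \<in> carrier LL" unfolding V by (rule ahom_closed[OF hopf_hom Z])
  next
    fix V assume V: "V \<in> carrier LL"
    from \<iota>_image[OF V] obtain W where W: "W \<in> carrier LL'" and eq: "\<iota> V = \<iota>' W" by (rule imageE)
    have fW: "?flop W \<in> carrier OS" by (rule ahom_closed[OF LL'_flip(1) W])
    have "\<iota> V = \<iota> (tensor_lift LL hopf_formula (?flop W))"
      unfolding \<iota>_hopf[OF fW] flop_flip[OF W] by (rule eq)
    then have "V = tensor_lift LL hopf_formula (?flop W)"
      by (rule \<iota>_eqI[OF _ V ahom_closed[OF hopf_hom fW]])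
    then show "V \<in> tensor_lift LL hopf_formula ` carrier OS" using fW by (rule image_eqI)
  qed
qed

section \<open>Verification of the left Hopf algebroid axioms\<close>

lemma ES_source_hom: "(\<lambda>b. src b) \<in> algebra_hom K B L"
  unfolding algebra_hom_def ring_hom_def
  by (simp add: B_closed src_in_L src_mult ahom_add[OF PP_pure_hom(2)] PP.smult_pure PP.one_eq del: PP.mult_pure)

lemma ES_target_hom: "(\<lambda>b. tgt b) \<in> algebra_hom K (opposite B) L"
  unfolding algebra_hom_def ring_hom_def
  by (simp add: B_closed tgt_in_L tgt_mult ahom_add[OF PP_pure_hom(1)] PP.smult_pure PP_smult_balance PP.one_eq del: PP.mult_pure)

lemma ES_left_hopf_algebroid:
  "left_hopf_algebroid K B L (ES_source K P) (ES_target K P) Cop (ES_counit P)"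
proof (rule left_hopf_algebroid.intro)
  show "left_bialgebroid K B L (ES_source K P) (ES_target K P) Cop (ES_counit P)"
    unfolding ES_counit_eq
  proof (rule left_bialgebroid.intro[OF B.algebra_over_field_axioms L.algebra_over_field_axioms], rule left_bialgebroid_axioms.intro, unfold bimodule_square_eq bimodule_cube_eq Let_def, unfold ES_source_eq ES_target_eq)
    show "(\<lambda>b. src b) \<in> algebra_hom K B L" by (rule ES_source_hom)
    show "(\<lambda>b. tgt b) \<in> algebra_hom K (opposite B) L" by (rule ES_target_hom)
    show "src b \<otimes>\<^bsub>L\<^esub> tgt c = tgt c \<otimes>\<^bsub>L\<^esub> src b" if "b \<in> carrier B" "c \<in> carrier B" for b c
      using that src_tgt_commute[of b c] by (simp add: B_closed)
    show "Cop \<in> ahom L LL" by (rule Cop_hom)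
    show "ce \<in> ahom L B"
      by (rule ahomI) (simp_all add: ce_in_B L_closed ahom_add[OF ce_hom])
    show "ce (src b \<otimes>\<^bsub>L\<^esub> (tgt c \<otimes>\<^bsub>L\<^esub> X)) = b \<otimes>\<^bsub>B\<^esub> ce X \<otimes>\<^bsub>B\<^esub> c"
      if "b \<in> carrier B" "c \<in> carrier B" "X \<in> carrier L" for b c X
      using that by (simp add: B_closed L_closed ce_src ce_tgt P.A.m_assoc)
    show "ce (src b \<otimes>\<^bsub>L\<^esub> X) = b \<otimes>\<^bsub>B\<^esub> ce X" if "b \<in> carrier B" "X \<in> carrier L" for b X
      using that by (simp add: B_closed L_closed ce_src)
    show "ce \<one>\<^bsub>L\<^esub> = \<one>\<^bsub>B\<^esub>" by (simp add: PP.one_eq ce_pure)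
    show "Cop X \<in> takeuchi_product B L (\<lambda>b. src b) (\<lambda>b. tgt b)" if "X \<in> carrier L" for X
      unfolding takeuchi_product_def bimodule_square_eq[unfolded ES_source_eq ES_target_eq] Let_def L_simps
      by (intro CollectI conjI ballI Cop_closed[OF that] Cop_takeuchi[OF that])
  qed (simp_all only: L_simps Cop_bimodule Cop_coassoc Cop_counit_left Cop_counit_right Cop_one Cop_mult
      ce_mult_source ce_mult_target L_closed)
  show "left_hopf_algebroid_axioms B L (ES_source K P) (ES_target K P) Cop"
    by (rule left_hopf_algebroid_axioms.intro) (unfold hopf_map_eq opposite_square_eq bimodule_square_eq, rule hopf_bij)
qed

end

theorem theorem4p4:
  fixes K :: "('k, 'c) ring_scheme"
    and H :: "('k, 'h, 'd) module_scheme"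
    and P :: "('k, 'p, 'e) module_scheme"
    and \<Delta> :: "'h \<Rightarrow> (('h \<times> 'h) \<Rightarrow>\<^sub>0 int) set" and \<epsilon> :: "'h \<Rightarrow> 'k" and S :: "'h \<Rightarrow> 'h"
    and \<delta> :: "'p \<Rightarrow> (('p \<times> 'h) \<Rightarrow>\<^sub>0 int) set"
  assumes "hopf_algebra K H \<Delta> \<epsilon> S"
    and "hopf_galois_extension K H \<Delta> \<epsilon> S P \<delta>"
    and "faithfully_flat_left TYPE(('h + 'p) list) (coinvariants K H P \<delta>) P (\<lambda>b p. b \<otimes>\<^bsub>P\<^esub> p)"
  shows "(\<forall>X\<in>carrier (ES_algebra K H P \<delta>). \<exists>!Y. Y \<in> carrier (ES_square K H P \<delta>) \<and>
            ES_inclusion K H P \<delta> Y = ES_coproduct_formula K H P \<delta> X) \<and>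
         left_hopf_algebroid K (coinvariants K H P \<delta>) (ES_algebra K H P \<delta>)
           (ES_source K P) (ES_target K P) (ES_coproduct K H P \<delta>) (ES_counit P)"
proof -
  interpret faithfully_flat_galois K H \<Delta> \<epsilon> S P \<delta>
    by (rule faithfully_flat_galois.intro[OF assms(2)], rule faithfully_flat_galois_axioms.intro) (rule assms(3))
  show ?thesis
    unfolding ES_square_eq ES_inclusion_eq
    by (intro conjI ballI coproduct_ex1 ES_left_hopf_algebroid)
qed

end
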